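(* Fix a positive integer $N$ and let $L_1\geq L_2\geq\cdots\geq L_K$ be nonnegative integers with $L_1\leq N$. Let $M:=\sum_{i=1}^K L_i$ and $\alpha:=M/N$. The following are equivalent: (1) $(L_1,\ldots,L_K)\in \mathrm{TFF}(\alpha,N)$, i.e. there exist orthogonal projections $P_1,\ldots,P_K$ on $\mathbb{R}^N$ with $\operatorname{rank}P_i=L_i$ and $\sum_{i=1}^K P_i=\alpha\mathbf I$; (2) the Littlewood–Richardson coefficient $c\big((N^{L_1}),\ldots,(N^{L_K});(M^N)\big)\neq 0$.
   Context: For a partition $\lambda$, $s_\lambda$ denotes the Schur polynomial (symmetric function). For partitions $\lambda^1,\ldots,\lambda^K$, the Littlewood–Richardson coefficients $c(\lambda^1,\ldots,\lambda^K;\mu)$ are defined by $\prod_{i=1}^K s_{\lambda^i}=\sum_\mu c(\lambda^1,\ldots,\lambda^K;\mu)\,s_\mu$. For positive integers $a$ and integers $b\ge 0$, $(a^b)$ denotes the rectangular partition $(a,\ldots,a)$ with $b$ parts ($(a^0)$ is the empty partition, with $s_{(a^0)}=1$). $\mathbf I$ is the identity on $\mathbb{R}^N$; a rank-zero projection is the zero operator. *)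

theory Defs
  imports "HOL-Analysis.Analysis" "HOL-Library.Poly_Mapping"
begin

(* Polynomials in the variables x_0, x_1, ... with integer coefficients:
  a monomial is an exponent vector (nat =>0 nat), a polynomial a finitely supported
  map from monomials to coefficients. *)
type_synonym ipoly = "(nat \<Rightarrow>\<^sub>0 nat) \<Rightarrow>\<^sub>0 int"

definition is_partition :: "nat list \<Rightarrow> bool" where
  "is_partition la \<longleftrightarrow> sorted (rev la) \<and> (\<forall>x\<in>set la. 0 < x)"

(* Rectangular partition (a^b); parts equal to 0 are dropped, so (0^b) is empty. *)
definition rect :: "nat \<Rightarrow> nat \<Rightarrow> nat list" where
  "rect a b = filter (\<lambda>x. 0 < x) (replicate b a)"

definition cells :: "nat list \<Rightarrow> (nat \<times> nat) set" where
  "cells la = {(i, j). i < length la \<and> j < la ! i}"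

definition ssyt :: "nat \<Rightarrow> nat list \<Rightarrow> (nat \<times> nat \<Rightarrow> nat) set" where
  "ssyt n la = {T. (\<forall>c\<in>cells la. T c < n) \<and> (\<forall>c. c \<notin> cells la \<longrightarrow> T c = 0)
     \<and> (\<forall>i j. (i, Suc j) \<in> cells la \<longrightarrow> T (i, j) \<le> T (i, Suc j))
     \<and> (\<forall>i j. (Suc i, j) \<in> cells la \<longrightarrow> T (i, j) < T (Suc i, j))}"

definition tab_monomial :: "nat list \<Rightarrow> (nat \<times> nat \<Rightarrow> nat) \<Rightarrow> ipoly" where
  "tab_monomial la T = Poly_Mapping.single (\<Sum>c\<in>cells la. Poly_Mapping.single (T c) (1::nat)) 1"

definition schur :: "nat \<Rightarrow> nat list \<Rightarrow> ipoly" where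
  "schur n la = (\<Sum>T\<in>ssyt n la. tab_monomial la T)"

(* Littlewood--Richardson coefficient c(la^1,...,la^K; mu), defined by expanding
  prod s_{la^i} in the Schur basis.  The computation is done in n = sum |la^i| variables,
  which is exact: only mu with |mu| = n occur, and these have at most n parts
  (Schur polynomials s_mu with length mu <le> n are linearly independent).
  The argument mu is normalised by dropping zero parts. *)
definition lr_coeff :: "nat list list \<Rightarrow> nat list \<Rightarrow> int" where
  "lr_coeff las mu =
     (let n = (\<Sum>la\<leftarrow>las. sum_list la) in
      (THE c :: nat list \<Rightarrow> int.
          finite {nu. c nu \<noteq> 0}
        \<and> (\<forall>nu. c nu \<noteq> 0 \<longrightarrow> is_partition nu \<and> length nu <= n)
        \<and> (\<Prod>la\<leftarrow>las. schur n la) = (\<Sum>nu\<in>{nu. c nu \<noteq> 0}. of_int (c nu) * schur n nu))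
      (filter (\<lambda>x. 0 < x) mu))"

definition orth_proj :: "real^'n^'n \<Rightarrow> bool" where
  "orth_proj P \<longleftrightarrow> P ** P = P \<and> transpose P = P"

end

theory Submission
  imports Defs "Jordan_Normal_Form.Determinant"
begin

text \<open>Let \<open>n = N M\<close> and let \<open>x\<close> be a generic \<open>n\<close> by \<open>M\<close> matrix whose columns are grouped into blocks of
  sizes \<open>L\<^sub>1, \<dots>, L\<^sub>K\<close>; the general linear group of the rows and those of the column blocks act on
  polynomials in \<open>x\<close>. By Jacobi--Trudi and the bialternant formula the Littlewood--Richardson coefficient is an
  alternating sum of dimensions of weight spaces of this action, and a Casimir argument in the spirit of
  Freudenthal shows that such a sum is nonzero exactly if there is a nonzero highest weight vector \<open>F\<close> whose
  weight is \<open>M\<close> on the first \<open>N\<close> rows, \<open>0\<close> on the other rows, and \<open>N\<close> on every column.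

  Given \<open>F\<close>, maximise \<open>\<bar>F\<bar>\<close> on the unit sphere. At a maximum the gradient is proportional to the point, so the
  equations \<open>E\<^sub>p\<^sub>q F = 0\<close> turn into orthogonality relations between rows and between columns of a block, which
  after rescaling say that the blocks are orthonormal bases of the ranges of the required projections.

  Conversely, consider \<open>F(B) = det [C\<^sub>i \<otimes> B\<^sub>i]\<close>, an \<open>n\<close> by \<open>n\<close> determinant in the blocks \<open>B\<^sub>i\<close> of \<open>x\<close> with constant
  coefficient matrices \<open>C\<^sub>i\<close>. It is a highest weight vector of the right weight. If it vanished for all \<open>C\<close>
  and all \<open>B\<close> near a tight frame, then by an argument of Schofield on generic representations of the star
  quiver some such \<open>B\<close> would have a subrepresentation of too large a slope, and the trace estimate
  for a tight frame excludes this.\<close>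

section \<open>Ranks of real matrices with arbitrary index sets\<close>

text \<open>Three points shape the proof. Complete reducibility is never invoked: in the alternating
  sum over subsets of positive roots the Casimir operator acts as one scalar, so a polynomial in
  (Casimir - scalar) with constant term 1 leaves the sum unchanged. Such a polynomial can annihilate
  every weight space with an unwanted contribution, and on what remains its square has nonzero trace
  by self-adjointness. Next, \<open>lr_coeff\<close> is computed in \<open>N M\<close> variables, so
  x has \<open>N M\<close> rows although the frame lives in dimension \<open>N\<close>; the weight 0
  of the surplus rows forces them to vanish at the critical point. Finally, 'generic' means
  throughout a nonempty open set, and the induction carries an open set of representations to an
  open set of subrepresentations. It yields a destabilized B near the given frame, not the frame
  itself, so the trace estimate has to tolerate an error; it does, because both sides of the slope
  inequality are integers and differ by at least 1.\<close>

definition cols_free :: "('i \<Rightarrow> 'j \<Rightarrow> real) \<Rightarrow> 'i set \<Rightarrow> 'j set \<Rightarrow> bool" where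
  "cols_free S I J \<longleftrightarrow>
     (\<exists>Z. \<forall>j\<in>J. \<forall>j'\<in>J. (\<Sum>i\<in>I. Z j i * S i j') = of_bool (j = j'))"

lemma cols_free_subset:
  assumes "cols_free S I J" "J' \<subseteq> J" shows "cols_free S I J'"
proof -
  obtain Z where "\<forall>j\<in>J. \<forall>j'\<in>J. (\<Sum>i\<in>I. Z j i * S i j') = of_bool (j = j')"
    using assms(1) unfolding cols_free_def by blast
  then have "\<forall>j\<in>J'. \<forall>j'\<in>J'. (\<Sum>i\<in>I. Z j i * S i j') = of_bool (j = j')"
    using assms(2) by blast
  then show ?thesis unfolding cols_free_def by blast
qed

lemma cols_free_empty [simp]: "cols_free S I {}"
  unfolding cols_free_def by simp

lemma cols_free_cong:
  assumes "\<And>i j. i \<in> I \<Longrightarrow> j \<in> J \<Longrightarrow> S i j = S' i j"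
  shows "cols_free S I J \<longleftrightarrow> cols_free S' I J"
  unfolding cols_free_def using assms by (simp cong: sum.cong)

lemma cols_freeD:
  assumes "cols_free S I J" "finite I" "finite J"
    and "\<And>i. i \<in> I \<Longrightarrow> (\<Sum>j\<in>J. S i j * v j) = 0" and "j \<in> J"
  shows "v j = 0"
proof -
  obtain Z where Z: "\<And>j j'. j \<in> J \<Longrightarrow> j' \<in> J \<Longrightarrow> (\<Sum>i\<in>I. Z j i * S i j') = of_bool (j = j')"
    using assms(1) unfolding cols_free_def by blast
  have "v j = (\<Sum>j'\<in>J. of_bool (j = j') * v j')"
    using assms(3,5) by (simp add: of_bool_def if_distrib[of "\<lambda>x. x * _"] cong: if_cong)
  also have "\<dots> = (\<Sum>j'\<in>J. \<Sum>i\<in>I. Z j i * S i j' * v j')"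
    using Z assms(5) by (intro sum.cong refl) (simp flip: sum_distrib_right)
  also have "\<dots> = (\<Sum>i\<in>I. Z j i * (\<Sum>j'\<in>J. S i j' * v j'))"
    by (subst sum.swap) (simp add: sum_distrib_left mult.assoc)
  also have "\<dots> = 0" using assms(4) by simp
  finally show ?thesis .
qed

text \<open>\<open>zw\<close> is the only possible coefficient vector for column \<open>j\<close>.
  If it fails in some row, the residual in that row is a functional that vanishes on the old columns
  but not on \<open>j\<close>, and this repairs the left inverse.\<close>

lemma cols_free_insert:
  assumes "finite I" "finite J" "cols_free S I J" "j \<notin> J"
  shows "cols_free S I (insert j J) \<or> (\<exists>z. \<forall>i\<in>I. S i j = (\<Sum>j'\<in>J. S i j' * z j'))"
proof -
  obtain Z where Z: "\<And>j j'. j \<in> J \<Longrightarrow> j' \<in> J \<Longrightarrow> (\<Sum>i\<in>I. Z j i * S i j') = of_bool (j = j')"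
    using assms(3) unfolding cols_free_def by blast
  define zw where "zw = (\<lambda>j'. \<Sum>i\<in>I. Z j' i * S i j)"
  show ?thesis
  proof (cases "\<forall>i\<in>I. S i j = (\<Sum>j'\<in>J. S i j' * zw j')")
    case True then show ?thesis by blast
  next
    case False
    then obtain i0 where i0: "i0 \<in> I" "S i0 j \<noteq> (\<Sum>j'\<in>J. S i0 j' * zw j')" by blast
    define r where "r = S i0 j - (\<Sum>j'\<in>J. S i0 j' * zw j')"
    have r: "r \<noteq> 0" using i0 r_def by simp
    define p where "p = (\<lambda>i. (of_bool (i = i0) - (\<Sum>j'\<in>J. S i0 j' * Z j' i)) / r)"
    have psum: "(\<Sum>i\<in>I. p i * u i) = (u i0 - (\<Sum>j'\<in>J. S i0 j' * (\<Sum>i\<in>I. Z j' i * u i))) / r" for u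
    proof -
      have "(\<Sum>i\<in>I. p i * u i) = (\<Sum>i\<in>I. (of_bool (i = i0) * u i - (\<Sum>j'\<in>J. S i0 j' * Z j' i * u i))) / r"
        unfolding p_def by (simp add: sum_divide_distrib left_diff_distrib sum_distrib_right)
      also have "(\<Sum>i\<in>I. of_bool (i = i0) * u i - (\<Sum>j'\<in>J. S i0 j' * Z j' i * u i))
         = u i0 - (\<Sum>i\<in>I. \<Sum>j'\<in>J. S i0 j' * Z j' i * u i)"
        using i0 assms(1) by (simp add: sum_subtractf of_bool_def if_distrib[of "\<lambda>x. x * _"] cong: if_cong)
      also have "(\<Sum>i\<in>I. \<Sum>j'\<in>J. S i0 j' * Z j' i * u i) = (\<Sum>j'\<in>J. S i0 j' * (\<Sum>i\<in>I. Z j' i * u i))"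
        by (subst sum.swap) (simp add: sum_distrib_left mult.assoc)
      finally show ?thesis .
    qed
    have pj: "(\<Sum>i\<in>I. p i * S i j) = 1" using psum[of "\<lambda>i. S i j"] r by (simp add: r_def zw_def)
    have pJ: "(\<Sum>i\<in>I. p i * S i j') = 0" if "j' \<in> J" for j'
    proof -
      have "(\<Sum>j''\<in>J. S i0 j'' * (\<Sum>i\<in>I. Z j'' i * S i j')) = (\<Sum>j''\<in>J. if j'' = j' then S i0 j'' else 0)"
        using Z that by (intro sum.cong) auto
      also have "\<dots> = S i0 j'" using that assms(2) by simp
      finally show ?thesis using psum[of "\<lambda>i. S i j'"] by simp
    qed
    \<comment> \<open>Subtracting \<open>zw j'\<close> times \<open>p\<close> makes the old rows of
      the left inverse vanish on the new column.\<close>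
    define Z' where "Z' = (\<lambda>j' i. if j' = j then p i else Z j' i - zw j' * p i)"
    have "(\<Sum>i\<in>I. Z' a i * S i b) = of_bool (a = b)" if "a \<in> insert j J" "b \<in> insert j J" for a b
    proof (cases "a = j")
      case True
      then show ?thesis using that pj pJ assms(4) by (auto simp: Z'_def)
    next
      case False
      then have "(\<Sum>i\<in>I. Z' a i * S i b) = (\<Sum>i\<in>I. Z a i * S i b) - zw a * (\<Sum>i\<in>I. p i * S i b)"
        by (simp add: Z'_def left_diff_distrib sum_subtractf sum_distrib_left mult.assoc)
      then show ?thesis using False that pj pJ Z assms(4) by (auto simp: zw_def)
    qed
    then show ?thesis unfolding cols_free_def by blast
  qed
qed

text \<open>Induction over the columns: a kernel vector on fewer columns extends by zero, and if a
  new column lay in the old span, its coefficients together with -1 would be a forbidden kernel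
  vector.\<close>

lemma cols_freeI:
  assumes "finite I" "finite J"
    and "\<And>v. (\<And>i. i \<in> I \<Longrightarrow> (\<Sum>j\<in>J. S i j * v j) = 0) \<Longrightarrow> \<forall>j\<in>J. v j = 0"
  shows "cols_free S I J"
  using assms(2,3)
proof (induction J rule: finite_induct)
  case (insert j J)
  have "cols_free S I J"
  proof (rule insert.IH)
    fix v assume v: "\<And>i. i \<in> I \<Longrightarrow> (\<Sum>j\<in>J. S i j * v j) = 0"
    have "(\<Sum>j'\<in>insert j J. S i j' * (v(j := 0)) j') = (\<Sum>j\<in>J. S i j * v j)" for i
      using insert.hyps by (simp, intro sum.cong, auto)
    then have "\<forall>j'\<in>insert j J. (v(j := 0)) j' = 0" using v by (intro insert.prems) auto
    then show "\<forall>j\<in>J. v j = 0" using insert.hyps(2) by (metis fun_upd_other insertI2)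
  qed
  then consider "cols_free S I (insert j J)" | z where "\<forall>i\<in>I. S i j = (\<Sum>j'\<in>J. S i j' * z j')"
    using cols_free_insert[OF assms(1) insert.hyps(1)] insert.hyps(2) by blast
  then show ?case
  proof cases
    case 2
    define v where "v = (\<lambda>j'. if j' = j then -1 else z j')"
    have "(\<Sum>j'\<in>insert j J. S i j' * v j') = 0" if "i \<in> I" for i
    proof -
      have "(\<Sum>j'\<in>J. S i j' * v j') = (\<Sum>j'\<in>J. S i j' * z j')"
        using insert.hyps(2) by (intro sum.cong) (auto simp: v_def)
      then show ?thesis using 2 that insert.hyps by (simp add: v_def)
    qed
    then have "v j = 0" using insert.prems by blast
    then show ?thesis by (simp add: v_def)
  qed
qed simp

text \<open>Gaussian elimination: a row with nonzero pivot \<open>j0\<close> eliminates that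
  variable from the remaining rows.\<close>

lemma underdetermined_system:
  assumes "finite I" "finite J" "card I < card J"
  shows "\<exists>v. (\<exists>j\<in>J. v j \<noteq> 0) \<and> (\<forall>i\<in>I. (\<Sum>j\<in>J. S i j * v j) = (0::real))"
  using assms
proof (induction I arbitrary: J S rule: finite_induct)
  case empty
  then obtain j where "j \<in> J" by fastforce
  then show ?case by (intro exI[of _ "\<lambda>_. 1"]) auto
next
  case (insert i0 I)
  show ?case
  proof (cases "\<forall>j\<in>J. S i0 j = 0")
    case True
    obtain v where v: "\<exists>j\<in>J. v j \<noteq> 0" "\<forall>i\<in>I. (\<Sum>j\<in>J. S i j * v j) = 0"
      using insert.IH[OF insert.prems(1), of S] insert.prems insert.hyps by auto
    then show ?thesis using True by (intro exI[of _ v]) auto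
  next
    case False
    then obtain j0 where j0: "j0 \<in> J" "S i0 j0 \<noteq> 0" by blast
    define J' where "J' = J - {j0}"
    have J: "J = insert j0 J'" "j0 \<notin> J'" "finite J'" using j0 insert.prems by (auto simp: J'_def)
    have "card I < card J'" using insert.prems insert.hyps J by simp
    then obtain v where v: "\<exists>j\<in>J'. v j \<noteq> 0"
        "\<forall>i\<in>I. (\<Sum>j\<in>J'. (S i j - S i j0 * S i0 j / S i0 j0) * v j) = 0"
      using insert.IH[OF J(3), of "\<lambda>i j. S i j - S i j0 * S i0 j / S i0 j0"] by blast
    define w where "w = (\<lambda>j. if j = j0 then - (\<Sum>j\<in>J'. S i0 j * v j) / S i0 j0 else v j)"
    have wJ: "(\<Sum>j\<in>J'. S i j * w j) = (\<Sum>j\<in>J'. S i j * v j)" for i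
      using J(2) by (intro sum.cong) (auto simp: w_def)
    have 1: "(\<Sum>j\<in>J. S i0 j * w j) = 0"
      unfolding J(1) using J(2,3) j0(2) by (simp add: wJ) (simp add: w_def)
    have 2: "(\<Sum>j\<in>J. S i j * w j) = 0" if "i \<in> I" for i
    proof -
      have "(\<Sum>j\<in>J'. (S i j - S i j0 * S i0 j / S i0 j0) * v j)
          = (\<Sum>j\<in>J'. S i j * v j) - (\<Sum>j\<in>J'. S i j0 / S i0 j0 * (S i0 j * v j))"
        by (simp add: sum_subtractf algebra_simps)
      then have "(\<Sum>j\<in>J'. S i j * v j) = S i j0 / S i0 j0 * (\<Sum>j\<in>J'. S i0 j * v j)"
        using v(2) that by (simp add: sum_distrib_left)
      then show ?thesis unfolding J(1) using J(2,3) by (simp add: wJ) (simp add: w_def)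
    qed
    have "\<exists>j\<in>J. w j \<noteq> 0" using v(1) J by (auto simp: w_def)
    then show ?thesis using 1 2 by blast
  qed
qed

lemma cols_free_card_le:
  assumes "finite I" "finite J" "cols_free S I J"
  shows "card J \<le> card I"
proof (rule ccontr)
  assume "\<not> card J \<le> card I"
  then obtain v where "\<exists>j\<in>J. v j \<noteq> 0" "\<forall>i\<in>I. (\<Sum>j\<in>J. S i j * v j) = 0"
    using underdetermined_system[OF assms(1,2), of S] by force
  then show False using cols_freeD[OF assms(3,1,2), of v] by blast
qed

lemma cols_free_mult:
  assumes "finite I" "finite J" "finite K" "cols_free S I J" "cols_free T J K"
  shows "cols_free (\<lambda>i k. \<Sum>j\<in>J. S i j * T j k) I K"
proof (rule cols_freeI[OF assms(1,3)])
  fix v assume v: "\<And>i. i \<in> I \<Longrightarrow> (\<Sum>k\<in>K. (\<Sum>j\<in>J. S i j * T j k) * v k) = 0"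
  have "(\<Sum>j\<in>J. S i j * (\<Sum>k\<in>K. T j k * v k)) = 0" if "i \<in> I" for i
    using v[OF that] by (simp add: sum_distrib_left sum_distrib_right mult.assoc) (subst sum.swap, simp)
  then have "(\<Sum>k\<in>K. T j k * v k) = 0" if "j \<in> J" for j
    using cols_freeD[OF assms(4,1,2), of "\<lambda>j. \<Sum>k\<in>K. T j k * v k"] that by simp
  then show "\<forall>k\<in>K. v k = 0" using cols_freeD[OF assms(5,2,3), of v] by blast
qed

definition col_rank :: "('i \<Rightarrow> 'j \<Rightarrow> real) \<Rightarrow> 'i set \<Rightarrow> 'j set \<Rightarrow> nat" where
  "col_rank S I J = Max (card ` {J0. J0 \<subseteq> J \<and> cols_free S I J0})"

lemma card_le_col_rank:
  assumes "finite J" "J0 \<subseteq> J" "cols_free S I J0"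
  shows "card J0 \<le> col_rank S I J"
  unfolding col_rank_def using assms by (intro Max_ge) (auto intro: finite_subset[of _ "Pow J"])

lemma col_rank_attained:
  assumes "finite J"
  obtains J0 where "J0 \<subseteq> J" "cols_free S I J0" "card J0 = col_rank S I J"
proof -
  have "col_rank S I J \<in> card ` {J0. J0 \<subseteq> J \<and> cols_free S I J0}"
    unfolding col_rank_def using assms
    by (intro Max_in) (auto intro: finite_subset[of _ "Pow J"] exI[of _ "{}"])
  then show ?thesis using that by fastforce
qed

lemma col_rank_le: "finite J \<Longrightarrow> col_rank S I J \<le> card J"
  unfolding col_rank_def
  by (subst Max_le_iff) (auto intro: finite_subset[of _ "Pow J"] card_mono exI[of _ "{}"])

lemma col_rank_cong:
  assumes "\<And>i j. i \<in> I \<Longrightarrow> j \<in> J \<Longrightarrow> S i j = S' i j"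
  shows "col_rank S I J = col_rank S' I J"
proof -
  have "cols_free S I J0 \<longleftrightarrow> cols_free S' I J0" if "J0 \<subseteq> J" for J0
    using assms that by (intro cols_free_cong) blast
  then have "{J0. J0 \<subseteq> J \<and> cols_free S I J0} = {J0. J0 \<subseteq> J \<and> cols_free S' I J0}" by blast
  then show ?thesis unfolding col_rank_def by simp
qed

section \<open>Kernels of nearby matrices whose rank cannot grow\<close>

lemma column_in_span:
  assumes "finite I" "finite J" "J0 \<subseteq> J" "cols_free S I J0" "col_rank S I J \<le> card J0" "j \<in> J - J0"
  shows "\<exists>z. \<forall>i\<in>I. S i j = (\<Sum>j'\<in>J0. S i j' * z j')"
proof -
  have fin: "finite J0" using assms finite_subset by blast
  have "\<not> cols_free S I (insert j J0)"
    using card_le_col_rank[OF assms(2), of "insert j J0" S I] assms fin by auto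
  then show ?thesis using cols_free_insert[OF assms(1) fin assms(4)] assms(6) by blast
qed

text \<open>A left inverse of the limit matrix inverts the nearby ones up to an error that can be
  absorbed. Beyond openness of freeness, the uniform constant \<open>\<kappa>\<close> is what later
  makes kernel vectors converge.\<close>

lemma eventually_cols_free_bound:
  assumes "finite I" "finite J" "cols_free S I J"
    and lim: "\<And>i j. i \<in> I \<Longrightarrow> j \<in> J \<Longrightarrow> ((\<lambda>t. S' t i j) \<longlongrightarrow> S i j) F"
  shows "\<exists>\<kappa>. eventually (\<lambda>t. \<forall>v. \<forall>j\<in>J. \<bar>v j\<bar> \<le> \<kappa> * (\<Sum>i\<in>I. \<bar>\<Sum>j\<in>J. S' t i j * v j\<bar>)) F"
proof -
  obtain Z where Z: "\<And>j j'. j \<in> J \<Longrightarrow> j' \<in> J \<Longrightarrow> (\<Sum>i\<in>I. Z j i * S i j') = of_bool (j = j')"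
    using assms(3) unfolding cols_free_def by blast
  define z where "z = (\<Sum>j\<in>J. \<Sum>i\<in>I. \<bar>Z j i\<bar>) + 1"
  have z0: "z > 0" unfolding z_def by (intro add_nonneg_pos sum_nonneg) auto
  have zji: "(\<Sum>j\<in>J. \<Sum>i\<in>I. \<bar>Z j i\<bar>) \<le> z" unfolding z_def by simp
  \<comment> \<open>With this \<open>e\<close> the perturbation contributes at most
    \<open>n / 2\<close> to the bound on \<open>n\<close>, and that half is absorbed on the
    left.\<close>
  define e where "e = 1 / (2 * z)"
  have e0: "e > 0" using z0 by (simp add: e_def)
  have ev: "eventually (\<lambda>t. \<forall>i\<in>I. \<forall>j\<in>J. \<bar>S' t i j - S i j\<bar> < e) F"
    using tendstoD[OF lim e0] assms(1,2)
    by (simp add: eventually_ball_finite_distrib dist_real_def)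
  show ?thesis
  proof (intro exI[of _ "2 * z"] eventually_mono[OF ev] allI ballI)
    fix t and v :: "'b \<Rightarrow> real" and j assume t: "\<forall>i\<in>I. \<forall>j\<in>J. \<bar>S' t i j - S i j\<bar> < e" and j: "j \<in> J"
    define n where "n = (\<Sum>j\<in>J. \<bar>v j\<bar>)"
    define s where "s = (\<Sum>i\<in>I. \<bar>\<Sum>j\<in>J. S' t i j * v j\<bar>)"
    have vj: "v j = (\<Sum>i\<in>I. Z j i * (\<Sum>j'\<in>J. S i j' * v j'))" if "j \<in> J" for j
    proof -
      have "v j = (\<Sum>j'\<in>J. of_bool (j = j') * v j')"
        using assms(2) that by (simp add: of_bool_def if_distrib[of "\<lambda>x. x * _"] cong: if_cong)
      also have "\<dots> = (\<Sum>j'\<in>J. \<Sum>i\<in>I. Z j i * S i j' * v j')"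
        using Z that by (intro sum.cong refl) (simp flip: sum_distrib_right)
      also have "\<dots> = (\<Sum>i\<in>I. Z j i * (\<Sum>j'\<in>J. S i j' * v j'))"
        by (subst sum.swap) (simp add: sum_distrib_left mult.assoc)
      finally show ?thesis .
    qed
    have inner: "\<bar>\<Sum>j'\<in>J. S i j' * v j'\<bar> \<le> s + e * n" if "i \<in> I" for i
    proof -
      have "(\<Sum>j'\<in>J. S i j' * v j') = (\<Sum>j'\<in>J. S' t i j' * v j') + (\<Sum>j'\<in>J. (S i j' - S' t i j') * v j')"
        by (simp add: sum.distrib[symmetric] algebra_simps)
      moreover have "\<bar>\<Sum>j'\<in>J. (S i j' - S' t i j') * v j'\<bar> \<le> (\<Sum>j'\<in>J. e * \<bar>v j'\<bar>)"
        using t that by (intro sum_abs[THEN order_trans] sum_mono)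
          (auto simp: abs_mult abs_minus_commute less_imp_le intro!: mult_right_mono)
      moreover have "\<bar>\<Sum>j'\<in>J. S' t i j' * v j'\<bar> \<le> s"
        unfolding s_def using that assms(1) by (intro member_le_sum) auto
      ultimately show ?thesis unfolding n_def sum_distrib_left by linarith
    qed
    have "0 \<le> s + e * n" unfolding s_def n_def using e0 by (intro add_nonneg_nonneg sum_nonneg mult_nonneg_nonneg) auto
    have "n \<le> (\<Sum>j\<in>J. (\<Sum>i\<in>I. \<bar>Z j i\<bar>) * (s + e * n))"
    proof -
      have "\<bar>v j\<bar> \<le> (\<Sum>i\<in>I. \<bar>Z j i\<bar>) * (s + e * n)" if "j \<in> J" for j
      proof -
        have "\<bar>v j\<bar> \<le> (\<Sum>i\<in>I. \<bar>Z j i * (\<Sum>j'\<in>J. S i j' * v j')\<bar>)"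
          by (subst vj[OF that]) (rule sum_abs)
        also have "\<dots> \<le> (\<Sum>i\<in>I. \<bar>Z j i\<bar> * (s + e * n))"
          using inner by (intro sum_mono) (simp add: abs_mult mult_left_mono)
        finally show ?thesis by (simp add: sum_distrib_right)
      qed
      then show ?thesis by (subst (1) n_def) (rule sum_mono)
    qed
    also have "\<dots> = (\<Sum>j\<in>J. \<Sum>i\<in>I. \<bar>Z j i\<bar>) * (s + e * n)" by (simp add: sum_distrib_right)
    also have "\<dots> \<le> z * (s + e * n)"
      using zji \<open>0 \<le> s + e * n\<close> by (intro mult_right_mono)
    also have "\<dots> = z * s + n / 2" using z0 by (simp add: e_def field_simps)
    finally have "n \<le> 2 * z * s" by simp
    moreover have "\<bar>v j\<bar> \<le> n" unfolding n_def using j assms(2) by (intro member_le_sum) auto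
    ultimately show "\<bar>v j\<bar> \<le> 2 * z * (\<Sum>i\<in>I. \<bar>\<Sum>j\<in>J. S' t i j * v j\<bar>)" unfolding s_def by simp
  qed
qed

lemma cols_free_of_bound:
  assumes "finite I" "finite J"
    and "\<And>v. \<forall>j\<in>J. \<bar>v j\<bar> \<le> \<kappa> * (\<Sum>i\<in>I. \<bar>\<Sum>j\<in>J. S i j * v j\<bar>)"
  shows "cols_free S I J"
proof (rule cols_freeI[OF assms(1,2)], rule ballI)
  fix v j assume "\<And>i. i \<in> I \<Longrightarrow> (\<Sum>j\<in>J. S i j * v j) = 0" "j \<in> J"
  then have "\<bar>v j\<bar> \<le> 0" using bspec[OF assms(3)[of v]] by fastforce
  then show "v j = 0" by simp
qed

lemma eventually_cols_free:
  assumes "finite I" "finite J" "cols_free S I J"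
    and "\<And>i j. i \<in> I \<Longrightarrow> j \<in> J \<Longrightarrow> ((\<lambda>t. S' t i j) \<longlongrightarrow> S i j) F"
  shows "eventually (\<lambda>t. cols_free (S' t) I J) F"
proof -
  obtain \<kappa> where "eventually (\<lambda>t. \<forall>v. \<forall>j\<in>J. \<bar>v j\<bar> \<le> \<kappa> * (\<Sum>i\<in>I. \<bar>\<Sum>j\<in>J. S' t i j * v j\<bar>)) F"
    using eventually_cols_free_bound[OF assms] by blast
  then show ?thesis
  proof (rule eventually_mono)
    fix t assume "\<forall>v. \<forall>j\<in>J. \<bar>v j\<bar> \<le> \<kappa> * (\<Sum>i\<in>I. \<bar>\<Sum>j\<in>J. S' t i j * v j\<bar>)"
    then show "cols_free (S' t) I J" by (intro cols_free_of_bound[OF assms(1,2), of \<kappa>]) blast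
  qed
qed

text \<open>As the rank does not grow, \<open>J0\<close> stays a column basis, so the coordinates
  off \<open>J0\<close> can be frozen at those of \<open>X\<close> and the system solved for the
  others. The difference from \<open>X\<close> lives on \<open>J0\<close>, where the uniform bound
  controls it by \<open>S' X\<close>, which tends to \<open>S X = 0\<close>.\<close>

lemma kernel_vector_limit:
  assumes "finite I" "finite J" "J0 \<subseteq> J" "cols_free S I J0"
    and lim: "\<And>i j. i \<in> I \<Longrightarrow> j \<in> J \<Longrightarrow> ((\<lambda>t. S' t i j) \<longlongrightarrow> S i j) F"
    and rk: "eventually (\<lambda>t. col_rank (S' t) I J \<le> card J0) F"
    and X: "\<And>i. i \<in> I \<Longrightarrow> (\<Sum>j\<in>J. S i j * X j) = 0"
  shows "\<exists>X'. (\<forall>j. ((\<lambda>t. X' t j) \<longlongrightarrow> X j) F) \<and> (\<forall>t. \<forall>j. j \<notin> J0 \<longrightarrow> X' t j = X j) \<and>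
     eventually (\<lambda>t. \<forall>i\<in>I. (\<Sum>j\<in>J. S' t i j * X' t j) = 0) F"
proof -
  have fin0: "finite J0" using assms finite_subset by blast
  obtain \<kappa> where \<kappa>: "eventually (\<lambda>t. \<forall>v. \<forall>j\<in>J0. \<bar>v j\<bar> \<le> \<kappa> * (\<Sum>i\<in>I. \<bar>\<Sum>j\<in>J0. S' t i j * v j\<bar>)) F"
    using eventually_cols_free_bound[OF assms(1) fin0 assms(4), of S' F] lim assms(3) by blast
  define P where "P = (\<lambda>t Y. (\<forall>j. j \<notin> J0 \<longrightarrow> Y j = X j) \<and> (\<forall>i\<in>I. (\<Sum>j\<in>J. S' t i j * Y j) = 0))"
  have exP: "eventually (\<lambda>t. \<exists>Y. P t Y) F"
    using \<kappa> rk
  proof eventually_elim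
    case (elim t)
    have free: "cols_free (S' t) I J0" using elim(1) by (intro cols_free_of_bound[OF assms(1) fin0, of \<kappa>]) blast
    have "\<forall>j\<in>J - J0. \<exists>z. \<forall>i\<in>I. S' t i j = (\<Sum>j'\<in>J0. S' t i j' * z j')"
      using column_in_span[OF assms(1,2,3) free] elim by blast
    then obtain z where z: "\<And>j i. j \<in> J - J0 \<Longrightarrow> i \<in> I \<Longrightarrow> S' t i j = (\<Sum>j'\<in>J0. S' t i j' * z j j')"
      by metis
    define Y where "Y = (\<lambda>j'. if j' \<in> J0 then - (\<Sum>j\<in>J - J0. z j j' * X j) else X j')"
    have "(\<Sum>j\<in>J. S' t i j * Y j) = 0" if i: "i \<in> I" for i
    proof -
      have "(\<Sum>j\<in>J. S' t i j * Y j) = (\<Sum>j\<in>J - J0. S' t i j * Y j) + (\<Sum>j\<in>J0. S' t i j * Y j)"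
        by (rule sum.subset_diff[OF assms(3,2)])
      also have "(\<Sum>j\<in>J - J0. S' t i j * Y j) = (\<Sum>j\<in>J - J0. (\<Sum>j'\<in>J0. S' t i j' * z j j') * X j)"
        using z i by (intro sum.cong) (auto simp: Y_def)
      also have "\<dots> = (\<Sum>j'\<in>J0. S' t i j' * (\<Sum>j\<in>J - J0. z j j' * X j))"
        by (simp add: sum_distrib_left sum_distrib_right mult.assoc) (subst sum.swap, simp)
      also have "(\<Sum>j\<in>J0. S' t i j * Y j) = - (\<Sum>j'\<in>J0. S' t i j' * (\<Sum>j\<in>J - J0. z j j' * X j))"
        by (simp add: Y_def sum_negf)
      finally show ?thesis by simp
    qed
    then show ?case unfolding P_def by (intro exI[of _ Y]) (auto simp: Y_def)
  qed
  \<comment> \<open>Where no solution exists the value defaults to \<open>X\<close>, so that the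
    coordinates off \<open>J0\<close> are right for every \<open>t\<close>.\<close>
  define X' where "X' = (\<lambda>t. if \<exists>Y. P t Y then SOME Y. P t Y else X)"
  have PX': "P t (X' t)" if "\<exists>Y. P t Y" for t using that unfolding X'_def by (simp add: someI_ex)
  have off: "X' t j = X j" if "j \<notin> J0" for t j
  proof (cases "\<exists>Y. P t Y")
    case True then show ?thesis using PX'[OF True] that unfolding P_def by simp
  next
    case False then have "X' t = X" unfolding X'_def by (rule if_not_P)
    then show ?thesis by simp
  qed
  have evP: "eventually (\<lambda>t. P t (X' t)) F" using exP by (rule eventually_mono) (rule PX')
  have "((\<lambda>t. X' t j) \<longlongrightarrow> X j) F" if j: "j \<in> J0" for j
  proof -
    define b where "b = (\<lambda>t. \<kappa> * (\<Sum>i\<in>I. \<bar>\<Sum>j\<in>J. S' t i j * X j\<bar>))"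
    have "(b \<longlongrightarrow> \<kappa> * (\<Sum>i\<in>I. \<bar>\<Sum>j\<in>J. S i j * X j\<bar>)) F"
      unfolding b_def using lim by (intro tendsto_intros) auto
    then have b0: "(b \<longlongrightarrow> 0) F" using X by simp
    have "eventually (\<lambda>t. \<bar>X' t j - X j\<bar> \<le> b t) F"
      using \<kappa> evP
    proof eventually_elim
      case (elim t)
      have "(\<Sum>j\<in>J0. S' t i j * (X' t j - X j)) = - (\<Sum>j\<in>J. S' t i j * X j)" if "i \<in> I" for i
      proof -
        have "(\<Sum>j\<in>J0. S' t i j * (X' t j - X j)) = (\<Sum>j\<in>J. S' t i j * (X' t j - X j))"
          using off assms(2,3) by (intro sum.mono_neutral_left) auto
        also have "\<dots> = - (\<Sum>j\<in>J. S' t i j * X j)"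
          using elim that unfolding P_def by (simp add: right_diff_distrib sum_subtractf)
        finally show ?thesis .
      qed
      then have "(\<Sum>i\<in>I. \<bar>\<Sum>j\<in>J0. S' t i j * (X' t j - X j)\<bar>) = (\<Sum>i\<in>I. \<bar>\<Sum>j\<in>J. S' t i j * X j\<bar>)"
        by (intro sum.cong) auto
      then show ?case using bspec[OF spec[OF elim(1), of "\<lambda>j. X' t j - X j"] j] by (simp add: b_def)
    qed
    then have "((\<lambda>t. X' t j - X j) \<longlongrightarrow> 0) F"
      by (intro Lim_null_comparison[OF _ b0]) (simp only: real_norm_def)
    then show ?thesis by (simp add: LIM_zero_iff)
  qed
  moreover have "((\<lambda>t. X' t j) \<longlongrightarrow> X j) F" if "j \<notin> J0" for j using off[OF that] by simp
  ultimately have "\<forall>j. ((\<lambda>t. X' t j) \<longlongrightarrow> X j) F" by blast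
  moreover have "eventually (\<lambda>t. \<forall>i\<in>I. (\<Sum>j\<in>J. S' t i j * X' t j) = 0) F"
    using evP by (rule eventually_mono) (simp add: P_def)
  ultimately show ?thesis using off by blast
qed

lemma kernel_vector_eq:
  assumes "finite I" "finite J" "J0 \<subseteq> J" "cols_free S I J0"
    and "\<And>i. i \<in> I \<Longrightarrow> (\<Sum>j\<in>J. S i j * X j) = 0" "\<And>i. i \<in> I \<Longrightarrow> (\<Sum>j\<in>J. S i j * Y j) = 0"
    and "\<And>j. j \<in> J - J0 \<Longrightarrow> X j = Y j" "j \<in> J"
  shows "X j = Y j"
proof (cases "j \<in> J0")
  case True
  have "(\<Sum>j\<in>J0. S i j * (X j - Y j)) = 0" if "i \<in> I" for i
  proof -
    have "(\<Sum>j\<in>J0. S i j * (X j - Y j)) = (\<Sum>j\<in>J. S i j * (X j - Y j))"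
      using assms by (intro sum.mono_neutral_left) auto
    then show ?thesis using assms(5,6) that by (simp add: right_diff_distrib sum_subtractf)
  qed
  then have "X j - Y j = 0"
    using cols_freeD[OF assms(4,1) _ _ True, of "\<lambda>j. X j - Y j"] assms finite_subset by blast
  then show ?thesis by simp
qed (use assms in auto)

text \<open>Functions carry the product topology, so limits of representations are checked entry by
  entry.\<close>

lemma tendsto_fun_iff:
  fixes f :: "'t \<Rightarrow> 'i \<Rightarrow> 'b::topological_space"
  shows "(f \<longlongrightarrow> l) F \<longleftrightarrow> (\<forall>i. ((\<lambda>t. f t i) \<longlongrightarrow> l i) F)"
  using limitin_componentwise[of "\<lambda>_. euclidean :: 'b topology" UNIV f l F]
  by (simp add: euclidean_product_topology extensional_def)

text \<open>Solving for the pivot columns \<open>J0\<close> gives one kernel vector for each other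
  column, equal to a unit vector off \<open>J0\<close>. In this normal form the kernel has the index
  set \<open>J - J0\<close>, and coordinates of a kernel vector are read off directly.\<close>

lemma kernel_basis:
  assumes "finite I" "finite J" "J0 \<subseteq> J" "cols_free S I J0" "col_rank S I J \<le> card J0"
  shows "\<exists>\<iota>. \<forall>b\<in>J - J0. (\<forall>j. j \<notin> J0 \<longrightarrow> \<iota> b j = of_bool (j = b)) \<and> (\<forall>i\<in>I. (\<Sum>j\<in>J. S i j * \<iota> b j) = 0)"
proof -
  have "\<forall>b\<in>J - J0. \<exists>z. \<forall>i\<in>I. S i b = (\<Sum>j'\<in>J0. S i j' * z j')"
    using column_in_span[OF assms] by blast
  then obtain z where z: "\<And>b i. b \<in> J - J0 \<Longrightarrow> i \<in> I \<Longrightarrow> S i b = (\<Sum>j'\<in>J0. S i j' * z b j')" by metis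
  define \<iota> where "\<iota> = (\<lambda>b j. if j \<in> J0 then - z b j else of_bool (j = b))"
  have "(\<Sum>j\<in>J. S i j * \<iota> b j) = 0" if "b \<in> J - J0" "i \<in> I" for b i
  proof -
    have "(\<Sum>j\<in>J. S i j * \<iota> b j) = (\<Sum>j\<in>J - J0. S i j * \<iota> b j) + (\<Sum>j\<in>J0. S i j * \<iota> b j)"
      by (rule sum.subset_diff[OF assms(3,2)])
    also have "(\<Sum>j\<in>J - J0. S i j * \<iota> b j) = (\<Sum>j\<in>J - J0. if j = b then S i j else 0)"
      by (intro sum.cong) (auto simp: \<iota>_def)
    also have "\<dots> = S i b" using that assms(2) by simp
    also have "(\<Sum>j\<in>J0. S i j * \<iota> b j) = - (\<Sum>j\<in>J0. S i j * z b j)"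
      by (simp add: \<iota>_def sum_negf)
    finally show ?thesis using z that by simp
  qed
  then show ?thesis by (intro exI[of _ \<iota>]) (auto simp: \<iota>_def)
qed

lemma kernel_vector_expansion:
  assumes "finite I" "finite J" "J0 \<subseteq> J" "cols_free S I J0"
    and "\<And>i. i \<in> I \<Longrightarrow> (\<Sum>j\<in>J. S i j * X j) = 0"
    and \<iota>: "\<And>b j. b \<in> J - J0 \<Longrightarrow> j \<notin> J0 \<Longrightarrow> \<iota> b j = of_bool (j = b)"
       "\<And>b i. b \<in> J - J0 \<Longrightarrow> i \<in> I \<Longrightarrow> (\<Sum>j\<in>J. S i j * \<iota> b j) = 0"
    and "j \<in> J"
  shows "X j = (\<Sum>b\<in>J - J0. X b * \<iota> b j)"
proof (rule kernel_vector_eq[OF assms(1-5) _ _ assms(8)])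
  fix i assume "i \<in> I"
  have "(\<Sum>j\<in>J. S i j * (\<Sum>b\<in>J - J0. X b * \<iota> b j)) = (\<Sum>b\<in>J - J0. X b * (\<Sum>j\<in>J. S i j * \<iota> b j))"
    by (simp add: sum_distrib_left mult.left_commute) (rule sum.swap)
  then show "(\<Sum>j\<in>J. S i j * (\<Sum>b\<in>J - J0. X b * \<iota> b j)) = 0" using \<iota>(2) \<open>i \<in> I\<close> by simp
next
  fix j assume j: "j \<in> J - J0"
  have "(\<Sum>b\<in>J - J0. X b * \<iota> b j) = (\<Sum>b\<in>J - J0. if b = j then X b else 0)"
    using \<iota>(1) j by (intro sum.cong) auto
  then show "X j = (\<Sum>b\<in>J - J0. X b * \<iota> b j)" using j assms(2) by simp
qed

section \<open>Generic representations of the star quiver\<close>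

text \<open>A representation \<open>B\<close> of the star quiver with \<open>k\<close> legs consists of maps \<open>B i\<close> from the space with basis \<open>Ai i\<close> to
  the one with basis \<open>A\<close>; \<open>C\<close> is the transposed representation with spaces \<open>W\<close> and \<open>Q\<close>. The kernel of \<open>hom_matrix B C\<close>
  consists of the \<open>X\<close> with \<open>C\<^sub>i X B\<^sub>i = 0\<close>, and \<open>ext_nonzero\<close> says that its cokernel is nonzero.\<close>

type_synonym legs = "nat \<Rightarrow> nat \<Rightarrow> nat \<Rightarrow> real"

definition leg_rows :: "nat \<Rightarrow> (nat \<Rightarrow> nat set) \<Rightarrow> nat set \<Rightarrow> (nat \<times> nat \<times> nat) set" where
  "leg_rows k Ai Q = (SIGMA i:{..<k}. Q \<times> Ai i)"

definition hom_matrix :: "legs \<Rightarrow> legs \<Rightarrow> nat \<times> nat \<times> nat \<Rightarrow> nat \<times> nat \<Rightarrow> real" where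
  "hom_matrix B C = (\<lambda>(i, s, c) (w, a). C i s w * B i a c)"

definition leg_mult :: "nat set \<Rightarrow> (nat \<times> nat \<Rightarrow> real) \<Rightarrow> legs \<Rightarrow> nat \<Rightarrow> nat \<Rightarrow> nat \<Rightarrow> real" where
  "leg_mult A X B i w c = (\<Sum>a\<in>A. X (w, a) * B i a c)"

definition ext_nonzero :: "nat \<Rightarrow> nat set \<Rightarrow> (nat \<Rightarrow> nat set) \<Rightarrow> nat set \<Rightarrow> nat set \<Rightarrow> legs \<Rightarrow> legs \<Rightarrow> bool" where
  "ext_nonzero k A Ai W Q B C \<longleftrightarrow> (\<exists>\<eta>. (\<exists>r\<in>leg_rows k Ai Q. \<eta> r \<noteq> 0) \<and>
     (\<forall>j\<in>W \<times> A. (\<Sum>r\<in>leg_rows k Ai Q. \<eta> r * hom_matrix B C r j) = 0))"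

text \<open>\<open>\<iota>\<close> and the \<open>\<kappa> i\<close> embed a subrepresentation whose
  own maps are the \<open>\<beta> i\<close>; the last line is the slope condition, weighted by the
  dimensions of \<open>W\<close> and \<open>Q\<close>.\<close>

definition destabilized :: "nat \<Rightarrow> nat set \<Rightarrow> (nat \<Rightarrow> nat set) \<Rightarrow> nat set \<Rightarrow> nat set \<Rightarrow> legs \<Rightarrow> bool" where
  "destabilized k A Ai W Q B \<longleftrightarrow> (\<exists>(U :: nat set) Y \<iota> \<kappa> \<beta>. finite U \<and> (\<forall>i<k. finite (Y i :: nat set)) \<and>
     cols_free \<iota> A U \<and> (\<forall>i<k. cols_free (\<kappa> i) (Ai i) (Y i)) \<and>
     (\<forall>i<k. \<forall>a\<in>A. \<forall>y\<in>Y i. (\<Sum>c\<in>Ai i. B i a c * \<kappa> i c y) = (\<Sum>u\<in>U. \<iota> a u * \<beta> i u y)) \<and>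
     card W * card U < card Q * (\<Sum>i<k. card (Y i)))"

lemma hom_kernel_iff:
  assumes "finite A" "finite W"
  shows "(\<Sum>j\<in>W \<times> A. hom_matrix B C (i, s, c) j * X j) = (\<Sum>w\<in>W. C i s w * leg_mult A X B i w c)"
  unfolding hom_matrix_def leg_mult_def
  by (simp add: sum.cartesian_product' sum_distrib_left mult_ac)

lemma sum_leg_rows:
  assumes "\<And>i. finite (Ai i)" "finite Q"
  shows "(\<Sum>r\<in>leg_rows k Ai Q. f r) = (\<Sum>i<k. \<Sum>s\<in>Q. \<Sum>c\<in>Ai i. f (i, s, c))"
proof -
  have "(\<Sum>i<k. \<Sum>s\<in>Q. \<Sum>c\<in>Ai i. f (i, s, c)) = (\<Sum>i<k. \<Sum>p\<in>Q \<times> Ai i. f (i, p))"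
    by (simp add: sum.cartesian_product')
  also have "\<dots> = (\<Sum>r\<in>leg_rows k Ai Q. f r)"
    unfolding leg_rows_def using assms by (subst sum.Sigma) auto
  finally show ?thesis by simp
qed

text \<open>First-order optimality: along \<open>C + t C'\<close> the rank cannot grow, so the derivative of the
  system maps its kernel into its image.\<close>

lemma tangent_condition:
  assumes fin: "finite A" "\<And>i. finite (Ai i)" "finite W" "finite Q"
    and "open \<Omega>" and "(V, C) \<in> \<Omega>"
    and max: "\<And>B C. (B, C) \<in> \<Omega> \<Longrightarrow> col_rank (hom_matrix B C) (leg_rows k Ai Q) (W \<times> A) \<le> card J0"
    and J0: "J0 \<subseteq> W \<times> A" "cols_free (hom_matrix V C) (leg_rows k Ai Q) J0"
    and X: "\<And>r. r \<in> leg_rows k Ai Q \<Longrightarrow> (\<Sum>j\<in>W \<times> A. hom_matrix V C r j * X j) = 0"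
    and \<eta>: "\<And>j. j \<in> W \<times> A \<Longrightarrow> (\<Sum>r\<in>leg_rows k Ai Q. \<eta> r * hom_matrix V C r j) = 0"
    and isw: "i < k" "s \<in> Q" "w \<in> W"
  shows "(\<Sum>c\<in>Ai i. \<eta> (i, s, c) * leg_mult A X V i w c) = 0"
proof -
  let ?I = "leg_rows k Ai Q" and ?J = "W \<times> A"
  have finI: "finite ?I" "finite ?J" using fin by (auto simp: leg_rows_def)
  \<comment> \<open>The elementary direction at \<open>(i, s, w)\<close> isolates one entry of the
    derivative.\<close>
  define C' where "C' = (\<lambda>i' s' w'. of_bool (i' = i \<and> s' = s \<and> w' = w) :: real)"
  define D where "D = (\<lambda>t i' s' w'. C i' s' w' + t * C' i' s' w')"
  have limD: "((\<lambda>t. D t i s w) \<longlongrightarrow> C i s w) (at 0)" for i s w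
  proof -
    have "((\<lambda>t. C i s w + t * C' i s w) \<longlongrightarrow> C i s w + 0 * C' i s w) (at 0)"
      by (intro tendsto_intros)
    then show ?thesis by (simp add: D_def)
  qed
  have "((\<lambda>t. (V, D t)) \<longlongrightarrow> (V, C)) (at 0)"
    by (intro tendsto_Pair tendsto_const) (simp add: tendsto_fun_iff limD)
  then have ev: "eventually (\<lambda>t. (V, D t) \<in> \<Omega>) (at 0)"
    using assms(5,6) by (rule topological_tendstoD)
  have "\<exists>X'. (\<forall>j. ((\<lambda>t. X' t j) \<longlongrightarrow> X j) (at 0)) \<and> (\<forall>t. \<forall>j. j \<notin> J0 \<longrightarrow> X' t j = X j) \<and>
     eventually (\<lambda>t. \<forall>r\<in>?I. (\<Sum>j\<in>?J. hom_matrix V (D t) r j * X' t j) = 0) (at 0)"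
  proof (rule kernel_vector_limit[OF finI J0 _ _ X])
    show "((\<lambda>t. hom_matrix V (D t) r j) \<longlongrightarrow> hom_matrix V C r j) (at 0)" for r j
      unfolding hom_matrix_def by (auto split: prod.split intro!: tendsto_intros limD)
    show "eventually (\<lambda>t. col_rank (hom_matrix V (D t)) ?I ?J \<le> card J0) (at 0)"
      using ev by (rule eventually_mono) (rule max)
  qed
  then obtain X' where X': "\<And>j. ((\<lambda>t. X' t j) \<longlongrightarrow> X j) (at 0)"
     and ker: "eventually (\<lambda>t. \<forall>r\<in>?I. (\<Sum>j\<in>?J. hom_matrix V (D t) r j * X' t j) = 0) (at 0)" by blast
  define \<phi> where "\<phi> = (\<lambda>Y. \<Sum>c\<in>Ai i. \<eta> (i, s, c) * leg_mult A Y V i w c)"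
  have "eventually (\<lambda>t. \<phi> (X' t) = 0) (at 0)"
    using ker eventually_neq_at_within[of 0 0]
  proof eventually_elim
    case (elim t)
    have eq: "hom_matrix V (D t) r j = hom_matrix V C r j + t * hom_matrix V C' r j" for r j
      unfolding hom_matrix_def D_def by (auto split: prod.split simp: algebra_simps)
    \<comment> \<open>Pairing with \<open>\<eta>\<close> removes the \<open>C\<close> part; dividing
      the rest by \<open>t\<close> leaves the pairing with the derivative, which survives in the
      limit.\<close>
    have "0 = (\<Sum>r\<in>?I. \<eta> r * (\<Sum>j\<in>?J. hom_matrix V (D t) r j * X' t j))"
      using elim(1) by simp
    also have "\<dots> = (\<Sum>r\<in>?I. \<eta> r * (\<Sum>j\<in>?J. hom_matrix V C r j * X' t j))
         + t * (\<Sum>r\<in>?I. \<eta> r * (\<Sum>j\<in>?J. hom_matrix V C' r j * X' t j))"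
      by (simp add: eq distrib_right sum.distrib distrib_left sum_distrib_left mult_ac)
    also have "(\<Sum>r\<in>?I. \<eta> r * (\<Sum>j\<in>?J. hom_matrix V C r j * X' t j))
        = (\<Sum>j\<in>?J. (\<Sum>r\<in>?I. \<eta> r * hom_matrix V C r j) * X' t j)"
      by (simp add: sum_distrib_left sum_distrib_right mult.assoc) (rule sum.swap)
    also have "\<dots> = 0" using \<eta> by simp
    finally have "(\<Sum>r\<in>?I. \<eta> r * (\<Sum>j\<in>?J. hom_matrix V C' r j * X' t j)) = 0"
      using elim(2) by simp
    moreover have "(\<Sum>r\<in>?I. \<eta> r * (\<Sum>j\<in>?J. hom_matrix V C' r j * X' t j)) = \<phi> (X' t)"
    proof -
      have in1: "(\<Sum>w'\<in>W. C' i' s' w' * leg_mult A (X' t) V i' w' c)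
          = of_bool (i' = i \<and> s' = s) * leg_mult A (X' t) V i' w c" for i' s' c
      proof -
        have "(\<Sum>w'\<in>W. C' i' s' w' * leg_mult A (X' t) V i' w' c)
           = (\<Sum>w'\<in>W. if w' = w then of_bool (i' = i \<and> s' = s) * leg_mult A (X' t) V i' w c else 0)"
          by (intro sum.cong) (auto simp: C'_def)
        then show ?thesis using isw fin by simp
      qed
      have "(\<Sum>r\<in>?I. \<eta> r * (\<Sum>j\<in>?J. hom_matrix V C' r j * X' t j))
        = (\<Sum>i'<k. \<Sum>s'\<in>Q. \<Sum>c\<in>Ai i'. \<eta> (i', s', c) * (of_bool (i' = i \<and> s' = s) * leg_mult A (X' t) V i' w c))"
        unfolding sum_leg_rows[OF fin(2,4)] hom_kernel_iff[OF fin(1,3)] in1 ..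
      also have "\<dots> = (\<Sum>i'<k. if i' = i then (\<Sum>s'\<in>Q. if s' = s then \<phi> (X' t) else 0) else 0)"
        unfolding \<phi>_def by (intro sum.cong refl) (auto intro!: sum.cong)
      also have "\<dots> = \<phi> (X' t)" using isw fin by simp
      finally show ?thesis .
    qed
    ultimately show ?case by simp
  qed
  moreover have "((\<lambda>t. \<phi> (X' t)) \<longlongrightarrow> \<phi> X) (at 0)"
    unfolding \<phi>_def leg_mult_def by (intro tendsto_intros X')
  ultimately have "\<phi> X = 0"
    using tendsto_unique[OF _ _ tendsto_eventually, of "at (0::real)" "\<lambda>t. \<phi> (X' t)" "\<phi> X" 0] by simp
  then show ?thesis by (simp add: \<phi>_def)
qed

lemma destabilized_of_no_homs:
  assumes fin: "finite A" "\<And>i. finite (Ai i)" "finite W" "finite Q"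
    and ext: "ext_nonzero k A Ai W Q B C"
    and inj: "\<And>X. (\<And>r. r \<in> leg_rows k Ai Q \<Longrightarrow> (\<Sum>j\<in>W \<times> A. hom_matrix B C r j * X j) = 0) \<Longrightarrow> \<forall>j\<in>W \<times> A. X j = 0"
  shows "destabilized k A Ai W Q B"
proof -
  let ?I = "leg_rows k Ai Q" and ?J = "W \<times> A"
  have finI: "finite ?I" "finite ?J" using fin by (auto simp: leg_rows_def)
  obtain \<eta> r0 where r0: "r0 \<in> ?I" "\<eta> r0 \<noteq> 0" and \<eta>: "\<And>j. j \<in> ?J \<Longrightarrow> (\<Sum>r\<in>?I. \<eta> r * hom_matrix B C r j) = 0"
    using ext unfolding ext_nonzero_def by blast
  have "cols_free (hom_matrix B C) (?I - {r0}) ?J"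
  proof (rule cols_freeI)
    fix v assume v: "\<And>r. r \<in> ?I - {r0} \<Longrightarrow> (\<Sum>j\<in>?J. hom_matrix B C r j * v j) = 0"
    have "0 = (\<Sum>j\<in>?J. (\<Sum>r\<in>?I. \<eta> r * hom_matrix B C r j) * v j)" using \<eta> by simp
    also have "\<dots> = (\<Sum>r\<in>?I. \<eta> r * (\<Sum>j\<in>?J. hom_matrix B C r j * v j))"
      by (simp add: sum_distrib_left sum_distrib_right mult.assoc) (rule sum.swap)
    also have "\<dots> = \<eta> r0 * (\<Sum>j\<in>?J. hom_matrix B C r0 j * v j)"
      using v by (subst sum.remove[OF finI(1) r0(1)]) simp
    finally have "(\<Sum>j\<in>?J. hom_matrix B C r0 j * v j) = 0" using r0 by simp
    then show "\<forall>j\<in>?J. v j = 0" using v by (intro inj) blast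
  qed (use finI in auto)
  then have "card ?J \<le> card (?I - {r0})" using finI by (intro cols_free_card_le) auto
  also have "\<dots> < card ?I" using r0 finI by (meson card_Diff1_less)
  also have "card ?I = card Q * (\<Sum>i<k. card (Ai i))"
    unfolding leg_rows_def using fin by (simp add: card_cartesian_product sum_distrib_left)
  finally have lt: "card W * card A < card Q * (\<Sum>i<k. card (Ai i))" by (simp add: card_cartesian_product)
  define d where "d = (\<lambda>a b :: nat. of_bool (a = b) :: real)"
  have d: "cols_free d S S" if "finite S" for S
    unfolding cols_free_def using that
    by (intro exI[of _ d]) (auto simp: d_def of_bool_def if_distrib[of "\<lambda>x. x * _"] cong: if_cong)
  have dr: "(\<Sum>u\<in>S. f u * d u y) = f y" if "finite S" "y \<in> S" for S f y
    using that by (simp add: d_def of_bool_def if_distrib[of "\<lambda>x. _ * x"] cong: if_cong)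
  have dl: "(\<Sum>u\<in>S. d y u * f u) = f y" if "finite S" "y \<in> S" for S f y
    using that by (simp add: d_def of_bool_def if_distrib[of "\<lambda>x. x * _"] cong: if_cong)
  show ?thesis
    unfolding destabilized_def
    by (rule exI[of _ A], rule exI[of _ Ai], rule exI[of _ d], rule exI[of _ "\<lambda>_. d"], rule exI[of _ B])
       (use fin lt d dr dl in auto)
qed

lemma leg_mult_add: "leg_mult A X (\<lambda>i a c. B i a c + D i a c) i w c = leg_mult A X B i w c + leg_mult A X D i w c"
  unfolding leg_mult_def by (simp add: distrib_left sum.distrib)

text \<open>The kernels of \<open>X\<close> and of the products of \<open>X\<close> with the legs
  form a subrepresentation, written as \<open>K\<close> in the bases \<open>\<iota>\<close> and
  \<open>\<kappa>\<close>. By \<open>tan\<close> each vector \<open>\<eta> (i, s, _)\<close> lies in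
  the kernel for leg \<open>i\<close>, hence is determined by its coordinates in
  \<open>Aci i\<close>; these coordinates form a nonzero cokernel element for
  \<open>K\<close>.\<close>

lemma ext_nonzero_restrict:
  assumes fin: "finite A" "\<And>i. finite (Ai i)" "finite W" "finite Q"
    and Ac: "Ac = A - JX" and Aci: "\<And>i. Aci i = Ai i - Ji i" and sub: "JX \<subseteq> A" "\<And>i. Ji i \<subseteq> Ai i"
    and \<iota>: "\<And>b a. b \<in> Ac \<Longrightarrow> a \<notin> JX \<Longrightarrow> \<iota> b a = of_bool (a = b)"
    and free: "\<And>i. i < k \<Longrightarrow> cols_free (leg_mult A X V i) W (Ji i)"
    and \<kappa>: "\<And>i c c'. i < k \<Longrightarrow> c \<in> Aci i \<Longrightarrow> c' \<notin> Ji i \<Longrightarrow> \<kappa> i c c' = of_bool (c' = c)"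
      "\<And>i c w. i < k \<Longrightarrow> c \<in> Aci i \<Longrightarrow> w \<in> W \<Longrightarrow> (\<Sum>c'\<in>Ai i. leg_mult A X V i w c' * \<kappa> i c c') = 0"
    and rel: "\<And>i a c. i < k \<Longrightarrow> a \<in> A \<Longrightarrow> c \<in> Aci i \<Longrightarrow>
        (\<Sum>c'\<in>Ai i. V i a c' * \<kappa> i c c') = (\<Sum>b\<in>Ac. \<iota> b a * K i b c)"
    and \<eta>0: "r0 \<in> leg_rows k Ai Q" "\<eta> r0 \<noteq> 0"
    and \<eta>: "\<And>j. j \<in> W \<times> A \<Longrightarrow> (\<Sum>r\<in>leg_rows k Ai Q. \<eta> r * hom_matrix V C r j) = 0"
    and tan: "\<And>i s w. i < k \<Longrightarrow> s \<in> Q \<Longrightarrow> w \<in> W \<Longrightarrow> (\<Sum>c\<in>Ai i. \<eta> (i, s, c) * leg_mult A X V i w c) = 0"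
  shows "ext_nonzero k Ac Aci W Q K C"
proof -
  have finc: "\<And>i. finite (Aci i)" "finite Ac" using fin Aci Ac by auto
  have exp: "\<eta> (i, s, c) = (\<Sum>d\<in>Aci i. \<eta> (i, s, d) * \<kappa> i d c)" if "i < k" "s \<in> Q" "c \<in> Ai i" for i s c
    unfolding Aci
  proof (rule kernel_vector_expansion[OF fin(3,2) sub(2) free[OF that(1)]])
    show "(\<Sum>j\<in>Ai i. leg_mult A X V i w j * \<eta> (i, s, j)) = 0" if "w \<in> W" for w
      using tan[OF \<open>i < k\<close> \<open>s \<in> Q\<close> that] by (simp add: mult.commute)
    show "\<kappa> i b j = of_bool (j = b)" if "b \<in> Ai i - Ji i" "j \<notin> Ji i" for b j
      using \<kappa>(1)[OF \<open>i < k\<close>] that Aci by simp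
    show "(\<Sum>j\<in>Ai i. leg_mult A X V i w j * \<kappa> i b j) = 0" if "b \<in> Ai i - Ji i" "w \<in> W" for b w
      using \<kappa>(2)[OF \<open>i < k\<close>] that Aci by simp
    show "c \<in> Ai i" by (rule that(3))
  qed
  have nz: "\<exists>r\<in>leg_rows k Aci Q. \<eta> r \<noteq> 0"
  proof (rule ccontr)
    assume "\<not> ?thesis"
    then have z: "\<eta> (i, s, d) = 0" if "i < k" "s \<in> Q" "d \<in> Aci i" for i s d
      using that by (auto simp: leg_rows_def)
    obtain i s c where r0: "r0 = (i, s, c)" "i < k" "s \<in> Q" "c \<in> Ai i" using \<eta>0(1) by (auto simp: leg_rows_def)
    then show False using exp[OF r0(2-4)] z \<eta>0(2) by simp
  qed
  have "(\<Sum>r\<in>leg_rows k Aci Q. \<eta> r * hom_matrix K C r j) = 0" if "j \<in> W \<times> Ac" for j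
  proof -
    obtain w a where j: "j = (w, a)" "w \<in> W" "a \<in> Ac" using \<open>j \<in> W \<times> Ac\<close> by auto
    have aA: "a \<in> A" "a \<notin> JX" using j Ac by auto
    have K: "(\<Sum>c\<in>Ai i. \<eta> (i, s, c) * V i a c) = (\<Sum>d\<in>Aci i. \<eta> (i, s, d) * K i a d)" if "i < k" "s \<in> Q" for i s
    proof -
      have "(\<Sum>c\<in>Ai i. \<eta> (i, s, c) * V i a c) = (\<Sum>c\<in>Ai i. (\<Sum>d\<in>Aci i. \<eta> (i, s, d) * \<kappa> i d c) * V i a c)"
        using exp[OF that] by (intro sum.cong) auto
      also have "\<dots> = (\<Sum>d\<in>Aci i. \<eta> (i, s, d) * (\<Sum>c\<in>Ai i. V i a c * \<kappa> i d c))"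
        by (simp add: sum_distrib_left sum_distrib_right mult_ac) (rule sum.swap)
      also have "\<dots> = (\<Sum>d\<in>Aci i. \<eta> (i, s, d) * K i a d)"
      proof (intro sum.cong refl)
        fix d assume d: "d \<in> Aci i"
        have "(\<Sum>b\<in>Ac. \<iota> b a * K i b d) = (\<Sum>b\<in>Ac. if b = a then K i b d else 0)"
          using \<iota> aA by (intro sum.cong) auto
        then show "\<eta> (i, s, d) * (\<Sum>c\<in>Ai i. V i a c * \<kappa> i d c) = \<eta> (i, s, d) * K i a d"
          using rel[OF that(1) aA(1) d] j finc by simp
      qed
      finally show ?thesis .
    qed
    have "(\<Sum>r\<in>leg_rows k Aci Q. \<eta> r * hom_matrix K C r j) = (\<Sum>i<k. \<Sum>s\<in>Q. C i s w * (\<Sum>d\<in>Aci i. \<eta> (i, s, d) * K i a d))"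
      unfolding sum_leg_rows[of Aci, OF finc(1) fin(4)] j hom_matrix_def by (simp add: sum_distrib_left mult_ac)
    also have "\<dots> = (\<Sum>i<k. \<Sum>s\<in>Q. C i s w * (\<Sum>c\<in>Ai i. \<eta> (i, s, c) * V i a c))"
      using K by (intro sum.cong refl) auto
    also have "\<dots> = (\<Sum>r\<in>leg_rows k Ai Q. \<eta> r * hom_matrix V C r j)"
      unfolding sum_leg_rows[of Ai, OF fin(2,4)] j hom_matrix_def by (simp add: sum_distrib_left mult_ac)
    also have "\<dots> = 0" using \<eta>[of j] j aA by simp
    finally show ?thesis .
  qed
  then show ?thesis unfolding ext_nonzero_def using nz by blast
qed

text \<open>A subrepresentation of a subrepresentation is one of the whole, by composing embeddings,
  and the slope test refers only to its own dimensions.\<close>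

lemma destabilized_lift:
  assumes fin: "finite A" "\<And>i. finite (Ai i)"
    and sub: "Ac \<subseteq> A" "\<And>i. Aci i \<subseteq> Ai i"
    and \<iota>: "\<And>b a. b \<in> Ac \<Longrightarrow> a \<in> Ac \<Longrightarrow> \<iota> b a = of_bool (a = b)"
    and \<kappa>: "\<And>i c c'. i < k \<Longrightarrow> c \<in> Aci i \<Longrightarrow> c' \<in> Aci i \<Longrightarrow> \<kappa> i c c' = of_bool (c' = c)"
    and rel: "\<And>i a c. i < k \<Longrightarrow> a \<in> A \<Longrightarrow> c \<in> Aci i \<Longrightarrow>
        (\<Sum>c'\<in>Ai i. V i a c' * \<kappa> i c c') = (\<Sum>b\<in>Ac. \<iota> b a * K i b c)"
    and bad: "destabilized k Ac Aci W Q K"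
  shows "destabilized k A Ai W Q V"
proof -
  have finc: "\<And>i. finite (Aci i)" "finite Ac" using finite_subset[OF sub(2) fin(2)] finite_subset[OF sub(1) fin(1)] by auto
  have free: "cols_free (\<lambda>a b. f b a) T S" if "S \<subseteq> T" "finite T" "\<And>b a. b \<in> S \<Longrightarrow> a \<in> S \<Longrightarrow> f b a = of_bool (a = b)"
    for S T :: "nat set" and f :: "nat \<Rightarrow> nat \<Rightarrow> real"
  proof -
    have "(\<Sum>a\<in>T. of_bool (a \<in> S \<and> a = b) * f b' a) = of_bool (b = b')" if "b \<in> S" "b' \<in> S" for b b'
    proof -
      have "(\<Sum>a\<in>T. of_bool (a \<in> S \<and> a = b) * f b' a) = (\<Sum>a\<in>T. if a = b then of_bool (b = b') else 0)"
        using that \<open>\<And>b a. b \<in> S \<Longrightarrow> a \<in> S \<Longrightarrow> f b a = of_bool (a = b)\<close> by (intro sum.cong) auto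
      then show ?thesis using that \<open>S \<subseteq> T\<close> \<open>finite T\<close> by auto
    qed
    then show ?thesis unfolding cols_free_def by (intro exI[of _ "\<lambda>b a. of_bool (a \<in> S \<and> a = b)"]) auto
  qed
  obtain U :: "nat set" and Y \<iota>' \<kappa>' \<beta> where U0: "finite U" "\<forall>i<k. finite (Y i :: nat set)"
     "cols_free \<iota>' Ac U" "\<forall>i<k. cols_free (\<kappa>' i) (Aci i) (Y i)"
     "\<forall>i<k. \<forall>a\<in>Ac. \<forall>y\<in>Y i. (\<Sum>c\<in>Aci i. K i a c * \<kappa>' i c y) = (\<Sum>u\<in>U. \<iota>' a u * \<beta> i u y)"
     "card W * card U < card Q * (\<Sum>i<k. card (Y i))"
    using bad unfolding destabilized_def by (elim exE conjE) (rule that)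
  note U = U0(1) U0(2)[rule_format] U0(3) U0(4)[rule_format] U0(5)[rule_format] U0(6)
  define \<iota>2 where "\<iota>2 = (\<lambda>a u. \<Sum>b\<in>Ac. \<iota> b a * \<iota>' b u)"
  define \<kappa>2 where "\<kappa>2 = (\<lambda>i c y. \<Sum>d\<in>Aci i. \<kappa> i d c * \<kappa>' i d y)"
  have 1: "cols_free \<iota>2 A U"
    unfolding \<iota>2_def by (rule cols_free_mult[OF fin(1) finc(2) U(1) free[OF sub(1) fin(1)] U(3)]) (rule \<iota>)
  have 2: "cols_free (\<kappa>2 i) (Ai i) (Y i)" if "i < k" for i
    unfolding \<kappa>2_def
    by (rule cols_free_mult[OF fin(2) finc(1) U(2) free[OF sub(2) fin(2)] U(4)]) (use \<kappa> that in auto)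
  have 3: "(\<Sum>c\<in>Ai i. V i a c * \<kappa>2 i c y) = (\<Sum>u\<in>U. \<iota>2 a u * \<beta> i u y)" if "i < k" "a \<in> A" "y \<in> Y i" for i a y
  proof -
    have "(\<Sum>c\<in>Ai i. V i a c * \<kappa>2 i c y) = (\<Sum>d\<in>Aci i. (\<Sum>c\<in>Ai i. V i a c * \<kappa> i d c) * \<kappa>' i d y)"
      unfolding \<kappa>2_def by (simp add: sum_distrib_left sum_distrib_right mult.assoc) (rule sum.swap)
    also have "\<dots> = (\<Sum>d\<in>Aci i. (\<Sum>b\<in>Ac. \<iota> b a * K i b d) * \<kappa>' i d y)"
      using rel that by (intro sum.cong) auto
    also have "\<dots> = (\<Sum>b\<in>Ac. \<iota> b a * (\<Sum>d\<in>Aci i. K i b d * \<kappa>' i d y))"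
      by (simp add: sum_distrib_left sum_distrib_right mult.assoc) (rule sum.swap)
    also have "\<dots> = (\<Sum>b\<in>Ac. \<iota> b a * (\<Sum>u\<in>U. \<iota>' b u * \<beta> i u y))"
      using U(5) that by (intro sum.cong) auto
    also have "\<dots> = (\<Sum>u\<in>U. \<iota>2 a u * \<beta> i u y)"
      unfolding \<iota>2_def by (simp add: sum_distrib_left sum_distrib_right mult.assoc) (rule sum.swap)
    finally show ?thesis .
  qed
  show ?thesis unfolding destabilized_def
    by (rule exI[of _ U], rule exI[of _ Y], rule exI[of _ \<iota>2], rule exI[of _ \<kappa>2], rule exI[of _ \<beta>])
       (use U 1 2 3 in auto)
qed

text \<open>Used for ranks: each rank can only jump up near a point, and a bound on their sum then
  keeps every single one constant.\<close>

lemma sum_le_imp_each_le: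
  fixes f g :: "'a \<Rightarrow> nat"
  assumes "finite S" "x + sum f S \<le> y + sum g S" "y \<le> x" "\<And>i. i \<in> S \<Longrightarrow> g i \<le> f i"
  shows "x \<le> y" "i \<in> S \<Longrightarrow> f i \<le> g i"
proof -
  have le: "sum g S \<le> sum f S" using assms(4) by (rule sum_mono)
  then show "x \<le> y" using assms(2) by linarith
  assume i: "i \<in> S"
  have "sum g (S - {i}) \<le> sum f (S - {i})" using assms(4) by (intro sum_mono) auto
  moreover have "sum f S = f i + sum f (S - {i})" "sum g S = g i + sum g (S - {i})"
    using i assms(1) by (simp_all add: sum.remove)
  ultimately show "f i \<le> g i" using assms(2,3) by linarith
qed

text \<open>Among the pairs of maximal rank with a kernel vector \<open>X\<close>, one is chosen for
  which the total rank of \<open>X\<close> and of its products with the legs is maximal. If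
  \<open>X = 0\<close>, the whole representation destabilizes. Otherwise the kernels of these maps
  form a smaller subrepresentation, and the crux is that every representation near it is the kernel
  subrepresentation of some \<open>V\<close> near \<open>B\<close>; so the induction hypothesis
  meets an open set again.\<close>

theorem generic_destabilized:
  assumes "finite A" "\<And>i. finite (Ai i)" "finite W" "finite Q" "open \<Omega>" "\<Omega> \<noteq> {}"
    and "\<And>B C. (B, C) \<in> \<Omega> \<Longrightarrow> ext_nonzero k A Ai W Q B C"
  shows "\<exists>B C. (B, C) \<in> \<Omega> \<and> destabilized k A Ai W Q B"
  using assms
proof (induction "card A" arbitrary: A Ai \<Omega> rule: less_induct)
  case less
  note fin = less.prems(1-4) and op = less.prems(5)
  let ?I = "leg_rows k Ai Q" and ?J = "W \<times> A"
  have finI: "finite ?I" "finite ?J" using fin by (auto simp: leg_rows_def)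
  define rk where "rk = (\<lambda>p. col_rank (hom_matrix (fst p) (snd p)) ?I ?J)"
  have "\<exists>p. p \<in> \<Omega> \<and> (\<forall>q. q \<in> \<Omega> \<longrightarrow> rk q \<le> rk p)"
  proof -
    obtain p0 where "p0 \<in> \<Omega>" using less.prems by blast
    then show ?thesis
      by (rule ex_has_greatest_nat[of "\<lambda>p. p \<in> \<Omega>" _ rk "Suc (card ?J)"])
         (use col_rank_le[OF finI(2)] in \<open>auto simp: rk_def less_Suc_eq_le\<close>)
  qed
  then obtain p1 where p1: "p1 \<in> \<Omega>" "\<And>q. q \<in> \<Omega> \<Longrightarrow> rk q \<le> rk p1" by blast
  define P where "P = (\<lambda>(B, C, X). (B, C) \<in> \<Omega> \<and> rk (B, C) = rk p1 \<and>
      (\<forall>r\<in>?I. (\<Sum>j\<in>?J. hom_matrix B C r j * X j) = 0))"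
  define xm where "xm = (\<lambda>(X :: nat \<times> nat \<Rightarrow> real) w a. X (w, a))"
  define f where "f = (\<lambda>(B :: legs, C :: legs, X). col_rank (xm X) W A + (\<Sum>i<k. col_rank (leg_mult A X B i) W (Ai i)))"
  have "\<exists>q. P q \<and> (\<forall>q'. P q' \<longrightarrow> f q' \<le> f q)"
  proof (rule ex_has_greatest_nat[of P "(fst p1, snd p1, \<lambda>_. 0)" f "Suc (card A + (\<Sum>i<k. card (Ai i)))"])
    show "P (fst p1, snd p1, \<lambda>_. 0)" using p1 by (simp add: P_def)
    show "\<forall>q. P q \<longrightarrow> f q < Suc (card A + (\<Sum>i<k. card (Ai i)))"
      unfolding f_def using fin by (auto simp: less_Suc_eq_le intro!: add_mono sum_mono col_rank_le)
  qed
  then obtain B C X where BCX: "P (B, C, X)" "\<And>B' C' X'. P (B', C', X') \<Longrightarrow> f (B', C', X') \<le> f (B, C, X)"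
    by auto
  then have BC: "(B, C) \<in> \<Omega>" "rk (B, C) = rk p1" and X: "\<And>r. r \<in> ?I \<Longrightarrow> (\<Sum>j\<in>?J. hom_matrix B C r j * X j) = 0"
    by (auto simp: P_def)
  show ?case
  proof (cases "\<forall>j\<in>?J. X j = 0")
    case True
    have rk0: "col_rank (\<lambda>w a. 0) W S = 0" if finS: "finite S" for S :: "nat set"
    proof -
      obtain J0 where J0: "J0 \<subseteq> S" "cols_free (\<lambda>w a. 0) W J0" "card J0 = col_rank (\<lambda>w a. 0) W S"
        using col_rank_attained[OF finS] by metis
      have "J0 = {}" using J0(2) unfolding cols_free_def by force
      then show ?thesis using J0(3) by simp
    qed
    have f0: "f (B, C, X) = 0"
    proof -
      have "col_rank (xm X) W A = col_rank (\<lambda>w a. 0) W A" using True by (intro col_rank_cong) (auto simp: xm_def)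
      moreover have "col_rank (leg_mult A X B i) W (Ai i) = col_rank (\<lambda>w a. 0) W (Ai i)" for i
        using True by (intro col_rank_cong) (auto simp: leg_mult_def)
      ultimately show ?thesis using rk0 fin by (simp add: f_def)
    qed
    have "destabilized k A Ai W Q B"
    proof (rule destabilized_of_no_homs[OF fin less.prems(7)[OF BC(1)]])
      fix X' assume "\<And>r. r \<in> ?I \<Longrightarrow> (\<Sum>j\<in>?J. hom_matrix B C r j * X' j) = 0"
      then have "P (B, C, X')" using BC by (simp add: P_def)
      then have "f (B, C, X') = 0" using BCX(2) f0 by fastforce
      then have c0: "col_rank (xm X') W A = 0" by (simp add: f_def)
      show "\<forall>j\<in>?J. X' j = 0"
      proof clarify
        fix w a assume wa: "w \<in> W" "a \<in> A"
        show "X' (w, a) = 0"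
        proof (rule ccontr)
          assume ne: "X' (w, a) \<noteq> 0"
          have "cols_free (xm X') W {a}"
            unfolding cols_free_def using wa ne fin
            by (intro exI[of _ "\<lambda>_ w'. if w' = w then 1 / X' (w, a) else 0"])
               (simp add: xm_def if_distrib[of "\<lambda>x. x * _"] cong: if_cong)
          then have "card {a} \<le> col_rank (xm X') W A" using wa fin by (intro card_le_col_rank) auto
          then show False using c0 by simp
        qed
      qed
    qed
    then show ?thesis using BC by blast
  next
    case False
    then obtain w1 a1 where wa1: "w1 \<in> W" "a1 \<in> A" "X (w1, a1) \<noteq> 0" by auto
    obtain J0 where J0: "J0 \<subseteq> ?J" "cols_free (hom_matrix B C) ?I J0" "card J0 = rk p1"
      using col_rank_attained[OF finI(2), of "hom_matrix B C" ?I] BC(2) unfolding rk_def by auto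
    have maxrk: "col_rank (hom_matrix B' C') ?I ?J \<le> card J0" if "(B', C') \<in> \<Omega>" for B' C'
      using p1(2)[OF that] J0(3) by (simp add: rk_def)
    obtain JX where JX: "JX \<subseteq> A" "cols_free (xm X) W JX" "card JX = col_rank (xm X) W A"
      using col_rank_attained[OF fin(1)] by metis
    have "\<forall>i. \<exists>J. J \<subseteq> Ai i \<and> cols_free (leg_mult A X B i) W J \<and> card J = col_rank (leg_mult A X B i) W (Ai i)"
      using col_rank_attained[OF fin(2)] by metis
    then obtain Ji where Ji: "\<And>i. Ji i \<subseteq> Ai i" "\<And>i. cols_free (leg_mult A X B i) W (Ji i)"
        "\<And>i. card (Ji i) = col_rank (leg_mult A X B i) W (Ai i)" by metis
    have finJ: "finite JX" "\<And>i. finite (Ji i)" using finite_subset[OF JX(1) fin(1)] finite_subset[OF Ji(1) fin(2)] by auto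
    define Ac where "Ac = A - JX"
    define Aci where "Aci = (\<lambda>i. Ai i - Ji i)"
    have finc: "finite Ac" "\<And>i. finite (Aci i)" using fin by (auto simp: Ac_def Aci_def)
    have "JX \<noteq> {}"
    proof
      assume "JX = {}"
      then have "col_rank (xm X) W A = 0" using JX(3) by simp
      moreover have "cols_free (xm X) W {a1}"
        unfolding cols_free_def using wa1 fin
        by (intro exI[of _ "\<lambda>_ w'. if w' = w1 then 1 / X (w1, a1) else 0"])
           (simp add: xm_def if_distrib[of "\<lambda>x. x * _"] cong: if_cong)
      ultimately show False using card_le_col_rank[OF fin(1), of "{a1}" "xm X" W] wa1 by simp
    qed
    then have small: "card Ac < card A"
      unfolding Ac_def using JX(1) fin(1) by (intro psubset_card_mono) auto
    obtain \<iota> where \<iota>: "\<And>b a. b \<in> Ac \<Longrightarrow> a \<notin> JX \<Longrightarrow> \<iota> b a = of_bool (a = b)"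
       "\<And>b w. b \<in> Ac \<Longrightarrow> w \<in> W \<Longrightarrow> (\<Sum>a\<in>A. xm X w a * \<iota> b a) = 0"
      using kernel_basis[OF fin(3,1) JX(1,2)] JX(3) unfolding Ac_def by auto
    have "\<forall>i. \<exists>\<kappa>. \<forall>b\<in>Aci i. (\<forall>j. j \<notin> Ji i \<longrightarrow> \<kappa> b j = of_bool (j = b)) \<and> (\<forall>w\<in>W. (\<Sum>j\<in>Ai i. leg_mult A X B i w j * \<kappa> b j) = 0)"
      using kernel_basis[OF fin(3,2) Ji(1,2)] Ji(3) unfolding Aci_def by simp
    then obtain \<kappa> where \<kappa>: "\<And>i c c'. c \<in> Aci i \<Longrightarrow> c' \<notin> Ji i \<Longrightarrow> \<kappa> i c c' = of_bool (c' = c)"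
       "\<And>i c w. c \<in> Aci i \<Longrightarrow> w \<in> W \<Longrightarrow> (\<Sum>c'\<in>Ai i. leg_mult A X B i w c' * \<kappa> i c c') = 0"
      by metis
    define BK where "BK = (\<lambda>i b c. \<Sum>c'\<in>Ai i. B i b c' * \<kappa> i c c')"
    \<comment> \<open>A nearby pair \<open>p\<close> prescribes a kernel subrepresentation
      \<open>fst p\<close> and a new \<open>C\<close>; all objects below depend on \<open>p\<close>
      and converge at \<open>(BK, C)\<close>.\<close>
    define F where "F = nhds (BK, C)"
    have limf: "((\<lambda>p. fst p i a c) \<longlongrightarrow> BK i a c) F" and lims: "((\<lambda>p. snd p i a c) \<longlongrightarrow> C i a c) F" for i a c
    proof -
      have "((\<lambda>p. p) \<longlongrightarrow> (BK, C)) F" unfolding F_def by (rule filterlim_ident)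
      from tendsto_fst[OF this] tendsto_snd[OF this]
      have "(fst \<longlongrightarrow> BK) F" "(snd \<longlongrightarrow> C) F" by simp_all
      then show "((\<lambda>p. fst p i a c) \<longlongrightarrow> BK i a c) F" "((\<lambda>p. snd p i a c) \<longlongrightarrow> C i a c) F"
        by (simp_all add: tendsto_fun_iff)
    qed
    have "((\<lambda>p. (B, snd p)) \<longlongrightarrow> (B, C)) F"
      by (intro tendsto_Pair tendsto_const) (simp add: tendsto_fun_iff lims)
    then have e1: "eventually (\<lambda>p. (B, snd p) \<in> \<Omega>) F" using op BC(1) by (rule topological_tendstoD)
    have limH: "((\<lambda>p. hom_matrix (V p) (snd p) r j) \<longlongrightarrow> hom_matrix B C r j) F"
      if "\<And>i a c. ((\<lambda>p. V p i a c) \<longlongrightarrow> B i a c) F" for V r j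
      unfolding hom_matrix_def by (auto split: prod.split intro!: tendsto_intros lims that)
    have e2: "eventually (\<lambda>p. cols_free (hom_matrix B (snd p)) ?I J0) F"
      using finite_subset[OF J0(1) finI(2)]
      by (intro eventually_cols_free[OF finI(1) _ J0(2)] limH tendsto_const)
    have "\<exists>X'. (\<forall>j. ((\<lambda>p. X' p j) \<longlongrightarrow> X j) F) \<and> (\<forall>p. \<forall>j. j \<notin> J0 \<longrightarrow> X' p j = X j) \<and>
       eventually (\<lambda>p. \<forall>r\<in>?I. (\<Sum>j\<in>?J. hom_matrix B (snd p) r j * X' p j) = 0) F"
    proof (rule kernel_vector_limit[OF finI J0(1,2) _ _ X])
      show "((\<lambda>p. hom_matrix B (snd p) r j) \<longlongrightarrow> hom_matrix B C r j) F" for r j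
        by (intro limH tendsto_const)
      show "eventually (\<lambda>p. col_rank (hom_matrix B (snd p)) ?I ?J \<le> card J0) F"
        using e1 by (rule eventually_mono) (rule maxrk)
    qed
    then obtain X' where X': "\<And>j. ((\<lambda>p. X' p j) \<longlongrightarrow> X j) F"
       and e3: "eventually (\<lambda>p. \<forall>r\<in>?I. (\<Sum>j\<in>?J. hom_matrix B (snd p) r j * X' p j) = 0) F" by blast
    have limL: "((\<lambda>p. leg_mult A (X' p) B i w c) \<longlongrightarrow> leg_mult A X B i w c) F" for i w c
      unfolding leg_mult_def by (intro tendsto_intros X')
    have e4: "eventually (\<lambda>p. cols_free (xm (X' p)) W JX) F"
      by (rule eventually_cols_free[OF fin(3) finJ(1) JX(2)]) (simp add: xm_def X')
    have e5: "eventually (\<lambda>p. \<forall>i\<in>{..<k}. cols_free (leg_mult A (X' p) B i) W (Ji i)) F"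
      by (intro eventually_ball_finite ballI eventually_cols_free[OF fin(3) finJ(2) Ji(2)] limL) simp
    \<comment> \<open>Each rank is at least its limit, and by the choice of \<open>X\<close> the
      total is not larger, so every rank stays constant.\<close>
    have e6: "eventually (\<lambda>p. col_rank (xm (X' p)) W A \<le> card JX \<and>
        (\<forall>i\<in>{..<k}. col_rank (leg_mult A (X' p) B i) W (Ai i) \<le> card (Ji i))) F"
      using e1 e2 e3 e4 e5
    proof eventually_elim
      case (elim p)
      have "rk (B, snd p) = rk p1"
      proof (rule antisym)
        show "rk (B, snd p) \<le> rk p1" using p1(2) elim(1) by blast
        show "rk p1 \<le> rk (B, snd p)"
          using card_le_col_rank[OF finI(2) J0(1) elim(2)] J0(3) by (simp add: rk_def)
      qed
      then have "P (B, snd p, X' p)" using elim by (simp add: P_def)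
      then have le: "col_rank (xm (X' p)) W A + (\<Sum>i<k. col_rank (leg_mult A (X' p) B i) W (Ai i))
          \<le> card JX + (\<Sum>i<k. card (Ji i))"
        using BCX(2) by (fastforce simp: f_def JX(3) Ji(3))
      have ge1: "card JX \<le> col_rank (xm (X' p)) W A" by (rule card_le_col_rank[OF fin(1) JX(1) elim(4)])
      have ge2: "card (Ji i) \<le> col_rank (leg_mult A (X' p) B i) W (Ai i)" if "i \<in> {..<k}" for i
        using elim(5) that by (intro card_le_col_rank[OF fin(2) Ji(1)]) auto
      show ?case using sum_le_imp_each_le[OF _ le ge1 ge2] by simp
    qed
    have "\<forall>b\<in>Ac. \<exists>Y. (\<forall>a. ((\<lambda>p. Y p a) \<longlongrightarrow> \<iota> b a) F) \<and> (\<forall>p. \<forall>a. a \<notin> JX \<longrightarrow> Y p a = \<iota> b a) \<and>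
       eventually (\<lambda>p. \<forall>w\<in>W. (\<Sum>a\<in>A. xm (X' p) w a * Y p a) = 0) F"
    proof
      fix b assume b: "b \<in> Ac"
      show "\<exists>Y. (\<forall>a. ((\<lambda>p. Y p a) \<longlongrightarrow> \<iota> b a) F) \<and> (\<forall>p. \<forall>a. a \<notin> JX \<longrightarrow> Y p a = \<iota> b a) \<and>
       eventually (\<lambda>p. \<forall>w\<in>W. (\<Sum>a\<in>A. xm (X' p) w a * Y p a) = 0) F"
      proof (rule kernel_vector_limit[OF fin(3,1) JX(1,2)])
        show "eventually (\<lambda>p. col_rank (xm (X' p)) W A \<le> card JX) F"
          using e6 by (rule eventually_mono) blast
        show "((\<lambda>p. xm (X' p) w a) \<longlongrightarrow> xm X w a) F" for w a by (simp add: xm_def X')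
      qed (rule \<iota>(2)[OF b])
    qed
    from bchoice[OF this] obtain \<iota>' where \<iota>'0: "\<forall>b\<in>Ac. (\<forall>a. ((\<lambda>p. \<iota>' b p a) \<longlongrightarrow> \<iota> b a) F) \<and> (\<forall>p. \<forall>a. a \<notin> JX \<longrightarrow> \<iota>' b p a = \<iota> b a) \<and>
       eventually (\<lambda>p. \<forall>w\<in>W. (\<Sum>a\<in>A. xm (X' p) w a * \<iota>' b p a) = 0) F" by blast
    have \<iota>': "\<And>b a. b \<in> Ac \<Longrightarrow> ((\<lambda>p. \<iota>' b p a) \<longlongrightarrow> \<iota> b a) F"
        "\<And>b p a. b \<in> Ac \<Longrightarrow> a \<notin> JX \<Longrightarrow> \<iota>' b p a = \<iota> b a"
        "\<And>b. b \<in> Ac \<Longrightarrow> eventually (\<lambda>p. \<forall>w\<in>W. (\<Sum>a\<in>A. xm (X' p) w a * \<iota>' b p a) = 0) F"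
      using \<iota>'0 by blast+
    have e7: "eventually (\<lambda>p. \<forall>b\<in>Ac. \<forall>w\<in>W. (\<Sum>a\<in>A. xm (X' p) w a * \<iota>' b p a) = 0) F"
      by (rule eventually_ball_finite[OF finc(1)], rule ballI, rule \<iota>'(3))
    define R where "R = (\<lambda>i c Y. (\<forall>a. ((\<lambda>p. Y p a) \<longlongrightarrow> \<kappa> i c a) F) \<and> (\<forall>p. \<forall>a. a \<notin> Ji i \<longrightarrow> Y p a = \<kappa> i c a) \<and>
       eventually (\<lambda>p. \<forall>w\<in>W. (\<Sum>a\<in>Ai i. leg_mult A (X' p) B i w a * Y p a) = 0) F)"
    have exR: "\<exists>Y. R i c Y" if i: "i < k" and c: "c \<in> Aci i" for i c
      unfolding R_def
    proof (rule kernel_vector_limit[OF fin(3,2) Ji(1,2) limL])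
      show "eventually (\<lambda>p. col_rank (leg_mult A (X' p) B i) W (Ai i) \<le> card (Ji i)) F"
        using e6 by (rule eventually_mono) (use i in blast)
    qed (rule \<kappa>(2)[OF c])
    have R: "R i c (SOME Y. R i c Y)" if "i < k" "c \<in> Aci i" for i c
      by (rule someI_ex[OF exR[OF that]])
    define \<kappa>' where "\<kappa>' = (\<lambda>i c. SOME Y. R i c Y)"
    have R': "(\<forall>a. ((\<lambda>p. \<kappa>' i c p a) \<longlongrightarrow> \<kappa> i c a) F) \<and> (\<forall>p. \<forall>a. a \<notin> Ji i \<longrightarrow> \<kappa>' i c p a = \<kappa> i c a) \<and>
       eventually (\<lambda>p. \<forall>w\<in>W. (\<Sum>a\<in>Ai i. leg_mult A (X' p) B i w a * \<kappa>' i c p a) = 0) F"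
      if "i < k" "c \<in> Aci i" for i c
      using R[OF that] unfolding R_def \<kappa>'_def .
    have \<kappa>': "((\<lambda>p. \<kappa>' i c p a) \<longlongrightarrow> \<kappa> i c a) F"
        "a \<notin> Ji i \<Longrightarrow> \<kappa>' i c p a = \<kappa> i c a"
        "eventually (\<lambda>p. \<forall>w\<in>W. (\<Sum>a\<in>Ai i. leg_mult A (X' p) B i w a * \<kappa>' i c p a) = 0) F"
      if "i < k" "c \<in> Aci i" for i c p a
      by (rule R'[OF that, THEN conjunct1, rule_format])
         (erule R'[OF that, THEN conjunct2, THEN conjunct1, rule_format], rule R'[OF that, THEN conjunct2, THEN conjunct2])
    have e8: "eventually (\<lambda>p. \<forall>i\<in>{..<k}. \<forall>c\<in>Aci i. \<forall>w\<in>W. (\<Sum>a\<in>Ai i. leg_mult A (X' p) B i w a * \<kappa>' i c p a) = 0) F"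
      by (rule eventually_ball_finite[OF finite_lessThan], rule ballI,
          rule eventually_ball_finite[OF finc(2)], rule ballI, rule \<kappa>'(3)) auto
    \<comment> \<open>\<open>D\<close> changes \<open>B\<close> only on the columns
      \<open>Aci i\<close>, and by vectors in the kernel of \<open>X' p\<close>. So the products of
      \<open>X' p\<close> with the legs are unaffected, while the kernel subrepresentation becomes
      exactly \<open>fst p\<close>.\<close>
    define \<Delta> where "\<Delta> = (\<lambda>p i b c. fst p i b c - (\<Sum>c'\<in>Ai i. B i b c' * \<kappa>' i c p c'))"
    define D where "D = (\<lambda>p i a c. if i < k \<and> c \<in> Aci i then (\<Sum>b\<in>Ac. \<iota>' b p a * \<Delta> p i b c) else 0)"
    define V where "V = (\<lambda>p i a c. B i a c + D p i a c)"
    have limD: "((\<lambda>p. D p i a c) \<longlongrightarrow> 0) F" for i a c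
    proof (cases "i < k \<and> c \<in> Aci i")
      case True
      have "((\<lambda>p. \<Sum>b\<in>Ac. \<iota>' b p a * \<Delta> p i b c) \<longlongrightarrow> (\<Sum>b\<in>Ac. \<iota> b a * (BK i b c - (\<Sum>c'\<in>Ai i. B i b c' * \<kappa> i c c')))) F"
        unfolding \<Delta>_def using True by (intro tendsto_intros limf \<iota>' \<kappa>') auto
      then show ?thesis using True by (simp add: D_def BK_def)
    next
      case False
      then have "D p i a c = 0" for p unfolding D_def by (rule if_not_P)
      then show ?thesis by simp
    qed
    have limV: "((\<lambda>p. V p i a c) \<longlongrightarrow> B i a c) F" for i a c
      unfolding V_def using tendsto_add[OF tendsto_const limD] by simp
    have "((\<lambda>p. (V p, snd p)) \<longlongrightarrow> (B, C)) F"
      by (intro tendsto_Pair) (simp_all add: tendsto_fun_iff lims limV)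
    then have e9: "eventually (\<lambda>p. (V p, snd p) \<in> \<Omega>) F" using op BC(1) by (rule topological_tendstoD)
    have e10: "eventually (\<lambda>p. cols_free (hom_matrix (V p) (snd p)) ?I J0) F"
      using finite_subset[OF J0(1) finI(2)]
      by (intro eventually_cols_free[OF finI(1) _ J0(2)] limH limV)
    define good where "good = (\<lambda>p. (V p, snd p) \<in> \<Omega> \<and> ext_nonzero k Ac Aci W Q (fst p) (snd p) \<and>
       (\<forall>i<k. \<forall>a\<in>A. \<forall>c\<in>Aci i. (\<Sum>c'\<in>Ai i. V p i a c' * \<kappa>' i c p c') = (\<Sum>b\<in>Ac. \<iota>' b p a * fst p i b c)))"
    have "eventually good F"
      using e3 e4 e5 e7 e8 e9 e10
    proof eventually_elim
      case (elim p)
      have XD: "leg_mult A (X' p) (D p) i w c = 0" if "i < k" "w \<in> W" for i w c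
      proof -
        have "(\<Sum>a\<in>A. X' p (w, a) * (\<Sum>b\<in>Ac. \<iota>' b p a * \<Delta> p i b c))
            = (\<Sum>b\<in>Ac. (\<Sum>a\<in>A. X' p (w, a) * \<iota>' b p a) * \<Delta> p i b c)"
          by (simp add: sum_distrib_left sum_distrib_right mult.assoc) (rule sum.swap)
        also have "\<dots> = 0" using elim(4) that by (simp add: xm_def)
        finally show ?thesis unfolding leg_mult_def D_def by (cases "i < k \<and> c \<in> Aci i") (simp_all only: if_True if_False simp_thms mult_zero_right sum.neutral_const)
      qed
      have XV: "leg_mult A (X' p) (V p) i w c = leg_mult A (X' p) B i w c" if "i < k" "w \<in> W" for i w c
        using XD[OF that] leg_mult_add[of A "X' p" B "D p"] by (simp add: V_def[abs_def])
      have XVk: "(\<Sum>j\<in>?J. hom_matrix (V p) (snd p) r j * X' p j) = 0" if rI: "r \<in> ?I" for r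
      proof -
        obtain i s c where r: "r = (i, s, c)" "i < k" using rI by (auto simp: leg_rows_def)
        have "(\<Sum>j\<in>?J. hom_matrix (V p) (snd p) r j * X' p j) = (\<Sum>j\<in>?J. hom_matrix B (snd p) r j * X' p j)"
          unfolding r hom_kernel_iff[OF fin(1,3)] using XV[OF r(2)] by (intro sum.cong) auto
        then show ?thesis using elim(1) that by simp
      qed
      have rel: "(\<Sum>c'\<in>Ai i. V p i a c' * \<kappa>' i c p c') = (\<Sum>b\<in>Ac. \<iota>' b p a * fst p i b c)"
        if i: "i < k" and a: "a \<in> A" and c: "c \<in> Aci i" for i a c
      proof -
        define y where "y = (\<lambda>a. \<Sum>c'\<in>Ai i. B i a c' * \<kappa>' i c p c')"
        have yk: "(\<Sum>a\<in>A. xm (X' p) w a * y a) = 0" if "w \<in> W" for w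
        proof -
          have "(\<Sum>a\<in>A. xm (X' p) w a * y a) = (\<Sum>c'\<in>Ai i. leg_mult A (X' p) B i w c' * \<kappa>' i c p c')"
            unfolding y_def leg_mult_def xm_def by (simp add: sum_distrib_left sum_distrib_right mult.assoc) (rule sum.swap)
          then show ?thesis using elim(5) i c that by simp
        qed
        have ye: "y a = (\<Sum>b\<in>Ac. y b * \<iota>' b p a)"
          unfolding Ac_def
          by (rule kernel_vector_expansion[OF fin(3,1) JX(1) elim(2) yk])
             (use \<iota>'(2) \<iota>(1) elim(4) a in \<open>auto simp: Ac_def\<close>)
        have "(\<Sum>c'\<in>Ai i. D p i a c' * \<kappa>' i c p c') = (\<Sum>c'\<in>Ai i. if c' = c then D p i a c else 0)"
        proof (intro sum.cong refl)
          fix c' assume "c' \<in> Ai i"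
          show "D p i a c' * \<kappa>' i c p c' = (if c' = c then D p i a c else 0)"
          proof (cases "c' \<in> Ji i")
            case True then show ?thesis using c by (auto simp: D_def Aci_def)
          next
            case False then show ?thesis using \<kappa>'(2)[OF i c False] \<kappa>(1)[OF c False] by simp
          qed
        qed
        also have "\<dots> = D p i a c" using c fin(2) by (simp add: Aci_def)
        finally have "(\<Sum>c'\<in>Ai i. V p i a c' * \<kappa>' i c p c') = y a + D p i a c"
          unfolding V_def y_def by (simp add: distrib_right sum.distrib)
        also have "D p i a c = (\<Sum>b\<in>Ac. \<iota>' b p a * (fst p i b c - y b))"
          using i c by (simp add: D_def \<Delta>_def y_def)
        also have "\<dots> = (\<Sum>b\<in>Ac. \<iota>' b p a * fst p i b c) - (\<Sum>b\<in>Ac. y b * \<iota>' b p a)"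
          by (simp add: right_diff_distrib sum_subtractf mult.commute)
        finally show ?thesis using ye by simp
      qed
      obtain \<eta> r0 where r0: "r0 \<in> ?I" "\<eta> r0 \<noteq> 0"
          and \<eta>: "\<And>j. j \<in> ?J \<Longrightarrow> (\<Sum>r\<in>?I. \<eta> r * hom_matrix (V p) (snd p) r j) = 0"
        using less.prems(7)[OF elim(6)] unfolding ext_nonzero_def by blast
      have "ext_nonzero k Ac Aci W Q (fst p) (snd p)"
      proof (rule ext_nonzero_restrict[where V="V p" and X="X' p" and \<iota>="\<lambda>b a. \<iota>' b p a" and \<kappa>="\<lambda>i c a. \<kappa>' i c p a"
             and A=A and Ai=Ai and JX=JX and Ji=Ji and \<eta>=\<eta> and ?r0.0=r0])
        show "cols_free (leg_mult A (X' p) (V p) i) W (Ji i)" if "i < k" for i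
        proof -
          have "cols_free (leg_mult A (X' p) B i) W (Ji i)" using elim(3) that by simp
          then show ?thesis using XV[OF that] by (subst cols_free_cong[where S'="leg_mult A (X' p) B i"]) auto
        qed
        show "\<iota>' b p a = of_bool (a = b)" if "b \<in> Ac" "a \<notin> JX" for b a using \<iota>'(2) \<iota>(1) that by simp
        show "\<kappa>' i c p c' = of_bool (c' = c)" if "i < k" "c \<in> Aci i" "c' \<notin> Ji i" for i c c'
          using \<kappa>'(2) \<kappa>(1) that by simp
        show "(\<Sum>c'\<in>Ai i. leg_mult A (X' p) (V p) i w c' * \<kappa>' i c p c') = 0" if "i < k" "c \<in> Aci i" "w \<in> W" for i c w
          using elim(5) that XV by simp
        show "(\<Sum>c\<in>Ai i. \<eta> (i, s, c) * leg_mult A (X' p) (V p) i w c) = 0" if "i < k" "s \<in> Q" "w \<in> W" for i s w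
          by (rule tangent_condition[OF fin op elim(6) maxrk J0(1) elim(7) XVk \<eta> that])
      qed (use fin JX(1) Ji(1) rel r0 \<eta> in \<open>auto simp: Ac_def Aci_def\<close>)
      then show ?case using elim(6) rel by (simp add: good_def)
    qed
    then obtain \<Omega>' where \<Omega>': "open \<Omega>'" "(BK, C) \<in> \<Omega>'" "\<And>p. p \<in> \<Omega>' \<Longrightarrow> good p"
      unfolding F_def eventually_nhds by blast
    have "\<exists>K C'. (K, C') \<in> \<Omega>' \<and> destabilized k Ac Aci W Q K"
    proof (rule less.hyps[OF small finc fin(3,4) \<Omega>'(1)])
      show "\<Omega>' \<noteq> {}" using \<Omega>'(2) by blast
      show "ext_nonzero k Ac Aci W Q K C'" if "(K, C') \<in> \<Omega>'" for K C'
        using \<Omega>'(3)[OF that] by (simp add: good_def)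
    qed
    then obtain K C' where K: "(K, C') \<in> \<Omega>'" "destabilized k Ac Aci W Q K" by blast
    then have g: "good (K, C')" using \<Omega>'(3) by blast
    have "destabilized k A Ai W Q (V (K, C'))"
      by (rule destabilized_lift[OF fin(1,2) _ _ _ _ _ K(2), where \<iota>="\<lambda>b a. \<iota>' b (K, C') a" and \<kappa>="\<lambda>i c a. \<kappa>' i c (K, C') a"])
         (use g \<iota>'(2) \<iota>(1) \<kappa>'(2) \<kappa>(1) in \<open>auto simp: good_def Ac_def Aci_def\<close>)
    then show ?thesis using g by (auto simp: good_def)
  qed
qed

section \<open>The trace estimate for nearly tight frames\<close>

lemma gram_schmidt:
  assumes "finite A" "finite U" "cols_free \<iota> A U"
  shows "\<exists>e R T. (\<forall>u\<in>U. \<forall>v\<in>U. (\<Sum>a\<in>A. e a u * e a v) = of_bool (u = v)) \<and>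
     (\<forall>u\<in>U. \<forall>a\<in>A. \<iota> a u = (\<Sum>v\<in>U. e a v * R v u)) \<and>
     (\<forall>u\<in>U. \<forall>a\<in>A. e a u = (\<Sum>v\<in>U. \<iota> a v * T v (u :: nat) :: real))"
  using assms(2,3)
proof (induction U rule: finite_induct)
  case (insert x U)
  have fr: "cols_free \<iota> A U" using insert.prems by (rule cols_free_subset) auto
  obtain e R T where e: "\<And>u v. u \<in> U \<Longrightarrow> v \<in> U \<Longrightarrow> (\<Sum>a\<in>A. e a u * e a v) = of_bool (u = v)"
    and R: "\<And>u a. u \<in> U \<Longrightarrow> a \<in> A \<Longrightarrow> \<iota> a u = (\<Sum>v\<in>U. e a v * R v u)"
    and T: "\<And>u a. u \<in> U \<Longrightarrow> a \<in> A \<Longrightarrow> e a u = (\<Sum>v\<in>U. \<iota> a v * T v u)"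
    using insert.IH[OF fr] by blast
  define g where "g = (\<lambda>u. \<Sum>a\<in>A. e a u * \<iota> a x)"
  define r where "r = (\<lambda>a. \<iota> a x - (\<Sum>u\<in>U. e a u * g u))"
  define n where "n = sqrt (\<Sum>a\<in>A. r a * r a)"
  define h where "h = (\<lambda>v. \<Sum>u\<in>U. T v u * g u)"
  have rh: "r a = \<iota> a x - (\<Sum>v\<in>U. \<iota> a v * h v)" if "a \<in> A" for a
  proof -
    have "(\<Sum>u\<in>U. e a u * g u) = (\<Sum>u\<in>U. (\<Sum>v\<in>U. \<iota> a v * T v u) * g u)"
      using T that by (intro sum.cong) auto
    also have "\<dots> = (\<Sum>v\<in>U. \<iota> a v * h v)"
      unfolding h_def by (simp add: sum_distrib_left sum_distrib_right mult.assoc) (rule sum.swap)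
    finally show ?thesis by (simp add: r_def)
  qed
  have "\<not> (\<forall>a\<in>A. r a = 0)"
  proof
    assume z: "\<forall>a\<in>A. r a = 0"
    define v where "v = (\<lambda>u. if u = x then 1 else - h u)"
    have "(\<Sum>u\<in>insert x U. \<iota> a u * v u) = 0" if "a \<in> A" for a
    proof -
      have "(\<Sum>u\<in>U. \<iota> a u * v u) = - (\<Sum>u\<in>U. \<iota> a u * h u)"
        unfolding sum_negf[symmetric] using insert.hyps by (intro sum.cong) (auto simp: v_def)
      then show ?thesis using z that rh[OF that] insert.hyps by (simp add: v_def)
    qed
    then have "v x = 0"
      using cols_freeD[OF insert.prems assms(1), of v x] insert.hyps by blast
    then show False by (simp add: v_def)
  qed
  then have "(\<Sum>a\<in>A. r a * r a) > 0"
    using assms(1) by (metis (no_types, lifting) mult_eq_0_iff order_le_less sum_nonneg sum_nonneg_eq_0_iff zero_le_square)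
  then have n: "n > 0" "n * n = (\<Sum>a\<in>A. r a * r a)" by (auto simp: n_def)
  have ortho: "(\<Sum>a\<in>A. e a u * r a) = 0" if u: "u \<in> U" for u
  proof -
    have "(\<Sum>a\<in>A. e a u * (\<Sum>v\<in>U. e a v * g v)) = (\<Sum>v\<in>U. (\<Sum>a\<in>A. e a u * e a v) * g v)"
      by (simp add: sum_distrib_left sum_distrib_right mult.assoc) (rule sum.swap)
    also have "\<dots> = (\<Sum>v\<in>U. if v = u then g v else 0)"
      using e u by (intro sum.cong) auto
    also have "\<dots> = g u" using u insert.hyps by simp
    finally show ?thesis by (simp add: r_def right_diff_distrib sum_subtractf g_def)
  qed
  define e' where "e' = (\<lambda>a u. if u = x then r a / n else e a u)"
  define R' where "R' = (\<lambda>v u. if u = x then (if v = x then n else g v) else (if v = x then 0 else R v u))"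
  define T' where "T' = (\<lambda>v u. if u = x then (if v = x then 1 / n else - h v / n) else (if v = x then 0 else T v u))"
  have xU: "u \<noteq> x" if "u \<in> U" for u using that insert.hyps by auto
  have "(\<Sum>a\<in>A. e' a u * e' a v) = of_bool (u = v)" if uv: "u \<in> insert x U" "v \<in> insert x U" for u v
  proof -
    consider "u = x" "v = x" | "u = x" "v \<in> U" | "u \<in> U" "v = x" | "u \<in> U" "v \<in> U" using uv by blast
    then show ?thesis
    proof cases
      case 1
      have "(\<Sum>a\<in>A. e' a u * e' a v) = (\<Sum>a\<in>A. r a * r a) / (n * n)"
        using 1 by (simp add: e'_def sum_divide_distrib)
      then show ?thesis using 1 n(1) unfolding n(2)[symmetric] by simp
    next
      case 2
      have "(\<Sum>a\<in>A. e' a u * e' a v) = (\<Sum>a\<in>A. e a v * r a) / n"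
        using 2 xU by (simp add: e'_def sum_divide_distrib mult.commute)
      then show ?thesis using 2 ortho xU by auto
    next
      case 3
      have "(\<Sum>a\<in>A. e' a u * e' a v) = (\<Sum>a\<in>A. e a u * r a) / n"
        using 3 xU by (simp add: e'_def sum_divide_distrib)
      then show ?thesis using 3 ortho xU by auto
    next
      case 4
      then show ?thesis using e xU by (simp add: e'_def)
    qed
  qed
  moreover have "\<iota> a u = (\<Sum>v\<in>insert x U. e' a v * R' v u)" if "u \<in> insert x U" "a \<in> A" for u a
  proof -
    have "(\<Sum>v\<in>U. e' a v * R' v u) = (\<Sum>v\<in>U. e a v * (if u = x then g v else R v u))"
      using xU by (intro sum.cong) (auto simp: e'_def R'_def)
    then show ?thesis using that insert.hyps xU R n(1) by (auto simp: e'_def R'_def r_def)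
  qed
  moreover have "e' a u = (\<Sum>v\<in>insert x U. \<iota> a v * T' v u)" if "u \<in> insert x U" "a \<in> A" for u a
  proof (cases "u = x")
    case True
    have "(\<Sum>v\<in>U. \<iota> a v * T' v u) = (\<Sum>v\<in>U. - (\<iota> a v * h v) / n)"
      using xU True by (intro sum.cong) (auto simp: T'_def)
    also have "\<dots> = - (\<Sum>v\<in>U. \<iota> a v * h v) / n" by (simp add: sum_negf sum_divide_distrib)
    finally show ?thesis using True insert.hyps rh[OF that(2)]
      by (simp add: e'_def T'_def diff_divide_distrib)
  next
    case False
    have "(\<Sum>v\<in>U. \<iota> a v * T' v u) = (\<Sum>v\<in>U. \<iota> a v * T v u)"
      using xU False by (intro sum.cong) (auto simp: T'_def)
    then show ?thesis using False that insert.hyps T by (simp add: e'_def T'_def)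
  qed
  ultimately show ?case by blast
qed simp

lemma bessel:
  assumes "finite A" "finite U" and e: "\<And>u v. u \<in> U \<Longrightarrow> v \<in> U \<Longrightarrow> (\<Sum>a\<in>A. e a u * e a v) = of_bool (u = v)"
  shows "(\<Sum>u\<in>U. (\<Sum>a\<in>A. e a u * x a)\<^sup>2) \<le> (\<Sum>a\<in>A. (x a :: real)\<^sup>2)"
proof -
  define g where "g = (\<lambda>u. \<Sum>a\<in>A. e a u * x a)"
  define y where "y = (\<lambda>a. \<Sum>u\<in>U. e a u * g u)"
  have xy: "(\<Sum>a\<in>A. x a * y a) = (\<Sum>u\<in>U. (g u)\<^sup>2)"
  proof -
    have "(\<Sum>a\<in>A. x a * y a) = (\<Sum>u\<in>U. (\<Sum>a\<in>A. e a u * x a) * g u)"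
      unfolding y_def by (simp add: sum_distrib_left sum_distrib_right mult_ac) (rule sum.swap)
    then show ?thesis by (simp add: g_def power2_eq_square)
  qed
  have yy: "(\<Sum>a\<in>A. y a * y a) = (\<Sum>u\<in>U. (g u)\<^sup>2)"
  proof -
    have "(\<Sum>a\<in>A. y a * y a) = (\<Sum>u\<in>U. (\<Sum>a\<in>A. e a u * y a) * g u)"
      by (subst (1) y_def) (simp add: sum_distrib_left sum_distrib_right mult_ac, rule sum.swap)
    also have "\<dots> = (\<Sum>u\<in>U. g u * g u)"
    proof (intro sum.cong refl)
      fix u assume u: "u \<in> U"
      have "(\<Sum>a\<in>A. e a u * y a) = (\<Sum>v\<in>U. (\<Sum>a\<in>A. e a u * e a v) * g v)"
        unfolding y_def by (simp add: sum_distrib_left sum_distrib_right mult.assoc) (rule sum.swap)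
      also have "\<dots> = (\<Sum>v\<in>U. if v = u then g v else 0)" using e u by (intro sum.cong) auto
      also have "\<dots> = g u" using u assms by simp
      finally show "(\<Sum>a\<in>A. e a u * y a) * g u = g u * g u" by simp
    qed
    finally show ?thesis by (simp add: power2_eq_square)
  qed
  have "0 \<le> (\<Sum>a\<in>A. (x a - y a)\<^sup>2)" by (intro sum_nonneg) auto
  also have "\<dots> = (\<Sum>a\<in>A. (x a)\<^sup>2) - 2 * (\<Sum>a\<in>A. x a * y a) + (\<Sum>a\<in>A. y a * y a)"
    by (simp add: power2_eq_square algebra_simps sum.distrib sum_subtractf sum_distrib_left)
  finally show ?thesis using xy yy by (simp add: g_def)
qed

text \<open>The entries of a unit vector have modulus at most 1, so the error is at most
  \<open>\<epsilon>\<close> for each of the entries of \<open>G\<close>.\<close>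

lemma quadratic_form_near_scalar:
  assumes "finite A" "\<And>a a'. a \<in> A \<Longrightarrow> a' \<in> A \<Longrightarrow> \<bar>G a a' - \<alpha> * of_bool (a = a')\<bar> \<le> \<epsilon>"
    and x: "(\<Sum>a\<in>A. x a * x a) = (1::real)" and "0 \<le> \<epsilon>"
  shows "\<bar>(\<Sum>a\<in>A. \<Sum>a'\<in>A. x a * x a' * G a a') - \<alpha>\<bar> \<le> \<epsilon> * (real (card A))\<^sup>2"
proof -
  have x1: "\<bar>x a\<bar> \<le> 1" if "a \<in> A" for a
  proof -
    have "x a * x a \<le> (\<Sum>a\<in>A. x a * x a)"
      using that assms(1) member_le_sum[of a A "\<lambda>a. x a * x a"] by simp
    then show ?thesis using x by (metis abs_mult_self_eq abs_ge_zero mult_le_one mult_mono not_le power2_eq_square abs_square_le_1)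
  qed
  have "(\<Sum>a\<in>A. \<Sum>a'\<in>A. x a * x a' * (\<alpha> * of_bool (a = a'))) = (\<Sum>a\<in>A. \<alpha> * (x a * x a))"
  proof (intro sum.cong refl)
    fix a assume "a \<in> A"
    have "(\<Sum>a'\<in>A. x a * x a' * (\<alpha> * of_bool (a = a'))) = (\<Sum>a'\<in>A. if a' = a then \<alpha> * (x a * x a) else 0)"
      by (intro sum.cong) auto
    then show "(\<Sum>a'\<in>A. x a * x a' * (\<alpha> * of_bool (a = a'))) = \<alpha> * (x a * x a)" using assms(1) \<open>a \<in> A\<close> by simp
  qed
  then have d: "(\<Sum>a\<in>A. \<Sum>a'\<in>A. x a * x a' * (\<alpha> * of_bool (a = a'))) = \<alpha>" using x by (simp add: sum_distrib_left[symmetric])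
  have "\<bar>(\<Sum>a\<in>A. \<Sum>a'\<in>A. x a * x a' * G a a') - \<alpha>\<bar>
     = \<bar>\<Sum>a\<in>A. \<Sum>a'\<in>A. x a * x a' * (G a a' - \<alpha> * of_bool (a = a'))\<bar>"
    by (simp only: right_diff_distrib sum_subtractf d)
  also have "\<dots> \<le> (\<Sum>a\<in>A. \<Sum>a'\<in>A. \<epsilon>)"
  proof (intro sum_abs[THEN order_trans] sum_mono)
    fix a a' assume a: "a \<in> A" "a' \<in> A"
    have "\<bar>x a * x a'\<bar> \<le> 1" using x1[OF a(1)] x1[OF a(2)] by (simp add: abs_mult mult_le_one)
    then have "\<bar>x a * x a'\<bar> * \<bar>G a a' - \<alpha> * of_bool (a = a')\<bar> \<le> 1 * \<epsilon>"
      using assms(2)[OF a] assms(4) by (intro mult_mono) auto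
    then show "\<bar>x a * x a' * (G a a' - \<alpha> * of_bool (a = a'))\<bar> \<le> \<epsilon>" by (simp add: abs_mult)
  qed
  also have "\<dots> = \<epsilon> * (real (card A))\<^sup>2" by (simp add: power2_eq_square)
  finally show ?thesis .
qed

text \<open>Each leg sends unit vectors of its subspace to nearly unit vectors in the span of
  \<open>U\<close>. Summing squared coordinates over the legs gives almost the total dimension of
  the \<open>Y i\<close>; by \<open>bessel\<close> the same sum is at most about
  \<open>M / N\<close> for each basis vector of the span of \<open>U\<close>. So the slope excess is
  below 1.\<close>

lemma near_tight_frame_not_destabilized:
  fixes B :: legs and \<epsilon> :: real
  assumes N: "N > 0" and M: "(\<Sum>i<k. l i) = M"
    and \<epsilon>: "0 \<le> \<epsilon>" "\<epsilon> * (real M ^ 3 + real N ^ 3) * real N < 1"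
    and orth: "\<And>i c c'. i < k \<Longrightarrow> c < l i \<Longrightarrow> c' < l i \<Longrightarrow> \<bar>(\<Sum>a<N. B i a c * B i a c') - 1 * of_bool (c = c')\<bar> \<le> \<epsilon>"
    and tight: "\<And>a a'. a < N \<Longrightarrow> a' < N \<Longrightarrow> \<bar>(\<Sum>i<k. \<Sum>c<l i. B i a c * B i a' c) - real M / real N * of_bool (a = a')\<bar> \<le> \<epsilon>"
  shows "\<not> destabilized k {..<N} (\<lambda>i. {..<l i}) {..<M} {..<N} B"
proof
  assume "destabilized k {..<N} (\<lambda>i. {..<l i}) {..<M} {..<N} B"
  then obtain U :: "nat set" and Y \<iota> \<kappa> \<beta> where U: "finite U" "\<forall>i<k. finite (Y i :: nat set)"
     "cols_free \<iota> {..<N} U" "\<forall>i<k. cols_free (\<kappa> i) {..<l i} (Y i)"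
     "\<forall>i<k. \<forall>a\<in>{..<N}. \<forall>y\<in>Y i. (\<Sum>c\<in>{..<l i}. B i a c * \<kappa> i c y) = (\<Sum>u\<in>U. \<iota> a u * \<beta> i u y)"
     "card {..<M} * card U < card {..<N} * (\<Sum>i<k. card (Y i))"
    unfolding destabilized_def by (elim exE conjE) (rule that)
  obtain e R T where e0: "\<forall>u\<in>U. \<forall>v\<in>U. (\<Sum>a<N. e a u * e a v) = of_bool (u = v)"
    and R0: "\<forall>u\<in>U. \<forall>a\<in>{..<N}. \<iota> a u = (\<Sum>v\<in>U. e a v * R v u)"
    and "\<forall>u\<in>U. \<forall>a\<in>{..<N}. e a u = (\<Sum>v\<in>U. \<iota> a v * T v u)"
    using gram_schmidt[OF finite_lessThan U(1,3)] by (elim exE conjE) (rule that)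
  have e: "(\<Sum>a<N. e a u * e a v) = of_bool (u = v)" if "u \<in> U" "v \<in> U" for u v
    using e0 that by blast
  have R: "\<iota> a u = (\<Sum>v\<in>U. e a v * R v u)" if "u \<in> U" "a < N" for u a
    using R0 that by blast
  have uN: "card U \<le> N" using cols_free_card_le[OF finite_lessThan U(1,3)] by simp
  \<comment> \<open>The squared length of the transposed leg applied to \<open>e u\<close>;
    summation over \<open>u\<close> or over \<open>i\<close> gives the two halves of the
    estimate.\<close>
  define p where "p = (\<lambda>i u. \<Sum>c<l i. (\<Sum>a<N. B i a c * e a u)\<^sup>2)"
  have leg: "(1 - \<epsilon> * (real M)\<^sup>2) * card (Y i) \<le> (\<Sum>u\<in>U. p i u) \<and> card (Y i) \<le> l i" if i: "i < k" for i
  proof -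
    have finY: "finite (Y i)" using U(2) i by blast
    have frY: "cols_free (\<kappa> i) {..<l i} (Y i)" using U(4) i by blast
    have li: "l i \<le> M" unfolding M[symmetric] using i by (intro member_le_sum) auto
    obtain f R' T where f0: "\<forall>u\<in>Y i. \<forall>v\<in>Y i. (\<Sum>c<l i. f c u * f c v) = of_bool (u = v)"
      and "\<forall>u\<in>Y i. \<forall>c\<in>{..<l i}. \<kappa> i c u = (\<Sum>v\<in>Y i. f c v * R' v u)"
      and T0: "\<forall>u\<in>Y i. \<forall>c\<in>{..<l i}. f c u = (\<Sum>v\<in>Y i. \<kappa> i c v * T v u)"
      using gram_schmidt[OF finite_lessThan finY frY] by (elim exE conjE) (rule that)
    have f: "(\<Sum>c<l i. f c u * f c v) = of_bool (u = v)" if "u \<in> Y i" "v \<in> Y i" for u v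
      using f0 that by blast
    have T: "f c u = (\<Sum>v\<in>Y i. \<kappa> i c v * T v u)" if "u \<in> Y i" "c < l i" for u c
      using T0 that by blast
    \<comment> \<open>Coordinates in the basis \<open>e\<close> of the image \<open>b\<close> of the
      orthonormal vector \<open>f y\<close>.\<close>
    define \<gamma> where "\<gamma> = (\<lambda>u y. \<Sum>z\<in>Y i. (\<Sum>u'\<in>U. R u u' * \<beta> i u' z) * T z y)"
    define b where "b = (\<lambda>a y. \<Sum>c<l i. B i a c * f c y)"
    have be: "b a y = (\<Sum>u\<in>U. e a u * \<gamma> u y)" if "a < N" "y \<in> Y i" for a y
    proof -
      have "b a y = (\<Sum>c<l i. B i a c * (\<Sum>z\<in>Y i. \<kappa> i c z * T z y))"
        unfolding b_def using T that by (intro sum.cong) auto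
      also have "\<dots> = (\<Sum>z\<in>Y i. (\<Sum>c<l i. B i a c * \<kappa> i c z) * T z y)"
        by (simp add: sum_distrib_left sum_distrib_right mult.assoc) (rule sum.swap)
      also have "\<dots> = (\<Sum>z\<in>Y i. (\<Sum>u'\<in>U. (\<Sum>u\<in>U. e a u * R u u') * \<beta> i u' z) * T z y)"
        using U(5) i that R by (intro sum.cong refl) auto
      also have "\<dots> = (\<Sum>z\<in>Y i. (\<Sum>u\<in>U. e a u * (\<Sum>u'\<in>U. R u u' * \<beta> i u' z)) * T z y)"
      proof -
        have "(\<Sum>u'\<in>U. (\<Sum>u\<in>U. e a u * R u u') * \<beta> i u' z) = (\<Sum>u\<in>U. e a u * (\<Sum>u'\<in>U. R u u' * \<beta> i u' z))" for z
          by (simp add: sum_distrib_left sum_distrib_right mult.assoc) (rule sum.swap)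
        then show ?thesis by simp
      qed
      also have "\<dots> = (\<Sum>u\<in>U. e a u * \<gamma> u y)"
        unfolding \<gamma>_def by (simp only: sum_distrib_left sum_distrib_right mult.assoc) (rule sum.swap)
      finally show ?thesis .
    qed
    have g: "\<gamma> u y = (\<Sum>a<N. e a u * b a y)" if "u \<in> U" "y \<in> Y i" for u y
    proof -
      have "(\<Sum>a<N. e a u * b a y) = (\<Sum>a<N. e a u * (\<Sum>v\<in>U. e a v * \<gamma> v y))"
        using be that by (intro sum.cong) auto
      also have "\<dots> = (\<Sum>v\<in>U. (\<Sum>a<N. e a u * e a v) * \<gamma> v y)"
        by (simp add: sum_distrib_left sum_distrib_right mult.assoc) (rule sum.swap)
      also have "\<dots> = (\<Sum>v\<in>U. if v = u then \<gamma> v y else 0)" using e that by (intro sum.cong) auto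
      finally show ?thesis using that U(1) by simp
    qed
    have one: "1 - \<epsilon> * (real M)\<^sup>2 \<le> (\<Sum>u\<in>U. (\<gamma> u y)\<^sup>2)" if y: "y \<in> Y i" for y
    proof -
      have "(\<Sum>u\<in>U. (\<gamma> u y)\<^sup>2) = (\<Sum>u\<in>U. (\<Sum>a<N. e a u * b a y) * \<gamma> u y)"
        using g y by (intro sum.cong) (auto simp: power2_eq_square)
      also have "\<dots> = (\<Sum>a<N. b a y * (\<Sum>u\<in>U. e a u * \<gamma> u y))"
        by (simp add: sum_distrib_left sum_distrib_right mult_ac) (rule sum.swap)
      also have "\<dots> = (\<Sum>a<N. b a y * b a y)" using be y by (intro sum.cong) auto
      also have "\<dots> = (\<Sum>a<N. \<Sum>c<l i. \<Sum>c'<l i. f c y * f c' y * (B i a c * B i a c'))"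
        unfolding b_def by (simp add: sum_product mult_ac)
      also have "\<dots> = (\<Sum>c<l i. \<Sum>c'<l i. f c y * f c' y * (\<Sum>a<N. B i a c * B i a c'))"
        by (subst sum.swap, simp only: sum_distrib_left, rule sum.cong[OF refl], rule sum.swap)
      finally have eq: "(\<Sum>u\<in>U. (\<gamma> u y)\<^sup>2) = (\<Sum>c<l i. \<Sum>c'<l i. f c y * f c' y * (\<Sum>a<N. B i a c * B i a c'))" .
      have "\<bar>(\<Sum>u\<in>U. (\<gamma> u y)\<^sup>2) - 1\<bar> \<le> \<epsilon> * (real (card {..<l i}))\<^sup>2"
        unfolding eq
        by (rule quadratic_form_near_scalar[where G="\<lambda>c c'. \<Sum>a<N. B i a c * B i a c'" and x="\<lambda>c. f c y"]) (use orth i f y \<epsilon> in auto)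
      also have "\<dots> \<le> \<epsilon> * (real M)\<^sup>2" using li \<epsilon>(1) by (intro mult_left_mono power_mono) auto
      finally show ?thesis by linarith
    qed
    have "(1 - \<epsilon> * (real M)\<^sup>2) * card (Y i) = (\<Sum>y\<in>Y i. 1 - \<epsilon> * (real M)\<^sup>2)" by simp
    also have "\<dots> \<le> (\<Sum>y\<in>Y i. \<Sum>u\<in>U. (\<gamma> u y)\<^sup>2)" by (intro sum_mono one)
    also have "\<dots> = (\<Sum>u\<in>U. \<Sum>y\<in>Y i. (\<gamma> u y)\<^sup>2)" by (rule sum.swap)
    also have "\<dots> \<le> (\<Sum>u\<in>U. p i u)"
    proof (intro sum_mono)
      fix u assume u: "u \<in> U"
      have "(\<Sum>y\<in>Y i. (\<gamma> u y)\<^sup>2) = (\<Sum>y\<in>Y i. (\<Sum>c<l i. f c y * (\<Sum>a<N. B i a c * e a u))\<^sup>2)"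
      proof (intro sum.cong refl arg_cong[of _ _ "\<lambda>x. x\<^sup>2"])
        fix y assume "y \<in> Y i"
        then have "\<gamma> u y = (\<Sum>a<N. \<Sum>c<l i. f c y * (B i a c * e a u))"
          using g[OF u] by (simp add: b_def sum_distrib_left mult_ac)
        then show "\<gamma> u y = (\<Sum>c<l i. f c y * (\<Sum>a<N. B i a c * e a u))"
          by (subst (asm) sum.swap) (simp add: sum_distrib_left)
      qed
      also have "\<dots> \<le> p i u" unfolding p_def by (rule bessel[OF finite_lessThan finY f])
      finally show "(\<Sum>y\<in>Y i. (\<gamma> u y)\<^sup>2) \<le> p i u" .
    qed
    finally show ?thesis using cols_free_card_le[OF finite_lessThan finY frY] by simp
  qed
  have total: "(\<Sum>i<k. p i u) \<le> real M / real N + \<epsilon> * (real N)\<^sup>2" if u: "u \<in> U" for u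
  proof -
    have "(\<Sum>i<k. p i u) = (\<Sum>i<k. \<Sum>c<l i. \<Sum>a<N. \<Sum>a'<N. e a u * e a' u * (B i a c * B i a' c))"
      unfolding p_def power2_eq_square by (simp add: sum_product mult_ac)
    also have "\<dots> = (\<Sum>i<k. \<Sum>a<N. \<Sum>a'<N. \<Sum>c<l i. e a u * e a' u * (B i a c * B i a' c))"
      by (rule sum.cong[OF refl], subst sum.swap, rule sum.cong[OF refl], rule sum.swap)
    also have "\<dots> = (\<Sum>a<N. \<Sum>a'<N. \<Sum>i<k. \<Sum>c<l i. e a u * e a' u * (B i a c * B i a' c))"
      by (subst sum.swap, rule sum.cong[OF refl], rule sum.swap)
    also have "\<dots> = (\<Sum>a<N. \<Sum>a'<N. e a u * e a' u * (\<Sum>i<k. \<Sum>c<l i. B i a c * B i a' c))"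
      by (simp add: sum_distrib_left)
    finally have eq: "(\<Sum>i<k. p i u) = (\<Sum>a<N. \<Sum>a'<N. e a u * e a' u * (\<Sum>i<k. \<Sum>c<l i. B i a c * B i a' c))" .
    have "\<bar>(\<Sum>i<k. p i u) - real M / real N\<bar> \<le> \<epsilon> * (real (card {..<N}))\<^sup>2"
      unfolding eq
      by (rule quadratic_form_near_scalar[where G="\<lambda>a a'. \<Sum>i<k. \<Sum>c<l i. B i a c * B i a' c" and x="\<lambda>a. e a u"]) (use tight e u \<epsilon> in auto)
    then show ?thesis by (simp add: abs_le_iff)
  qed
  define y where "y = (\<Sum>i<k. card (Y i))"
  have yM: "y \<le> M" unfolding y_def M[symmetric] using leg by (intro sum_mono) auto
  have "(1 - \<epsilon> * (real M)\<^sup>2) * real y = (\<Sum>i<k. (1 - \<epsilon> * (real M)\<^sup>2) * card (Y i))"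
    unfolding y_def by (simp add: sum_distrib_left)
  also have "\<dots> \<le> (\<Sum>i<k. \<Sum>u\<in>U. p i u)" using leg by (intro sum_mono) auto
  also have "\<dots> = (\<Sum>u\<in>U. \<Sum>i<k. p i u)" by (rule sum.swap)
  also have "\<dots> \<le> (\<Sum>u\<in>U. real M / real N + \<epsilon> * (real N)\<^sup>2)" by (intro sum_mono total)
  also have "\<dots> = card U * (real M / real N + \<epsilon> * (real N)\<^sup>2)" by simp
  finally have main: "(1 - \<epsilon> * (real M)\<^sup>2) * real y \<le> card U * (real M / real N + \<epsilon> * (real N)\<^sup>2)" .
  have "\<epsilon> * (real M)\<^sup>2 * real y \<le> \<epsilon> * (real M)\<^sup>2 * real M"
    using yM \<epsilon>(1) by (intro mult_left_mono) auto
  moreover have "real (card U) * (\<epsilon> * (real N)\<^sup>2) \<le> real N * (\<epsilon> * (real N)\<^sup>2)"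
    using uN \<epsilon>(1) by (intro mult_right_mono) auto
  ultimately have "real y - \<epsilon> * real M ^ 3 \<le> card U * (real M / real N) + \<epsilon> * real N ^ 3"
    using main by (simp add: algebra_simps power2_eq_square power3_eq_cube)
  then have "real N * (real y - \<epsilon> * real M ^ 3) \<le> real N * (card U * (real M / real N) + \<epsilon> * real N ^ 3)"
    by (intro mult_left_mono) auto
  then have "real N * real y - real M * real (card U) \<le> \<epsilon> * (real M ^ 3 + real N ^ 3) * real N"
    using N by (simp add: algebra_simps)
  then have "real N * real y - real M * real (card U) < 1" using \<epsilon>(2) by linarith
  \<comment> \<open>A strict inequality between integers has a gap of at least 1.\<close>
  moreover have "M * card U + 1 \<le> N * y" using U(6) by (simp add: y_def)
  then have "real M * real (card U) + 1 \<le> real N * real y"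
    by (metis of_nat_add of_nat_mult of_nat_1 of_nat_le_iff)
  ultimately show False by linarith
qed

text \<open>If all pairs were singular, the cylinder of all \<open>C\<close> over any neighbourhood
  of \<open>B0\<close> would contain a destabilized \<open>B\<close>, and the trace estimate forbids
  this close to a tight frame.\<close>

theorem tight_frame_generic_nonsingular:
  fixes B0 :: legs
  assumes N: "N > 0" and M: "(\<Sum>i<k. l i) = M"
    and orth: "\<And>i c c'. i < k \<Longrightarrow> c < l i \<Longrightarrow> c' < l i \<Longrightarrow> (\<Sum>a<N. B0 i a c * B0 i a c') = of_bool (c = c')"
    and tight: "\<And>a a'. a < N \<Longrightarrow> a' < N \<Longrightarrow> (\<Sum>i<k. \<Sum>c<l i. B0 i a c * B0 i a' c) = real M / real N * of_bool (a = a')"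
  shows "\<exists>B C. \<not> ext_nonzero k {..<N} (\<lambda>i. {..<l i}) {..<M} {..<N} B C"
proof (rule ccontr)
  assume all: "\<not> ?thesis"
  \<comment> \<open>Half of the error at which the trace estimate breaks down.\<close>
  define \<epsilon> where "\<epsilon> = 1 / (2 * ((real M ^ 3 + real N ^ 3) * real N))"
  have pos: "(real M ^ 3 + real N ^ 3) * real N > 0" using N by (intro mult_pos_pos add_nonneg_pos) auto
  have \<epsilon>: "\<epsilon> > 0" "\<epsilon> * (real M ^ 3 + real N ^ 3) * real N < 1"
    using pos by (auto simp: \<epsilon>_def field_simps)
  have lim: "((\<lambda>B. B i a c) \<longlongrightarrow> B0 i a c) (nhds B0)" for i a c
  proof -
    have "((\<lambda>p. p) \<longlongrightarrow> B0) (nhds B0)" by (rule filterlim_ident)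
    then show ?thesis by (simp add: tendsto_fun_iff)
  qed
  have ev1: "eventually (\<lambda>B. \<bar>(\<Sum>a<N. B i a c * B i a c') - 1 * of_bool (c = c')\<bar> \<le> \<epsilon>) (nhds B0)"
    if "i < k" "c < l i" "c' < l i" for i c c'
  proof -
    have "((\<lambda>B. \<Sum>a<N. B i a c * B i a c') \<longlongrightarrow> (\<Sum>a<N. B0 i a c * B0 i a c')) (nhds B0)"
      by (intro tendsto_intros lim)
    from tendstoD[OF this \<epsilon>(1)] show ?thesis
      by (rule eventually_mono) (use orth[OF that] in \<open>simp add: dist_real_def\<close>)
  qed
  have ev2: "eventually (\<lambda>B. \<bar>(\<Sum>i<k. \<Sum>c<l i. B i a c * B i a' c) - real M / real N * of_bool (a = a')\<bar> \<le> \<epsilon>) (nhds B0)"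
    if "a < N" "a' < N" for a a'
  proof -
    have "((\<lambda>B. \<Sum>i<k. \<Sum>c<l i. B i a c * B i a' c) \<longlongrightarrow> (\<Sum>i<k. \<Sum>c<l i. B0 i a c * B0 i a' c)) (nhds B0)"
      by (intro tendsto_intros lim)
    from tendstoD[OF this \<epsilon>(1)] show ?thesis
      by (rule eventually_mono) (use tight[OF that] in \<open>simp add: dist_real_def\<close>)
  qed
  have "eventually (\<lambda>B. (\<forall>i\<in>{..<k}. \<forall>c\<in>{..<l i}. \<forall>c'\<in>{..<l i}. \<bar>(\<Sum>a<N. B i a c * B i a c') - 1 * of_bool (c = c')\<bar> \<le> \<epsilon>) \<and>
     (\<forall>a\<in>{..<N}. \<forall>a'\<in>{..<N}. \<bar>(\<Sum>i<k. \<Sum>c<l i. B i a c * B i a' c) - real M / real N * of_bool (a = a')\<bar> \<le> \<epsilon>)) (nhds B0)"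
    using ev1 ev2 by (intro eventually_conj eventually_ball_finite finite_lessThan ballI) auto
  then obtain T where T: "open T" "B0 \<in> T" and TB: "\<forall>B\<in>T. (\<forall>i\<in>{..<k}. \<forall>c\<in>{..<l i}. \<forall>c'\<in>{..<l i}. \<bar>(\<Sum>a<N. B i a c * B i a c') - 1 * of_bool (c = c')\<bar> \<le> \<epsilon>) \<and>
     (\<forall>a\<in>{..<N}. \<forall>a'\<in>{..<N}. \<bar>(\<Sum>i<k. \<Sum>c<l i. B i a c * B i a' c) - real M / real N * of_bool (a = a')\<bar> \<le> \<epsilon>)"
    unfolding eventually_nhds by blast
  have "\<exists>B C. (B, C) \<in> T \<times> (UNIV :: legs set) \<and> destabilized k {..<N} (\<lambda>i. {..<l i}) {..<M} {..<N} B"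
    by (rule generic_destabilized) (use T all in \<open>auto intro: open_Times\<close>)
  then obtain B where B: "B \<in> T" "destabilized k {..<N} (\<lambda>i. {..<l i}) {..<M} {..<N} B" by blast
  have "\<not> destabilized k {..<N} (\<lambda>i. {..<l i}) {..<M} {..<N} B"
    using TB B(1) \<epsilon> by (intro near_tight_frame_not_destabilized[OF N M, of \<epsilon>]) auto
  then show False using B(2) by blast
qed

section \<open>Operators on polynomials\<close>

text \<open>A polynomial is represented by its coefficient function on exponent vectors \<open>mon\<close>; \<open>dX\<close> and \<open>mX\<close> are
  differentiation by and multiplication with a variable.\<close>

type_synonym idx = "nat \<times> nat"
type_synonym mon = "idx \<times> idx \<Rightarrow> nat"

definition dX :: "idx \<times> idx \<Rightarrow> (mon \<Rightarrow> real) \<Rightarrow> mon \<Rightarrow> real" where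
  "dX e f m = real (m e + 1) * f (m(e := m e + 1))"

definition mX :: "idx \<times> idx \<Rightarrow> (mon \<Rightarrow> real) \<Rightarrow> mon \<Rightarrow> real" where
  "mX e f m = (if m e = 0 then 0 else f (m(e := m e - 1)))"

lemma dX_mX: "dX e (mX g h) m = mX g (dX e h) m + of_bool (e = g) * h m"
proof (cases "e = g")
  case True
  have "m e * h m = mX g (dX e h) m"
    using True by (auto simp: mX_def dX_def simp flip: of_nat_Suc)
  moreover have "dX e (mX g h) m = (m e + 1) * h m" using True by (simp add: dX_def mX_def)
  ultimately show ?thesis using True by (simp add: algebra_simps)
next
  case False
  then show ?thesis by (auto simp: dX_def mX_def fun_upd_twist)
qed

lemma mX_commute: "mX e (mX g h) = mX g (mX e h)"
  by (cases "e = g") (auto simp: mX_def fun_eq_iff fun_upd_twist)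

lemma dX_commute: "dX e (dX g h) = dX g (dX e h)"
  by (cases "e = g") (auto simp: dX_def fun_eq_iff fun_upd_twist)

lemma mX_dX_same: "mX e (dX e f) m = m e * f m"
  by (auto simp: mX_def dX_def simp flip: of_nat_Suc)

definition lin :: "((mon \<Rightarrow> real) \<Rightarrow> mon \<Rightarrow> real) \<Rightarrow> bool" where
  "lin T \<longleftrightarrow> (\<forall>f g. T (\<lambda>m. f m + g m) = (\<lambda>m. T f m + T g m)) \<and> (\<forall>c f. T (\<lambda>m. c * f m) = (\<lambda>m. c * T f m))"

lemma lin_add: "lin T \<Longrightarrow> T (\<lambda>m. f m + g m) = (\<lambda>m. T f m + T g m)"
  and lin_scale: "lin T \<Longrightarrow> T (\<lambda>m. c * f m) = (\<lambda>m. c * T f m)"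
  by (auto simp: lin_def)

lemma lin_zero: "lin T \<Longrightarrow> T (\<lambda>m. 0) = (\<lambda>m. 0)"
  using lin_scale[of T 0 "\<lambda>_. 0"] by simp

lemma lin_sum:
  assumes "lin T" "finite J"
  shows "T (\<lambda>m. \<Sum>j\<in>J. c j * f j m) = (\<lambda>m. \<Sum>j\<in>J. c j * T (f j) m)"
  using assms(2)
proof (induction J rule: finite_induct)
  case empty then show ?case using lin_zero[OF assms(1)] by simp
next
  case (insert x J)
  have "T (\<lambda>m. \<Sum>j\<in>insert x J. c j * f j m) = T (\<lambda>m. c x * f x m + (\<Sum>j\<in>J. c j * f j m))"
    using insert by simp
  also have "\<dots> = (\<lambda>m. T (\<lambda>m. c x * f x m) m + T (\<lambda>m. \<Sum>j\<in>J. c j * f j m) m)"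
    by (rule lin_add[OF assms(1)])
  also have "\<dots> = (\<lambda>m. c x * T (f x) m + (\<Sum>j\<in>J. c j * T (f j) m))"
    by (simp only: lin_scale[OF assms(1)] insert.IH)
  finally show ?case using insert by simp
qed

definition \<delta>m :: "mon \<Rightarrow> mon \<Rightarrow> real" where "\<delta>m k = (\<lambda>m. of_bool (m = k))"

text \<open>The weight of a single variable, which belongs to one row and one column and counts for
  both.\<close>

definition inc :: "idx \<times> idx \<Rightarrow> idx \<Rightarrow> int" where "inc e x = of_bool (fst e = x) + of_bool (snd e = x)"

text \<open>The root attached to the pair, the weight of \<open>E p q\<close>.\<close>

definition rt :: "idx \<Rightarrow> idx \<Rightarrow> idx \<Rightarrow> int" where "rt p q x = of_bool (x = p) - of_bool (x = q)"

text \<open>Coefficient of (multiply by \<open>e'\<close>) after (differentiate by \<open>e\<close>)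
  in the polarisation operator: replacing line \<open>q\<close> of \<open>e\<close> by
  \<open>p\<close>, either as row or as column, has to give \<open>e'\<close>.\<close>

definition hop :: "idx \<Rightarrow> idx \<Rightarrow> idx \<times> idx \<Rightarrow> idx \<times> idx \<Rightarrow> real" where
  "hop p q e' e = of_bool (fst e' = p \<and> fst e = q \<and> snd e' = snd e) + of_bool (snd e' = p \<and> snd e = q \<and> fst e' = fst e)"

lemma hop_alt: "hop p q e' e = of_bool (e = (q, snd e')) * of_bool (fst e' = p) + of_bool (e = (fst e', q)) * of_bool (snd e' = p)"
  by (simp add: hop_def prod_eq_iff eq_commute of_bool_conj mult_ac)

lemma hop_inc: "hop p q e' e \<noteq> 0 \<Longrightarrow> inc e' x - inc e x = rt p q x"
proof -
  assume "hop p q e' e \<noteq> 0"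
  then have "fst e' = p \<and> fst e = q \<and> snd e' = snd e \<or> snd e' = p \<and> snd e = q \<and> fst e' = fst e" (is "?A \<or> ?B")
  proof (rule contrapos_np)
    assume "\<not> (?A \<or> ?B)"
    then have "\<not> ?A" "\<not> ?B" by blast+
    then show "hop p q e' e = 0" unfolding hop_def of_bool_def by (simp only: if_False add_0)
  qed
  then show ?thesis by (elim disjE conjE) (simp_all add: inc_def rt_def eq_commute)
qed

text \<open>The matrix unit relations on each of two tensor factors. \<open>R\<close> tells row
  labels from column labels, so terms with one operator in each factor cancel in the
  commutator.\<close>

lemma hop_bracket_aux:
  fixes a b c d p q r s :: 'x
  assumes "R a" "\<not> R b" "R c" "\<not> R d" "R p = R q" "R r = R s"
  shows "(of_bool (a = p) * (of_bool (q = r \<and> c = s \<and> b = d) + of_bool (b = r \<and> d = s \<and> q = c)) +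
      of_bool (b = p) * (of_bool (a = r \<and> c = s \<and> q = d) + of_bool (q = r \<and> d = s \<and> a = c))) -
     (of_bool (a = r) * (of_bool (s = p \<and> c = q \<and> b = d) + of_bool (b = p \<and> d = q \<and> s = c)) +
      of_bool (b = r) * (of_bool (a = p \<and> c = q \<and> s = d) + of_bool (s = p \<and> d = q \<and> a = c)))
   = of_bool (q = r) * (of_bool (a = p \<and> c = s \<and> b = d) + of_bool (b = p \<and> d = s \<and> a = c))
   - (of_bool (p = s) * (of_bool (a = r \<and> c = q \<and> b = d) + of_bool (b = r \<and> d = q \<and> a = c)) :: real)"
proof (cases "R p")
  case p: True
  then have 1: "b \<noteq> p" "d \<noteq> q" "b \<noteq> q" using assms by auto
  show ?thesis
  proof (cases "R r")
    case True
    then have "b \<noteq> r" "d \<noteq> s" using assms by auto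
    with 1 show ?thesis by (simp add: of_bool_conj eq_commute mult_ac)
  next
    case False
    then have "a \<noteq> r" "c \<noteq> s" "q \<noteq> r" "p \<noteq> s" using assms p by auto
    with 1 show ?thesis by (simp add: of_bool_conj eq_commute mult_ac)
  qed
next
  case p: False
  then have 1: "a \<noteq> p" "c \<noteq> q" using assms by auto
  show ?thesis
  proof (cases "R r")
    case True
    then have "b \<noteq> r" "d \<noteq> s" "q \<noteq> r" "p \<noteq> s" using assms p by auto
    with 1 show ?thesis by (simp add: of_bool_conj eq_commute mult_ac)
  next
    case False
    then have "a \<noteq> r" "c \<noteq> s" using assms by auto
    with 1 show ?thesis by (simp add: of_bool_conj eq_commute mult_ac)
  qed
qed

lemma hop_transpose: "hop p q e' e = hop q p e e'" unfolding hop_def by (simp add: conj_ac eq_commute)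

text \<open>Block \<open>0\<close> indexes the rows and the blocks \<open>1, \<dots>, k\<close> the columns of the matrix of variables; \<open>E p q\<close> is the
  polarisation operator that replaces line \<open>q\<close> by line \<open>p\<close>.\<close>

locale tables =
  fixes sz :: "nat \<Rightarrow> nat" and k :: nat
begin

definition I :: "idx set" where "I = (SIGMA b:{..k}. {..<sz b})"

definition vars :: "(idx \<times> idx) set" where
  "vars = {(r, c). r \<in> I \<and> c \<in> I \<and> fst r = 0 \<and> fst c \<noteq> 0}"

definition Rp :: "(idx \<times> idx) set" where
  "Rp = {(p, q). p \<in> I \<and> q \<in> I \<and> fst p = fst q \<and> snd p < snd q}"

definition same :: "(idx \<times> idx) set" where
  "same = {(p, q). p \<in> I \<and> q \<in> I \<and> fst p = fst q}"

lemma finite_I [simp]: "finite I" unfolding I_def by simp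
lemma finite_vars [simp]: "finite vars"
  by (rule finite_subset[of _ "I \<times> I"]) (auto simp: vars_def)
lemma finite_same [simp]: "finite same"
  by (rule finite_subset[of _ "I \<times> I"]) (auto simp: same_def)
lemma finite_Rp [simp]: "finite Rp"
  by (rule finite_subset[of _ "I \<times> I"]) (auto simp: Rp_def)

definition G :: "(idx \<times> idx \<Rightarrow> idx \<times> idx \<Rightarrow> real) \<Rightarrow> (mon \<Rightarrow> real) \<Rightarrow> mon \<Rightarrow> real" where
  "G A f m = (\<Sum>e'\<in>vars. \<Sum>e\<in>vars. A e' e * mX e' (dX e f) m)"

lemma lin_G: "lin (G A)"
  unfolding lin_def G_def
  by (auto simp: fun_eq_iff mX_def dX_def sum.distrib[symmetric] algebra_simps sum_distrib_left intro!: sum.cong)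

text \<open>Normal ordering: moving a derivative past a multiplication leaves a second-order part,
  in which both operators enter alike, plus the operator of the matrix product.\<close>

lemma G_G: "G A (G B f) m = (\<Sum>e'\<in>vars. \<Sum>e\<in>vars. \<Sum>g'\<in>vars. \<Sum>g\<in>vars. A e' e * B g' g * mX e' (mX g' (dX e (dX g f))) m)
     + G (\<lambda>e' g. \<Sum>e\<in>vars. A e' e * B e g) f m"
proof -
  have d: "dX e (G B f) m = (\<Sum>g'\<in>vars. \<Sum>g\<in>vars. B g' g * dX e (mX g' (dX g f)) m)" for e m
    unfolding G_def dX_def by (simp add: sum_distrib_left mult_ac)
  have md: "mX e' (dX e (G B f)) m = (\<Sum>g'\<in>vars. \<Sum>g\<in>vars. B g' g * mX e' (dX e (mX g' (dX g f))) m)" for e' e m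
    by (simp add: mX_def d)
  have md2: "mX e' (dX e (mX g' h)) m = mX e' (mX g' (dX e h)) m + of_bool (e = g') * mX e' h m" for e' e g' h m
    by (simp add: mX_def[of e'] dX_mX)
  have del: "(\<Sum>e\<in>vars. \<Sum>g'\<in>vars. \<Sum>g\<in>vars. A e' e * B g' g * (of_bool (e = g') * mX e' (dX g f) m))
     = (\<Sum>g\<in>vars. (\<Sum>e\<in>vars. A e' e * B e g) * mX e' (dX g f) m)" for e'
  proof -
    have S: "(\<Sum>g'\<in>vars. \<Sum>g\<in>vars. A e' e * B g' g * (of_bool (e = g') * mX e' (dX g f) m))
       = (\<Sum>g\<in>vars. A e' e * B e g * mX e' (dX g f) m)" if "e \<in> vars" for e
    proof -
      have "(\<Sum>g'\<in>vars. \<Sum>g\<in>vars. A e' e * B g' g * (of_bool (e = g') * mX e' (dX g f) m))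
         = (\<Sum>g'\<in>vars. if g' = e then (\<Sum>g\<in>vars. A e' e * B e g * mX e' (dX g f) m) else 0)"
        by (intro sum.cong) auto
      then show ?thesis using that by simp
    qed
    have "(\<Sum>e\<in>vars. \<Sum>g'\<in>vars. \<Sum>g\<in>vars. A e' e * B g' g * (of_bool (e = g') * mX e' (dX g f) m))
      = (\<Sum>e\<in>vars. \<Sum>g\<in>vars. A e' e * B e g * mX e' (dX g f) m)" by (rule sum.cong[OF refl S])
    also have "\<dots> = (\<Sum>g\<in>vars. \<Sum>e\<in>vars. A e' e * B e g * mX e' (dX g f) m)" by (rule sum.swap)
    finally show ?thesis by (simp add: sum_distrib_right)
  qed
  have "G A (G B f) m = (\<Sum>e'\<in>vars. \<Sum>e\<in>vars. \<Sum>g'\<in>vars. \<Sum>g\<in>vars. A e' e * B g' g * mX e' (dX e (mX g' (dX g f))) m)"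
    by (subst G_def) (simp add: md sum_distrib_left mult.assoc)
  also have "\<dots> = (\<Sum>e'\<in>vars. \<Sum>e\<in>vars. \<Sum>g'\<in>vars. \<Sum>g\<in>vars. A e' e * B g' g * mX e' (mX g' (dX e (dX g f))) m)
     + (\<Sum>e'\<in>vars. \<Sum>e\<in>vars. \<Sum>g'\<in>vars. \<Sum>g\<in>vars. A e' e * B g' g * (of_bool (e = g') * mX e' (dX g f) m))"
    by (simp only: md2 distrib_left sum.distrib)
  finally show ?thesis unfolding del by (simp add: G_def)
qed

text \<open>The second-order parts cancel because multiplications commute among themselves and so do
  derivatives; hence \<open>G\<close> is a Lie algebra homomorphism.\<close>

lemma G_commutator:
  "G A (G B f) m - G B (G A f) m = G (\<lambda>e' g. (\<Sum>e\<in>vars. A e' e * B e g) - (\<Sum>e\<in>vars. B e' e * A e g)) f m"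
proof -
  have "(\<Sum>e'\<in>vars. \<Sum>e\<in>vars. \<Sum>g'\<in>vars. \<Sum>g\<in>vars. A e' e * B g' g * mX e' (mX g' (dX e (dX g f))) m)
    = (\<Sum>g'\<in>vars. \<Sum>g\<in>vars. \<Sum>e'\<in>vars. \<Sum>e\<in>vars. A e' e * B g' g * mX e' (mX g' (dX e (dX g f))) m)"
    (is "?L = ?R")
  proof -
    have "?L = (\<Sum>x\<in>vars \<times> vars. \<Sum>y\<in>vars \<times> vars. A (fst x) (snd x) * B (fst y) (snd y) * mX (fst x) (mX (fst y) (dX (snd x) (dX (snd y) f))) m)"
      by (simp add: sum.cartesian_product')
    also have "\<dots> = (\<Sum>y\<in>vars \<times> vars. \<Sum>x\<in>vars \<times> vars. A (fst x) (snd x) * B (fst y) (snd y) * mX (fst x) (mX (fst y) (dX (snd x) (dX (snd y) f))) m)"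
      by (rule sum.swap)
    also have "\<dots> = ?R" by (simp add: sum.cartesian_product')
    finally show ?thesis .
  qed
  also have "\<dots> = (\<Sum>g'\<in>vars. \<Sum>g\<in>vars. \<Sum>e'\<in>vars. \<Sum>e\<in>vars. B g' g * A e' e * mX g' (mX e' (dX g (dX e f))) m)"
  proof -
    have "A e' e * B g' g * mX e' (mX g' (dX e (dX g f))) m = B g' g * A e' e * mX g' (mX e' (dX g (dX e f))) m" for e' e g' g
      by (subst mX_commute, subst dX_commute) simp
    then show ?thesis by (simp only:)
  qed
  finally have eq: "(\<Sum>e'\<in>vars. \<Sum>e\<in>vars. \<Sum>g'\<in>vars. \<Sum>g\<in>vars. A e' e * B g' g * mX e' (mX g' (dX e (dX g f))) m)
    = (\<Sum>g'\<in>vars. \<Sum>g\<in>vars. \<Sum>e'\<in>vars. \<Sum>e\<in>vars. B g' g * A e' e * mX g' (mX e' (dX g (dX e f))) m)" .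
  show ?thesis
    unfolding G_G[of A B] G_G[of B A] eq
    by (simp add: G_def left_diff_distrib sum_subtractf)
qed

definition E :: "idx \<Rightarrow> idx \<Rightarrow> (mon \<Rightarrow> real) \<Rightarrow> mon \<Rightarrow> real" where "E p q = G (hop p q)"

lemma lin_E: "lin (E p q)" unfolding E_def by (rule lin_G)

lemma hop_sum:
  assumes "(p, q) \<in> same" "e' \<in> vars"
  shows "(\<Sum>e\<in>vars. hop p q e' e * h e) = of_bool (fst e' = p) * h (q, snd e') + of_bool (snd e' = p) * h (fst e', q)"
proof -
  have "(\<Sum>e\<in>vars. hop p q e' e * h e) = (\<Sum>e\<in>vars. (if e = (q, snd e') then of_bool (fst e' = p) * h (q, snd e') else 0))
      + (\<Sum>e\<in>vars. (if e = (fst e', q) then of_bool (snd e' = p) * h (fst e', q) else 0))"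
    unfolding sum.distrib[symmetric] by (intro sum.cong refl) (simp add: hop_alt of_bool_def)
  also have "(\<Sum>e\<in>vars. (if e = (q, snd e') then of_bool (fst e' = p) * h (q, snd e') else 0)) = of_bool (fst e' = p) * h (q, snd e')"
  proof (cases "fst e' = p")
    case True
    then have "(q, snd e') \<in> vars" using assms by (simp add: same_def vars_def case_prod_beta)
    then show ?thesis by simp
  qed simp
  also have "(\<Sum>e\<in>vars. (if e = (fst e', q) then of_bool (snd e' = p) * h (fst e', q) else 0)) = of_bool (snd e' = p) * h (fst e', q)"
  proof (cases "snd e' = p")
    case True
    then have "(fst e', q) \<in> vars" using assms by (simp add: same_def vars_def case_prod_beta)
    then show ?thesis by simp
  qed simp
  finally show ?thesis .
qed

lemma hop_commutator:
  assumes "(p, q) \<in> same" "(r, s) \<in> same" "e' \<in> vars" "g \<in> vars"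
  shows "(\<Sum>e\<in>vars. hop p q e' e * hop r s e g) - (\<Sum>e\<in>vars. hop r s e' e * hop p q e g)
     = of_bool (q = r) * hop p s e' g - of_bool (p = s) * hop r q e' g"
  unfolding hop_sum[OF assms(1,3)] hop_sum[OF assms(2,3)]
  unfolding hop_def fst_conv snd_conv
  by (rule hop_bracket_aux[where R="\<lambda>x. fst x = 0"])
     (use assms in \<open>simp_all add: same_def vars_def case_prod_beta\<close>)

text \<open>The defining relations of a product of general linear Lie algebras, one for each
  block.\<close>

lemma E_commutator:
  assumes "(p, q) \<in> same" "(r, s) \<in> same"
  shows "E p q (E r s f) m - E r s (E p q f) m = of_bool (q = r) * E p s f m - of_bool (p = s) * E r q f m"
proof -
  have "G (\<lambda>e' g. (\<Sum>e\<in>vars. hop p q e' e * hop r s e g) - (\<Sum>e\<in>vars. hop r s e' e * hop p q e g)) f m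
     = (\<Sum>e'\<in>vars. \<Sum>g\<in>vars. (of_bool (q = r) * hop p s e' g - of_bool (p = s) * hop r q e' g) * mX e' (dX g f) m)"
    unfolding G_def by (intro sum.cong refl) (simp only: hop_commutator[OF assms])
  also have "\<dots> = of_bool (q = r) * G (hop p s) f m - of_bool (p = s) * G (hop r q) f m"
    by (simp only: G_def left_diff_distrib sum_subtractf sum_distrib_left mult.assoc)
  finally show ?thesis by (simp only: E_def G_commutator)
qed

definition wt :: "mon \<Rightarrow> idx \<Rightarrow> int" where "wt m x = (\<Sum>e\<in>vars. inc e x * int (m e))"

lemma E_diag: 
  assumes "p \<in> I" shows "E p p f m = of_int (wt m p) * f m"
proof -
  have "(p, p) \<in> same" using assms by (auto simp: same_def)
  then have "E p p f m = (\<Sum>e'\<in>vars. of_bool (fst e' = p) * mX e' (dX (p, snd e') f) m + of_bool (snd e' = p) * mX e' (dX (fst e', p) f) m)"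
    unfolding E_def G_def by (intro sum.cong refl) (simp add: hop_sum)
  also have "\<dots> = (\<Sum>e'\<in>vars. of_int (inc e' p) * (m e' * f m))"
  proof (intro sum.cong refl)
    fix e :: "idx \<times> idx"
    have "of_bool (fst e = p) * mX e (dX (p, snd e) f) m = of_bool (fst e = p) * (m e * f m)"
      using mX_dX_same[of e f m] by (cases e) auto
    moreover have "of_bool (snd e = p) * mX e (dX (fst e, p) f) m = of_bool (snd e = p) * (m e * f m)"
      using mX_dX_same[of e f m] by (cases e) auto
    ultimately show "of_bool (fst e = p) * mX e (dX (p, snd e) f) m + of_bool (snd e = p) * mX e (dX (fst e, p) f) m = of_int (inc e p) * (m e * f m)"
      by (simp only: inc_def distrib_right of_int_add of_int_of_bool)
  qed
  finally show ?thesis by (simp add: wt_def sum_distrib_left sum_distrib_right mult_ac)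
qed

definition Mon :: "(idx \<Rightarrow> int) \<Rightarrow> mon set" where
  "Mon \<mu> = {m. (\<forall>e. e \<notin> vars \<longrightarrow> m e = 0) \<and> (\<forall>p\<in>I. wt m p = \<mu> p)}"

lemma wt_upd: "e \<in> vars \<Longrightarrow> wt (m(e := n)) x = wt m x + inc e x * (int n - int (m e))"
proof -
  assume e: "e \<in> vars"
  have "(\<Sum>g\<in>vars - {e}. inc g x * int ((m(e := n)) g)) = (\<Sum>g\<in>vars - {e}. inc g x * int (m g))"
    by (intro sum.cong) auto
  then show ?thesis unfolding wt_def sum.remove[OF finite_vars e] by (simp add: algebra_simps)
qed

lemma wt_ge: "e \<in> vars \<Longrightarrow> int (m e) \<le> wt m (fst e)"
proof -
  assume e: "e \<in> vars"
  have "inc e (fst e) * int (m e) \<le> wt m (fst e)"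
    unfolding wt_def using e by (intro member_le_sum) (auto simp: inc_def)
  moreover have "inc e (fst e) \<ge> 1" by (simp add: inc_def)
  then have "1 * int (m e) \<le> inc e (fst e) * int (m e)" by (intro mult_right_mono) auto
  ultimately show ?thesis by simp
qed

text \<open>Every variable counts in the weight of its row, so a weight bounds all
  exponents.\<close>

lemma finite_Mon [simp]: "finite (Mon \<mu>)"
proof (rule finite_subset)
  define D where "D = (\<Sum>p\<in>I. nat \<bar>\<mu> p\<bar>)"
  show "Mon \<mu> \<subseteq> {m. \<forall>e. (e \<in> vars \<longrightarrow> m e \<in> {..D}) \<and> (e \<notin> vars \<longrightarrow> m e = 0)}"
  proof
    fix m assume m: "m \<in> Mon \<mu>"
    have "m e \<le> D" if e: "e \<in> vars" for e
    proof -
      have p: "fst e \<in> I" using e by (auto simp: vars_def)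
      then have "int (m e) \<le> \<mu> (fst e)" using wt_ge[OF e, of m] m by (simp add: Mon_def)
      then have "m e \<le> nat \<bar>\<mu> (fst e)\<bar>" by simp
      also have "\<dots> \<le> D" unfolding D_def using p by (intro member_le_sum) auto
      finally show ?thesis .
    qed
    then show "m \<in> {m. \<forall>e. (e \<in> vars \<longrightarrow> m e \<in> {..D}) \<and> (e \<notin> vars \<longrightarrow> m e = 0)}"
      using m by (auto simp: Mon_def)
  qed
  show "finite {m. \<forall>e. (e \<in> vars \<longrightarrow> m e \<in> {..D}) \<and> (e \<notin> vars \<longrightarrow> m e = (0::nat))}"
    by (rule finite_set_of_finite_funs) auto
qed

definition V :: "(idx \<Rightarrow> int) \<Rightarrow> (mon \<Rightarrow> real) set" where
  "V \<mu> = {f. \<forall>m. f m \<noteq> 0 \<longrightarrow> m \<in> Mon \<mu>}"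

lemma V_expand: "f \<in> V \<mu> \<Longrightarrow> f = (\<lambda>m. \<Sum>j\<in>Mon \<mu>. f j * \<delta>m j m)"
proof
  fix m assume f: "f \<in> V \<mu>"
  have "(\<Sum>j\<in>Mon \<mu>. f j * \<delta>m j m) = (\<Sum>j\<in>Mon \<mu>. if j = m then f m else 0)"
    by (intro sum.cong) (auto simp: \<delta>m_def)
  then show "f m = (\<Sum>j\<in>Mon \<mu>. f j * \<delta>m j m)" using f by (auto simp: V_def)
qed

lemma lin_expand: "lin T \<Longrightarrow> f \<in> V \<mu> \<Longrightarrow> T f m = (\<Sum>j\<in>Mon \<mu>. f j * T (\<delta>m j) m)"
proof -
  assume T: "lin T" and f: "f \<in> V \<mu>"
  have "T f = T (\<lambda>m. \<Sum>j\<in>Mon \<mu>. f j * \<delta>m j m)" using V_expand[OF f] by (rule arg_cong)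
  then show ?thesis using lin_sum[OF T finite_Mon, of f \<delta>m \<mu>] by simp
qed

lemma delta_in_V: "j \<in> Mon \<mu> \<Longrightarrow> \<delta>m j \<in> V \<mu>" by (auto simp: V_def \<delta>m_def)

lemma E_in_V:
  assumes pq: "(p, q) \<in> same" and f: "f \<in> V \<mu>"
  shows "E p q f \<in> V (\<lambda>x. \<mu> x + rt p q x)"
  unfolding V_def
proof (intro CollectI allI impI)
  fix m assume "E p q f m \<noteq> 0"
  then obtain e' e where e: "e' \<in> vars" "e \<in> vars" "hop p q e' e * mX e' (dX e f) m \<noteq> 0"
    unfolding E_def G_def by (meson sum.neutral)
  define n where "n = m(e' := m e' - 1)"
  have m0: "m e' \<noteq> 0" and fn: "f (n(e := n e + 1)) \<noteq> 0"
    using e(3) by (auto simp: mX_def dX_def n_def split: if_splits)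
  have n: "n(e := n e + 1) \<in> Mon \<mu>" using f fn by (simp add: V_def)
  have "wt m x = \<mu> x + rt p q x" if "x \<in> I" for x
  proof -
    have "wt (n(e := n e + 1)) x = wt m x - inc e' x + inc e x"
      using e m0 by (simp add: wt_upd n_def[of] of_nat_diff)
    moreover have "inc e' x - inc e x = rt p q x"
      using e(3) by (intro hop_inc) simp
    ultimately show ?thesis using n that by (simp add: Mon_def)
  qed
  moreover have "m a = 0" if "a \<notin> vars" for a
  proof -
    have "(n(e := n e + 1)) a = 0" using n that unfolding Mon_def by blast
    then show ?thesis using that e by (auto simp: n_def split: if_splits)
  qed
  ultimately show "m \<in> Mon (\<lambda>x. \<mu> x + rt p q x)" by (simp add: Mon_def)
qed

section \<open>The invariant inner product\<close>

definition mfact :: "mon \<Rightarrow> real" where "mfact m = (\<Prod>e\<in>vars. fact (m e))"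

text \<open>The Fischer inner product: with factorial weights, multiplication by a variable is
  adjoint to differentiation, so \<open>E p q\<close> is adjoint to \<open>E q p\<close>. The weight
  is a parameter because the sum runs over one weight space only.\<close>

definition ip :: "(idx \<Rightarrow> int) \<Rightarrow> (mon \<Rightarrow> real) \<Rightarrow> (mon \<Rightarrow> real) \<Rightarrow> real" where
  "ip \<mu> f g = (\<Sum>m\<in>Mon \<mu>. mfact m * f m * g m)"

lemma mfact_pos: "mfact m > 0" unfolding mfact_def by (intro prod_pos) auto

lemma mfact_upd: "e \<in> vars \<Longrightarrow> mfact (m(e := m e + 1)) = real (m e + 1) * mfact m"
proof -
  assume e: "e \<in> vars"
  have "(\<Prod>g\<in>vars - {e}. fact ((m(e := m e + 1)) g) :: real) = (\<Prod>g\<in>vars - {e}. fact (m g))"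
    by (intro prod.cong) auto
  then show ?thesis unfolding mfact_def prod.remove[OF finite_vars e] by (simp add: algebra_simps)
qed

lemma ip_sym: "ip \<mu> f g = ip \<mu> g f" unfolding ip_def by (simp add: mult_ac)

lemma ip_nonneg: "ip \<mu> f f \<ge> 0"
  unfolding ip_def using mfact_pos by (intro sum_nonneg) (simp add: less_imp_le mult.assoc)

lemma ip_eq_0: "f \<in> V \<mu> \<Longrightarrow> ip \<mu> f f = 0 \<Longrightarrow> f = (\<lambda>_. 0)"
proof
  fix m assume f: "f \<in> V \<mu>" "ip \<mu> f f = 0"
  have "\<forall>m\<in>Mon \<mu>. mfact m * f m * f m = 0"
    using f(2) mfact_pos unfolding ip_def
    by (subst (asm) sum_nonneg_eq_0_iff) (auto simp: less_imp_le mult.assoc)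
  moreover have "mfact m \<noteq> 0" using mfact_pos[of m] by simp
  ultimately show "f m = 0" using f(1) unfolding V_def by force
qed

lemma ip_mX:
  assumes e: "e \<in> vars"
  shows "ip \<mu> (mX e h) g = ip (\<lambda>x. \<mu> x - inc e x) h (dX e g)"
proof -
  have "ip \<mu> (mX e h) g = (\<Sum>m\<in>{m \<in> Mon \<mu>. m e \<noteq> 0}. mfact m * mX e h m * g m)"
    unfolding ip_def by (intro sum.mono_neutral_right) (auto simp: mX_def)
  also have "\<dots> = (\<Sum>n\<in>Mon (\<lambda>x. \<mu> x - inc e x). mfact n * h n * dX e g n)"
  proof (rule sum.reindex_bij_witness[of _ "\<lambda>n. n(e := n e + 1)" "\<lambda>m. m(e := m e - 1)"])
    fix m assume m: "m \<in> {m \<in> Mon \<mu>. m e \<noteq> 0}"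
    then show "(m(e := m e - 1))(e := (m(e := m e - 1)) e + 1) = m" by auto
    show "m(e := m e - 1) \<in> Mon (\<lambda>x. \<mu> x - inc e x)"
      using m e by (auto simp: Mon_def wt_upd of_nat_diff)
    have "mfact m = real (m e) * mfact (m(e := m e - 1))"
      using mfact_upd[OF e, of "m(e := m e - 1)"] m by (simp add: fun_upd_idem)
    then show "mfact (m(e := m e - 1)) * h (m(e := m e - 1)) * dX e g (m(e := m e - 1)) = mfact m * mX e h m * g m"
      using m by (simp add: mX_def dX_def fun_upd_idem)
  next
    fix n assume n: "n \<in> Mon (\<lambda>x. \<mu> x - inc e x)"
    then show "(n(e := n e + 1))(e := (n(e := n e + 1)) e - 1) = n" by auto
    show "n(e := n e + 1) \<in> {m \<in> Mon \<mu>. m e \<noteq> 0}"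
      using n e by (auto simp: Mon_def wt_upd)
  qed
  finally show ?thesis by (simp add: ip_def)
qed

lemma ip_E:
  assumes pq: "(p, q) \<in> same"
  shows "ip (\<lambda>x. \<mu> x + rt p q x) (E p q f) g = ip \<mu> f (E q p g)"
proof -
  let ?\<mu>' = "\<lambda>x. \<mu> x + rt p q x"
  have "ip ?\<mu>' (E p q f) g = (\<Sum>e'\<in>vars. \<Sum>e\<in>vars. hop p q e' e * ip ?\<mu>' (mX e' (dX e f)) g)"
    unfolding ip_def E_def G_def
    by (simp add: sum_distrib_left sum_distrib_right mult_ac)
       (subst sum.swap, rule sum.cong[OF refl], subst sum.swap, simp)
  also have "\<dots> = (\<Sum>e'\<in>vars. \<Sum>e\<in>vars. hop q p e e' * ip \<mu> (mX e (dX e' g)) f)"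
  proof (intro sum.cong refl)
    fix e' e assume e: "e' \<in> vars" "e \<in> vars"
    show "hop p q e' e * ip ?\<mu>' (mX e' (dX e f)) g = hop q p e e' * ip \<mu> (mX e (dX e' g)) f"
    proof (cases "hop p q e' e = 0")
      case True then show ?thesis using hop_transpose[of p q e' e] by simp
    next
      case False
      have "(\<lambda>x. ?\<mu>' x - inc e' x) = (\<lambda>x. \<mu> x - inc e x)"
        using hop_inc[OF False] by (simp add: fun_eq_iff algebra_simps)
      then have "ip (\<lambda>x. ?\<mu>' x - inc e' x) (dX e f) (dX e' g) = ip (\<lambda>x. \<mu> x - inc e x) (dX e' g) (dX e f)"
        by (simp add: ip_sym)
      then show ?thesis using e hop_transpose[of p q e' e] by (simp add: ip_mX)
    qed
  qed
  also have "\<dots> = (\<Sum>e\<in>vars. \<Sum>e'\<in>vars. hop q p e e' * ip \<mu> (mX e (dX e' g)) f)" by (rule sum.swap)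
  also have "\<dots> = ip \<mu> (E q p g) f"
    unfolding ip_def E_def G_def
    by (simp add: sum_distrib_left sum_distrib_right mult_ac)
       (subst (2) sum.swap, rule sum.cong[OF refl], subst (2) sum.swap, simp)
  finally show ?thesis by (simp add: ip_sym)
qed

end

lemma sum_Pow_insert:
  fixes g :: "'a set \<Rightarrow> real"
  assumes "finite R" "a \<notin> R"
  shows "(\<Sum>S\<in>Pow (insert a R). g S) = (\<Sum>S\<in>Pow R. g S + g (insert a S))"
proof -
  have inj: "inj_on (insert a) (Pow R)" using assms(2) by (auto simp: inj_on_def)
  have "(\<Sum>S\<in>Pow (insert a R). g S) = (\<Sum>S\<in>Pow R. g S) + (\<Sum>S\<in>insert a ` Pow R. g S)"
    unfolding Pow_insert using assms by (intro sum.union_disjoint) auto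
  then show ?thesis using inj by (simp add: sum.reindex sum.distrib)
qed

lemma rt_add_rev: "(\<lambda>x. \<mu> x + rt p q x + rt q p x) = \<mu>"
  by (auto simp: rt_def fun_eq_iff)

section \<open>The Casimir operator and polynomials in it\<close>

context tables begin

definition blk :: "idx \<Rightarrow> idx set" where "blk p = {q \<in> I. fst q = fst p}"

lemma finite_blk [simp]: "finite (blk p)" by (simp add: blk_def)

definition Cas :: "(mon \<Rightarrow> real) \<Rightarrow> mon \<Rightarrow> real" where
  "Cas f m = (\<Sum>p\<in>I. \<Sum>q\<in>blk p. E p q (E q p f) m)"

lemma same_iff: "(p, q) \<in> same \<longleftrightarrow> p \<in> I \<and> q \<in> blk p" by (auto simp: same_def blk_def)
lemma same_sym: "(p, q) \<in> same \<Longrightarrow> (q, p) \<in> same" by (auto simp: same_def)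
lemma Rp_same: "(p, q) \<in> Rp \<Longrightarrow> (p, q) \<in> same" by (auto simp: same_def Rp_def)

lemma lin_EE: "lin (\<lambda>f. E p q (E r s f))"
  using lin_E[of p q] lin_E[of r s] by (simp add: lin_def)

lemma lin_Cas: "lin Cas"
  unfolding lin_def Cas_def
  by (simp add: fun_eq_iff lin_add[OF lin_EE] lin_scale[OF lin_EE] sum.distrib sum_distrib_left)

text \<open>The commutator with \<open>E r s\<close> consists of sums over the block of
  \<open>r\<close> and over the block of \<open>s\<close> with opposite signs; the two blocks
  coincide.\<close>

lemma Cas_E:
  assumes rs: "(r, s) \<in> same"
  shows "Cas (E r s f) = E r s (Cas f)"
proof
  fix m
  have sI: "r \<in> I" "s \<in> I" "blk r = blk s" using rs by (auto simp: same_def blk_def)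
  have bracket: "E p q (E q p (E r s f)) m - E r s (E p q (E q p f)) m =
      of_bool (p = r) * E r q (E q s f) m - of_bool (q = s) * E p s (E r p f) m
    + of_bool (q = r) * E p s (E r p f) m - of_bool (p = s) * E r q (E q s f) m"
    if pq: "(p, q) \<in> same" for p q
  proof -
    have qp: "(q, p) \<in> same" using pq by (rule same_sym)
    have "E q p (E r s f) = (\<lambda>m. E r s (E q p f) m + (of_bool (p = r) * E q s f m + (- of_bool (q = s)) * E r p f m))"
      using E_commutator[OF qp rs, of f] by (simp add: fun_eq_iff algebra_simps)
    then have "E p q (E q p (E r s f)) = E p q (\<lambda>m. E r s (E q p f) m + (of_bool (p = r) * E q s f m + (- of_bool (q = s)) * E r p f m))"
      by simp
    also have "\<dots> = (\<lambda>m. E p q (E r s (E q p f)) m + (of_bool (p = r) * E p q (E q s f) m + (- of_bool (q = s)) * E p q (E r p f) m))"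
      by (simp only: lin_add[OF lin_E] lin_scale[OF lin_E])
    finally have 1: "E p q (E q p (E r s f)) m = E p q (E r s (E q p f)) m + (of_bool (p = r) * E p q (E q s f) m - of_bool (q = s) * E p q (E r p f) m)"
      by simp
    have 2: "E p q (E r s (E q p f)) m - E r s (E p q (E q p f)) m = of_bool (q = r) * E p s (E q p f) m - of_bool (p = s) * E r q (E q p f) m"
      by (rule E_commutator[OF pq rs])
    show ?thesis using 1 2 by (auto simp: of_bool_def)
  qed
  define h1 where "h1 = (\<lambda>q. E r q (E q s f) m)"
  define h2 where "h2 = (\<lambda>p. E p s (E r p f) m)"
  have swap: "(\<Sum>p\<in>I. \<Sum>q\<in>blk p. of_bool (q = x) * h p) = (\<Sum>p\<in>blk x. h p)" if "x \<in> I" for x and h :: "idx \<Rightarrow> real"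
  proof -
    have "(\<Sum>q\<in>blk p. of_bool (q = x) * h p) = (if p \<in> blk x then h p else 0)" if "p \<in> I" for p
    proof -
      have "(\<Sum>q\<in>blk p. of_bool (q = x) * h p) = (\<Sum>q\<in>blk p. if q = x then h p else 0)" by (intro sum.cong) auto
      also have "\<dots> = (if x \<in> blk p then h p else 0)" by simp
      also have "x \<in> blk p \<longleftrightarrow> p \<in> blk x" using that \<open>x \<in> I\<close> by (auto simp: blk_def)
      finally show ?thesis .
    qed
    then have "(\<Sum>p\<in>I. \<Sum>q\<in>blk p. of_bool (q = x) * h p) = (\<Sum>p\<in>I. if p \<in> blk x then h p else 0)"
      by (rule sum.cong[OF refl])
    also have "\<dots> = (\<Sum>p\<in>I \<inter> blk x. h p)" by (simp add: sum.inter_restrict)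
    also have "I \<inter> blk x = blk x" by (auto simp: blk_def)
    finally show ?thesis .
  qed
  have fix1: "(\<Sum>p\<in>I. \<Sum>q\<in>blk p. of_bool (p = x) * h q) = (\<Sum>q\<in>blk x. h q)" if "x \<in> I" for x and h :: "idx \<Rightarrow> real"
  proof -
    have "(\<Sum>p\<in>I. \<Sum>q\<in>blk p. of_bool (p = x) * h q) = (\<Sum>p\<in>I. if p = x then (\<Sum>q\<in>blk p. h q) else 0)"
      by (intro sum.cong refl) simp
    then show ?thesis using that by simp
  qed
  have Er: "E r s (Cas f) m = (\<Sum>p\<in>I. \<Sum>q\<in>blk p. E r s (E p q (E q p f)) m)"
  proof -
    have "E r s (Cas f) = E r s (\<lambda>m. \<Sum>j\<in>same. 1 * E (fst j) (snd j) (E (snd j) (fst j) f) m)"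
    proof (rule arg_cong[of _ _ "E r s"])
      show "Cas f = (\<lambda>m. \<Sum>j\<in>same. 1 * E (fst j) (snd j) (E (snd j) (fst j) f) m)"
      proof
        fix m
        have "same = (SIGMA p:I. blk p)" by (auto simp: same_iff)
        then show "Cas f m = (\<Sum>j\<in>same. 1 * E (fst j) (snd j) (E (snd j) (fst j) f) m)"
          by (simp add: Cas_def sum.Sigma case_prod_beta)
      qed
    qed
    also have "\<dots> = (\<lambda>m. \<Sum>j\<in>same. 1 * E r s (E (fst j) (snd j) (E (snd j) (fst j) f)) m)"
      by (rule lin_sum[OF lin_E finite_same])
    finally have "E r s (Cas f) m = (\<Sum>j\<in>same. E r s (E (fst j) (snd j) (E (snd j) (fst j) f)) m)" by simp
    also have "same = (SIGMA p:I. blk p)" by (auto simp: same_iff)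
    finally show ?thesis by (simp add: sum.Sigma case_prod_beta)
  qed
  have "Cas (E r s f) m - E r s (Cas f) m =
     (\<Sum>p\<in>I. \<Sum>q\<in>blk p. E p q (E q p (E r s f)) m - E r s (E p q (E q p f)) m)"
    unfolding Er by (simp add: Cas_def sum_subtractf)
  also have "\<dots> = (\<Sum>p\<in>I. \<Sum>q\<in>blk p. of_bool (p = r) * h1 q - of_bool (q = s) * h2 p + of_bool (q = r) * h2 p - of_bool (p = s) * h1 q)"
    unfolding h1_def h2_def by (intro sum.cong refl bracket) (simp add: same_iff)
  also have "\<dots> = (\<Sum>q\<in>blk r. h1 q) - (\<Sum>p\<in>blk s. h2 p) + (\<Sum>p\<in>blk r. h2 p) - (\<Sum>q\<in>blk s. h1 q)"
    by (simp only: sum.distrib sum_subtractf swap[OF sI(1)] swap[OF sI(2)] fix1[OF sI(1)] fix1[OF sI(2)])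
  also have "\<dots> = 0" using sI(3) by simp
  finally show "Cas (E r s f) m = E r s (Cas f) m" by simp
qed

text \<open>The Casimir eigenvalue on a highest weight vector, \<open><\<mu>, \<mu> + 2 rho>\<close>
  with \<open>rho\<close> half the sum of the positive roots.\<close>

definition q0 :: "(idx \<Rightarrow> int) \<Rightarrow> real" where
  "q0 \<mu> = of_int ((\<Sum>p\<in>I. \<mu> p * \<mu> p) + (\<Sum>(p, q)\<in>Rp. \<mu> p - \<mu> q))"

lemma E_diag_V: "p \<in> I \<Longrightarrow> f \<in> V \<mu> \<Longrightarrow> E p p f m = of_int (\<mu> p) * f m"
  using E_diag[of p f m] by (cases "f m = 0") (auto simp: V_def Mon_def)

lemma E_pq_qp:
  assumes "(p, q) \<in> same" "f \<in> V \<mu>"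
  shows "E p q (E q p f) m = E q p (E p q f) m + of_int (\<mu> p - \<mu> q) * f m"
proof -
  have "p \<in> I" "q \<in> I" using assms by (auto simp: same_def)
  then show ?thesis using E_commutator[OF assms(1) same_sym[OF assms(1)], of f m] E_diag_V[OF _ assms(2)]
    by (simp add: algebra_simps)
qed

text \<open>Commuting each product for a positive root into the form (lower after raise) produces
  the linear part of \<open>q0\<close>; what is left vanishes on highest weight vectors.\<close>

lemma Cas_V:
  assumes f: "f \<in> V \<mu>"
  shows "Cas f m = q0 \<mu> * f m + 2 * (\<Sum>(p, q)\<in>Rp. E q p (E p q f) m)"
proof -
  define h where "h = (\<lambda>(p, q). E p q (E q p f) m)"
  have "same = (SIGMA p:I. blk p)" by (auto simp: same_iff)
  then have "Cas f m = (\<Sum>j\<in>same. h j)"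
    by (simp add: Cas_def h_def sum.Sigma case_prod_beta)
  also have "same = (Rp \<union> prod.swap ` Rp) \<union> (\<lambda>p. (p, p)) ` I"
    by (auto simp: same_def Rp_def image_iff)
  also have "(\<Sum>j\<in>(Rp \<union> prod.swap ` Rp) \<union> (\<lambda>p. (p, p)) ` I. h j) = (\<Sum>j\<in>Rp \<union> prod.swap ` Rp. h j) + (\<Sum>j\<in>(\<lambda>p. (p, p)) ` I. h j)"
    by (intro sum.union_disjoint) (simp_all, auto simp: Rp_def)
  also have "(\<Sum>j\<in>Rp \<union> prod.swap ` Rp. h j) = (\<Sum>j\<in>Rp. h j) + (\<Sum>j\<in>prod.swap ` Rp. h j)"
    by (intro sum.union_disjoint) (simp_all, auto simp: Rp_def)
  also have "(\<Sum>j\<in>prod.swap ` Rp. h j) = (\<Sum>(p, q)\<in>Rp. E q p (E p q f) m)"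
    by (subst sum.reindex) (auto simp: h_def case_prod_beta)
  also have "(\<Sum>j\<in>(\<lambda>p. (p, p)) ` I. h j) = (\<Sum>p\<in>I. of_int (\<mu> p * \<mu> p) * f m)"
  proof -
    have "h (p, p) = of_int (\<mu> p * \<mu> p) * f m" if "p \<in> I" for p
    proof -
      have "E p p f = (\<lambda>m. of_int (\<mu> p) * f m)" using E_diag_V[OF that f] by auto
      then show ?thesis using E_diag_V[OF that f] by (simp add: h_def lin_scale[OF lin_E] mult.assoc)
    qed
    then show ?thesis by (subst sum.reindex) (auto simp: inj_on_def)
  qed
  also have "(\<Sum>j\<in>Rp. h j) = (\<Sum>(p, q)\<in>Rp. E q p (E p q f) m) + (\<Sum>(p, q)\<in>Rp. of_int (\<mu> p - \<mu> q) * f m)"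
    unfolding sum.distrib[symmetric] h_def using E_pq_qp[OF Rp_same f]
    by (intro sum.cong refl) (simp add: case_prod_beta)
  finally show ?thesis by (simp add: q0_def case_prod_beta sum_distrib_left algebra_simps)
qed

lemma Cas_in_V: "f \<in> V \<mu> \<Longrightarrow> Cas f \<in> V \<mu>"
proof -
  assume f: "f \<in> V \<mu>"
  have "E q p (E p q f) \<in> V \<mu>" if "(p, q) \<in> Rp" for p q
    using E_in_V[OF same_sym[OF Rp_same[OF that]] E_in_V[OF Rp_same[OF that] f]] by (simp add: rt_add_rev)
  then have z: "E q p (E p q f) m = 0" if "(p, q) \<in> Rp" "m \<notin> Mon \<mu>" for p q m
    using that unfolding V_def by blast
  have "Cas f m = 0" if "m \<notin> Mon \<mu>" for m
  proof -
    have "(\<Sum>(p, q)\<in>Rp. E q p (E p q f) m) = 0" using z that by (intro sum.neutral) auto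
    then show ?thesis using f that by (auto simp: Cas_V[OF f] V_def)
  qed
  then show ?thesis unfolding V_def by blast
qed

lemma ip_EE:
  assumes pq: "(p, q) \<in> same"
  shows "ip \<mu> (E p q (E q p f)) g = ip (\<lambda>x. \<mu> x + rt q p x) (E q p f) (E q p g)"
  using ip_E[OF pq, of "\<lambda>x. \<mu> x + rt q p x" "E q p f" g] by (simp add: rt_add_rev)

lemma ip_Cas: "ip \<mu> (Cas f) g = ip \<mu> f (Cas g)"
proof -
  have "ip \<mu> (Cas f) g = (\<Sum>p\<in>I. \<Sum>q\<in>blk p. ip \<mu> (E p q (E q p f)) g)" for f g
    unfolding ip_def Cas_def
    by (simp only: sum_distrib_left sum_distrib_right)
       (subst sum.swap, rule sum.cong[OF refl], rule sum.swap)
  moreover have "ip \<mu> (E p q (E q p f)) g = ip \<mu> (E p q (E q p g)) f" if "p \<in> I" "q \<in> blk p" for p q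
  proof -
    have pq: "(p, q) \<in> same" using that by (simp add: same_iff)
    show ?thesis unfolding ip_EE[OF pq] by (rule ip_sym)
  qed
  ultimately have "ip \<mu> (Cas f) g = ip \<mu> (Cas g) f" by (simp cong: sum.cong)
  then show ?thesis by (simp add: ip_sym)
qed

definition Q :: "real \<Rightarrow> (mon \<Rightarrow> real) \<Rightarrow> mon \<Rightarrow> real" where "Q c f m = Cas f m - c * f m"

text \<open>Polynomials in \<open>Q c\<close>, generated inductively so that linearity, stability of
  weight spaces, commutation with \<open>E\<close> and self-adjointness are checked on generators
  only.\<close>

inductive_set PO :: "real \<Rightarrow> ((mon \<Rightarrow> real) \<Rightarrow> mon \<Rightarrow> real) set" for c :: real where
  PO_id: "(\<lambda>f. f) \<in> PO c"
| PO_Q: "Y \<in> PO c \<Longrightarrow> (\<lambda>f. Q c (Y f)) \<in> PO c"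
| PO_lc: "Y \<in> PO c \<Longrightarrow> Z \<in> PO c \<Longrightarrow> (\<lambda>f m. a * Y f m + b * Z f m) \<in> PO c"

lemma lin_Q: "lin (Q c)"
  using lin_Cas unfolding lin_def by (simp add: fun_eq_iff Q_def algebra_simps)

lemma Q_in_V: "f \<in> V \<mu> \<Longrightarrow> Q c f \<in> V \<mu>"
proof -
  assume f: "f \<in> V \<mu>"
  have "f m = 0 \<and> Cas f m = 0" if "m \<notin> Mon \<mu>" for m
    using that f Cas_in_V[OF f] unfolding V_def by blast
  then have "Q c f m = 0" if "m \<notin> Mon \<mu>" for m using that by (simp add: Q_def)
  then show ?thesis unfolding V_def by blast
qed

lemma Q_E: "(r, s) \<in> same \<Longrightarrow> Q c (E r s f) = E r s (Q c f)"
proof -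
  assume rs: "(r, s) \<in> same"
  have "E r s (\<lambda>m. Cas f m + (- c) * f m) = (\<lambda>m. E r s (Cas f) m + (- c) * E r s f m)"
    by (simp only: lin_add[OF lin_E] lin_scale[OF lin_E])
  moreover have "Q c f = (\<lambda>m. Cas f m + (- c) * f m)" by (simp add: Q_def fun_eq_iff)
  ultimately have "E r s (Q c f) = (\<lambda>m. E r s (Cas f) m + (- c) * E r s f m)" by (simp only:)
  then show ?thesis by (simp add: fun_eq_iff Q_def[of c "E r s f"] Cas_E[OF rs])
qed

lemma ip_Q: "ip \<mu> (Q c f) g = ip \<mu> f (Q c g)"
proof -
  have "ip \<mu> (Q c f) g = ip \<mu> (Cas f) g - c * ip \<mu> f g" for f g
    unfolding ip_def Q_def by (simp add: algebra_simps sum_subtractf sum_distrib_left)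
  then show ?thesis by (metis ip_Cas ip_sym)
qed

lemma PO_lin: "Y \<in> PO c \<Longrightarrow> lin Y"
proof (induction rule: PO.induct)
  case (PO_Q Y)
  then show ?case using lin_Q[of c] by (simp add: lin_def)
next
  case (PO_lc Y Z a b)
  then show ?case by (simp add: lin_def algebra_simps)
qed (simp add: lin_def)

lemma PO_V: "Y \<in> PO c \<Longrightarrow> f \<in> V \<mu> \<Longrightarrow> Y f \<in> V \<mu>"
proof (induction rule: PO.induct)
  case (PO_lc Y Z a b)
  then have "Y f m = 0 \<and> Z f m = 0" if "m \<notin> Mon \<mu>" for m using that unfolding V_def by blast
  then show ?case unfolding V_def by fastforce
qed (auto intro: Q_in_V)

lemma PO_E: "Y \<in> PO c \<Longrightarrow> (r, s) \<in> same \<Longrightarrow> Y (E r s f) = E r s (Y f)"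
proof (induction rule: PO.induct)
  case (PO_lc Y Z a b)
  have "E r s (\<lambda>m. a * Y f m + b * Z f m) = (\<lambda>m. a * E r s (Y f) m + b * E r s (Z f) m)"
    by (simp only: lin_add[OF lin_E] lin_scale[OF lin_E])
  then show ?case using PO_lc by simp
qed (simp_all add: Q_E)

lemma PO_Q_commute: "Y \<in> PO c \<Longrightarrow> Y (Q c f) = Q c (Y f)"
proof (induction rule: PO.induct)
  case (PO_lc Y Z a b)
  have "Q c (\<lambda>m. a * Y f m + b * Z f m) = (\<lambda>m. a * Q c (Y f) m + b * Q c (Z f) m)"
    by (simp only: lin_add[OF lin_Q] lin_scale[OF lin_Q])
  then show ?case using PO_lc by simp
qed simp_all

lemma PO_ip: "Y \<in> PO c \<Longrightarrow> ip \<mu> (Y f) g = ip \<mu> f (Y g)"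
proof (induction arbitrary: f g rule: PO.induct)
  case (PO_Q Y)
  have "ip \<mu> (Q c (Y f)) g = ip \<mu> f (Y (Q c g))" by (simp add: ip_Q PO_Q.IH)
  then show ?case by (simp add: PO_Q_commute[OF PO_Q.hyps])
next
  case (PO_lc Y Z a b)
  have "ip \<mu> (\<lambda>m. a * Y f m + b * Z f m) g = a * ip \<mu> (Y f) g + b * ip \<mu> (Z f) g"
    unfolding ip_def by (simp add: algebra_simps sum.distrib sum_distrib_left)
  moreover have "ip \<mu> f (\<lambda>m. a * Y g m + b * Z g m) = a * ip \<mu> f (Y g) + b * ip \<mu> f (Z g)"
    unfolding ip_def by (simp add: algebra_simps sum.distrib sum_distrib_left)
  ultimately show ?case using PO_lc by simp
qed simp

lemma PO_comp: "Y \<in> PO c \<Longrightarrow> Z \<in> PO c \<Longrightarrow> (\<lambda>f. Y (Z f)) \<in> PO c"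
  by (induction rule: PO.induct) (auto intro: PO.intros)

lemma PO_sum:
  assumes "finite J" "\<And>j. j \<in> J \<Longrightarrow> Y j \<in> PO c"
  shows "(\<lambda>f m. \<Sum>j\<in>J. a j * Y j f m) \<in> PO c"
  using assms
proof (induction J rule: finite_induct)
  case empty
  have "(\<lambda>f m. 0 * f m + 0 * f m) \<in> PO c" by (rule PO_lc[OF PO_id PO_id])
  then show ?case by simp
next
  case (insert x J)
  have "(\<lambda>f m. a x * Y x f m + 1 * (\<Sum>j\<in>J. a j * Y j f m)) \<in> PO c"
    by (rule PO_lc) (use insert in auto)
  then show ?case using insert by simp
qed

lemma PO_pow: "((Q c) ^^ n) \<in> PO c"
proof (induction n)
  case 0 then show ?case using PO_id by (simp add: id_def)
next
  case (Suc n) then show ?case using PO_Q[OF Suc] by (simp add: o_def)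
qed

text \<open>Polynomials in \<open>Q c\<close> with constant term 1; they fix the kernel of
  \<open>Q c\<close> pointwise.\<close>

definition PU :: "real \<Rightarrow> ((mon \<Rightarrow> real) \<Rightarrow> mon \<Rightarrow> real) set" where
  "PU c = {Y \<in> PO c. \<exists>S\<in>PO c. \<forall>f. Y f = (\<lambda>m. f m + Q c (S f) m)}"

lemma PU_comp:
  assumes "Y \<in> PU c" "Z \<in> PU c"
  shows "(\<lambda>f. Y (Z f)) \<in> PU c"
proof -
  obtain S where S: "S \<in> PO c" "\<And>f. Y f = (\<lambda>m. f m + Q c (S f) m)" using assms(1) by (auto simp: PU_def)
  obtain T where T: "T \<in> PO c" "\<And>f. Z f = (\<lambda>m. f m + Q c (T f) m)" using assms(2) by (auto simp: PU_def)
  have "(\<lambda>f m. 1 * T f m + 1 * S (Z f) m) \<in> PO c"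
  proof (rule PO_lc[OF T(1)], rule PO_comp[OF S(1)])
    show "Z \<in> PO c" using assms by (simp add: PU_def)
  qed
  moreover have "Y (Z f) = (\<lambda>m. f m + Q c (\<lambda>m. 1 * T f m + 1 * S (Z f) m) m)" for f
  proof -
    have "Q c (\<lambda>m. 1 * T f m + 1 * S (Z f) m) = (\<lambda>m. Q c (T f) m + Q c (S (Z f)) m)"
      by (simp add: lin_add[OF lin_Q])
    moreover have "Y (Z f) m = Z f m + Q c (S (Z f)) m" for m using S(2)[of "Z f"] by (rule fun_cong)
    moreover have "Z f m = f m + Q c (T f) m" for m using T(2)[of f] by (rule fun_cong)
    ultimately show ?thesis by (intro ext) (simp only: add.assoc)
  qed
  moreover have "(\<lambda>f. Y (Z f)) \<in> PO c" by (rule PO_comp) (use assms in \<open>auto simp: PU_def\<close>)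
  ultimately show ?thesis unfolding PU_def by (intro CollectI conjI bexI allI)
qed

lemma PU_id: "(\<lambda>f. f) \<in> PU c"
proof -
  have 0: "(\<lambda>f m. 0 * f m + 0 * f m) \<in> PO c" by (rule PO_lc[OF PO_id PO_id])
  have "f = (\<lambda>m. f m + Q c (\<lambda>m. 0 * f m + 0 * f m) m)" for f
    by (simp add: lin_zero[OF lin_Q])
  then show ?thesis unfolding PU_def by (intro CollectI conjI PO_id bexI[OF _ 0] allI)
qed

lemma PU_fix: "Y \<in> PU c \<Longrightarrow> Q c f = (\<lambda>_. 0) \<Longrightarrow> Y f = f"
proof -
  assume Y: "Y \<in> PU c" and f: "Q c f = (\<lambda>_. 0)"
  obtain S where S: "S \<in> PO c" "\<And>f. Y f = (\<lambda>m. f m + Q c (S f) m)" using Y by (auto simp: PU_def)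
  have "Q c (S f) = S (Q c f)" using PO_Q_commute[OF S(1)] by simp
  also have "\<dots> = (\<lambda>_. 0)" unfolding f by (rule lin_zero[OF PO_lin[OF S(1)]])
  finally show ?thesis using S(2)[of f] by simp
qed

text \<open>On a finite-dimensional weight space the powers of \<open>Q c\<close> are linearly
  dependent. Injectivity allows a relation to be divided by its lowest power of \<open>Q c\<close>,
  and division by the lowest coefficient then makes the constant term 1.\<close>

lemma annihilating_polynomial:
  assumes inj: "\<And>f. f \<in> V \<mu> \<Longrightarrow> Q c f = (\<lambda>_. 0) \<Longrightarrow> f = (\<lambda>_. 0)"
  shows "\<exists>R\<in>PU c. \<forall>f\<in>V \<mu>. R f = (\<lambda>_. 0)"
proof -
  \<comment> \<open>There are \<open>D\<close> matrix entries but \<open>D + 1\<close> powers with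
    exponents from 0 to \<open>D\<close>, so a relation exists.\<close>
  define D where "D = card (Mon \<mu> \<times> Mon \<mu>)"
  have "\<exists>v. (\<exists>j\<in>{..D}. v j \<noteq> 0) \<and> (\<forall>i\<in>Mon \<mu> \<times> Mon \<mu>. (\<Sum>j\<in>{..D}. ((Q c ^^ j) (\<delta>m (snd i)) (fst i)) * v j) = (0::real))"
    by (rule underdetermined_system) (auto simp: D_def)
  then obtain v where v: "\<exists>j\<le>D. v j \<noteq> 0"
     and vs: "\<And>m n. m \<in> Mon \<mu> \<Longrightarrow> n \<in> Mon \<mu> \<Longrightarrow> (\<Sum>j\<le>D. (Q c ^^ j) (\<delta>m n) m * v j) = 0" by fastforce
  define j0 where "j0 = (LEAST j. v j \<noteq> 0)"
  have j0: "v j0 \<noteq> 0" "j0 \<le> D" and less: "\<And>j. j < j0 \<Longrightarrow> v j = 0"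
    unfolding j0_def using v by (auto intro: LeastI dest: not_less_Least Least_le) (metis (mono_tags, lifting) LeastI Least_le order_trans)+
  define R where "R = (\<lambda>f m. \<Sum>j\<in>{j0..D}. v j / v j0 * (Q c ^^ (j - j0)) f m)"
  have RPO: "R \<in> PO c" unfolding R_def by (intro PO_sum PO_pow) auto
  have QR: "(Q c ^^ j0) (R f) = (\<lambda>_. 0)" if f: "f \<in> V \<mu>" for f
  proof
    fix m
    have l: "lin (Q c ^^ j0)" by (rule PO_lin[OF PO_pow])
    have "(Q c ^^ j0) (R f) m = (\<Sum>j\<in>{j0..D}. v j / v j0 * (Q c ^^ j0) ((Q c ^^ (j - j0)) f) m)"
      unfolding R_def using lin_sum[OF l, of "{j0..D}" "\<lambda>j. v j / v j0" "\<lambda>j. (Q c ^^ (j - j0)) f"] by simp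
    also have "\<dots> = (\<Sum>j\<in>{j0..D}. v j / v j0 * (Q c ^^ j) f m)"
    proof (intro sum.cong refl)
      fix j assume "j \<in> {j0..D}"
      then have "Q c ^^ j = Q c ^^ j0 \<circ> Q c ^^ (j - j0)" by (simp flip: funpow_add)
      then show "v j / v j0 * (Q c ^^ j0) ((Q c ^^ (j - j0)) f) m = v j / v j0 * (Q c ^^ j) f m" by simp
    qed
    also have "\<dots> = (\<Sum>j\<le>D. v j / v j0 * (Q c ^^ j) f m)"
      using less by (intro sum.mono_neutral_left) auto
    also have "\<dots> = 0"
    proof (cases "m \<in> Mon \<mu>")
      case True
      have "(\<Sum>j\<le>D. v j / v j0 * (Q c ^^ j) f m) = (\<Sum>j\<le>D. \<Sum>n\<in>Mon \<mu>. f n / v j0 * ((Q c ^^ j) (\<delta>m n) m * v j))"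
        by (intro sum.cong refl) (simp add: lin_expand[OF PO_lin[OF PO_pow] f] sum_distrib_left mult_ac)
      also have "\<dots> = (\<Sum>n\<in>Mon \<mu>. f n / v j0 * (\<Sum>j\<le>D. (Q c ^^ j) (\<delta>m n) m * v j))"
        by (subst sum.swap) (simp add: sum_distrib_left)
      also have "\<dots> = 0" using vs True by simp
      finally show ?thesis .
    next
      case False
      then have "(Q c ^^ j) f m = 0" for j using PO_V[OF PO_pow f, of j] by (auto simp: V_def)
      then show ?thesis by simp
    qed
    finally show "(Q c ^^ j0) (R f) m = 0" .
  qed
  have down: "(Q c ^^ j) g = (\<lambda>_. 0) \<Longrightarrow> g \<in> V \<mu> \<Longrightarrow> g = (\<lambda>_. 0)" for j g
  proof (induction j)
    case (Suc j)
    have "(Q c ^^ j) g \<in> V \<mu>" using PO_V[OF PO_pow Suc.prems(2)] .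
    then have "(Q c ^^ j) g = (\<lambda>_. 0)" using inj Suc.prems(1) by simp
    then show ?case using Suc by blast
  qed simp
  have "R f = (\<lambda>_. 0)" if "f \<in> V \<mu>" for f
    using down[OF QR[OF that]] PO_V[OF RPO that] by blast
  moreover have "R \<in> PU c"
  proof -
    define S where "S = (\<lambda>f m. \<Sum>j\<in>{Suc j0..D}. v j / v j0 * (Q c ^^ (j - Suc j0)) f m)"
    have "S \<in> PO c" unfolding S_def by (intro PO_sum PO_pow) auto
    have "R f = (\<lambda>m. f m + Q c (S f) m)" for f
    proof
      fix m
      have "R f m = f m + (\<Sum>j\<in>{Suc j0..D}. v j / v j0 * (Q c ^^ (j - j0)) f m)"
        unfolding R_def using j0 by (simp add: sum.atLeast_Suc_atMost)
      also have "(\<Sum>j\<in>{Suc j0..D}. v j / v j0 * (Q c ^^ (j - j0)) f m) = (\<Sum>j\<in>{Suc j0..D}. v j / v j0 * Q c ((Q c ^^ (j - Suc j0)) f) m)"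
      proof (intro sum.cong refl)
        fix j assume "j \<in> {Suc j0..D}"
        then have "j - j0 = Suc (j - Suc j0)" by auto
        then show "v j / v j0 * (Q c ^^ (j - j0)) f m = v j / v j0 * Q c ((Q c ^^ (j - Suc j0)) f) m" by simp
      qed
      also have "\<dots> = Q c (S f) m"
        unfolding S_def using lin_sum[OF lin_Q, of "{Suc j0..D}" c "\<lambda>j. v j / v j0" "\<lambda>j. (Q c ^^ (j - Suc j0)) f"] by simp
      finally show "R f m = f m + Q c (S f) m" .
    qed
    then show ?thesis using RPO \<open>S \<in> PO c\<close> unfolding PU_def by (intro CollectI conjI bexI allI)
  qed
  ultimately show ?thesis by blast
qed

section \<open>Signed traces and a Freudenthal type recursion\<close>

definition tr :: "(idx \<Rightarrow> int) \<Rightarrow> ((mon \<Rightarrow> real) \<Rightarrow> mon \<Rightarrow> real) \<Rightarrow> real" where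
  "tr \<mu> T = (\<Sum>m\<in>Mon \<mu>. T (\<delta>m m) m)"

lemma tr_cyclic:
  assumes "lin A" "lin B" "\<And>f. f \<in> V \<mu> \<Longrightarrow> B f \<in> V \<mu>'" "\<And>f. f \<in> V \<mu>' \<Longrightarrow> A f \<in> V \<mu>"
  shows "tr \<mu> (\<lambda>f. A (B f)) = tr \<mu>' (\<lambda>f. B (A f))"
proof -
  have "tr \<mu> (\<lambda>f. A (B f)) = (\<Sum>m\<in>Mon \<mu>. \<Sum>n\<in>Mon \<mu>'. B (\<delta>m m) n * A (\<delta>m n) m)"
    unfolding tr_def by (intro sum.cong refl lin_expand assms(1,3) delta_in_V)
  also have "\<dots> = (\<Sum>n\<in>Mon \<mu>'. \<Sum>m\<in>Mon \<mu>. A (\<delta>m n) m * B (\<delta>m m) n)"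
    by (subst sum.swap) (simp add: mult.commute)
  also have "\<dots> = tr \<mu>' (\<lambda>f. B (A f))"
    unfolding tr_def by (intro sum.cong refl lin_expand[symmetric] assms(2,4) delta_in_V)
  finally show ?thesis .
qed


definition \<gamma> :: "(idx \<times> idx) set \<Rightarrow> idx \<Rightarrow> int" where "\<gamma> S x = (\<Sum>(p, q)\<in>S. rt p q x)"

text \<open>This is \<open>|rho|^2 - |rho - \<gamma> S|^2\<close>, so it vanishes whenever
  \<open>\<gamma> S\<close> has the form \<open>rho - w rho\<close> for a permutation
  \<open>w\<close>.\<close>

definition nrm :: "(idx \<times> idx) set \<Rightarrow> int" where
  "nrm S = (\<Sum>(p, q)\<in>Rp. \<gamma> S p - \<gamma> S q) - (\<Sum>x\<in>I. \<gamma> S x * \<gamma> S x)"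

text \<open>The coefficient at \<open>\<nu>\<close> in the product of the generating function of the
  weight space traces with the Weyl denominator, expanded over subsets of positive roots.\<close>

definition signed_tr :: "(idx \<Rightarrow> int) \<Rightarrow> ((mon \<Rightarrow> real) \<Rightarrow> mon \<Rightarrow> real) \<Rightarrow> real" where
  "signed_tr \<nu> Y = (\<Sum>S\<in>Pow Rp. (-1) ^ card S * tr (\<lambda>x. \<nu> x + \<gamma> S x) Y)"

lemma rt_pair:
  assumes "p \<in> I" "q \<in> I"
  shows "(\<Sum>x\<in>I. \<xi> x * rt p q x) = \<xi> p - \<xi> q"
proof -
  have "(\<Sum>x\<in>I. \<xi> x * rt p q x) = (\<Sum>x\<in>I. if x = p then \<xi> x else 0) - (\<Sum>x\<in>I. if x = q then \<xi> x else 0)"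
    unfolding sum_subtractf[symmetric] by (intro sum.cong) (auto simp: rt_def)
  then show ?thesis using assms by simp
qed

lemma gamma_pair:
  assumes "S \<subseteq> Rp"
  shows "(\<Sum>x\<in>I. \<xi> x * \<gamma> S x) = (\<Sum>(p, q)\<in>S. \<xi> p - \<xi> q)"
proof -
  have "(\<Sum>x\<in>I. \<xi> x * \<gamma> S x) = (\<Sum>(p, q)\<in>S. \<Sum>x\<in>I. \<xi> x * rt p q x)"
    unfolding \<gamma>_def by (simp add: sum_distrib_left case_prod_beta) (rule sum.swap)
  also have "\<dots> = (\<Sum>(p, q)\<in>S. \<xi> p - \<xi> q)"
  proof (rule sum.cong[OF refl])
    fix j assume "j \<in> S"
    then have "fst j \<in> I" "snd j \<in> I" using assms by (auto simp: Rp_def)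
    then show "(case j of (p, q) \<Rightarrow> \<Sum>x\<in>I. \<xi> x * rt p q x) = (case j of (p, q) \<Rightarrow> \<xi> p - \<xi> q)"
      by (simp add: case_prod_beta rt_pair)
  qed
  finally show ?thesis .
qed

lemma tr_add: "tr \<mu> (\<lambda>f m. A f m + B f m) = tr \<mu> A + tr \<mu> B"
  unfolding tr_def by (rule sum.distrib)
lemma tr_scale: "tr \<mu> (\<lambda>f m. c * A f m) = c * tr \<mu> A"
  unfolding tr_def by (simp add: sum_distrib_left)
lemma tr_sum: "tr \<mu> (\<lambda>f m. \<Sum>j\<in>J. A j f m) = (\<Sum>j\<in>J. tr \<mu> (A j))"
  unfolding tr_def by (rule sum.swap)
lemma tr_cong: "(\<And>f m. f \<in> V \<mu> \<Longrightarrow> A f m = B f m) \<Longrightarrow> tr \<mu> A = tr \<mu> B"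
  unfolding tr_def by (intro sum.cong refl) (simp add: delta_in_V)

text \<open>Cyclicity moves \<open>E q p\<close> to the other end and the trace to the weight
  shifted by the root; commuting the two operators back costs the pairing of that weight with the
  root. This is one step of Freudenthal's recursion.\<close>

lemma tr_step:
  assumes Y: "Y \<in> PO c" and pq: "(p, q) \<in> Rp"
  defines "t \<equiv> \<lambda>\<mu>. tr \<mu> (\<lambda>f. E q p (E p q (Y f)))"
  shows "t \<mu> = t (\<lambda>x. \<mu> x + rt p q x) + of_int ((\<mu> p + rt p q p) - (\<mu> q + rt p q q)) * tr (\<lambda>x. \<mu> x + rt p q x) Y"
proof -
  let ?\<mu>' = "\<lambda>x. \<mu> x + rt p q x"
  have s: "(p, q) \<in> same" "(q, p) \<in> same" using Rp_same[OF pq] same_sym by blast+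
  have lEY: "lin (\<lambda>f. E p q (Y f))" using lin_E[of p q] PO_lin[OF Y] by (simp add: lin_def)
  have "t \<mu> = tr ?\<mu>' (\<lambda>f. E p q (Y (E q p f)))"
    unfolding t_def
  proof (rule tr_cyclic[OF lin_E lEY])
    show "E p q (Y f) \<in> V ?\<mu>'" if "f \<in> V \<mu>" for f using E_in_V[OF s(1) PO_V[OF Y that]] .
    show "E q p f \<in> V \<mu>" if "f \<in> V ?\<mu>'" for f using E_in_V[OF s(2) that] by (simp add: rt_add_rev)
  qed
  also have "\<dots> = tr ?\<mu>' (\<lambda>f m. E q p (E p q (Y f)) m + of_int (?\<mu>' p - ?\<mu>' q) * Y f m)"
    by (rule tr_cong) (simp add: PO_E[OF Y s(2)] E_pq_qp[OF s(1) PO_V[OF Y]])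
  also have "\<dots> = t ?\<mu>' + of_int (?\<mu>' p - ?\<mu>' q) * tr ?\<mu>' Y"
    unfolding tr_add tr_scale t_def ..
  finally show ?thesis .
qed

lemma tr_Cas:
  assumes Y: "Y \<in> PO c"
  shows "tr \<mu> (\<lambda>f. Cas (Y f)) = q0 \<mu> * tr \<mu> Y + 2 * (\<Sum>(p, q)\<in>Rp. tr \<mu> (\<lambda>f. E q p (E p q (Y f))))"
proof -
  have "tr \<mu> (\<lambda>f. Cas (Y f)) = tr \<mu> (\<lambda>f m. q0 \<mu> * Y f m + 2 * (\<Sum>j\<in>Rp. E (snd j) (fst j) (E (fst j) (snd j) (Y f)) m))"
    by (rule tr_cong) (simp add: Cas_V[OF PO_V[OF Y]] case_prod_beta)
  then show ?thesis by (simp add: tr_add tr_scale tr_sum case_prod_beta)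
qed

text \<open>Subsets with and without \<open>(p, q)\<close> are paired. Their weights differ by this
  root, so \<open>tr_step\<close> cancels the traces of the products and leaves the pairing
  terms.\<close>

lemma signed_root_sum:
  assumes Y: "Y \<in> PO c" and pq: "(p, q) \<in> Rp"
  shows "(\<Sum>S\<in>Pow Rp. (-1) ^ card S * tr (\<lambda>x. \<nu> x + \<gamma> S x) (\<lambda>f. E q p (E p q (Y f))))
   = - (\<Sum>S\<in>Pow Rp. (-1) ^ card S * (of_bool ((p, q) \<in> S) * of_int ((\<nu> p + \<gamma> S p) - (\<nu> q + \<gamma> S q)) * tr (\<lambda>x. \<nu> x + \<gamma> S x) Y))"
proof -
  define R where "R = Rp - {(p, q)}"
  have R: "Rp = insert (p, q) R" "(p, q) \<notin> R" "finite R" using pq by (auto simp: R_def)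
  define t where "t = (\<lambda>\<mu>. tr \<mu> (\<lambda>f. E q p (E p q (Y f))))"
  have ins: "\<gamma> (insert (p, q) S) = (\<lambda>x. \<gamma> S x + rt p q x)" "card (insert (p, q) S) = Suc (card S)" if "S \<in> Pow R" for S
  proof -
    have "finite S" "(p, q) \<notin> S" using that R finite_subset by auto
    then show "\<gamma> (insert (p, q) S) = (\<lambda>x. \<gamma> S x + rt p q x)" "card (insert (p, q) S) = Suc (card S)"
      by (simp_all add: \<gamma>_def fun_eq_iff add.commute)
  qed
  have notin: "(p, q) \<notin> S" if "S \<in> Pow R" for S using that R by auto
  have step: "t (\<lambda>x. \<nu> x + \<gamma> S x) = t (\<lambda>x. \<nu> x + (\<gamma> S x + rt p q x)) +
       of_int ((\<nu> p + (\<gamma> S p + rt p q p)) - (\<nu> q + (\<gamma> S q + rt p q q))) * tr (\<lambda>x. \<nu> x + (\<gamma> S x + rt p q x)) Y" for S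
    using tr_step[OF Y pq, of "\<lambda>x. \<nu> x + \<gamma> S x"] unfolding t_def by (simp add: add.assoc)
  have "(\<Sum>S\<in>Pow Rp. (-1) ^ card S * t (\<lambda>x. \<nu> x + \<gamma> S x))
     = (\<Sum>S\<in>Pow R. (-1) ^ card S * t (\<lambda>x. \<nu> x + \<gamma> S x) + (-1) ^ card (insert (p, q) S) * t (\<lambda>x. \<nu> x + \<gamma> (insert (p, q) S) x))"
    unfolding R(1) by (rule sum_Pow_insert[OF R(3,2)])
  also have "\<dots> = (\<Sum>S\<in>Pow R. (-1) ^ card S * (of_int ((\<nu> p + (\<gamma> S p + rt p q p)) - (\<nu> q + (\<gamma> S q + rt p q q))) * tr (\<lambda>x. \<nu> x + (\<gamma> S x + rt p q x)) Y))"
    by (intro sum.cong refl) (simp add: ins step distrib_left)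
  also have "\<dots> = - (\<Sum>S\<in>Pow R. (-1) ^ card S * (of_bool ((p, q) \<in> S) * of_int ((\<nu> p + \<gamma> S p) - (\<nu> q + \<gamma> S q)) * tr (\<lambda>x. \<nu> x + \<gamma> S x) Y)
     + (-1) ^ card (insert (p, q) S) * (of_bool ((p, q) \<in> insert (p, q) S) * of_int ((\<nu> p + \<gamma> (insert (p, q) S) p) - (\<nu> q + \<gamma> (insert (p, q) S) q)) * tr (\<lambda>x. \<nu> x + \<gamma> (insert (p, q) S) x) Y))"
    unfolding sum_negf[symmetric] by (intro sum.cong refl) (simp add: ins notin)
  also have "\<dots> = - (\<Sum>S\<in>Pow Rp. (-1) ^ card S * (of_bool ((p, q) \<in> S) * of_int ((\<nu> p + \<gamma> S p) - (\<nu> q + \<gamma> S q)) * tr (\<lambda>x. \<nu> x + \<gamma> S x) Y))"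
    unfolding R(1) by (subst sum_Pow_insert[OF R(3,2)]) simp
  finally show ?thesis by (simp add: t_def)
qed

text \<open>Completing the square: the mixed terms in \<open>\<nu>\<close> and
  \<open>\<gamma> S\<close> cancel, and \<open>nrm S\<close> collects the terms in
  \<open>\<gamma> S\<close> alone.\<close>

lemma q0_shift:
  assumes S: "S \<subseteq> Rp"
  shows "q0 (\<lambda>x. \<nu> x + \<gamma> S x) - 2 * (\<Sum>(p, q)\<in>S. of_int ((\<nu> p + \<gamma> S p) - (\<nu> q + \<gamma> S q))) = q0 \<nu> + of_int (nrm S)"
proof -
  have 1: "(\<Sum>(p, q)\<in>S. (\<nu> p + \<gamma> S p) - (\<nu> q + \<gamma> S q)) = (\<Sum>x\<in>I. (\<nu> x + \<gamma> S x) * \<gamma> S x)"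
    using gamma_pair[OF S, of "\<lambda>x. \<nu> x + \<gamma> S x"] by simp
  have 2: "(\<Sum>(p, q)\<in>Rp. (\<nu> p + \<gamma> S p) - (\<nu> q + \<gamma> S q)) = (\<Sum>(p, q)\<in>Rp. \<nu> p - \<nu> q) + (\<Sum>(p, q)\<in>Rp. \<gamma> S p - \<gamma> S q)"
    unfolding sum.distrib[symmetric] by (intro sum.cong) auto
  have "(\<Sum>x\<in>I. (\<nu> x + \<gamma> S x) * (\<nu> x + \<gamma> S x)) - 2 * (\<Sum>x\<in>I. (\<nu> x + \<gamma> S x) * \<gamma> S x) = (\<Sum>x\<in>I. \<nu> x * \<nu> x) - (\<Sum>x\<in>I. \<gamma> S x * \<gamma> S x)"
    unfolding sum_distrib_left sum_subtractf[symmetric] by (intro sum.cong) (auto simp: algebra_simps)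
  then have "((\<Sum>x\<in>I. (\<nu> x + \<gamma> S x) * (\<nu> x + \<gamma> S x)) + (\<Sum>(p, q)\<in>Rp. (\<nu> p + \<gamma> S p) - (\<nu> q + \<gamma> S q)))
     - 2 * (\<Sum>(p, q)\<in>S. (\<nu> p + \<gamma> S p) - (\<nu> q + \<gamma> S q)) = ((\<Sum>x\<in>I. \<nu> x * \<nu> x) + (\<Sum>(p, q)\<in>Rp. \<nu> p - \<nu> q)) + nrm S"
    unfolding 1 2 nrm_def by linarith
  from arg_cong[OF this, of real_of_int] show ?thesis
    unfolding q0_def by (simp add: case_prod_beta)
qed

text \<open>In the term of \<open>S\<close> the recursion replaces the Casimir operator by the
  scalar \<open>q0 \<nu> + nrm S\<close>; the contributions of \<open>nrm S\<close> sum to zero by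
  \<open>weyl\<close>.\<close>

lemma signed_tr_Cas:
  assumes weyl: "\<And>F :: (idx \<Rightarrow> int) \<Rightarrow> real. (\<Sum>S\<in>Pow Rp. (-1) ^ card S * (of_int (nrm S) * F (\<gamma> S))) = 0"
    and Y: "Y \<in> PO c"
  shows "signed_tr \<nu> (\<lambda>f. Cas (Y f)) = q0 \<nu> * signed_tr \<nu> Y"
proof -
  define n where "n = (\<lambda>S. tr (\<lambda>x. \<nu> x + \<gamma> S x) Y)"
  define h where "h = (\<lambda>S (p, q). real_of_int ((\<nu> p + \<gamma> S p) - (\<nu> q + \<gamma> S q)))"
  have "signed_tr \<nu> (\<lambda>f. Cas (Y f)) = (\<Sum>S\<in>Pow Rp. (-1) ^ card S * (q0 (\<lambda>x. \<nu> x + \<gamma> S x) * n S))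
     + 2 * (\<Sum>(p, q)\<in>Rp. \<Sum>S\<in>Pow Rp. (-1) ^ card S * tr (\<lambda>x. \<nu> x + \<gamma> S x) (\<lambda>f. E q p (E p q (Y f))))"
    unfolding signed_tr_def tr_Cas[OF Y] n_def
    by (simp add: distrib_left sum.distrib sum_distrib_left case_prod_beta mult.left_commute) (rule sum.swap)
  also have "(\<Sum>(p, q)\<in>Rp. \<Sum>S\<in>Pow Rp. (-1) ^ card S * tr (\<lambda>x. \<nu> x + \<gamma> S x) (\<lambda>f. E q p (E p q (Y f))))
     = (\<Sum>j\<in>Rp. - (\<Sum>S\<in>Pow Rp. (-1) ^ card S * (of_bool (j \<in> S) * h S j * n S)))"
    by (intro sum.cong refl) (auto simp: signed_root_sum[OF Y] h_def n_def)
  also have "\<dots> = - (\<Sum>S\<in>Pow Rp. \<Sum>j\<in>Rp. (-1) ^ card S * (of_bool (j \<in> S) * h S j * n S))"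
    unfolding sum_negf by (subst sum.swap) simp
  also have "(\<Sum>S\<in>Pow Rp. \<Sum>j\<in>Rp. (-1) ^ card S * (of_bool (j \<in> S) * h S j * n S)) = (\<Sum>S\<in>Pow Rp. (-1) ^ card S * ((\<Sum>j\<in>S. h S j) * n S))"
  proof (intro sum.cong refl)
    fix S assume S: "S \<in> Pow Rp"
    have "(\<Sum>j\<in>S. h S j) = (\<Sum>j\<in>Rp. of_bool (j \<in> S) * h S j)"
      using S by (intro sum.mono_neutral_cong_left) auto
    then show "(\<Sum>j\<in>Rp. (-1) ^ card S * (of_bool (j \<in> S) * h S j * n S)) = (-1) ^ card S * ((\<Sum>j\<in>S. h S j) * n S)"
      by (simp only: sum_distrib_left sum_distrib_right)
  qed
  finally have "signed_tr \<nu> (\<lambda>f. Cas (Y f)) = (\<Sum>S\<in>Pow Rp. (-1) ^ card S * ((q0 (\<lambda>x. \<nu> x + \<gamma> S x) - 2 * (\<Sum>j\<in>S. h S j)) * n S))"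
    by (simp add: left_diff_distrib right_diff_distrib sum_subtractf sum_distrib_left mult_ac)
  also have "\<dots> = (\<Sum>S\<in>Pow Rp. (-1) ^ card S * ((q0 \<nu> + of_int (nrm S)) * n S))"
  proof (intro sum.cong refl)
    fix S assume "S \<in> Pow Rp"
    then show "(-1) ^ card S * ((q0 (\<lambda>x. \<nu> x + \<gamma> S x) - 2 * (\<Sum>j\<in>S. h S j)) * n S) = (-1) ^ card S * ((q0 \<nu> + of_int (nrm S)) * n S)"
      using q0_shift[of S \<nu>] by (simp add: h_def case_prod_beta)
  qed
  also have "\<dots> = q0 \<nu> * signed_tr \<nu> Y + (\<Sum>S\<in>Pow Rp. (-1) ^ card S * (of_int (nrm S) * tr (\<lambda>x. \<nu> x + \<gamma> S x) Y))"
    unfolding signed_tr_def n_def by (simp add: distrib_left distrib_right sum.distrib sum_distrib_left mult_ac)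
  also have "(\<Sum>S\<in>Pow Rp. (-1) ^ card S * (of_int (nrm S) * tr (\<lambda>x. \<nu> x + \<gamma> S x) Y)) = 0"
    by (rule weyl[of "\<lambda>g. tr (\<lambda>x. \<nu> x + g x) Y"])
  finally show ?thesis by simp
qed

text \<open>\<open>Y\<close> differs from the identity by \<open>Cas - q0 \<nu>\<close> applied to a
  polynomial in it, and that part has signed trace zero.\<close>

lemma signed_tr_PU:
  assumes weyl: "\<And>F :: (idx \<Rightarrow> int) \<Rightarrow> real. (\<Sum>S\<in>Pow Rp. (-1) ^ card S * (of_int (nrm S) * F (\<gamma> S))) = 0"
    and Y: "Y \<in> PU (q0 \<nu>)"
  shows "signed_tr \<nu> Y = signed_tr \<nu> (\<lambda>f. f)"
proof -
  obtain S where S: "S \<in> PO (q0 \<nu>)" "\<And>f. Y f = (\<lambda>m. f m + Q (q0 \<nu>) (S f) m)" using Y by (auto simp: PU_def)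
  have "tr \<mu> Y = tr \<mu> (\<lambda>f. f) + (tr \<mu> (\<lambda>f. Cas (S f)) - q0 \<nu> * tr \<mu> S)" for \<mu>
  proof -
    have "tr \<mu> Y = tr \<mu> (\<lambda>f m. f m + (Cas (S f) m + (- q0 \<nu>) * S f m))"
      by (rule tr_cong) (simp add: S(2) Q_def)
    also have "\<dots> = tr \<mu> (\<lambda>f. f) + (tr \<mu> (\<lambda>f. Cas (S f)) + (- q0 \<nu>) * tr \<mu> S)"
      by (simp only: tr_add tr_scale)
    finally show ?thesis by simp
  qed
  then have "signed_tr \<nu> Y = signed_tr \<nu> (\<lambda>f. f) + (signed_tr \<nu> (\<lambda>f. Cas (S f)) - q0 \<nu> * signed_tr \<nu> S)"
    unfolding signed_tr_def by (simp add: distrib_left right_diff_distrib sum.distrib sum_subtractf sum_distrib_left mult_ac)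
  then show ?thesis using signed_tr_Cas[OF weyl S(1)] by simp
qed

section \<open>Highest weight vectors and the nonvanishing criterion\<close>

definition ht :: "(idx \<Rightarrow> int) \<Rightarrow> int" where "ht \<mu> = (\<Sum>x\<in>I. int (snd x) * \<mu> x)"

lemma weight_nonneg: "f \<in> V \<mu> \<Longrightarrow> f \<noteq> (\<lambda>_. 0) \<Longrightarrow> x \<in> I \<Longrightarrow> \<mu> x \<ge> 0"
proof -
  assume f: "f \<in> V \<mu>" "f \<noteq> (\<lambda>_. 0)" "x \<in> I"
  obtain m where "f m \<noteq> 0" using f(2) by auto
  then have "wt m x = \<mu> x" using f by (auto simp: V_def Mon_def)
  moreover have "wt m x \<ge> 0" unfolding wt_def by (intro sum_nonneg mult_nonneg_nonneg) (auto simp: inc_def)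
  ultimately show ?thesis by simp
qed

text \<open>A raising operator strictly decreases \<open>ht\<close>, which is nonnegative on nonzero
  weight spaces, so repeated raising ends at a highest weight vector. The counters \<open>n\<close>
  record the roots used; if all are zero, \<open>f\<close> itself was one.\<close>

lemma highest_weight_exists:
  assumes "f \<in> V \<mu>" "f \<noteq> (\<lambda>_. 0)" "Cas f = (\<lambda>m. c * f m)"
  shows "\<exists>\<kappa> g n. g \<in> V \<kappa> \<and> g \<noteq> (\<lambda>_. 0) \<and> Cas g = (\<lambda>m. c * g m) \<and> (\<forall>(p, q)\<in>Rp. E p q g = (\<lambda>_. 0)) \<and>
     (\<forall>x. \<kappa> x = \<mu> x + (\<Sum>j\<in>Rp. int (n j) * rt (fst j) (snd j) x)) \<and>
     ((\<forall>j\<in>Rp. n j = (0::nat)) \<longrightarrow> (\<forall>(p, q)\<in>Rp. E p q f = (\<lambda>_. 0)))"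
  using assms
proof (induction "nat (ht \<mu>)" arbitrary: f \<mu> rule: less_induct)
  case less
  show ?case
  proof (cases "\<forall>(p, q)\<in>Rp. E p q f = (\<lambda>_. 0)")
    case True
    then show ?thesis using less.prems by (intro exI[of _ \<mu>] exI[of _ f] exI[of _ "\<lambda>_. 0"]) auto
  next
    case False
    then obtain p q where pq: "(p, q) \<in> Rp" "E p q f \<noteq> (\<lambda>_. 0)" by auto
    have s: "(p, q) \<in> same" by (rule Rp_same[OF pq(1)])
    define \<mu>' where "\<mu>' = (\<lambda>x. \<mu> x + rt p q x)"
    have V': "E p q f \<in> V \<mu>'" unfolding \<mu>'_def by (rule E_in_V[OF s less.prems(1)])
    have C': "Cas (E p q f) = (\<lambda>m. c * E p q f m)"
      unfolding Cas_E[OF s] less.prems(3) by (rule lin_scale[OF lin_E])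
    have "ht \<mu>' = ht \<mu> + (\<Sum>x\<in>I. int (snd x) * rt p q x)"
      unfolding ht_def \<mu>'_def by (simp add: distrib_left sum.distrib)
    also have "(\<Sum>x\<in>I. int (snd x) * rt p q x) = int (snd p) - int (snd q)"
      using pq by (intro rt_pair) (auto simp: Rp_def)
    finally have "ht \<mu>' < ht \<mu>" using pq by (auto simp: Rp_def)
    moreover have "ht \<mu>' \<ge> 0" unfolding ht_def using weight_nonneg[OF V' pq(2)] by (intro sum_nonneg) auto
    ultimately have "nat (ht \<mu>') < nat (ht \<mu>)" by simp
    then obtain \<kappa> g n where g: "g \<in> V \<kappa>" "g \<noteq> (\<lambda>_. 0)" "Cas g = (\<lambda>m. c * g m)" "\<forall>(p, q)\<in>Rp. E p q g = (\<lambda>_. 0)"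
       and \<kappa>: "\<forall>x. \<kappa> x = \<mu>' x + (\<Sum>j\<in>Rp. int (n j) * rt (fst j) (snd j) x)"
      using less.hyps[OF _ V' pq(2) C'] by blast
    define n' where "n' = n((p, q) := Suc (n (p, q)))"
    have "\<kappa> x = \<mu> x + (\<Sum>j\<in>Rp. int (n' j) * rt (fst j) (snd j) x)" for x
    proof -
      have "(\<Sum>j\<in>Rp. int (n' j) * rt (fst j) (snd j) x) = (\<Sum>j\<in>Rp. int (n j) * rt (fst j) (snd j) x + (if j = (p, q) then rt p q x else 0))"
        by (intro sum.cong refl) (simp add: n'_def distrib_right)
      also have "\<dots> = (\<Sum>j\<in>Rp. int (n j) * rt (fst j) (snd j) x) + rt p q x" using pq(1) by (simp add: sum.distrib)
      finally show ?thesis using spec[OF \<kappa>, of x] by (simp add: \<mu>'_def)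
    qed
    moreover have "\<not> (\<forall>j\<in>Rp. n' j = 0)" using pq(1) by (auto simp: n'_def)
    ultimately show ?thesis using g by (intro exI[of _ \<kappa>] exI[of _ g] exI[of _ n']) blast
  qed
qed

text \<open>The squared norm of \<open>E q p g\<close> is \<open>\<kappa> p - \<kappa> q\<close>
  times that of \<open>g\<close>.\<close>

lemma highest_weight_dominant:
  assumes g: "g \<in> V \<kappa>" "g \<noteq> (\<lambda>_. 0)" and pq: "(p, q) \<in> Rp" "E p q g = (\<lambda>_. 0)"
  shows "\<kappa> q \<le> \<kappa> p"
proof -
  have s: "(p, q) \<in> same" "(q, p) \<in> same" using Rp_same[OF pq(1)] same_sym by blast+
  have "0 \<le> ip (\<lambda>x. \<kappa> x + rt q p x) (E q p g) (E q p g)" by (rule ip_nonneg)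
  also have "\<dots> = ip \<kappa> (E p q (E q p g)) g" by (simp add: ip_EE[OF s(1)])
  also have "E p q (E q p g) = (\<lambda>m. of_int (\<kappa> p - \<kappa> q) * g m)"
    using E_pq_qp[OF s(1) g(1)] pq(2) by (simp add: fun_eq_iff lin_zero[OF lin_E])
  also have "ip \<kappa> (\<lambda>m. of_int (\<kappa> p - \<kappa> q) * g m) g = of_int (\<kappa> p - \<kappa> q) * ip \<kappa> g g"
    unfolding ip_def by (simp add: sum_distrib_left mult_ac)
  finally have "0 \<le> of_int (\<kappa> p - \<kappa> q) * ip \<kappa> g g" .
  moreover have "ip \<kappa> g g > 0" using ip_nonneg[of \<kappa> g] ip_eq_0[OF g(1)] g(2) by fastforce
  ultimately show ?thesis by (simp add: zero_le_mult_iff)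
qed

text \<open>The factor on the right is the coordinate of \<open>2 rho\<close> in the block of
  \<open>x\<close>.\<close>

lemma Rp_sum: "(\<Sum>(p, q)\<in>Rp. \<eta> p - \<eta> q) = (\<Sum>x\<in>I. \<eta> x * (int (sz (fst x)) - 1 - 2 * int (snd x)))"
proof -
  have R1: "Rp = (SIGMA p:I. {q \<in> I. fst q = fst p \<and> snd p < snd q})" by (auto simp: Rp_def)
  have c1: "card {q \<in> I. fst q = fst p \<and> snd p < snd q} = sz (fst p) - 1 - snd p" if "p \<in> I" for p
  proof -
    have "{q \<in> I. fst q = fst p \<and> snd p < snd q} = Pair (fst p) ` {snd p<..<sz (fst p)}"
      using that by (auto simp: I_def image_iff)
    then show ?thesis by (simp add: card_image inj_on_def)
  qed
  have c2: "card {p \<in> I. fst p = fst q \<and> snd p < snd q} = snd q" if "q \<in> I" for q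
  proof -
    have "{p \<in> I. fst p = fst q \<and> snd p < snd q} = Pair (fst q) ` {..<snd q}"
      using that by (auto simp: I_def image_iff)
    then show ?thesis by (simp add: card_image inj_on_def)
  qed
  have s1: "(\<Sum>(p, q)\<in>Rp. \<eta> p) = (\<Sum>p\<in>I. int (sz (fst p) - 1 - snd p) * \<eta> p)"
    unfolding R1 by (subst sum.Sigma[symmetric]) (auto simp: c1)
  have "(\<Sum>(p, q)\<in>Rp. \<eta> q) = (\<Sum>(q, p)\<in>(SIGMA q:I. {p \<in> I. fst p = fst q \<and> snd p < snd q}). \<eta> q)"
    by (rule sum.reindex_bij_witness[of _ prod.swap prod.swap]) (auto simp: Rp_def)
  also have "\<dots> = (\<Sum>q\<in>I. int (snd q) * \<eta> q)"
    by (subst sum.Sigma[symmetric]) (auto simp: c2)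
  finally have s2: "(\<Sum>(p, q)\<in>Rp. \<eta> q) = (\<Sum>q\<in>I. int (snd q) * \<eta> q)" .
  have "(\<Sum>(p, q)\<in>Rp. \<eta> p - \<eta> q) = (\<Sum>(p, q)\<in>Rp. \<eta> p) - (\<Sum>(p, q)\<in>Rp. \<eta> q)"
    unfolding sum_subtractf[symmetric] by (intro sum.cong) auto
  also have "\<dots> = (\<Sum>x\<in>I. \<eta> x * (int (sz (fst x)) - 1 - 2 * int (snd x)))"
    unfolding s1 s2 sum_subtractf[symmetric]
    by (intro sum.cong refl) (auto simp: I_def algebra_simps of_nat_diff)
  finally show ?thesis .
qed

text \<open>Raising \<open>f\<close> reaches a highest weight \<open>\<kappa>\<close> with the same
  Casimir eigenvalue, and \<open>\<kappa> - \<nu>\<close> is a nonnegative combination of positive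
  roots. Equality of eigenvalues makes it orthogonal to \<open>\<kappa> + \<nu> + 2 rho\<close>,
  which pairs strictly positively with every positive root; so all coefficients are zero.\<close>

lemma Casimir_kernel:
  assumes dom: "\<And>p q. (p, q) \<in> Rp \<Longrightarrow> \<nu> q \<le> \<nu> p" and S: "S \<subseteq> Rp"
    and f: "f \<in> V (\<lambda>x. \<nu> x + \<gamma> S x)" "f \<noteq> (\<lambda>_. 0)" "Cas f = (\<lambda>m. q0 \<nu> * f m)"
  shows "S = {} \<and> (\<forall>(p, q)\<in>Rp. E p q f = (\<lambda>_. 0))"
proof -
  obtain \<kappa> g n where g: "g \<in> V \<kappa>" "g \<noteq> (\<lambda>_. 0)" "Cas g = (\<lambda>m. q0 \<nu> * g m)" "\<forall>(p, q)\<in>Rp. E p q g = (\<lambda>_. 0)"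
     and \<kappa>: "\<And>x. \<kappa> x = \<nu> x + \<gamma> S x + (\<Sum>j\<in>Rp. int (n j) * rt (fst j) (snd j) x)"
     and n0: "(\<forall>j\<in>Rp. n j = (0::nat)) \<longrightarrow> (\<forall>(p, q)\<in>Rp. E p q f = (\<lambda>_. 0))"
    using highest_weight_exists[OF f] by blast
  \<comment> \<open>Multiplicity of a root in \<open>\<kappa> - \<nu>\<close>, counting both
    \<open>S\<close> and the raising steps.\<close>
  define k' where "k' = (\<lambda>j. int (n j) + of_bool (j \<in> S))"
  have k0: "k' j \<ge> 0" for j by (simp add: k'_def)
  define \<eta> where "\<eta> = (\<lambda>x. \<kappa> x - \<nu> x)"
  have \<eta>: "\<eta> x = (\<Sum>j\<in>Rp. k' j * rt (fst j) (snd j) x)" for x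
  proof -
    have "\<gamma> S x = (\<Sum>j\<in>Rp. of_bool (j \<in> S) * rt (fst j) (snd j) x)"
      unfolding \<gamma>_def case_prod_beta using S by (intro sum.mono_neutral_cong_left) auto
    then show ?thesis by (simp add: \<eta>_def \<kappa> k'_def distrib_right sum.distrib)
  qed
  have pair: "(\<Sum>x\<in>I. \<xi> x * \<eta> x) = (\<Sum>j\<in>Rp. k' j * (\<xi> (fst j) - \<xi> (snd j)))" for \<xi> :: "idx \<Rightarrow> int"
  proof -
    have "(\<Sum>x\<in>I. \<xi> x * \<eta> x) = (\<Sum>j\<in>Rp. k' j * (\<Sum>x\<in>I. \<xi> x * rt (fst j) (snd j) x))"
      unfolding \<eta> by (simp add: sum_distrib_left mult.left_commute) (rule sum.swap)
    also have "\<dots> = (\<Sum>j\<in>Rp. k' j * (\<xi> (fst j) - \<xi> (snd j)))"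
      by (intro sum.cong refl arg_cong[of _ _ "(*) _"] rt_pair) (auto simp: Rp_def)
    finally show ?thesis .
  qed
  have ldom: "\<kappa> q \<le> \<kappa> p" if "(p, q) \<in> Rp" for p q
    using highest_weight_dominant[OF g(1,2) that] g(4) that by auto
  obtain m where m: "g m \<noteq> 0" using g(2) by auto
  have "(\<Sum>(p, q)\<in>Rp. E q p (E p q g) m) = 0"
    using g(4) by (intro sum.neutral) (auto simp: lin_zero[OF lin_E])
  then have "q0 \<kappa> * g m = q0 \<nu> * g m" using Cas_V[OF g(1), of m] fun_cong[OF g(3), of m] by auto
  then have "q0 \<kappa> = q0 \<nu>" using m by simp
  then have q: "(\<Sum>p\<in>I. \<kappa> p * \<kappa> p) + (\<Sum>(p, q)\<in>Rp. \<kappa> p - \<kappa> q) = (\<Sum>p\<in>I. \<nu> p * \<nu> p) + (\<Sum>(p, q)\<in>Rp. \<nu> p - \<nu> q)"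
    unfolding q0_def using of_int_eq_iff by blast
  have "(\<Sum>p\<in>I. \<kappa> p * \<kappa> p) - (\<Sum>p\<in>I. \<nu> p * \<nu> p) = (\<Sum>x\<in>I. (\<kappa> x + \<nu> x) * \<eta> x)"
    unfolding sum_subtractf[symmetric] by (intro sum.cong) (auto simp: \<eta>_def algebra_simps)
  moreover have "(\<Sum>(p, q)\<in>Rp. \<kappa> p - \<kappa> q) - (\<Sum>(p, q)\<in>Rp. \<nu> p - \<nu> q) = (\<Sum>(p, q)\<in>Rp. \<eta> p - \<eta> q)"
    unfolding sum_subtractf[symmetric] by (intro sum.cong) (auto simp: \<eta>_def)
  ultimately have "(\<Sum>x\<in>I. (\<kappa> x + \<nu> x) * \<eta> x) + (\<Sum>x\<in>I. (int (sz (fst x)) - 1 - 2 * int (snd x)) * \<eta> x) = 0"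
    using q Rp_sum[of \<eta>] by (simp add: mult.commute)
  then have "(\<Sum>x\<in>I. (\<kappa> x + \<nu> x + (int (sz (fst x)) - 1 - 2 * int (snd x))) * \<eta> x) = 0"
    by (simp add: distrib_right sum.distrib)
  then have z: "(\<Sum>j\<in>Rp. k' j * ((\<kappa> (fst j) + \<nu> (fst j) + (int (sz (fst (fst j))) - 1 - 2 * int (snd (fst j))))
        - (\<kappa> (snd j) + \<nu> (snd j) + (int (sz (fst (snd j))) - 1 - 2 * int (snd (snd j)))))) = 0" (is "(\<Sum>j\<in>Rp. k' j * ?d j) = 0")
    by (simp only: pair)
  have d: "?d j > 0" if "j \<in> Rp" for j
    using ldom[of "fst j" "snd j"] dom[of "fst j" "snd j"] that by (cases j) (auto simp: Rp_def)
  have "\<forall>j\<in>Rp. k' j * ?d j = 0"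
  proof -
    have "0 \<le> k' j * ?d j" if "j \<in> Rp" for j
      using k0[of j] d[OF that] by (intro mult_nonneg_nonneg) (simp_all only: less_imp_le)
    then show ?thesis using z sum_nonneg_eq_0_iff[OF finite_Rp, of "\<lambda>j. k' j * ?d j"] by blast
  qed
  then have kz: "k' j = 0" if "j \<in> Rp" for j using d[OF that] that by fastforce
  have "n j = 0 \<and> j \<notin> S" if "j \<in> Rp" for j
    using kz[OF that] unfolding k'_def by (cases "j \<in> S") simp_all
  then show ?thesis using n0 S by auto
qed

lemma common_annihilator:
  assumes "finite T" "\<And>S. S \<in> T \<Longrightarrow> \<exists>R\<in>PU c. \<forall>f\<in>V (\<mu> S). R f = (\<lambda>_. 0)"
  shows "\<exists>R\<in>PU c. \<forall>S\<in>T. \<forall>f\<in>V (\<mu> S). R f = (\<lambda>_. 0)"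
  using assms
proof (induction T rule: finite_induct)
  case empty then show ?case using PU_id by auto
next
  case (insert S T)
  obtain R1 where R1: "R1 \<in> PU c" "\<And>f. f \<in> V (\<mu> S) \<Longrightarrow> R1 f = (\<lambda>_. 0)" using insert.prems[of S] by auto
  obtain R2 where R2: "R2 \<in> PU c" "\<And>S' f. S' \<in> T \<Longrightarrow> f \<in> V (\<mu> S') \<Longrightarrow> R2 f = (\<lambda>_. 0)"
    using insert.IH insert.prems by auto
  have PO: "R1 \<in> PO c" "R2 \<in> PO c" using R1 R2 by (auto simp: PU_def)
  have "R1 (R2 f) = (\<lambda>_. 0)" if "S' \<in> insert S T" "f \<in> V (\<mu> S')" for S' f
  proof (cases "S' = S")
    case True then show ?thesis using R1(2) PO_V[OF PO(2)] that by simp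
  next
    case False then show ?thesis using R2(2) that lin_zero[OF PO_lin[OF PO(1)]] by auto
  qed
  then show ?case using PU_comp[OF R1(1) R2(1)] by (intro bexI[of _ "\<lambda>f. R1 (R2 f)"]) auto
qed

text \<open>Elements of \<open>PU\<close> have the same signed trace as the identity. Without a
  highest weight vector one of them kills all weight spaces in the sum. With a highest weight vector
  \<open>f\<close>, one kills all of them except that of \<open>S = {}\<close>, where it fixes
  \<open>f\<close>, and self-adjointness makes the trace of its square positive.\<close>

theorem highest_weight_vector_iff:
  assumes weyl: "\<And>F :: (idx \<Rightarrow> int) \<Rightarrow> real. (\<Sum>S\<in>Pow Rp. (-1) ^ card S * (of_int (nrm S) * F (\<gamma> S))) = 0"
    and dom: "\<And>p q. (p, q) \<in> Rp \<Longrightarrow> \<nu> q \<le> \<nu> p"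
  shows "(\<Sum>S\<in>Pow Rp. (-1) ^ card S * real (card (Mon (\<lambda>x. \<nu> x + \<gamma> S x)))) \<noteq> 0 \<longleftrightarrow>
     (\<exists>f\<in>V \<nu>. f \<noteq> (\<lambda>_. 0) \<and> (\<forall>(p, q)\<in>Rp. E p q f = (\<lambda>_. 0)))"
proof -
  let ?c = "q0 \<nu>" and ?\<mu> = "\<lambda>S x. \<nu> x + \<gamma> S x"
  have g0: "?\<mu> {} = \<nu>" by (simp add: \<gamma>_def)
  have Qz: "Q ?c f = (\<lambda>_. 0) \<longleftrightarrow> Cas f = (\<lambda>m. ?c * f m)" for f by (auto simp: Q_def fun_eq_iff)
  have "tr \<mu> (\<lambda>f. f) = real (card (Mon \<mu>))" for \<mu> by (simp add: tr_def \<delta>m_def)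
  then have lhs: "(\<Sum>S\<in>Pow Rp. (-1) ^ card S * real (card (Mon (?\<mu> S)))) = signed_tr \<nu> (\<lambda>f. f)"
    by (simp add: signed_tr_def)
  have ann: "\<exists>R\<in>PU ?c. \<forall>f\<in>V (?\<mu> S). R f = (\<lambda>_. 0)"
    if "S \<subseteq> Rp" "S = {} \<longrightarrow> \<not> (\<exists>f\<in>V \<nu>. f \<noteq> (\<lambda>_. 0) \<and> (\<forall>(p, q)\<in>Rp. E p q f = (\<lambda>_. 0)))" for S
  proof (rule annihilating_polynomial, rule ccontr)
    fix f assume f: "f \<in> V (?\<mu> S)" "Q ?c f = (\<lambda>_. 0)" "f \<noteq> (\<lambda>_. 0)"
    have "S = {} \<and> (\<forall>(p, q)\<in>Rp. E p q f = (\<lambda>_. 0))"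
      by (rule Casimir_kernel[OF dom that(1) f(1,3)]) (use f(2) Qz in auto)
    then show False using that(2) f(1,3) g0 by auto
  qed
  show ?thesis
  proof (cases "\<exists>f\<in>V \<nu>. f \<noteq> (\<lambda>_. 0) \<and> (\<forall>(p, q)\<in>Rp. E p q f = (\<lambda>_. 0))")
    case False
    obtain R where R: "R \<in> PU ?c" "\<forall>S\<in>Pow Rp. \<forall>f\<in>V (?\<mu> S). R f = (\<lambda>_. 0)"
      using common_annihilator[of "Pow Rp" ?c ?\<mu>] ann False by auto
    have "tr (?\<mu> S) R = 0" if "S \<in> Pow Rp" for S
    proof -
      have "R (\<delta>m m) = (\<lambda>_. 0)" if "m \<in> Mon (?\<mu> S)" for m
        using R(2) \<open>S \<in> Pow Rp\<close> delta_in_V[OF that] by blast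
      then show ?thesis unfolding tr_def by (intro sum.neutral) auto
    qed
    then have "signed_tr \<nu> R = 0" unfolding signed_tr_def by (intro sum.neutral) auto
    then show ?thesis using signed_tr_PU[OF weyl R(1)] lhs False by simp
  next
    case True
    then obtain f where f: "f \<in> V \<nu>" "f \<noteq> (\<lambda>_. 0)" "\<forall>(p, q)\<in>Rp. E p q f = (\<lambda>_. 0)" by blast
    have "(\<Sum>(p, q)\<in>Rp. E q p (E p q f) m) = 0" for m
      using f(3) by (intro sum.neutral) (auto simp: lin_zero[OF lin_E])
    then have Qf: "Q ?c f = (\<lambda>_. 0)" unfolding Qz using Cas_V[OF f(1)] by auto
    obtain R where R: "R \<in> PU ?c" "\<forall>S\<in>Pow Rp - {{}}. \<forall>f\<in>V (?\<mu> S). R f = (\<lambda>_. 0)"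
      using common_annihilator[of "Pow Rp - {{}}" ?c ?\<mu>] ann by auto
    have RPO: "R \<in> PO ?c" using R by (simp add: PU_def)
    \<comment> \<open>Squaring matters: the trace of a nonzero self-adjoint operator may be zero,
      that of its square is not.\<close>
    define RR where "RR = (\<lambda>f. R (R f))"
    have RRU: "RR \<in> PU ?c" unfolding RR_def by (rule PU_comp[OF R(1) R(1)])
    have z: "tr (?\<mu> S) RR = 0" if S: "S \<in> Pow Rp - {{}}" for S
    proof -
      have "RR (\<delta>m m) = (\<lambda>_. 0)" if "m \<in> Mon (?\<mu> S)" for m
        using R(2) S PO_V[OF RPO delta_in_V[OF that]] unfolding RR_def by blast
      then show ?thesis unfolding tr_def by (intro sum.neutral) auto
    qed
    have "signed_tr \<nu> RR = (\<Sum>S\<in>{{}}. (-1) ^ card S * tr (?\<mu> S) RR)"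
      unfolding signed_tr_def using z by (intro sum.mono_neutral_right) auto
    then have st: "signed_tr \<nu> RR = tr \<nu> RR" using g0 by simp
    \<comment> \<open>Self-adjointness in matrix entries, up to the factorial weights; it turns the
      trace of the square into a sum of nonnegative terms.\<close>
    have sym: "mfact m * R (\<delta>m n) m = mfact n * R (\<delta>m m) n" if "m \<in> Mon \<nu>" "n \<in> Mon \<nu>" for m n
    proof -
      have e: "ip \<nu> h (\<delta>m j) = mfact j * h j" if "j \<in> Mon \<nu>" for h j
      proof -
        have "ip \<nu> h (\<delta>m j) = (\<Sum>m\<in>Mon \<nu>. if m = j then mfact j * h j else 0)"
          unfolding ip_def by (intro sum.cong) (auto simp: \<delta>m_def)
        then show ?thesis using that by simp
      qed
      have "mfact m * R (\<delta>m n) m = ip \<nu> (R (\<delta>m n)) (\<delta>m m)" using e that by simp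
      also have "\<dots> = ip \<nu> (R (\<delta>m m)) (\<delta>m n)" unfolding PO_ip[OF RPO, of \<nu> "\<delta>m n"] by (rule ip_sym)
      also have "\<dots> = mfact n * R (\<delta>m m) n" using e that by simp
      finally show ?thesis .
    qed
    have "tr \<nu> RR = (\<Sum>m\<in>Mon \<nu>. \<Sum>n\<in>Mon \<nu>. R (\<delta>m m) n * R (\<delta>m n) m)"
      unfolding tr_def RR_def by (intro sum.cong refl lin_expand PO_lin[OF RPO] PO_V[OF RPO] delta_in_V)
    also have "\<dots> = (\<Sum>m\<in>Mon \<nu>. \<Sum>n\<in>Mon \<nu>. mfact n / mfact m * (R (\<delta>m m) n)\<^sup>2)"
    proof (intro sum.cong refl)
      fix m n assume mn: "m \<in> Mon \<nu>" "n \<in> Mon \<nu>"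
      have "R (\<delta>m n) m = mfact n / mfact m * R (\<delta>m m) n"
        using sym[OF mn] mfact_pos[of m] by (simp add: field_simps)
      then show "R (\<delta>m m) n * R (\<delta>m n) m = mfact n / mfact m * (R (\<delta>m m) n)\<^sup>2"
        by (simp add: power2_eq_square)
    qed
    finally have trs: "tr \<nu> RR = (\<Sum>m\<in>Mon \<nu>. \<Sum>n\<in>Mon \<nu>. mfact n / mfact m * (R (\<delta>m m) n)\<^sup>2)" .
    have nn: "mfact n / mfact m * (R (\<delta>m m) n)\<^sup>2 \<ge> 0" for m n
      using mfact_pos[of m] mfact_pos[of n] by simp
    have "tr \<nu> RR \<noteq> 0"
    proof
      assume "tr \<nu> RR = 0"
      then have "\<forall>m\<in>Mon \<nu>. \<forall>n\<in>Mon \<nu>. mfact n / mfact m * (R (\<delta>m m) n)\<^sup>2 = 0"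
        unfolding trs using nn by (simp add: sum_nonneg_eq_0_iff sum_nonneg)
      then have "R (\<delta>m m) n = 0" if "m \<in> Mon \<nu>" "n \<in> Mon \<nu>" for m n
        using that mfact_pos[of m] mfact_pos[of n] by fastforce
      then have "R f n = 0" if "n \<in> Mon \<nu>" for n
        using that lin_expand[OF PO_lin[OF RPO] f(1)] by simp
      moreover have "R f = f" by (rule PU_fix[OF R(1) Qf])
      ultimately have "f = (\<lambda>_. 0)" using f(1) by (force simp: V_def)
      then show False using f(2) by blast
    qed
    then show ?thesis using signed_tr_PU[OF weyl RRU] st lhs True by simp
  qed
qed

end

section \<open>Maximising a highest weight vector on the sphere\<close>

text \<open>Grouping the monomials by the exponent of one variable gives a polynomial in that
  variable which vanishes identically, so each group vanishes as a function of the others.\<close>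

lemma polynomial_function_zero:
  fixes c :: "('e \<Rightarrow> nat) \<Rightarrow> real"
  assumes "finite A" "finite S" "\<And>m m'. m \<in> S \<Longrightarrow> m' \<in> S \<Longrightarrow> (\<And>e. e \<in> A \<Longrightarrow> m e = m' e) \<Longrightarrow> m = m'"
    and "\<And>x. (\<Sum>m\<in>S. c m * (\<Prod>e\<in>A. x e ^ m e)) = 0"
    and "m \<in> S"
  shows "c m = 0"
  using assms
proof (induction A arbitrary: S m rule: finite_induct)
  case empty
  have "m' = m" if "m' \<in> S" for m'
    by (rule empty.prems(2)[OF that empty.prems(4)]) simp
  then have "S = {m}" using empty.prems(4) by blast
  then show ?case using empty.prems(3)[of undefined] by simp
next
  case (insert a A)
  define S' where "S' = {m' \<in> S. m' a = m a}"
  have fS: "finite S" by fact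
  define D where "D = Max (insert (m a) ((\<lambda>m. m a) ` S))"
  have D: "m' a \<le> D" if "m' \<in> S" for m' using that fS by (simp add: D_def)
  show ?case
  proof (rule insert.IH[of S'])
    show "finite S'" using fS by (simp add: S'_def)
    show "m \<in> S'" using insert.prems by (simp add: S'_def)
    show "m1 = m2" if "m1 \<in> S'" "m2 \<in> S'" and eq: "\<And>e. e \<in> A \<Longrightarrow> m1 e = m2 e" for m1 m2
    proof (rule insert.prems(2))
      show "m1 \<in> S" "m2 \<in> S" using that by (auto simp: S'_def)
      show "m1 e = m2 e" if "e \<in> insert a A" for e
        using that eq \<open>m1 \<in> S'\<close> \<open>m2 \<in> S'\<close> by (auto simp: S'_def)
    qed
    show "(\<Sum>m\<in>S'. c m * (\<Prod>e\<in>A. x e ^ m e)) = 0" for x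
    proof -
      define b where "b = (\<lambda>d. \<Sum>m\<in>{m \<in> S. m a = d}. c m * (\<Prod>e\<in>A. x e ^ m e))"
      have "(\<Sum>d\<le>D. b d * t ^ d) = 0" for t
      proof -
        have "(\<Sum>d\<le>D. b d * t ^ d) = (\<Sum>d\<le>D. \<Sum>m\<in>{m \<in> S. m a = d}. c m * (t ^ m a * (\<Prod>e\<in>A. x e ^ m e)))"
          unfolding b_def sum_distrib_right by (intro sum.cong refl) (simp add: mult_ac)
        also have "\<dots> = (\<Sum>m\<in>S. c m * (t ^ m a * (\<Prod>e\<in>A. x e ^ m e)))"
          using fS D by (intro sum.group) auto
        also have "\<dots> = (\<Sum>m\<in>S. c m * (\<Prod>e\<in>insert a A. (x(a := t)) e ^ m e))"
        proof (intro sum.cong refl)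
          fix m' :: "'e \<Rightarrow> nat"
          have "(\<Prod>e\<in>A. (x(a := t)) e ^ m' e) = (\<Prod>e\<in>A. x e ^ m' e)"
            using insert.hyps by (intro prod.cong) auto
          then show "c m' * (t ^ m' a * (\<Prod>e\<in>A. x e ^ m' e)) = c m' * (\<Prod>e\<in>insert a A. (x(a := t)) e ^ m' e)"
            using insert.hyps by simp
        qed
        finally show ?thesis using insert.prems(3) by simp
      qed
      then have "\<forall>d\<le>D. b d = 0" using polyfun_eq_0[of b D] by blast
      then show ?thesis using D[OF insert.prems(4)] by (simp add: b_def S'_def)
    qed
  qed
qed

section \<open>Evaluation of polynomials and their derivatives\<close>

definition supp :: "(mon \<Rightarrow> real) \<Rightarrow> mon set" where "supp f = {m. f m \<noteq> 0}"

context tables begin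

definition mono_at :: "(idx \<times> idx \<Rightarrow> real) \<Rightarrow> mon \<Rightarrow> real" where "mono_at x m = (\<Prod>e\<in>vars. x e ^ m e)"

definition pev :: "(mon \<Rightarrow> real) \<Rightarrow> (idx \<times> idx \<Rightarrow> real) \<Rightarrow> real" where
  "pev f x = (\<Sum>m\<in>supp f. f m * mono_at x m)"

lemma pev_superset: "finite S \<Longrightarrow> supp f \<subseteq> S \<Longrightarrow> pev f x = (\<Sum>m\<in>S. f m * mono_at x m)"
  unfolding pev_def by (rule sum.mono_neutral_left) (auto simp: supp_def)

lemma mono_at_remove: "e \<in> vars \<Longrightarrow> mono_at x m = x e ^ m e * (\<Prod>g\<in>vars - {e}. x g ^ m g)"
  unfolding mono_at_def by (rule prod.remove) auto

lemma mono_at_upd: "e \<in> vars \<Longrightarrow> mono_at x (m(e := d)) = x e ^ d * (\<Prod>g\<in>vars - {e}. x g ^ m g)"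
proof -
  assume e: "e \<in> vars"
  have "(\<Prod>g\<in>vars - {e}. x g ^ (m(e := d)) g) = (\<Prod>g\<in>vars - {e}. x g ^ m g)"
    by (rule prod.cong) auto
  then show ?thesis unfolding mono_at_remove[OF e] by simp
qed

lemma mono_at_arg_upd: "e \<in> vars \<Longrightarrow> mono_at (x(e := t)) m = t ^ m e * (\<Prod>g\<in>vars - {e}. x g ^ m g)"
proof -
  assume e: "e \<in> vars"
  have "(\<Prod>g\<in>vars - {e}. (x(e := t)) g ^ m g) = (\<Prod>g\<in>vars - {e}. x g ^ m g)"
    by (rule prod.cong) auto
  then show ?thesis unfolding mono_at_remove[OF e] by simp
qed

lemma supp_mX: "supp (mX e h) = (\<lambda>m. m(e := m e + 1)) ` supp h"
proof (intro equalityI subsetI)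
  fix m assume "m \<in> supp (mX e h)"
  then have "m e \<noteq> 0" "m(e := m e - 1) \<in> supp h" by (auto simp: supp_def mX_def split: if_splits)
  moreover from this have "m = (m(e := m e - 1))(e := (m(e := m e - 1)) e + 1)" by auto
  ultimately show "m \<in> (\<lambda>m. m(e := m e + 1)) ` supp h" by blast
qed (auto simp: supp_def mX_def)

lemma inj_upd: "inj_on (\<lambda>m :: mon. m(e := m e + 1)) S"
proof (rule inj_onI)
  fix m m' :: mon assume eq: "m(e := m e + 1) = m'(e := m' e + 1)"
  show "m = m'"
  proof
    fix g show "m g = m' g" using fun_cong[OF eq, of g] by (cases "g = e") auto
  qed
qed

lemma pev_mX: "e \<in> vars \<Longrightarrow> pev (mX e h) x = x e * pev h x"
proof -
  assume e: "e \<in> vars"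
  have "pev (mX e h) x = (\<Sum>m\<in>supp h. mX e h (m(e := m e + 1)) * mono_at x (m(e := m e + 1)))"
    unfolding pev_def supp_mX sum.reindex[OF inj_upd] by simp
  also have "\<dots> = (\<Sum>m\<in>supp h. x e * (h m * mono_at x m))"
    by (intro sum.cong refl) (simp only: mono_at_upd[OF e] mono_at_remove[OF e, of x], simp add: mX_def)
  finally show ?thesis by (simp add: pev_def sum_distrib_left)
qed

lemma pev_dX:
  assumes e: "e \<in> vars" and f: "finite (supp f)"
  shows "pev (dX e f) x = (\<Sum>m\<in>supp f. f m * (real (m e) * x e ^ (m e - 1) * (\<Prod>g\<in>vars - {e}. x g ^ m g)))"
proof -
  have "(\<Sum>m\<in>supp f. f m * (real (m e) * x e ^ (m e - 1) * (\<Prod>g\<in>vars - {e}. x g ^ m g)))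
     = (\<Sum>m\<in>{m \<in> supp f. m e \<noteq> 0}. f m * (real (m e) * x e ^ (m e - 1) * (\<Prod>g\<in>vars - {e}. x g ^ m g)))"
    using f by (intro sum.mono_neutral_right) auto
  also have "\<dots> = pev (dX e f) x"
    unfolding pev_def
  proof (rule sum.reindex_bij_witness[of _ "\<lambda>n. n(e := n e + 1)" "\<lambda>m. m(e := m e - 1)"])
    fix m assume m: "m \<in> {m \<in> supp f. m e \<noteq> 0}"
    then show u: "(m(e := m e - 1))(e := (m(e := m e - 1)) e + 1) = m" by auto
    have d: "dX e f (m(e := m e - 1)) = real (m e) * f m" using m unfolding dX_def u by simp
    then show "m(e := m e - 1) \<in> supp (dX e f)" using m by (simp add: supp_def)
    show "dX e f (m(e := m e - 1)) * mono_at x (m(e := m e - 1)) = f m * (real (m e) * x e ^ (m e - 1) * (\<Prod>g\<in>vars - {e}. x g ^ m g))"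
      unfolding d mono_at_upd[OF e] by simp
  qed (auto simp: supp_def dX_def)
  finally show ?thesis ..
qed

lemma pev_sum:
  assumes J: "finite J" "\<And>j. j \<in> J \<Longrightarrow> finite (supp (f j))"
  shows "pev (\<lambda>m. \<Sum>j\<in>J. c j * f j m) x = (\<Sum>j\<in>J. c j * pev (f j) x)"
proof -
  define S where "S = (\<Union>j\<in>J. supp (f j))"
  have fS: "finite S" using J by (simp add: S_def)
  have "supp (\<lambda>m. \<Sum>j\<in>J. c j * f j m) \<subseteq> S"
  proof
    fix m assume "m \<in> supp (\<lambda>m. \<Sum>j\<in>J. c j * f j m)"
    then have "(\<Sum>j\<in>J. c j * f j m) \<noteq> 0" by (simp add: supp_def)
    then obtain j where "j \<in> J" "c j * f j m \<noteq> 0" by (rule sum.not_neutral_contains_not_neutral)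
    then show "m \<in> S" by (auto simp: S_def supp_def)
  qed
  then have "pev (\<lambda>m. \<Sum>j\<in>J. c j * f j m) x = (\<Sum>m\<in>S. (\<Sum>j\<in>J. c j * f j m) * mono_at x m)" by (rule pev_superset[OF fS])
  also have "\<dots> = (\<Sum>j\<in>J. c j * (\<Sum>m\<in>S. f j m * mono_at x m))"
    unfolding sum_distrib_left sum_distrib_right by (subst sum.swap) (simp add: mult_ac)
  also have "\<dots> = (\<Sum>j\<in>J. c j * pev (f j) x)"
  proof (rule sum.cong[OF refl])
    fix j assume "j \<in> J"
    then have "supp (f j) \<subseteq> S" by (auto simp: S_def)
    then show "c j * (\<Sum>m\<in>S. f j m * mono_at x m) = c j * pev (f j) x" using pev_superset[OF fS] by simp
  qed
  finally show ?thesis .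
qed

lemma finite_supp_dX: "finite (supp f) \<Longrightarrow> finite (supp (dX e f))"
proof -
  assume f: "finite (supp f)"
  have "(\<lambda>m. m(e := m e + 1)) ` supp (dX e f) \<subseteq> supp f" by (auto simp: supp_def dX_def)
  then have "finite ((\<lambda>m. m(e := m e + 1)) ` supp (dX e f))" using f finite_subset by blast
  then show ?thesis using finite_imageD[OF _ inj_upd] by blast
qed

lemma pev_E_hop:
  assumes f: "finite (supp f)"
  shows "pev (E p q f) x = (\<Sum>e'\<in>vars. \<Sum>e\<in>vars. hop p q e' e * (x e' * pev (dX e f) x))"
proof -
  have "E p q f = (\<lambda>m. \<Sum>j\<in>vars \<times> vars. hop p q (fst j) (snd j) * mX (fst j) (dX (snd j) f) m)"
    unfolding E_def G_def[abs_def] by (simp add: sum.cartesian_product case_prod_beta)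
  then have "pev (E p q f) x = (\<Sum>j\<in>vars \<times> vars. hop p q (fst j) (snd j) * pev (mX (fst j) (dX (snd j) f)) x)"
    using f by (simp only:) (rule pev_sum, auto simp: supp_mX finite_supp_dX)
  also have "\<dots> = (\<Sum>e'\<in>vars. \<Sum>e\<in>vars. hop p q e' e * pev (mX e' (dX e f)) x)"
    by (simp add: sum.cartesian_product case_prod_beta)
  also have "\<dots> = (\<Sum>e'\<in>vars. \<Sum>e\<in>vars. hop p q e' e * (x e' * pev (dX e f) x))"
    by (intro sum.cong refl) (simp add: pev_mX)
  finally show ?thesis .
qed

lemma pev_E:
  assumes pq: "(p, q) \<in> same" and f: "finite (supp f)"
  shows "pev (E p q f) x = (\<Sum>e\<in>vars. of_bool (fst e = p) * (x e * pev (dX (q, snd e) f) x) + of_bool (snd e = p) * (x e * pev (dX (fst e, q) f) x))"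
  unfolding pev_E_hop[OF f] by (rule sum.cong[OF refl]) (rule hop_sum[OF pq])

text \<open>\<open>E p q\<close> read as a vector field: it differentiates along the motion that
  adds a multiple of line \<open>p\<close> to line \<open>q\<close>.\<close>

lemma pev_E_direction:
  assumes pq: "(p, q) \<in> same" and f: "finite (supp f)"
  shows "pev (E p q f) x = (\<Sum>e\<in>vars. (of_bool (fst e = q) * x (p, snd e) + of_bool (snd e = q) * x (fst e, p)) * pev (dX e f) x)"
proof -
  have "pev (E p q f) x = (\<Sum>e\<in>vars. (\<Sum>e'\<in>vars. hop q p e e' * x e') * pev (dX e f) x)"
    unfolding pev_E_hop[OF f] sum_distrib_right
    by (subst sum.swap) (simp add: hop_transpose[of p q] mult.assoc)
  also have "\<dots> = (\<Sum>e\<in>vars. (of_bool (fst e = q) * x (p, snd e) + of_bool (snd e = q) * x (fst e, p)) * pev (dX e f) x)"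
    by (rule sum.cong[OF refl]) (simp only: hop_sum[OF same_sym[OF pq]])
  finally show ?thesis .
qed

lemma pev_line_derivative:
  assumes f: "finite (supp f)"
  shows "((\<lambda>t. pev f (\<lambda>e. x e + t * y e)) has_real_derivative (\<Sum>e\<in>vars. y e * pev (dX e f) x)) (at 0)"
proof -
  have "((\<lambda>t. \<Prod>e\<in>vars. (x e + t * y e) ^ m e) has_real_derivative
      (\<Sum>e\<in>vars. (real (m e) * x e ^ (m e - 1) * y e) * (\<Prod>g\<in>vars - {e}. (x g + 0 * y g) ^ m g))) (at 0)" for m
    by (rule has_field_derivative_prod) (auto intro!: derivative_eq_intros)
  then have "((\<lambda>t. \<Sum>m\<in>supp f. f m * (\<Prod>e\<in>vars. (x e + t * y e) ^ m e)) has_real_derivative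
      (\<Sum>m\<in>supp f. f m * (\<Sum>e\<in>vars. (real (m e) * x e ^ (m e - 1) * y e) * (\<Prod>g\<in>vars - {e}. (x g + 0 * y g) ^ m g)))) (at 0)"
    by (intro DERIV_sum DERIV_cmult)
  also have "(\<Sum>m\<in>supp f. f m * (\<Sum>e\<in>vars. (real (m e) * x e ^ (m e - 1) * y e) * (\<Prod>g\<in>vars - {e}. (x g + 0 * y g) ^ m g)))
     = (\<Sum>e\<in>vars. y e * (\<Sum>m\<in>supp f. f m * (real (m e) * x e ^ (m e - 1) * (\<Prod>g\<in>vars - {e}. x g ^ m g))))"
    unfolding sum_distrib_left by (subst sum.swap) (simp add: mult_ac)
  also have "\<dots> = (\<Sum>e\<in>vars. y e * pev (dX e f) x)"
    by (rule sum.cong[OF refl]) (simp only: pev_dX[OF _ f])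
  finally show ?thesis by (simp add: pev_def mono_at_def)
qed

lemma pev_zero_imp:
  assumes f: "finite (supp f)" "\<And>m e. f m \<noteq> 0 \<Longrightarrow> e \<notin> vars \<Longrightarrow> m e = 0" and z: "\<And>x. pev f x = 0"
  shows "f = (\<lambda>_. 0)"
proof
  fix m show "f m = 0"
  proof (cases "m \<in> supp f")
    case True
    show ?thesis
    proof (rule polynomial_function_zero[OF finite_vars f(1) _ _ True])
      show "m1 = m2" if "m1 \<in> supp f" "m2 \<in> supp f" "\<And>e. e \<in> vars \<Longrightarrow> m1 e = m2 e" for m1 m2
      proof
        fix e show "m1 e = m2 e" using that f(2)[of m1 e] f(2)[of m2 e] by (cases "e \<in> vars") (auto simp: supp_def)
      qed
      show "(\<Sum>m\<in>supp f. f m * (\<Prod>e\<in>vars. x e ^ m e)) = 0" for x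
        using z[of x] by (simp add: pev_def mono_at_def)
    qed
  qed (simp add: supp_def)
qed

lemma V_supp: "f \<in> V \<mu> \<Longrightarrow> supp f \<subseteq> Mon \<mu>"
  by (auto simp: V_def supp_def)

lemma V_finite_supp: "f \<in> V \<mu> \<Longrightarrow> finite (supp f)"
  using V_supp finite_subset[OF _ finite_Mon] by blast

lemma V_vars: "f \<in> V \<mu> \<Longrightarrow> f m \<noteq> 0 \<Longrightarrow> e \<notin> vars \<Longrightarrow> m e = 0"
  unfolding V_def Mon_def by blast

text \<open>For two rows, or two columns of one block, this is their inner product.\<close>

definition gram :: "(idx \<times> idx \<Rightarrow> real) \<Rightarrow> idx \<Rightarrow> idx \<Rightarrow> real" where
  "gram x p q = (\<Sum>e\<in>vars. of_bool (fst e = p) * (x e * x (q, snd e)) + of_bool (snd e = p) * (x e * x (fst e, q)))"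

lemma gram_sym: assumes pq: "(p, q) \<in> same" shows "gram x p q = gram x q p"
proof -
  have "gram x p q = (\<Sum>e'\<in>vars. \<Sum>e\<in>vars. hop p q e' e * (x e' * x e))" if "(p, q) \<in> same" for p q
    unfolding gram_def by (rule sum.cong[OF refl]) (rule hop_sum[OF that, symmetric])
  from this[OF pq] this[OF same_sym[OF pq]] show ?thesis
    using hop_transpose[of p q] by (subst (asm) (2) sum.swap) (simp add: mult_ac)
qed

section \<open>The maximum on the unit sphere\<close>

lemma continuous_pev: "continuous_on UNIV (pev f)"
  unfolding pev_def mono_at_def by (intro continuous_intros continuous_on_product_coordinates)

text \<open>The points are functions on all pairs of indices; coordinates outside
  \<open>vars\<close> are fixed at zero to obtain compactness in the product topology.\<close>

lemma sphere_compact: "compact {x. (\<forall>e. e \<notin> vars \<longrightarrow> x e = 0) \<and> (\<Sum>e\<in>vars. (x e)\<^sup>2) = (1::real)}"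
proof -
  define B where "B = (\<lambda>e. if e \<in> vars then {-1..1} else {0::real})"
  have "compactin (product_topology (\<lambda>_. euclidean) UNIV) (PiE UNIV B)"
    unfolding compactin_PiE by (auto simp: B_def)
  then have c: "compact (PiE UNIV B)" by (simp add: euclidean_product_topology)
  have "closed ((\<lambda>x. \<Sum>e\<in>vars. (x e)\<^sup>2) -` {1::real})"
    by (intro closed_vimage closed_singleton continuous_intros continuous_on_product_coordinates)
  then have "compact (PiE UNIV B \<inter> (\<lambda>x. \<Sum>e\<in>vars. (x e)\<^sup>2) -` {1})" by (rule compact_Int_closed[OF c])
  moreover have "{x. (\<forall>e. e \<notin> vars \<longrightarrow> x e = 0) \<and> (\<Sum>e\<in>vars. (x e)\<^sup>2) = (1::real)} = PiE UNIV B \<inter> (\<lambda>x. \<Sum>e\<in>vars. (x e)\<^sup>2) -` {1}"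
  proof (intro equalityI subsetI)
    fix x assume x: "x \<in> {x. (\<forall>e. e \<notin> vars \<longrightarrow> x e = 0) \<and> (\<Sum>e\<in>vars. (x e)\<^sup>2) = (1::real)}"
    have "x e \<in> B e" for e
    proof (cases "e \<in> vars")
      case True
      then have "(x e)\<^sup>2 \<le> (\<Sum>e\<in>vars. (x e)\<^sup>2)" by (intro member_le_sum) auto
      then have "\<bar>x e\<bar> \<le> 1" using x by (simp add: abs_square_le_1)
      then show ?thesis using True by (auto simp: B_def)
    next
      case False
      moreover have "x e = 0" using x False by blast
      ultimately show ?thesis by (simp add: B_def)
    qed
    then show "x \<in> PiE UNIV B \<inter> (\<lambda>x. \<Sum>e\<in>vars. (x e)\<^sup>2) -` {1}" using x by auto
  next
    fix x assume x: "x \<in> PiE UNIV B \<inter> (\<lambda>x. \<Sum>e\<in>vars. (x e)\<^sup>2) -` {1::real}"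
    then have "x e \<in> B e" for e by auto
    then have "x e = 0" if "e \<notin> vars" for e using that by (metis B_def singletonD)
    then show "x \<in> {x. (\<forall>e. e \<notin> vars \<longrightarrow> x e = 0) \<and> (\<Sum>e\<in>vars. (x e)\<^sup>2) = (1::real)}" using x by auto
  qed
  ultimately show ?thesis by simp
qed

lemma pev_scale:
  assumes f: "f \<in> V \<mu>" and D: "\<And>m. m \<in> Mon \<mu> \<Longrightarrow> (\<Sum>e\<in>vars. m e) = D"
    and y: "\<And>e. e \<in> vars \<Longrightarrow> y e = t * x e"
  shows "pev f y = t ^ D * pev f x"
proof -
  have "mono_at y m = t ^ D * mono_at x m" if "m \<in> supp f" for m
  proof -
    have "mono_at y m = (\<Prod>e\<in>vars. t ^ m e * x e ^ m e)"
      unfolding mono_at_def by (intro prod.cong refl) (simp add: y power_mult_distrib)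
    then show ?thesis using D[of m] V_supp[OF f] that by (auto simp: prod.distrib mono_at_def simp flip: power_sum)
  qed
  then show ?thesis unfolding pev_def sum_distrib_left by (intro sum.cong) auto
qed

text \<open>The maximum on the sphere extends by homogeneity to an inequality at all points, free of
  any constraint.\<close>

lemma pev_maximum:
  assumes f: "f \<in> V \<mu>" "f \<noteq> (\<lambda>_. 0)" and D: "\<And>m. m \<in> Mon \<mu> \<Longrightarrow> (\<Sum>e\<in>vars. m e) = D" "D > 0"
  shows "\<exists>z. (\<Sum>e\<in>vars. (z e)\<^sup>2) = 1 \<and> pev f z \<noteq> 0 \<and> (\<forall>x. (pev f x)\<^sup>2 \<le> (pev f z)\<^sup>2 * (\<Sum>e\<in>vars. (x e)\<^sup>2) ^ D)"
proof -
  define K where "K = {x. (\<forall>e. e \<notin> vars \<longrightarrow> x e = 0) \<and> (\<Sum>e\<in>vars. (x e)\<^sup>2) = (1::real)}"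
  have norm: "\<exists>y\<in>K. pev f x = sqrt (\<Sum>e\<in>vars. (x e)\<^sup>2) ^ D * pev f y" if s: "(\<Sum>e\<in>vars. (x e)\<^sup>2) \<noteq> 0" for x
  proof -
    define s where "s = sqrt (\<Sum>e\<in>vars. (x e)\<^sup>2)"
    have s2: "s\<^sup>2 = (\<Sum>e\<in>vars. (x e)\<^sup>2)" by (simp add: s_def sum_nonneg)
    have s0: "s \<noteq> 0" using s by (simp add: s_def)
    define y where "y = (\<lambda>e. if e \<in> vars then x e / s else 0)"
    have "(\<Sum>e\<in>vars. (y e)\<^sup>2) = (\<Sum>e\<in>vars. (x e)\<^sup>2) / s\<^sup>2"
      unfolding sum_divide_distrib by (intro sum.cong refl) (simp add: y_def power_divide)
    then have "y \<in> K" using s0 by (simp add: K_def y_def flip: s2)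
    moreover have "pev f x = s ^ D * pev f y"
      using s0 by (intro pev_scale[OF f(1) D(1)]) (auto simp: y_def)
    ultimately show ?thesis unfolding s_def by blast
  qed
  have zero: "pev f x = 0" if s: "(\<Sum>e\<in>vars. (x e)\<^sup>2) = 0" for x
  proof -
    have "\<forall>e\<in>vars. (x e)\<^sup>2 = 0" using s by (subst (asm) sum_nonneg_eq_0_iff) auto
    then have "pev f x = 0 ^ D * pev f x" by (intro pev_scale[OF f(1) D(1)]) auto
    then show ?thesis using D(2) by (simp add: power_0_left)
  qed
  obtain x1 where x1: "pev f x1 \<noteq> 0"
    using pev_zero_imp[of f, OF V_finite_supp[OF f(1)]] V_vars[OF f(1)] f(2) by blast
  then have "(\<Sum>e\<in>vars. (x1 e)\<^sup>2) \<noteq> 0" using zero by blast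
  from norm[OF this] obtain y1 where y1: "y1 \<in> K" "pev f y1 \<noteq> 0" using x1 by auto
  have "continuous_on K (\<lambda>x. (pev f x)\<^sup>2)"
    by (intro continuous_intros continuous_on_subset[OF continuous_pev]) auto
  then obtain z where z: "z \<in> K" "\<And>y. y \<in> K \<Longrightarrow> (pev f y)\<^sup>2 \<le> (pev f z)\<^sup>2"
    using continuous_attains_sup[of K "\<lambda>x. (pev f x)\<^sup>2"] sphere_compact y1(1) unfolding K_def[symmetric] by blast
  have "pev f z \<noteq> 0"
  proof
    assume "pev f z = 0"
    then have "(pev f y1)\<^sup>2 \<le> 0" using z(2)[OF y1(1)] by simp
    then show False using y1(2) by simp
  qed
  moreover have "(pev f x)\<^sup>2 \<le> (pev f z)\<^sup>2 * (\<Sum>e\<in>vars. (x e)\<^sup>2) ^ D" for x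
  proof (cases "(\<Sum>e\<in>vars. (x e)\<^sup>2) = 0")
    case True then show ?thesis using zero by simp
  next
    case False
    then obtain y where y: "y \<in> K" "pev f x = sqrt (\<Sum>e\<in>vars. (x e)\<^sup>2) ^ D * pev f y" using norm by blast
    have "(pev f x)\<^sup>2 = (\<Sum>e\<in>vars. (x e)\<^sup>2) ^ D * (pev f y)\<^sup>2"
      unfolding y(2) power_mult_distrib by (subst power_mult[symmetric], subst mult.commute, subst power_mult) (simp add: sum_nonneg)
    also have "\<dots> \<le> (\<Sum>e\<in>vars. (x e)\<^sup>2) ^ D * (pev f z)\<^sup>2"
      using z(2)[OF y(1)] by (intro mult_left_mono zero_le_power sum_nonneg zero_le_power2)
    finally show ?thesis by (simp add: mult.commute)
  qed
  ultimately show ?thesis using z(1) by (auto simp: K_def)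
qed

text \<open>By the homogeneous inequality the function \<open>h\<close> of a single coordinate has
  an unconstrained maximum at \<open>z e\<close>; its vanishing derivative replaces a Lagrange
  multiplier.\<close>

lemma pev_gradient:
  assumes f: "f \<in> V \<mu>" and z: "(\<Sum>e\<in>vars. (z e)\<^sup>2) = 1" "pev f z \<noteq> 0"
    and max: "\<And>x. (pev f x)\<^sup>2 \<le> (pev f z)\<^sup>2 * (\<Sum>e\<in>vars. (x e)\<^sup>2) ^ D" and e: "e \<in> vars"
  shows "pev (dX e f) z = real D * pev f z * z e"
proof -
  define c where "c = (\<Sum>g\<in>vars - {e}. (z g)\<^sup>2)"
  have sq: "(\<Sum>g\<in>vars. ((z(e := t)) g)\<^sup>2) = t\<^sup>2 + c" for t
  proof -
    have "(\<Sum>g\<in>vars - {e}. ((z(e := t)) g)\<^sup>2) = c" unfolding c_def by (rule sum.cong) auto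
    then show ?thesis using sum.remove[OF finite_vars e, of "\<lambda>g. ((z(e := t)) g)\<^sup>2"] by simp
  qed
  have c1: "(z e)\<^sup>2 + c = 1" using sq[of "z e"] z(1) by simp
  define h where "h = (\<lambda>t. (pev f (z(e := t)))\<^sup>2 - (pev f z)\<^sup>2 * (t\<^sup>2 + c) ^ D)"
  have pd: "((\<lambda>t. pev f (z(e := t))) has_real_derivative pev (dX e f) z) (at (z e))"
    unfolding pev_def[of f] mono_at_arg_upd[OF e] pev_dX[OF e V_finite_supp[OF f]]
    by (auto intro!: derivative_eq_intros sum.cong simp: mult_ac)
  have "(h has_real_derivative (2 * pev f z * pev (dX e f) z - (pev f z)\<^sup>2 * (real D * ((z e)\<^sup>2 + c) ^ (D - 1) * (2 * z e)))) (at (z e))"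
    unfolding h_def by (auto intro!: derivative_eq_intros pd simp: power2_eq_square)
  then have "2 * pev f z * pev (dX e f) z - (pev f z)\<^sup>2 * (real D * ((z e)\<^sup>2 + c) ^ (D - 1) * (2 * z e)) = 0"
  proof (rule DERIV_local_max[of _ _ _ 1])
    show "\<forall>t. \<bar>z e - t\<bar> < 1 \<longrightarrow> h t \<le> h (z e)"
      using max[of "z(e := _)"] c1 unfolding h_def sq by simp
  qed simp
  then have "pev f z * (pev (dX e f) z - real D * pev f z * z e) = 0"
    unfolding c1 by (simp add: power2_eq_square algebra_simps)
  then show ?thesis using z(2) by simp
qed

text \<open>Since the gradient at \<open>z\<close> is \<open>D F(z) z\<close>, the value of
  \<open>E p q F\<close> at \<open>z\<close> is \<open>D F(z)\<close> times the Gram entry. Raising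
  operators make the entries on one side of the diagonal zero, symmetry the others, and the diagonal
  is read off from the weight.\<close>

theorem highest_weight_critical_point:
  assumes f: "f \<in> V \<nu>" "f \<noteq> (\<lambda>_. 0)" and hw: "\<And>p q. (p, q) \<in> Rp \<Longrightarrow> E p q f = (\<lambda>_. 0)"
    and D: "\<And>m. m \<in> Mon \<nu> \<Longrightarrow> (\<Sum>e\<in>vars. m e) = D" "D > 0"
  shows "\<exists>x. \<forall>p q. (p, q) \<in> same \<longrightarrow> gram x p q = of_bool (p = q) * of_int (\<nu> p) / real D"
proof -
  obtain z where z: "(\<Sum>e\<in>vars. (z e)\<^sup>2) = 1" "pev f z \<noteq> 0" "\<And>x. (pev f x)\<^sup>2 \<le> (pev f z)\<^sup>2 * (\<Sum>e\<in>vars. (x e)\<^sup>2) ^ D"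
    using pev_maximum[OF f D] by blast
  note grad = pev_gradient[OF f(1) z]
  have E: "pev (E p q f) z = real D * pev f z * gram z p q" if pq: "(p, q) \<in> same" for p q
  proof -
    have "pev (E p q f) z = (\<Sum>e\<in>vars. real D * pev f z * (of_bool (fst e = p) * (z e * z (q, snd e)) + of_bool (snd e = p) * (z e * z (fst e, q))))"
      unfolding pev_E[OF pq V_finite_supp[OF f(1)]]
    proof (rule sum.cong[OF refl])
      fix e assume e: "e \<in> vars"
      have "of_bool (fst e = p) * (z e * pev (dX (q, snd e) f) z) = of_bool (fst e = p) * (z e * (real D * pev f z * z (q, snd e)))"
      proof (cases "fst e = p")
        case True
        then have "(q, snd e) \<in> vars" using e pq by (auto simp: vars_def same_def)
        then show ?thesis by (simp add: grad)
      qed simp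
      moreover have "of_bool (snd e = p) * (z e * pev (dX (fst e, q) f) z) = of_bool (snd e = p) * (z e * (real D * pev f z * z (fst e, q)))"
      proof (cases "snd e = p")
        case True
        then have "(fst e, q) \<in> vars" using e pq by (auto simp: vars_def same_def)
        then show ?thesis by (simp add: grad)
      qed simp
      ultimately show "of_bool (fst e = p) * (z e * pev (dX (q, snd e) f) z) + of_bool (snd e = p) * (z e * pev (dX (fst e, q) f) z)
         = real D * pev f z * (of_bool (fst e = p) * (z e * z (q, snd e)) + of_bool (snd e = p) * (z e * z (fst e, q)))"
        by (simp only: distrib_left mult_ac)
    qed
    then show ?thesis by (simp add: gram_def sum_distrib_left)
  qed
  have up: "gram z p q = 0" if "(p, q) \<in> Rp" for p q
  proof -
    have "pev (E p q f) z = 0" unfolding hw[OF that] by (simp add: pev_def supp_def)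
    then show ?thesis using E[OF Rp_same[OF that]] D(2) z(2) by simp
  qed
  have dia: "gram z p p = of_int (\<nu> p) / real D" if p: "p \<in> I" for p
  proof -
    have s: "(p, p) \<in> same" using p by (simp add: same_def)
    have "E p p f = (\<lambda>m. of_int (\<nu> p) * f m)" using E_diag_V[OF p f(1)] by (simp add: fun_eq_iff)
    then have "pev (E p p f) z = of_int (\<nu> p) * pev f z"
      using pev_superset[OF V_finite_supp[OF f(1)], of "\<lambda>m. of_int (\<nu> p) * f m" z]
      by (simp add: pev_def[of f] sum_distrib_left mult.assoc supp_def Collect_mono)
    then have "real D * gram z p p = of_int (\<nu> p)" using E[OF s] z(2) by simp
    then show ?thesis using D(2) by (simp add: field_simps)
  qed
  have "gram z p q = of_bool (p = q) * of_int (\<nu> p) / real D" if pq: "(p, q) \<in> same" for p q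
  proof -
    consider "p = q" | "(p, q) \<in> Rp" | "(q, p) \<in> Rp" using pq by (cases p, cases q) (auto simp: same_def Rp_def, fastforce)
    then show ?thesis
    proof cases
      case 1 then show ?thesis using dia pq by (simp add: same_def)
    next
      case 2 then show ?thesis using up[OF 2] by (auto simp: Rp_def)
    next
      case 3 then show ?thesis using up[OF 3] gram_sym[OF pq, of z] by (auto simp: Rp_def)
    qed
  qed
  then show ?thesis by blast
qed

end

section \<open>Schur polynomials: bialternants and Jacobi--Trudi\<close>

text \<open>The Leibniz determinant on plain functions of two indices, so that truncation and
  reindexing need no matrix type.\<close>

definition adet :: "nat \<Rightarrow> (nat \<Rightarrow> nat \<Rightarrow> 'a) \<Rightarrow> 'a :: comm_ring_1" where
  "adet n A = (\<Sum>p | p permutes {..<n}. of_int (sign p) * (\<Prod>i<n. A i (p i)))"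

lemma adet_eq_det: "adet n A = Determinant.det (Matrix.mat n n (\<lambda>(i, j). A i j))"
  unfolding adet_def Determinant.det_def'[OF mat_carrier]
  by (intro sum.cong refl arg_cong2[of _ _ _ _ "(*)"] prod.cong)
     (auto simp: atLeast0LessThan sign_def permutes_in_image)

lemma adet_cong: "(\<And>i j. i < n \<Longrightarrow> j < n \<Longrightarrow> A i j = B i j) \<Longrightarrow> adet n A = adet n B"
  unfolding adet_def
  by (intro sum.cong refl arg_cong2[of _ _ _ _ "(*)"] prod.cong) (auto dest: permutes_in_image)

lemma adet_0 [simp]: "adet 0 A = 1"
  unfolding adet_def by simp

lemma adet_mult:
  "adet n (\<lambda>i j. \<Sum>k<n. A i k * B k j) = adet n A * adet n B"
proof -
  have "Matrix.mat n n (\<lambda>(i, j). \<Sum>k<n. A i k * B k j)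
      = Matrix.mat n n (\<lambda>(i, j). A i j) * Matrix.mat n n (\<lambda>(i, j). B i j)"
    by (rule eq_matI) (auto simp: scalar_prod_def atLeast0LessThan intro!: sum.cong)
  then show ?thesis unfolding adet_eq_det by (simp add: Determinant.det_mult[of _ n])
qed

lemma adet_upper_triangular:
  assumes "\<And>i j. j < i \<Longrightarrow> i < n \<Longrightarrow> U i j = 0"
  shows "adet n U = (\<Prod>i<n. U i i)"
proof -
  have "Determinant.det (Matrix.mat n n (\<lambda>(i, j). U i j)) = prod_list (diag_mat (Matrix.mat n n (\<lambda>(i, j). U i j)))"
    by (rule Determinant.det_upper_triangular[of _ n]) (use assms in \<open>auto simp: upper_triangular_def\<close>)
  also have "diag_mat (Matrix.mat n n (\<lambda>(i, j). U i j)) = map (\<lambda>i. U i i) [0..<n]"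
    by (auto simp: diag_mat_def)
  finally show ?thesis by (simp add: adet_eq_det prod.distinct_set_conv_list[symmetric] atLeast0LessThan)
qed

text \<open>Left multiplication by an upper unitriangular matrix.\<close>

lemma adet_row_op:
  "adet n (\<lambda>i j. if Suc i < n then A i j - c i * A (Suc i) j else A i j) = adet n A"
proof -
  define U where "U = (\<lambda>i k. if k = i then 1 else if k = Suc i then - c i else (0::'a))"
  have "adet n (\<lambda>i j. if Suc i < n then A i j - c i * A (Suc i) j else A i j) = adet n (\<lambda>i j. \<Sum>k<n. U i k * A k j)"
  proof (rule adet_cong)
    fix i j assume i: "i < n" "j < n"
    have "(\<Sum>k<n. U i k * A k j) = (\<Sum>k<n. (if k = i then A i j else 0) + (if k = Suc i then - c i * A (Suc i) j else 0))"
      by (intro sum.cong) (auto simp: U_def)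
    then show "(if Suc i < n then A i j - c i * A (Suc i) j else A i j) = (\<Sum>k<n. U i k * A k j)"
      using i by (simp add: sum.distrib)
  qed
  also have "\<dots> = adet n U * adet n A" by (rule adet_mult)
  also have "adet n U = 1" by (subst adet_upper_triangular) (auto simp: U_def)
  finally show ?thesis by simp
qed

lemma adet_rows_sum:
  assumes "\<And>i. i < n \<Longrightarrow> finite (T i)"
  shows "adet n (\<lambda>i j. \<Sum>t\<in>T i. g i t j) = (\<Sum>\<tau>\<in>PiE {..<n} T. adet n (\<lambda>i j. g i (\<tau> i) j))"
proof -
  have "adet n (\<lambda>i j. \<Sum>t\<in>T i. g i t j) = (\<Sum>p | p permutes {..<n}. \<Sum>\<tau>\<in>PiE {..<n} T. of_int (sign p) * (\<Prod>i<n. g i (\<tau> i) (p i)))"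
  proof -
    have "(\<Prod>i<n. \<Sum>t\<in>T i. g i t (p i)) = (\<Sum>\<tau>\<in>PiE {..<n} T. \<Prod>i<n. g i (\<tau> i) (p i))" for p
      by (rule prod_sum_PiE) (use assms in auto)
    then show ?thesis unfolding adet_def by (simp add: sum_distrib_left)
  qed
  also have "\<dots> = (\<Sum>\<tau>\<in>PiE {..<n} T. adet n (\<lambda>i j. g i (\<tau> i) j))"
    unfolding adet_def by (rule sum.swap)
  finally show ?thesis .
qed

lemma adet_scale_rows: "adet n (\<lambda>i j. c i * A i j) = (\<Prod>i<n. c i) * adet n A"
  unfolding adet_def by (simp add: prod.distrib sum_distrib_left mult_ac)

lemma adet_scale_cols: "adet n (\<lambda>i j. c j * A i j) = (\<Prod>j<n. c j) * adet n A"
proof -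
  have "(\<Prod>i<n. c (p i)) = (\<Prod>j<n. c j)" if "p permutes {..<n}" for p
    using prod.permute[OF that, of c] by (simp add: o_def)
  then show ?thesis unfolding adet_def by (simp add: prod.distrib sum_distrib_left mult_ac)
qed

lemma adet_permute_rows:
  assumes "p permutes {..<n}"
  shows "adet n (\<lambda>i j. A (p i) j) = of_int (sign p) * adet n A"
proof -
  have "Determinant.det (Matrix.mat n n (\<lambda>(i, j). Matrix.mat n n (\<lambda>(i, j). A i j) $$ (p i, j))) = signof p * Determinant.det (Matrix.mat n n (\<lambda>(i, j). A i j))"
    by (rule Determinant.det_permute_rows) (use assms in \<open>auto simp: atLeast0LessThan\<close>)
  moreover have "Matrix.mat n n (\<lambda>(i, j). Matrix.mat n n (\<lambda>(i, j). A i j) $$ (p i, j)) = Matrix.mat n n (\<lambda>(i, j). A (p i) j)"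
    using permutes_in_image[OF assms] by (intro eq_matI) auto
  ultimately show ?thesis by (simp add: adet_eq_det sign_def)
qed

lemma adet_last_column:
  assumes "\<And>i. i < n \<Longrightarrow> A i n = 0"
  shows "adet (Suc n) A = A n n * adet n A"
proof -
  let ?M = "Matrix.mat (Suc n) (Suc n) (\<lambda>(i, j). A i j)"
  have "adet (Suc n) A = (\<Sum>i<Suc n. ?M $$ (i, n) * cofactor ?M i n)"
    unfolding adet_eq_det by (rule laplace_expansion_column) auto
  also have "\<dots> = A n n * cofactor ?M n n" using assms by simp
  also have "cofactor ?M n n = adet n A"
  proof -
    have "mat_delete ?M n n = Matrix.mat n n (\<lambda>(i, j). A i j)" unfolding mat_delete_def by (rule eq_matI) auto
    then show ?thesis by (simp add: cofactor_def adet_eq_det)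
  qed
  finally show ?thesis .
qed

section \<open>Branching of alternants and of Jacobi-Trudi determinants\<close>

definition alternant :: "nat \<Rightarrow> (nat \<Rightarrow> 'a) \<Rightarrow> (nat \<Rightarrow> nat) \<Rightarrow> 'a :: comm_ring_1" where
  "alternant n x k = adet n (\<lambda>i j. x j ^ k i)"

lemma geometric_strip:
  fixes a b :: "'a :: comm_ring_1"
  assumes "l \<le> k"
  shows "a ^ k - b ^ (k - l) * a ^ l = (a - b) * (\<Sum>t\<in>{l..<k}. b ^ (k - 1 - t) * a ^ t)"
proof -
  have eq: "(\<Sum>t<k - l. a ^ l * (b ^ (k - l - Suc t) * a ^ t)) = (\<Sum>t\<in>{l..<k}. b ^ (k - 1 - t) * a ^ t)"
    by (rule sum.reindex_bij_witness[of _ "\<lambda>t. t - l" "\<lambda>t. t + l"]) (auto simp: power_add mult_ac add.commute)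
  have "a ^ k = a ^ l * a ^ (k - l)" using assms by (simp flip: power_add)
  then have "a ^ k - b ^ (k - l) * a ^ l = a ^ l * (a ^ (k - l) - b ^ (k - l))" by (simp add: algebra_simps)
  also have "a ^ (k - l) - b ^ (k - l) = (a - b) * (\<Sum>t<k - l. b ^ (k - l - Suc t) * a ^ t)"
    by (rule power_diff_sumr2)
  finally show ?thesis unfolding eq[symmetric] by (simp add: sum_distrib_left mult_ac)
qed

text \<open>Subtracting \<open>x n ^ (k i - k (Suc i))\<close> times the next row clears the last
  column except at the bottom. The remaining entries are \<open>x j - x n\<close> times geometric
  sums, and multilinearity in the rows picks one exponent from each gap.\<close>

lemma alternant_branch:
  assumes "\<And>i. i < n \<Longrightarrow> k (Suc i) \<le> k i"
  shows "alternant (Suc n) x k = x n ^ k n * (\<Prod>j<n. x j - x n) *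
     (\<Sum>\<tau>\<in>PiE {..<n} (\<lambda>i. {k (Suc i)..<k i}). (\<Prod>i<n. x n ^ (k i - 1 - \<tau> i)) * alternant n x \<tau>)"
proof -
  define A where "A = (\<lambda>i j. if Suc i < Suc n then x j ^ k i - x n ^ (k i - k (Suc i)) * x j ^ k (Suc i) else x j ^ k i)"
  have "alternant (Suc n) x k = adet (Suc n) A"
    unfolding alternant_def A_def by (rule adet_row_op[symmetric])
  also have "\<dots> = A n n * adet n A"
    using assms by (intro adet_last_column) (auto simp: A_def simp flip: power_add)
  also have "A n n = x n ^ k n" by (simp add: A_def)
  also have "adet n A = adet n (\<lambda>i j. (x j - x n) * (\<Sum>t\<in>{k (Suc i)..<k i}. x n ^ (k i - 1 - t) * x j ^ t))"
    using assms by (intro adet_cong) (auto simp: A_def geometric_strip)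
  also have "\<dots> = (\<Prod>j<n. x j - x n) * (\<Sum>\<tau>\<in>PiE {..<n} (\<lambda>i. {k (Suc i)..<k i}). adet n (\<lambda>i j. x n ^ (k i - 1 - \<tau> i) * x j ^ \<tau> i))"
    unfolding adet_scale_cols by (subst adet_rows_sum) auto
  finally show ?thesis by (simp add: adet_scale_rows alternant_def mult.assoc)
qed

lemma alternant_cong: "(\<And>i. i < n \<Longrightarrow> k i = k' i) \<Longrightarrow> alternant n x k = alternant n x k'"
  unfolding alternant_def by (intro adet_cong) auto

definition vdm :: "nat \<Rightarrow> (nat \<Rightarrow> 'a) \<Rightarrow> 'a :: comm_ring_1" where
  "vdm n x = alternant n x (\<lambda>i. n - 1 - i)"

text \<open>Each gap between consecutive exponents contains a single number.\<close>

lemma vdm_Suc: "vdm (Suc n) x = (\<Prod>j<n. x j - x n) * vdm n x"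
proof -
  let ?k = "\<lambda>i. Suc n - 1 - i"
  define d where "d = restrict (\<lambda>i. n - 1 - i) {..<n}"
  have d: "d i = n - 1 - i" if "i < n" for i using that by (simp add: d_def)
  have "PiE {..<n} (\<lambda>i. {?k (Suc i)..<?k i}) = PiE {..<n} (\<lambda>i. {d i})"
    by (rule PiE_cong) (auto simp: d)
  also have "\<dots> = {d}" unfolding d_def by (rule PiE_singleton[OF restrict_extensional])
  finally have S: "PiE {..<n} (\<lambda>i. {?k (Suc i)..<?k i}) = {d}" .
  have "vdm (Suc n) x = x n ^ ?k n * (\<Prod>j<n. x j - x n) * ((\<Prod>i<n. x n ^ (?k i - 1 - d i)) * alternant n x d)"
    using alternant_branch[of n ?k x] unfolding vdm_def S by simp
  moreover have "alternant n x d = vdm n x" unfolding vdm_def by (rule alternant_cong) (rule d)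
  moreover have "(\<Prod>i<n. x n ^ (?k i - 1 - d i)) = 1" by (rule prod.neutral) (simp add: d)
  ultimately show ?thesis by simp
qed

lemma vdm_prod: "vdm n x = (\<Prod>j<n. \<Prod>i<j. x i - x j)"
  by (induction n) (simp_all add: vdm_Suc mult.commute, simp add: vdm_def alternant_def)

lemma vdm_expand: "vdm n x = (\<Sum>p | p permutes {..<n}. of_int (sign p) * (\<Prod>j<n. x j ^ (n - 1 - p j)))"
proof -
  have "vdm n x = adet n (\<lambda>j i. x j ^ (n - 1 - i))"
    unfolding vdm_def alternant_def adet_eq_det
    by (subst Determinant.det_transpose[symmetric, of _ n])
       (auto intro!: arg_cong[of _ _ Determinant.det] eq_matI)
  then show ?thesis by (simp add: adet_def)
qed

text \<open>The shift \<open>\<tau> i = \<kappa> i + n - 1 - i\<close> turns a choice of exponents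
  in half-open gaps into a shape interlacing with \<open>lam\<close>.\<close>

lemma alternant_weight_branch:
  assumes "\<And>i. i < n \<Longrightarrow> lam (Suc i) \<le> lam i"
  shows "alternant (Suc n) x (\<lambda>i. lam i + n - i) = (\<Prod>j<n. x j - x n) *
     (\<Sum>\<kappa>\<in>PiE {..<n} (\<lambda>i. {lam (Suc i)..lam i}). x n ^ (lam n + (\<Sum>i<n. lam i - \<kappa> i)) * alternant n x (\<lambda>i. \<kappa> i + n - 1 - i))"
proof -
  let ?k = "\<lambda>i. lam i + n - i"
  have k: "?k (Suc i) \<le> ?k i" if "i < n" for i using assms[OF that] that by auto
  have "(\<Sum>\<tau>\<in>PiE {..<n} (\<lambda>i. {?k (Suc i)..<?k i}). (\<Prod>i<n. x n ^ (?k i - 1 - \<tau> i)) * alternant n x \<tau>)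
     = (\<Sum>\<kappa>\<in>PiE {..<n} (\<lambda>i. {lam (Suc i)..lam i}). x n ^ (\<Sum>i<n. lam i - \<kappa> i) * alternant n x (\<lambda>i. \<kappa> i + n - 1 - i))"
  proof (rule sum.reindex_bij_witness[of _ "\<lambda>\<kappa>. restrict (\<lambda>i. \<kappa> i + n - 1 - i) {..<n}" "\<lambda>\<tau>. restrict (\<lambda>i. \<tau> i + i + 1 - n) {..<n}"])
    fix \<tau> assume \<tau>: "\<tau> \<in> PiE {..<n} (\<lambda>i. {?k (Suc i)..<?k i})"
    have t: "n \<le> \<tau> i + i + 1" "\<tau> i + i + 1 \<le> lam i + n" "lam (Suc i) + n \<le> \<tau> i + i + 1" if "i < n" for i
    proof -
      have "?k (Suc i) \<le> \<tau> i" "\<tau> i < ?k i" using PiE_mem[OF \<tau>, of i] that by auto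
      then show "n \<le> \<tau> i + i + 1" "\<tau> i + i + 1 \<le> lam i + n" "lam (Suc i) + n \<le> \<tau> i + i + 1" using that by linarith+
    qed
    have u: "\<tau> i + i + 1 - n + n - 1 - i = \<tau> i" "lam i - (\<tau> i + i + 1 - n) = ?k i - 1 - \<tau> i"
      "lam (Suc i) \<le> \<tau> i + i + 1 - n" "\<tau> i + i + 1 - n \<le> lam i" if "i < n" for i
      using t[OF that] that by linarith+
    let ?\<kappa> = "restrict (\<lambda>i. \<tau> i + i + 1 - n) {..<n}"
    show "restrict (\<lambda>i. ?\<kappa> i + n - 1 - i) {..<n} = \<tau>"
    proof
      fix i show "restrict (\<lambda>i. ?\<kappa> i + n - 1 - i) {..<n} i = \<tau> i"
        using u[of i] PiE_arb[OF \<tau>, of i] by (cases "i < n") simp_all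
    qed
    show "?\<kappa> \<in> PiE {..<n} (\<lambda>i. {lam (Suc i)..lam i})"
    proof (rule PiE_I)
      fix i assume "i \<in> {..<n}"
      then show "?\<kappa> i \<in> {lam (Suc i)..lam i}" using u[of i] by simp
    qed simp
    have "alternant n x (\<lambda>i. ?\<kappa> i + n - 1 - i) = alternant n x \<tau>"
      by (rule alternant_cong) (use u in simp)
    moreover have "(\<Sum>i<n. lam i - ?\<kappa> i) = (\<Sum>i<n. ?k i - 1 - \<tau> i)"
      by (rule sum.cong) (use u in simp_all)
    ultimately show "x n ^ (\<Sum>i<n. lam i - ?\<kappa> i) * alternant n x (\<lambda>i. ?\<kappa> i + n - 1 - i) = (\<Prod>i<n. x n ^ (?k i - 1 - \<tau> i)) * alternant n x \<tau>"
      by (simp add: power_sum)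
  next
    fix \<kappa> assume \<kappa>: "\<kappa> \<in> PiE {..<n} (\<lambda>i. {lam (Suc i)..lam i})"
    have t: "lam (Suc i) \<le> \<kappa> i" "\<kappa> i \<le> lam i" if "i < n" for i using \<kappa> that by (auto simp: PiE_iff)
    let ?\<tau> = "restrict (\<lambda>i. \<kappa> i + n - 1 - i) {..<n}"
    show "restrict (\<lambda>i. ?\<tau> i + i + 1 - n) {..<n} = \<kappa>"
    proof
      fix i show "restrict (\<lambda>i. ?\<tau> i + i + 1 - n) {..<n} i = \<kappa> i"
      proof (cases "i < n")
        case True
        then have "\<kappa> i + n - 1 - i + i + 1 - n = \<kappa> i" by linarith
        then show ?thesis using True by simp
      qed (use PiE_arb[OF \<kappa>, of i] in simp)
    qed
    show "?\<tau> \<in> PiE {..<n} (\<lambda>i. {?k (Suc i)..<?k i})"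
    proof (rule PiE_I)
      fix i assume "i \<in> {..<n}"
      then have "i < n" "?k (Suc i) \<le> \<kappa> i + n - 1 - i" "\<kappa> i + n - 1 - i < ?k i" using t[of i] by simp_all
      then show "?\<tau> i \<in> {?k (Suc i)..<?k i}" by simp
    qed simp
  qed
  then have "alternant (Suc n) x ?k = x n ^ ?k n * (\<Prod>j<n. x j - x n) *
      (\<Sum>\<kappa>\<in>PiE {..<n} (\<lambda>i. {lam (Suc i)..lam i}). x n ^ (\<Sum>i<n. lam i - \<kappa> i) * alternant n x (\<lambda>i. \<kappa> i + n - 1 - i))"
    using alternant_branch[of n ?k x, OF k] by (simp only:)
  moreover have "?k n = lam n" by simp
  ultimately show ?thesis by (simp only: power_add sum_distrib_left mult_ac)
qed

text \<open>The analogue of the row operation for alternants. \<open>H\<close> and \<open>G\<close>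
  stand for the complete symmetric polynomials with and without the variable \<open>x\<close>;
  telescoping \<open>HG\<close> and subtracting the next row leaves in row \<open>i\<close> the
  terms from \<open>lam (Suc i)\<close> to \<open>lam i\<close>.\<close>

lemma JT_branch:
  fixes H G :: "int \<Rightarrow> 'a :: comm_ring_1"
  assumes HG: "\<And>j. H j = G j + x * H (j - 1)" and neg: "\<And>j. j < 0 \<Longrightarrow> G j = 0" "\<And>j. j < 0 \<Longrightarrow> H j = 0"
    and dec: "\<And>i. Suc i < l \<Longrightarrow> lam (Suc i) \<le> lam i"
  shows "adet l (\<lambda>i j. H (int (lam i) - int i + int j))
    = (\<Sum>\<kappa>\<in>PiE {..<l} (\<lambda>i. {(if Suc i < l then lam (Suc i) else 0)..lam i}). x ^ (\<Sum>i<l. lam i - \<kappa> i) * adet l (\<lambda>i j. G (int (\<kappa> i) - int i + int j)))"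
proof -
  have telescope: "H j = (\<Sum>t<s. x ^ t * G (j - int t)) + x ^ s * H (j - int s)" for j s
  proof (induction s)
    case (Suc s)
    have "H (j - int s) = G (j - int s) + x * H (j - int s - 1)" by (rule HG)
    then show ?case using Suc by (simp add: algebra_simps)
  qed simp
  define c where "c = (\<lambda>i. x ^ (lam i - lam (Suc i) + 1))"
  define lo where "lo = (\<lambda>i. if Suc i < l then lam (Suc i) else 0)"
  have "adet l (\<lambda>i j. H (int (lam i) - int i + int j)) = adet l (\<lambda>i j. if Suc i < l then H (int (lam i) - int i + int j) - c i * H (int (lam (Suc i)) - int (Suc i) + int j) else H (int (lam i) - int i + int j))"
    by (rule adet_row_op[symmetric])
  also have "\<dots> = adet l (\<lambda>i j. \<Sum>t\<in>{lo i..lam i}. x ^ (lam i - t) * G (int t - int i + int j))"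
  proof (rule adet_cong)
    fix i j assume ij: "i < l" "j < l"
    let ?J = "int (lam i) - int i + int j"
    have lo: "lo i \<le> lam i" using dec by (auto simp: lo_def)
    have re: "(\<Sum>t\<in>{lo i..lam i}. x ^ (lam i - t) * G (int t - int i + int j)) = (\<Sum>t<lam i - lo i + 1. x ^ t * G (?J - int t))"
      by (rule sum.reindex_bij_witness[of _ "\<lambda>t. lam i - t" "\<lambda>t. lam i - t"]) (use lo in \<open>auto simp: of_nat_diff algebra_simps\<close>)
    have rec: "H ?J = (\<Sum>t<lam i - lo i + 1. x ^ t * G (?J - int t)) + x ^ (lam i - lo i + 1) * H (?J - int (lam i - lo i + 1))"
      by (rule telescope)
    show "(if Suc i < l then H ?J - c i * H (int (lam (Suc i)) - int (Suc i) + int j) else H ?J) = (\<Sum>t\<in>{lo i..lam i}. x ^ (lam i - t) * G (int t - int i + int j))"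
    proof (cases "Suc i < l")
      case True
      then have "?J - int (lam i - lo i + 1) = int (lam (Suc i)) - int (Suc i) + int j"
        using dec[OF True] by (simp add: lo_def of_nat_diff)
      with rec have "H ?J = (\<Sum>t<lam i - lo i + 1. x ^ t * G (?J - int t)) + c i * H (int (lam (Suc i)) - int (Suc i) + int j)"
        using True by (simp only: c_def lo_def if_True)
      then show ?thesis using True unfolding re by (simp only: if_True add_diff_cancel_right')
    next
      case False
      \<comment> \<open>In the last row the remainder has index \<open>j - i - 1\<close>, which is
        negative, so no next row is required to cancel it.\<close>
      then have "?J - int (lam i - lo i + 1) < 0" using ij by (simp add: lo_def)
      then show ?thesis using False rec neg(2) unfolding re by simp
    qed
  qed
  also have "\<dots> = (\<Sum>\<kappa>\<in>PiE {..<l} (\<lambda>i. {lo i..lam i}). adet l (\<lambda>i j. x ^ (lam i - \<kappa> i) * G (int (\<kappa> i) - int i + int j)))"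
    by (rule adet_rows_sum) simp
  finally show ?thesis unfolding lo_def by (simp add: adet_scale_rows power_sum)
qed

section \<open>Tableaux and the bialternant formula\<close>

definition X :: "nat \<Rightarrow> ipoly" where "X i = Poly_Mapping.single (Poly_Mapping.single i 1) 1"

lemma prod_single_one:
  fixes e :: "'c \<Rightarrow> nat \<Rightarrow>\<^sub>0 nat"
  shows "finite C \<Longrightarrow> (\<Prod>c\<in>C. Poly_Mapping.single (e c) (1::int)) = Poly_Mapping.single (\<Sum>c\<in>C. e c) 1"
  by (induction C rule: finite_induct) (simp_all add: mult_single single_one)

definition shape_cells :: "nat \<Rightarrow> (nat \<Rightarrow> nat) \<Rightarrow> (nat \<times> nat) set" where
  "shape_cells l lam = {(i, j). i < l \<and> j < lam i}"

lemma cells_map: "cells (map lam [0..<l]) = shape_cells l lam"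
  by (auto simp: cells_def shape_cells_def)

lemma shape_cells_Sigma: "shape_cells l lam = (SIGMA i:{..<l}. {..<lam i})" by (auto simp: shape_cells_def)

lemma finite_shape_cells [simp]: "finite (shape_cells l lam)" by (simp add: shape_cells_Sigma)

lemma card_shape_cells: "card (shape_cells l lam) = (\<Sum>i<l. lam i)" by (simp add: shape_cells_Sigma)

definition SYT :: "nat \<Rightarrow> nat \<Rightarrow> (nat \<Rightarrow> nat) \<Rightarrow> (nat \<times> nat \<Rightarrow> nat) set" where
  "SYT n l lam = {T. (\<forall>c\<in>shape_cells l lam. T c < n) \<and> (\<forall>c. c \<notin> shape_cells l lam \<longrightarrow> T c = 0)
     \<and> (\<forall>i j. (i, Suc j) \<in> shape_cells l lam \<longrightarrow> T (i, j) \<le> T (i, Suc j))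
     \<and> (\<forall>i j. (Suc i, j) \<in> shape_cells l lam \<longrightarrow> T (i, j) < T (Suc i, j))}"

text \<open>The Schur polynomial of a shape given by row lengths on \<open>l\<close> rows; empty
  rows are allowed, which keeps the number of rows fixed in the branching.\<close>

definition SS :: "nat \<Rightarrow> nat \<Rightarrow> (nat \<Rightarrow> nat) \<Rightarrow> ipoly" where
  "SS n l lam = (\<Sum>T\<in>SYT n l lam. \<Prod>c\<in>shape_cells l lam. X (T c))"

lemma schur_eq_SS:
  assumes "cells la = shape_cells l lam"
  shows "schur n la = SS n l lam"
  unfolding schur_def SS_def tab_monomial_def ssyt_def SYT_def assms X_def
  by (simp add: prod_single_one)

lemma schur_map: "schur n (map lam [0..<l]) = SS n l lam"
  by (rule schur_eq_SS[OF cells_map])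

lemma finite_SYT [simp]: "finite (SYT n l lam)"
proof (rule finite_subset)
  show "SYT n l lam \<subseteq> {T. \<forall>c. (c \<in> shape_cells l lam \<longrightarrow> T c \<in> {..<n}) \<and> (c \<notin> shape_cells l lam \<longrightarrow> T c = 0)}"
    unfolding SYT_def by (intro subsetI) simp
  show "finite {T. \<forall>c. (c \<in> shape_cells l lam \<longrightarrow> T c \<in> {..<n}) \<and> (c \<notin> shape_cells l lam \<longrightarrow> T c = (0::nat))}"
    by (rule finite_set_of_finite_funs) auto
qed

text \<open>The shapes left after removing a horizontal strip.\<close>

definition strip :: "nat \<Rightarrow> (nat \<Rightarrow> nat) \<Rightarrow> (nat \<Rightarrow> nat) set" where
  "strip l lam = PiE {..<l} (\<lambda>i. {(if Suc i < l then lam (Suc i) else 0)..lam i})"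

lemma finite_strip [simp]: "finite (strip l lam)" unfolding strip_def by (intro finite_PiE) auto

lemma downward_closed_eq:
  fixes D :: "nat set"
  assumes "finite D" "\<And>j. Suc j \<in> D \<Longrightarrow> j \<in> D"
  shows "D = {..<card D}"
proof -
  have down: "j \<in> D" if "j + d \<in> D" for j d using that by (induction d) (use assms(2) in auto)
  show ?thesis
  proof (cases "D = {}")
    case False
    have "D = {..Max D}"
    proof
      show "D \<subseteq> {..Max D}" using assms(1) by auto
      show "{..Max D} \<subseteq> D"
      proof
        fix j assume "j \<in> {..Max D}"
        then have "j + (Max D - j) \<in> D" using Max_in[OF assms(1) False] by simp
        then show "j \<in> D" by (rule down)
      qed
    qed
    then show ?thesis by (metis card_atMost lessThan_Suc_atMost)
  qed simp
qed

lemma SYT_prefix: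
  assumes T: "T \<in> SYT (Suc n) l lam" and i: "i < l"
  shows "{j. j < lam i \<and> T (i, j) < n} = {..<card {j. j < lam i \<and> T (i, j) < n}}"
proof (rule downward_closed_eq)
  fix j assume j: "Suc j \<in> {j. j < lam i \<and> T (i, j) < n}"
  then have "T (i, j) \<le> T (i, Suc j)" using T i by (auto simp: SYT_def shape_cells_def)
  then show "j \<in> {j. j < lam i \<and> T (i, j) < n}" using j by simp
qed simp

text \<open>The cells with the largest entry \<open>n\<close> form a horizontal strip. Deleting them
  is a bijection onto pairs of an interlacing shape and a tableau with smaller entries; its inverse
  fills the strip with \<open>n\<close>.\<close>

lemma SYT_branch:
  assumes dec: "\<And>i. Suc i < l \<Longrightarrow> lam (Suc i) \<le> lam i"
  shows "SS (Suc n) l lam = (\<Sum>\<kappa>\<in>strip l lam. X n ^ (\<Sum>i<l. lam i - \<kappa> i) * SS n l \<kappa>)"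
proof -
  define cut where "cut = (\<lambda>T. restrict (\<lambda>i. card {j. j < lam i \<and> T (i, j) < n}) {..<l})"
  define rst where "rst = (\<lambda>(\<kappa> :: nat \<Rightarrow> nat) (T :: nat \<times> nat \<Rightarrow> nat) c. if c \<in> shape_cells l \<kappa> then T c else 0)"
  define ext where "ext = (\<lambda>(\<kappa> :: nat \<Rightarrow> nat) (T :: nat \<times> nat \<Rightarrow> nat) c. if c \<in> shape_cells l \<kappa> then T c else if c \<in> shape_cells l lam then n else 0)"
  have sub: "shape_cells l \<kappa> \<subseteq> shape_cells l lam" if "\<kappa> \<in> strip l lam" for \<kappa>
  proof -
    have "\<kappa> i \<le> lam i" if "i < l" for i
      using PiE_mem[OF \<open>\<kappa> \<in> strip l lam\<close>[unfolded strip_def], of i] that by simp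
    then show ?thesis by (auto simp: shape_cells_def intro: less_le_trans)
  qed
  have cut: "T (i, j) < n \<longleftrightarrow> j < cut T i" "cut T i \<le> lam i" if "T \<in> SYT (Suc n) l lam" "i < l" "j < lam i" for T i j
  proof -
    have e: "{j. j < lam i \<and> T (i, j) < n} = {..<cut T i}"
      using SYT_prefix[OF that(1,2)] that(2) by (simp add: cut_def)
    then show "T (i, j) < n \<longleftrightarrow> j < cut T i" using that(3) by blast
    have "{..<cut T i} \<subseteq> {..<lam i}" unfolding e[symmetric] by auto
    then show "cut T i \<le> lam i" by simp
  qed
  have cutle: "cut T i \<le> lam i" if "i < l" for T i
  proof -
    have "card {j. j < lam i \<and> T (i, j) < n} \<le> card {..<lam i}" by (rule card_mono) auto
    then show ?thesis using that by (simp add: cut_def)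
  qed
  have cells_cut: "c \<in> shape_cells l (cut T) \<longleftrightarrow> c \<in> shape_cells l lam \<and> T c < n" if "T \<in> SYT (Suc n) l lam" for T c
  proof -
    obtain i j where c: "c = (i, j)" by (cases c)
    have "j < cut T i \<longleftrightarrow> j < lam i \<and> T (i, j) < n" if "i < l"
    proof (cases "j < lam i")
      case True then show ?thesis using cut(1)[OF \<open>T \<in> _\<close> that True] by simp
    next
      case False then show ?thesis using cutle[OF that, of T] by simp
    qed
    then show ?thesis by (auto simp: c shape_cells_def)
  qed
  have "(\<Sum>\<kappa>\<in>strip l lam. X n ^ (\<Sum>i<l. lam i - \<kappa> i) * SS n l \<kappa>)
     = (\<Sum>p\<in>(SIGMA \<kappa>:strip l lam. SYT n l \<kappa>). X n ^ (\<Sum>i<l. lam i - fst p i) * (\<Prod>c\<in>shape_cells l (fst p). X (snd p c)))"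
    unfolding SS_def by (simp add: sum_distrib_left sum.Sigma case_prod_beta)
  also have "\<dots> = (\<Sum>T\<in>SYT (Suc n) l lam. \<Prod>c\<in>shape_cells l lam. X (T c))"
  proof (rule sum.reindex_bij_witness[of _ "\<lambda>T. (cut T, rst (cut T) T)" "\<lambda>p. ext (fst p) (snd p)"])
    fix T assume T: "T \<in> SYT (Suc n) l lam"
    have Tc: "T c < Suc n" if "c \<in> shape_cells l lam" for c using T that by (auto simp: SYT_def)
    show "ext (fst (cut T, rst (cut T) T)) (snd (cut T, rst (cut T) T)) = T"
    proof
      fix c
      have "T c = n" if "c \<in> shape_cells l lam" "\<not> T c < n" using Tc[OF that(1)] that(2) by simp
      moreover have "T c = 0" if "c \<notin> shape_cells l lam" using T that unfolding SYT_def by blast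
      ultimately show "ext (fst (cut T, rst (cut T) T)) (snd (cut T, rst (cut T) T)) c = T c"
        by (auto simp: ext_def rst_def cells_cut[OF T])
    qed
    have "cut T \<in> strip l lam"
      unfolding strip_def
    proof (rule PiE_I)
      fix i assume i: "i \<in> {..<l}"
      have "lam (Suc i) \<le> cut T i" if si: "Suc i < l"
      proof (rule ccontr)
        assume "\<not> lam (Suc i) \<le> cut T i"
        then have j: "cut T i < lam (Suc i)" by simp
        then have "(Suc i, cut T i) \<in> shape_cells l lam" using si by (simp add: shape_cells_def)
        then have "T (i, cut T i) < T (Suc i, cut T i)" "T (Suc i, cut T i) < Suc n" using T Tc by (auto simp: SYT_def)
        then have "T (i, cut T i) < n" by simp
        then show False using cut(1)[OF T, of i "cut T i"] i j dec[OF si] by simp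
      qed
      then show "cut T i \<in> {(if Suc i < l then lam (Suc i) else 0)..lam i}" using cutle i by simp
    qed (simp add: cut_def)
    moreover have "rst (cut T) T \<in> SYT n l (cut T)"
    proof -
      have R: "rst (cut T) T c = T c" if "c \<in> shape_cells l (cut T)" for c using that by (simp add: rst_def)
      have 1: "rst (cut T) T (i, j) \<le> rst (cut T) T (i, Suc j)" if "(i, Suc j) \<in> shape_cells l (cut T)" for i j
      proof -
        have "(i, j) \<in> shape_cells l (cut T)" using that by (auto simp: shape_cells_def)
        moreover have "T (i, j) \<le> T (i, Suc j)" using T that cells_cut[OF T] by (simp add: SYT_def)
        ultimately show ?thesis using R that by simp
      qed
      have 2: "rst (cut T) T (i, j) < rst (cut T) T (Suc i, j)" if "(Suc i, j) \<in> shape_cells l (cut T)" for i j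
      proof -
        have m: "(Suc i, j) \<in> shape_cells l lam" "T (Suc i, j) < n" using that cells_cut[OF T] by auto
        then have lt: "T (i, j) < T (Suc i, j)" using T by (simp add: SYT_def)
        have "(i, j) \<in> shape_cells l lam" using m(1) dec[of i] by (auto simp: shape_cells_def)
        then have "(i, j) \<in> shape_cells l (cut T)" using lt m(2) cells_cut[OF T] by simp
        then show ?thesis using R that lt by simp
      qed
      show ?thesis unfolding SYT_def using 1 2 cells_cut[OF T] by (auto simp: rst_def)
    qed
    ultimately show "(cut T, rst (cut T) T) \<in> (SIGMA \<kappa>:strip l lam. SYT n l \<kappa>)" by simp
  next
    fix p assume "p \<in> (SIGMA \<kappa>:strip l lam. SYT n l \<kappa>)"
    then obtain \<kappa> T where p: "p = (\<kappa>, T)" and \<kappa>: "\<kappa> \<in> strip l lam" and T: "T \<in> SYT n l \<kappa>" by auto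
    let ?E = "ext \<kappa> T"
    have kl: "\<kappa> i \<le> lam i" if "i < l" for i using \<kappa> that by (auto simp: strip_def PiE_iff)
    have kg: "lam (Suc i) \<le> \<kappa> i" if "Suc i < l" for i
      using PiE_mem[OF \<kappa>[unfolded strip_def], of i] that by simp
    have E1: "?E c = T c" "T c < n" if "c \<in> shape_cells l \<kappa>" for c using that T by (auto simp: ext_def SYT_def)
    have E2: "?E c = n" if "c \<in> shape_cells l lam" "c \<notin> shape_cells l \<kappa>" for c using that by (simp add: ext_def)
    have Ele: "?E c \<le> n" for c using E1[of c] by (cases "c \<in> shape_cells l \<kappa>") (auto simp: ext_def)
    have ES: "?E \<in> SYT (Suc n) l lam"
    proof -
      have 1: "?E (i, j) \<le> ?E (i, Suc j)" if c: "(i, Suc j) \<in> shape_cells l lam" for i j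
      proof (cases "(i, Suc j) \<in> shape_cells l \<kappa>")
        case True
        then have "(i, j) \<in> shape_cells l \<kappa>" by (auto simp: shape_cells_def)
        moreover have "T (i, j) \<le> T (i, Suc j)" using T True by (simp add: SYT_def)
        ultimately show ?thesis using True by (simp add: ext_def)
      next
        case False then show ?thesis using E2[OF c False] Ele by simp
      qed
      have 2: "?E (i, j) < ?E (Suc i, j)" if c: "(Suc i, j) \<in> shape_cells l lam" for i j
      proof -
        have ij: "(i, j) \<in> shape_cells l \<kappa>" using c kg[of i] by (auto simp: shape_cells_def)
        show ?thesis
        proof (cases "(Suc i, j) \<in> shape_cells l \<kappa>")
          case True
          moreover have "T (i, j) < T (Suc i, j)" using T True by (simp add: SYT_def)
          ultimately show ?thesis using ij by (simp add: ext_def)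
        next
          case False then show ?thesis using E2[OF c False] E1[OF ij] by simp
        qed
      qed
      have 3: "?E c = 0" if "c \<notin> shape_cells l lam" for c using that sub[OF \<kappa>] by (auto simp: ext_def)
      show ?thesis unfolding SYT_def using 1 2 3 Ele by (auto simp: less_Suc_eq_le)
    qed
    then show "ext (fst p) (snd p) \<in> SYT (Suc n) l lam" by (simp add: p)
    have cc: "shape_cells l (cut ?E) = shape_cells l \<kappa>"
    proof (intro equalityI subsetI)
      fix c assume "c \<in> shape_cells l (cut ?E)"
      then have "c \<in> shape_cells l lam" "?E c < n" using cells_cut[OF ES] by blast+
      then show "c \<in> shape_cells l \<kappa>" using E2[of c] by fastforce
    next
      fix c assume "c \<in> shape_cells l \<kappa>"
      then show "c \<in> shape_cells l (cut ?E)" using cells_cut[OF ES] E1[of c] sub[OF \<kappa>] by auto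
    qed
    have "cut ?E = \<kappa>"
    proof
      fix i show "cut ?E i = \<kappa> i"
      proof (cases "i < l")
        case True
        have "j < cut ?E i \<longleftrightarrow> j < \<kappa> i" for j using cc True by (auto simp: shape_cells_def set_eq_iff)
        then show ?thesis by (meson linorder_neqE_nat less_irrefl)
      next
        case False then show ?thesis using PiE_arb[OF \<kappa>[unfolded strip_def], of i] by (simp add: cut_def)
      qed
    qed
    moreover have "rst \<kappa> ?E = T" using T by (auto simp: rst_def ext_def SYT_def fun_eq_iff)
    ultimately show "(cut (ext (fst p) (snd p)), rst (cut (ext (fst p) (snd p))) (ext (fst p) (snd p))) = p" by (simp add: p)
    have "(\<Prod>c\<in>shape_cells l lam. X (?E c)) = (\<Prod>c\<in>shape_cells l lam - shape_cells l \<kappa>. X (?E c)) * (\<Prod>c\<in>shape_cells l \<kappa>. X (?E c))"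
      using sub[OF \<kappa>] by (intro prod.subset_diff) auto
    also have "(\<Prod>c\<in>shape_cells l lam - shape_cells l \<kappa>. X (?E c)) = X n ^ card (shape_cells l lam - shape_cells l \<kappa>)"
      using E2 by (simp add: prod_constant)
    also have "card (shape_cells l lam - shape_cells l \<kappa>) = (\<Sum>i<l. lam i - \<kappa> i)"
      using sub[OF \<kappa>] sum_subtractf_nat[of "{..<l}" \<kappa> lam] kl by (simp add: card_Diff_subset card_shape_cells)
    also have "(\<Prod>c\<in>shape_cells l \<kappa>. X (?E c)) = (\<Prod>c\<in>shape_cells l \<kappa>. X (T c))"
      by (intro prod.cong) (auto simp: E1)
    finally show "(\<Prod>c\<in>shape_cells l lam. X (ext (fst p) (snd p) c)) = X n ^ (\<Sum>i<l. lam i - fst p i) * (\<Prod>c\<in>shape_cells l (fst p). X (snd p c))"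
      by (simp add: p)
  qed
  finally show ?thesis by (simp add: SS_def)
qed

lemma SS_cong: "(\<And>i. i < l \<Longrightarrow> lam i = lam' i) \<Longrightarrow> SS n l lam = SS n l lam'"
proof -
  assume "\<And>i. i < l \<Longrightarrow> lam i = lam' i"
  then have "shape_cells l lam = shape_cells l lam'" by (auto simp: shape_cells_def)
  then show ?thesis by (simp add: SS_def SYT_def)
qed

lemma SYT_column:
  assumes T: "T \<in> SYT n l lam" and dec: "\<And>i. Suc i < l \<Longrightarrow> lam (Suc i) \<le> lam i" and i: "i < l" "lam i > 0"
  shows "i \<le> T (i, 0)"
  using i
proof (induction i)
  case (Suc i)
  then have "(Suc i, 0) \<in> shape_cells l lam" by (simp add: shape_cells_def)
  then have "T (i, 0) < T (Suc i, 0)" using T by (simp add: SYT_def)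
  moreover have "i \<le> T (i, 0)" using Suc dec[of i] by auto
  ultimately show ?case by simp
qed simp

text \<open>A strictly increasing first column of \<open>n + 1\<close> cells does not fit into
  \<open>n\<close> values.\<close>

lemma SS_too_long:
  assumes dec: "\<And>i. Suc i < Suc n \<Longrightarrow> lam (Suc i) \<le> lam i" and "lam n > 0"
  shows "SS n (Suc n) lam = 0"
proof -
  have "SYT n (Suc n) lam = {}"
  proof (rule ccontr)
    assume "SYT n (Suc n) lam \<noteq> {}"
    then obtain T where T: "T \<in> SYT n (Suc n) lam" by blast
    have "n \<le> T (n, 0)" by (rule SYT_column[OF T]) (use assms in auto)
    moreover have "T (n, 0) < n" using T assms(2) by (auto simp: SYT_def shape_cells_def)
    ultimately show False by simp
  qed
  then show ?thesis by (simp add: SS_def)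
qed

lemma SS_drop_zero: "lam n = 0 \<Longrightarrow> SS m (Suc n) lam = SS m n lam"
proof -
  assume "lam n = 0"
  then have "shape_cells (Suc n) lam = shape_cells n lam" by (auto simp: shape_cells_def less_Suc_eq)
  then show ?thesis by (simp add: SS_def SYT_def)
qed

text \<open>Both sides branch in the last variable over interlacing shapes. The alternant leaves
  shapes with \<open>n\<close> rows, the tableaux shapes with \<open>n + 1\<close> rows; those with
  \<open>\<kappa> n > 0\<close> contribute zero in \<open>n\<close> variables.\<close>

theorem bialternant:
  assumes "\<And>i. Suc i < n \<Longrightarrow> lam (Suc i) \<le> lam i"
  shows "alternant n X (\<lambda>i. lam i + n - 1 - i) = vdm n X * SS n n lam"
  using assms
proof (induction n arbitrary: lam)
  case 0
  have "SYT 0 0 lam = {\<lambda>_. 0}" by (auto simp: SYT_def shape_cells_def)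
  then show ?case by (simp add: alternant_def vdm_def SS_def shape_cells_def)
next
  case (Suc n)
  define K where "K = PiE {..<n} (\<lambda>i. {lam (Suc i)..lam i})"
  have IH: "alternant n X (\<lambda>i. \<kappa> i + n - 1 - i) = vdm n X * SS n n \<kappa>" if "\<kappa> \<in> K" for \<kappa>
  proof (rule Suc.IH)
    fix i assume i: "Suc i < n"
    have "\<kappa> (Suc i) \<le> lam (Suc i)" "lam (Suc i) \<le> \<kappa> i"
      using PiE_mem[OF that[unfolded K_def], of i] PiE_mem[OF that[unfolded K_def], of "Suc i"] i by auto
    then show "\<kappa> (Suc i) \<le> \<kappa> i" by simp
  qed
  have dec: "lam (Suc i) \<le> lam i" if "i < n" for i using Suc.prems that by simp
  have "alternant (Suc n) X (\<lambda>i. lam i + Suc n - 1 - i) = (\<Prod>j<n. X j - X n) *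
     (\<Sum>\<kappa>\<in>K. X n ^ (lam n + (\<Sum>i<n. lam i - \<kappa> i)) * alternant n X (\<lambda>i. \<kappa> i + n - 1 - i))"
    unfolding K_def using alternant_weight_branch[of n lam X, OF dec] by simp
  also have "\<dots> = (\<Prod>j<n. X j - X n) * (\<Sum>\<kappa>\<in>K. X n ^ (lam n + (\<Sum>i<n. lam i - \<kappa> i)) * (vdm n X * SS n n \<kappa>))"
    using IH by simp
  also have "\<dots> = vdm (Suc n) X * (\<Sum>\<kappa>\<in>K. X n ^ (lam n + (\<Sum>i<n. lam i - \<kappa> i)) * SS n n \<kappa>)"
    by (simp add: vdm_Suc sum_distrib_left mult_ac)
  also have "(\<Sum>\<kappa>\<in>K. X n ^ (lam n + (\<Sum>i<n. lam i - \<kappa> i)) * SS n n \<kappa>)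
     = (\<Sum>\<kappa>\<in>{\<kappa> \<in> strip (Suc n) lam. \<kappa> n = 0}. X n ^ (\<Sum>i<Suc n. lam i - \<kappa> i) * SS n (Suc n) \<kappa>)"
  proof (rule sum.reindex_bij_witness[of _ "\<lambda>\<kappa>. restrict \<kappa> {..<n}" "\<lambda>\<kappa>. \<kappa>(n := 0)"])
    fix \<kappa> assume \<kappa>: "\<kappa> \<in> K"
    show "restrict (\<kappa>(n := 0)) {..<n} = \<kappa>"
      using PiE_arb[OF \<kappa>[unfolded K_def]] by (auto simp: fun_eq_iff restrict_def)
    have mem: "\<kappa> i \<in> {lam (Suc i)..lam i}" if "i < n" for i using PiE_mem[OF \<kappa>[unfolded K_def], of i] that by simp
    have arb: "\<kappa> i = undefined" if "\<not> i < n" for i using PiE_arb[OF \<kappa>[unfolded K_def], of i] that by simp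
    show "\<kappa>(n := 0) \<in> {\<kappa> \<in> strip (Suc n) lam. \<kappa> n = 0}"
      unfolding strip_def
    proof (intro CollectI conjI PiE_I)
      fix i assume "i \<in> {..<Suc n}"
      then show "(\<kappa>(n := 0)) i \<in> {(if Suc i < Suc n then lam (Suc i) else 0)..lam i}"
        using mem[of i] by (cases "i = n") auto
    next
      fix i assume "i \<notin> {..<Suc n}"
      then show "(\<kappa>(n := 0)) i = undefined" using arb[of i] by auto
    qed simp
    have "SS n (Suc n) (\<kappa>(n := 0)) = SS n n \<kappa>"
      using SS_drop_zero[of "\<kappa>(n := 0)" n n] SS_cong[of n "\<kappa>(n := 0)" \<kappa> n] by simp
    moreover have "(\<Sum>i<Suc n. lam i - (\<kappa>(n := 0)) i) = lam n + (\<Sum>i<n. lam i - \<kappa> i)"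
    proof -
      have "(\<Sum>i<n. lam i - (\<kappa>(n := 0)) i) = (\<Sum>i<n. lam i - \<kappa> i)" by (intro sum.cong) auto
      then show ?thesis by simp
    qed
    ultimately show "X n ^ (\<Sum>i<Suc n. lam i - (\<kappa>(n := 0)) i) * SS n (Suc n) (\<kappa>(n := 0)) = X n ^ (lam n + (\<Sum>i<n. lam i - \<kappa> i)) * SS n n \<kappa>"
      by (simp only:)
  next
    fix \<kappa> assume \<kappa>: "\<kappa> \<in> {\<kappa> \<in> strip (Suc n) lam. \<kappa> n = 0}"
    then have k: "\<kappa> \<in> PiE {..<Suc n} (\<lambda>i. {(if Suc i < Suc n then lam (Suc i) else 0)..lam i})" "\<kappa> n = 0"
      by (auto simp: strip_def)
    show "(restrict \<kappa> {..<n})(n := 0) = \<kappa>"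
    proof
      fix i show "((restrict \<kappa> {..<n})(n := 0)) i = \<kappa> i"
        using k(2) PiE_arb[OF k(1), of i] by (cases "i < n"; cases "i = n") auto
    qed
    show "restrict \<kappa> {..<n} \<in> K"
      unfolding K_def
    proof (rule PiE_I)
      fix i assume "i \<in> {..<n}"
      then show "restrict \<kappa> {..<n} i \<in> {lam (Suc i)..lam i}" using PiE_mem[OF k(1), of i] by auto
    qed simp
  qed
  also have "\<dots> = (\<Sum>\<kappa>\<in>strip (Suc n) lam. X n ^ (\<Sum>i<Suc n. lam i - \<kappa> i) * SS n (Suc n) \<kappa>)"
  proof (rule sum.mono_neutral_left)
    show "\<forall>\<kappa>\<in>strip (Suc n) lam - {\<kappa> \<in> strip (Suc n) lam. \<kappa> n = 0}. X n ^ (\<Sum>i<Suc n. lam i - \<kappa> i) * SS n (Suc n) \<kappa> = 0"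
    proof
      fix \<kappa> assume \<kappa>: "\<kappa> \<in> strip (Suc n) lam - {\<kappa> \<in> strip (Suc n) lam. \<kappa> n = 0}"
      have k: "\<kappa> i \<in> {(if Suc i < Suc n then lam (Suc i) else 0)..lam i}" if "i < Suc n" for i
        using \<kappa> PiE_mem[of \<kappa> "{..<Suc n}" _ i] that unfolding strip_def by blast
      have "SS n (Suc n) \<kappa> = 0"
      proof (rule SS_too_long)
        fix i assume "Suc i < Suc n"
        then show "\<kappa> (Suc i) \<le> \<kappa> i" using k[of i] k[of "Suc i"] by auto
      qed (use \<kappa> in auto)
      then show "X n ^ (\<Sum>i<Suc n. lam i - \<kappa> i) * SS n (Suc n) \<kappa> = 0" by simp
    qed
  qed auto
  also have "\<dots> = SS (Suc n) (Suc n) lam" using SYT_branch[of "Suc n" lam n] Suc.prems by simp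
  finally show ?case .
qed

section \<open>Complete symmetric polynomials and Jacobi-Trudi\<close>

definition compos :: "nat \<Rightarrow> nat \<Rightarrow> (nat \<Rightarrow> nat) set" where
  "compos n d = {a. (\<forall>i. n \<le> i \<longrightarrow> a i = 0) \<and> (\<Sum>i<n. a i) = d}"

lemma finite_compos [simp]: "finite (compos n d)"
proof (rule finite_subset)
  show "compos n d \<subseteq> {a. \<forall>i. (i \<in> {..<n} \<longrightarrow> a i \<in> {..d}) \<and> (i \<notin> {..<n} \<longrightarrow> a i = 0)}"
    by (auto simp: compos_def intro: member_le_sum)
  show "finite {a. \<forall>i. (i \<in> {..<n} \<longrightarrow> a i \<in> {..d}) \<and> (i \<notin> {..<n} \<longrightarrow> a i = (0::nat))}"
    by (rule finite_set_of_finite_funs) auto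
qed

definition hsym :: "nat \<Rightarrow> (nat \<Rightarrow> 'a) \<Rightarrow> int \<Rightarrow> 'a :: comm_ring_1" where
  "hsym n x d = (if d < 0 then 0 else (\<Sum>a\<in>compos n (nat d). \<Prod>i<n. x i ^ a i))"

text \<open>Monomials are split by whether the last variable occurs; if it does, one factor is taken
  out.\<close>

lemma hsym_Suc: "hsym (Suc n) x d = hsym n x d + x n * hsym (Suc n) x (d - 1)"
proof (cases "d < 0")
  case False
  define D where "D = nat d"
  have "compos (Suc n) D = compos n D \<union> {a \<in> compos (Suc n) D. a n \<noteq> 0}"
  proof (intro equalityI subsetI)
    fix a assume a: "a \<in> compos (Suc n) D"
    show "a \<in> compos n D \<union> {a \<in> compos (Suc n) D. a n \<noteq> 0}"
    proof (cases "a n = 0")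
      case True
      have "a i = 0" if "n \<le> i" for i using a True that by (cases "i = n") (auto simp: compos_def)
      then show ?thesis using a True by (auto simp: compos_def)
    qed (use a in simp)
  qed (auto simp: compos_def)
  moreover have disj: "compos n D \<inter> {a \<in> compos (Suc n) D. a n \<noteq> 0} = {}" by (auto simp: compos_def)
  ultimately have "(\<Sum>a\<in>compos (Suc n) D. \<Prod>i<Suc n. x i ^ a i) = (\<Sum>a\<in>compos n D. \<Prod>i<Suc n. x i ^ a i)
     + (\<Sum>a\<in>{a \<in> compos (Suc n) D. a n \<noteq> 0}. \<Prod>i<Suc n. x i ^ a i)"
    using sum.union_disjoint[OF _ _ disj, of "\<lambda>a. \<Prod>i<Suc n. x i ^ a i"] by simp
  also have "(\<Sum>a\<in>compos n D. \<Prod>i<Suc n. x i ^ a i) = (\<Sum>a\<in>compos n D. \<Prod>i<n. x i ^ a i)"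
    by (intro sum.cong refl) (simp add: compos_def)
  also have "(\<Sum>a\<in>{a \<in> compos (Suc n) D. a n \<noteq> 0}. \<Prod>i<Suc n. x i ^ a i) = x n * hsym (Suc n) x (d - 1)"
  proof (cases "D = 0")
    case True
    then have "{a \<in> compos (Suc n) D. a n \<noteq> 0} = {}" by (auto simp: compos_def)
    then have "(\<Sum>a\<in>{a \<in> compos (Suc n) D. a n \<noteq> 0}. \<Prod>i<Suc n. x i ^ a i) = 0" by (simp only: sum.empty)
    moreover have "d - 1 < 0" using True False by (simp add: D_def)
    then have "hsym (Suc n) x (d - 1) = 0" by (simp add: hsym_def)
    ultimately show ?thesis by (simp only: mult_zero_right)
  next
    case D: False
    have "(\<Sum>a\<in>compos (Suc n) (D - 1). x n * (\<Prod>i<Suc n. x i ^ a i)) = (\<Sum>a\<in>{a \<in> compos (Suc n) D. a n \<noteq> 0}. \<Prod>i<Suc n. x i ^ a i)"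
    proof (rule sum.reindex_bij_witness[of _ "\<lambda>a. a(n := a n - 1)" "\<lambda>a. a(n := Suc (a n))"])
      fix a assume "a \<in> compos (Suc n) (D - 1)"
      then show "a(n := Suc (a n)) \<in> {a \<in> compos (Suc n) D. a n \<noteq> 0}" using D by (auto simp: compos_def)
      show "(\<Prod>i<Suc n. x i ^ (a(n := Suc (a n))) i) = x n * (\<Prod>i<Suc n. x i ^ a i)" by (simp add: mult_ac)
    next
      fix a assume "a \<in> {a \<in> compos (Suc n) D. a n \<noteq> 0}"
      then show "a(n := a n - 1) \<in> compos (Suc n) (D - 1)" by (auto simp: compos_def)
    qed auto
    moreover have "nat (d - 1) = D - 1" "\<not> d - 1 < 0" using D False by (auto simp: D_def)
    ultimately show ?thesis by (simp add: hsym_def sum_distrib_left)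
  qed
  finally show ?thesis using False by (simp add: hsym_def D_def)
qed (simp add: hsym_def)

text \<open>Tableaux and determinant branch alike in the number of variables; with no variables both
  are 1 for the empty shape and 0 for any other.\<close>

theorem jacobi_trudi:
  assumes "\<And>i. Suc i < l \<Longrightarrow> lam (Suc i) \<le> lam i"
  shows "SS n l lam = adet l (\<lambda>i j. hsym n X (int (lam i) - int i + int j))"
  using assms
proof (induction n arbitrary: lam)
  case 0
  have h0: "hsym 0 X d = of_bool (d = 0)" for d
  proof -
    have "compos 0 D = (if D = 0 then {\<lambda>_. 0} else {})" for D by (auto simp: compos_def)
    then show ?thesis by (auto simp: hsym_def)
  qed
  show ?case
  proof (cases "\<forall>i<l. lam i = 0")
    case True
    then have "shape_cells l lam = {}" by (auto simp: shape_cells_def)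
    moreover from this have "SYT 0 l lam = {\<lambda>_. 0}" by (auto simp: SYT_def)
    moreover have "adet l (\<lambda>i j. hsym 0 X (int (lam i) - int i + int j)) = (\<Prod>i<l. hsym 0 X (int (lam i) - int i + int i))"
      using True by (intro adet_upper_triangular) (auto simp: h0)
    ultimately show ?thesis using True by (simp add: SS_def h0)
  next
    case False
    then obtain i0 where i0: "i0 < l" "lam i0 > 0" by auto
    then have "(i0, 0) \<in> shape_cells l lam" by (simp add: shape_cells_def)
    then have "SYT 0 l lam = {}" by (auto simp: SYT_def)
    then have "SS 0 l lam = 0" by (simp add: SS_def)
    moreover have "lam 0 > 0"
    proof -
      have "lam i \<le> lam 0" if "i < l" for i using that
      proof (induction i)
        case (Suc i) then show ?case using "0.prems"[of i] by simp
      qed simp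
      then show ?thesis using i0 by fastforce
    qed
    then have "(\<Prod>i<l. hsym 0 X (int (lam i) - int i + int (p i))) = 0" for p
      using i0 by (intro prod_zero) (auto simp: h0 intro!: bexI[of _ 0])
    then have "adet l (\<lambda>i j. hsym 0 X (int (lam i) - int i + int j)) = 0" unfolding adet_def by (simp only: mult_zero_right sum.neutral_const)
    ultimately show ?thesis by simp
  qed
next
  case (Suc n)
  have "adet l (\<lambda>i j. hsym (Suc n) X (int (lam i) - int i + int j))
    = (\<Sum>\<kappa>\<in>strip l lam. X n ^ (\<Sum>i<l. lam i - \<kappa> i) * adet l (\<lambda>i j. hsym n X (int (\<kappa> i) - int i + int j)))"
    unfolding strip_def by (rule JT_branch, rule hsym_Suc) (simp_all add: hsym_def Suc.prems)
  also have "\<dots> = (\<Sum>\<kappa>\<in>strip l lam. X n ^ (\<Sum>i<l. lam i - \<kappa> i) * SS n l \<kappa>)"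
  proof (rule sum.cong[OF refl])
    fix \<kappa> assume \<kappa>: "\<kappa> \<in> strip l lam"
    have "\<kappa> (Suc i) \<le> \<kappa> i" if "Suc i < l" for i
      using PiE_mem[OF \<kappa>[unfolded strip_def], of i] PiE_mem[OF \<kappa>[unfolded strip_def], of "Suc i"] that by auto
    then show "X n ^ (\<Sum>i<l. lam i - \<kappa> i) * adet l (\<lambda>i j. hsym n X (int (\<kappa> i) - int i + int j)) = X n ^ (\<Sum>i<l. lam i - \<kappa> i) * SS n l \<kappa>"
      using Suc.IH by simp
  qed
  also have "\<dots> = SS (Suc n) l lam" using SYT_branch[of l lam n] Suc.prems by simp
  finally show ?case by simp
qed

section \<open>Extraction of Schur coefficients\<close>

lemma X_power: "X i ^ d = Poly_Mapping.single (Poly_Mapping.single i d) 1"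
proof (induction d)
  case (Suc d)
  have "Poly_Mapping.single i (Suc 0) + Poly_Mapping.single i d = Poly_Mapping.single i (Suc d)"
    by (simp flip: single_add)
  then show ?case using Suc by (simp add: X_def mult_single)
qed (simp add: single_zero single_one)

lemma prod_X_power: "finite S \<Longrightarrow> (\<Prod>i\<in>S. X (g i) ^ k i) = Poly_Mapping.single (\<Sum>i\<in>S. Poly_Mapping.single (g i) (k i)) 1"
  by (simp add: X_power prod_single_one)

definition expo :: "nat \<Rightarrow> (nat \<Rightarrow> nat) \<Rightarrow> nat \<Rightarrow>\<^sub>0 nat" where
  "expo n k = (\<Sum>i<n. Poly_Mapping.single i (k i))"

lemma lookup_expo: "Poly_Mapping.lookup (expo n k) j = (if j < n then k j else 0)"
proof -
  have "Poly_Mapping.lookup (expo n k) j = (\<Sum>i<n. if i = j then k j else 0)"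
    unfolding expo_def Poly_Mapping.lookup_sum by (intro sum.cong) (auto simp: Poly_Mapping.lookup_single)
  then show ?thesis by simp
qed

lemma expo_eq_iff: "expo n k = expo n k' \<longleftrightarrow> (\<forall>i<n. k i = k' i)"
proof
  assume "expo n k = expo n k'"
  then have eq: "Poly_Mapping.lookup (expo n k) i = Poly_Mapping.lookup (expo n k') i" for i by simp
  show "\<forall>i<n. k i = k' i"
  proof (intro allI impI)
    fix i assume "i < n"
    then show "k i = k' i" using eq[of i] by (simp add: lookup_expo)
  qed
next
  assume "\<forall>i<n. k i = k' i"
  then show "expo n k = expo n k'" unfolding expo_def by (intro sum.cong) auto
qed

lemma prod_X_perm:
  assumes "p permutes {..<n}"
  shows "(\<Prod>i<n. X (p i) ^ k i) = Poly_Mapping.single (expo n (\<lambda>j. k (Hilbert_Choice.inv p j))) 1"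
proof -
  have "(\<Sum>i<n. Poly_Mapping.single (p i) (k i)) = (\<Sum>i<n. Poly_Mapping.single (p i) (k (Hilbert_Choice.inv p (p i))))"
    using permutes_inverses(2)[OF assms] by simp
  also have "\<dots> = expo n (\<lambda>j. k (Hilbert_Choice.inv p j))"
    unfolding expo_def using sum.permute[OF assms, of "\<lambda>j. Poly_Mapping.single j (k (Hilbert_Choice.inv p j))"]
    by (simp add: o_def)
  finally show ?thesis by (simp add: prod_X_power)
qed

lemma lookup_of_int_times: "Poly_Mapping.lookup (of_int z * (f :: ipoly)) e = z * Poly_Mapping.lookup f e"
  by (induction z rule: int_induct[of _ 0]) (simp_all add: algebra_simps Poly_Mapping.lookup_add Poly_Mapping.lookup_minus)

lemma strict_mono_permutation:
  assumes p: "p permutes {..<n}" and mono: "\<And>i j. i < j \<Longrightarrow> j < n \<Longrightarrow> p i < p j"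
  shows "p = (id :: nat \<Rightarrow> nat)"
proof
  fix i
  have ge: "i \<le> p i" if "i < n" for i using that
  proof (induction i)
    case (Suc i)
    then show ?case using mono[of i "Suc i"] by simp
  qed simp
  have "(\<Sum>i<n. p i) = (\<Sum>i<n. i)" using sum.permute[OF p, of "\<lambda>i. i"] by (simp add: o_def)
  then have eq: "(\<Sum>i<n. p i - i) = 0" using ge sum_subtractf_nat[of "{..<n}" "\<lambda>i. i" p] by simp
  show "p i = id i"
  proof (cases "i < n")
    case True
    then have "p i - i = 0" using eq by simp
    then show ?thesis using ge[OF True] by simp
  next
    case False then show ?thesis using permutes_not_in[OF p] by simp
  qed
qed

text \<open>A permutation that carries one strictly decreasing exponent sequence to another
  preserves the order and is therefore the identity.\<close>

lemma lookup_alternant: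
  assumes k: "\<And>i j. i < j \<Longrightarrow> j < n \<Longrightarrow> k j < k i" and k0: "\<And>i j. i < j \<Longrightarrow> j < n \<Longrightarrow> k0 j < k0 i"
  shows "Poly_Mapping.lookup (alternant n X k) (expo n k0) = of_bool (\<forall>i<n. k i = k0 i)"
proof -
  have summand: "Poly_Mapping.lookup (of_int (sign p) * (\<Prod>i<n. X (p i) ^ k i)) (expo n k0) = (if p = id then of_bool (\<forall>i<n. k i = k0 i) else 0)"
    if p: "p permutes {..<n}" for p
  proof -
    have iff: "expo n (\<lambda>j. k (Hilbert_Choice.inv p j)) = expo n k0 \<longleftrightarrow> (\<forall>i<n. k i = k0 (p i))"
      unfolding expo_eq_iff
    proof (intro iffI allI impI)
      fix i assume h: "\<forall>i<n. k (Hilbert_Choice.inv p i) = k0 i" and i: "i < n"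
      have "p i < n" using permutes_in_image[OF p, of i] i by simp
      then show "k i = k0 (p i)" using h permutes_inverses(2)[OF p, of i] by metis
    next
      fix i assume h: "\<forall>i<n. k i = k0 (p i)" and i: "i < n"
      have "Hilbert_Choice.inv p i < n" using permutes_in_image[OF permutes_inv[OF p], of i] i by simp
      then show "k (Hilbert_Choice.inv p i) = k0 i" using h permutes_inverses(1)[OF p, of i] by metis
    qed
    have "p = id" if h: "\<forall>i<n. k i = k0 (p i)"
    proof (rule strict_mono_permutation[OF p])
      fix i j assume ij: "i < j" "j < (n::nat)"
      have pn: "p i < n" "p j < n" using permutes_in_image[OF p] ij by auto
      have "k0 (p j) < k0 (p i)" using h k[OF ij] ij by simp
      then show "p i < p j" using k0[of "p j" "p i"] pn by (metis linorder_neqE_nat less_asym less_irrefl)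
    qed
    then show ?thesis
      unfolding lookup_of_int_times prod_X_perm[OF p] Poly_Mapping.lookup_single when_def iff
      by (auto simp: sign_id)
  qed
  have "Poly_Mapping.lookup (alternant n X k) (expo n k0) = (\<Sum>p | p permutes {..<n}. if p = id then of_bool (\<forall>i<n. k i = k0 i) else 0)"
    unfolding alternant_def adet_def Poly_Mapping.lookup_sum by (rule sum.cong[OF refl]) (rule summand, simp)
  also have "\<dots> = of_bool (\<forall>i<n. k i = k0 i)"
    by (subst sum.delta) (auto simp: finite_permutations permutes_id)
  finally show ?thesis .
qed

definition pad :: "nat list \<Rightarrow> nat \<Rightarrow> nat" where "pad \<nu> i = (if i < length \<nu> then \<nu> ! i else 0)"

lemma pad_dec:
  assumes "is_partition \<nu>" shows "pad \<nu> (Suc i) \<le> pad \<nu> i"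
proof (cases "Suc i < length \<nu>")
  case True
  have "sorted (rev \<nu>)" using assms by (simp add: is_partition_def)
  then have "\<nu> ! Suc i \<le> \<nu> ! i" using True by (simp add: sorted_rev_nth_mono)
  then show ?thesis using True by (simp add: pad_def)
qed (simp add: pad_def)

lemma pad_mono: "is_partition \<nu> \<Longrightarrow> i \<le> j \<Longrightarrow> pad \<nu> j \<le> pad \<nu> i"
  by (rule lift_Suc_antimono_le[of "pad \<nu>"]) (rule pad_dec)

lemma pad_inj:
  assumes "is_partition \<nu>" "is_partition \<mu>" "length \<nu> \<le> n" "length \<mu> \<le> n" "\<And>i. i < n \<Longrightarrow> pad \<nu> i = pad \<mu> i"
  shows "\<nu> = \<mu>"
proof -
  have pos: "i < length \<rho> \<longleftrightarrow> pad \<rho> i > 0" if "is_partition \<rho>" for \<rho> i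
    using that nth_mem[of i \<rho>] by (auto simp: pad_def is_partition_def)
  have "i < length \<nu> \<longleftrightarrow> i < length \<mu>" for i
    using pos[OF assms(1), of i] pos[OF assms(2), of i] assms(3-5) by (metis less_le_trans)
  then have len: "length \<nu> = length \<mu>" by (metis linorder_neqE_nat less_irrefl)
  show ?thesis
  proof (rule nth_equalityI[OF len])
    fix i assume "i < length \<nu>"
    then show "\<nu> ! i = \<mu> ! i" using assms(5)[of i] assms(3) len by (simp add: pad_def)
  qed
qed

lemma schur_pad:
  assumes "length \<nu> \<le> n" shows "schur n \<nu> = SS n n (pad \<nu>)"
proof (rule schur_eq_SS)
  show "cells \<nu> = shape_cells n (pad \<nu>)"
    unfolding cells_def shape_cells_def using assms by (auto simp: pad_def split: if_splits)
qed

text \<open>The exponents of \<open>\<nu> + delta\<close> with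
  \<open>delta = (n - 1, ..., 0)\<close>.\<close>

definition wexp :: "nat \<Rightarrow> nat list \<Rightarrow> nat \<Rightarrow> nat" where "wexp n \<nu> i = pad \<nu> i + n - 1 - i"

lemma wexp_strict: "is_partition \<nu> \<Longrightarrow> i < j \<Longrightarrow> j < n \<Longrightarrow> wexp n \<nu> j < wexp n \<nu> i"
  using pad_mono[of \<nu> i j] by (simp add: wexp_def)

lemma vdm_schur:
  assumes "is_partition \<nu>" "length \<nu> \<le> n"
  shows "vdm n X * schur n \<nu> = alternant n X (wexp n \<nu>)"
  using bialternant[of n "pad \<nu>"] pad_dec[OF assms(1)] unfolding schur_pad[OF assms(2)] wexp_def[abs_def] by simp

text \<open>After multiplication by the Vandermonde determinant, these coefficients are functionals
  dual to the Schur polynomials; both independence and extraction rest on them.\<close>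

lemma lookup_vdm_schur:
  assumes "is_partition \<nu>" "length \<nu> \<le> n" "is_partition \<mu>" "length \<mu> \<le> n"
  shows "Poly_Mapping.lookup (vdm n X * schur n \<nu>) (expo n (wexp n \<mu>)) = of_bool (\<nu> = \<mu>)"
proof -
  have "(\<forall>i<n. wexp n \<nu> i = wexp n \<mu> i) \<longleftrightarrow> \<nu> = \<mu>"
  proof
    assume "\<forall>i<n. wexp n \<nu> i = wexp n \<mu> i"
    then show "\<nu> = \<mu>" by (intro pad_inj[OF assms(1,3,2,4)]) (fastforce simp: wexp_def)
  qed simp
  then show ?thesis unfolding vdm_schur[OF assms(1,2)]
    using lookup_alternant[of n "wexp n \<nu>" "wexp n \<mu>"] wexp_strict assms by simp
qed

text \<open>The additive group generated by alternants. It is closed under multiplication by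
  \<open>hsym\<close>, and each member is the Vandermonde determinant times an integral combination
  of Schur polynomials, so it gives existence of Schur expansions without a theory of symmetric
  polynomials.\<close>

inductive_set AS :: "nat \<Rightarrow> ipoly set" for n where
  AS_base: "of_int z * alternant n X k \<in> AS n"
| AS_add: "f \<in> AS n \<Longrightarrow> g \<in> AS n \<Longrightarrow> f + g \<in> AS n"

lemma AS_zero: "0 \<in> AS n" using AS_base[of 0 n] by simp

lemma AS_sum: "finite S \<Longrightarrow> (\<And>s. s \<in> S \<Longrightarrow> f s \<in> AS n) \<Longrightarrow> (\<Sum>s\<in>S. f s) \<in> AS n"
  by (induction S rule: finite_induct) (auto intro: AS_zero AS_add)

lemma AS_scale: "f \<in> AS n \<Longrightarrow> of_int z * f \<in> AS n"
proof (induction rule: AS.induct)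
  case (AS_base z' k)
  have "of_int z * (of_int z' * alternant n X k) = of_int (z * z') * alternant n X k" by (simp add: mult.assoc)
  then show ?case by (simp only: AS.AS_base)
next
  case (AS_add f g)
  then show ?case by (simp add: distrib_left AS.AS_add)
qed

lemma hsym_permute:
  assumes p: "p permutes {..<n}"
  shows "(\<Sum>a\<in>compos n d. \<Prod>i<n. x i ^ a i) = (\<Sum>a\<in>compos n d. \<Prod>i<n. x (p i) ^ a i :: 'a :: comm_ring_1)"
proof (rule sum.reindex_bij_witness[of _ "\<lambda>a. a \<circ> Hilbert_Choice.inv p" "\<lambda>a. a \<circ> p"])
  have cp: "a \<circ> q \<in> compos n d" if "a \<in> compos n d" and q: "q permutes {..<n}" for a q
  proof -
    have "(\<Sum>i<n. a (q i)) = (\<Sum>i<n. a i)" using sum.permute[OF q, of a] by (simp add: o_def)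
    moreover have "q i = i" if "n \<le> i" for i using permutes_not_in[OF q, of i] that by simp
    ultimately show ?thesis using that by (auto simp: compos_def)
  qed
  fix a assume a: "a \<in> compos n d"
  show "a \<circ> p \<in> compos n d" by (rule cp[OF a p])
  show "a \<circ> Hilbert_Choice.inv p \<in> compos n d" by (rule cp[OF a permutes_inv[OF p]])
  show "a \<circ> p \<circ> Hilbert_Choice.inv p = a" "a \<circ> Hilbert_Choice.inv p \<circ> p = a"
    using permutes_inverses[OF p] by (auto simp: fun_eq_iff)
  show "(\<Prod>i<n. x (p i) ^ (a \<circ> p) i) = (\<Prod>i<n. x i ^ a i)"
    using prod.permute[OF p, of "\<lambda>i. x i ^ a i"] by (simp add: o_def)
qed

text \<open>By symmetry of \<open>hsym\<close>, its variables can be permuted separately in each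
  Leibniz term, along with those of the alternant.\<close>

lemma alternant_times_hsym:
  "alternant n x k * hsym n x d = (if d < 0 then 0 else (\<Sum>a\<in>compos n (nat d). alternant n x (\<lambda>i. k i + a i)))"
proof (cases "d < 0")
  case False
  have "alternant n x k * hsym n x d = (\<Sum>p | p permutes {..<n}. of_int (sign p) * (\<Prod>i<n. x (p i) ^ k i) * (\<Sum>a\<in>compos n (nat d). \<Prod>i<n. x (p i) ^ a i))"
    unfolding alternant_def adet_def sum_distrib_right
  proof (rule sum.cong[OF refl])
    fix p assume "p \<in> {p. p permutes {..<n}}"
    then have p: "p permutes {..<n}" by simp
    have "hsym n x d = (\<Sum>a\<in>compos n (nat d). \<Prod>i<n. x (p i) ^ a i)"
      using hsym_permute[OF p, of x "nat d"] False by (simp add: hsym_def)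
    then show "of_int (sign p) * (\<Prod>i<n. x (p i) ^ k i) * hsym n x d = of_int (sign p) * (\<Prod>i<n. x (p i) ^ k i) * (\<Sum>a\<in>compos n (nat d). \<Prod>i<n. x (p i) ^ a i)"
      by (simp only:)
  qed
  also have "\<dots> = (\<Sum>p | p permutes {..<n}. \<Sum>a\<in>compos n (nat d). of_int (sign p) * (\<Prod>i<n. x (p i) ^ (k i + a i)))"
    by (simp add: sum_distrib_left power_add prod.distrib mult.assoc)
  also have "\<dots> = (\<Sum>a\<in>compos n (nat d). alternant n x (\<lambda>i. k i + a i))"
    unfolding alternant_def adet_def by (rule sum.swap)
  finally show ?thesis using False by simp
qed (simp add: hsym_def)

lemma AS_hsym: "f \<in> AS n \<Longrightarrow> f * hsym n X d \<in> AS n"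
proof (induction rule: AS.induct)
  case (AS_base z k)
  have "alternant n X k * hsym n X d \<in> AS n"
  proof (cases "d < 0")
    case False
    have "alternant n X k' \<in> AS n" for k' using AS.AS_base[of 1 n k'] by simp
    then show ?thesis unfolding alternant_times_hsym using False by (auto intro: AS_sum)
  qed (simp add: hsym_def AS_zero)
  then show ?case using AS_scale[of _ n z] by (simp add: mult.assoc)
next
  case (AS_add f g)
  then show ?case by (simp add: distrib_right AS.AS_add)
qed

lemma AS_prod_hsym: "finite S \<Longrightarrow> f \<in> AS n \<Longrightarrow> f * (\<Prod>s\<in>S. hsym n X (d s)) \<in> AS n"
proof (induction S arbitrary: f rule: finite_induct)
  case (insert s S)
  have "f * (\<Prod>s\<in>insert s S. hsym n X (d s)) = (f * hsym n X (d s)) * (\<Prod>s\<in>S. hsym n X (d s))"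
    using insert by (simp add: mult.assoc)
  then show ?case by (simp only: insert.IH[OF AS_hsym[OF insert.prems]])
qed simp

lemma AS_adet: "f \<in> AS n \<Longrightarrow> f * adet l (\<lambda>i j. hsym n X (d i j)) \<in> AS n"
proof -
  assume f: "f \<in> AS n"
  have "f * adet l (\<lambda>i j. hsym n X (d i j)) = (\<Sum>p | p permutes {..<l}. of_int (sign p) * (f * (\<Prod>i<l. hsym n X (d i (p i)))))"
    unfolding adet_def by (simp add: sum_distrib_left mult_ac)
  also have "\<dots> \<in> AS n" using f by (intro AS_sum AS_scale AS_prod_hsym) (auto simp: finite_permutations)
  finally show ?thesis .
qed

lemma decreasing_rearrangement:
  fixes k :: "nat \<Rightarrow> nat" and n :: nat
  assumes "inj_on k {..<n}"
  shows "\<exists>p. p permutes {..<n} \<and> (\<forall>i j. i < j \<longrightarrow> j < n \<longrightarrow> (k (p j) :: nat) < k (p i))"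
proof -
  define M where "M = k ` {..<n}"
  have cM: "card M = n" using assms by (simp add: M_def card_image)
  obtain h where h: "bij_betw h {..<n} M" "strict_mono_on {..<n} h"
    using ex_bij_betw_strict_mono_card[of M] cM by (auto simp: M_def)
  define p where "p = (\<lambda>i. if i < n then inv_into {..<n} k (h (n - 1 - i)) else i)"
  have hm: "h (n - 1 - i) \<in> M" if "i < n" for i using bij_betwE[OF h(1)] that by auto
  have kp: "k (p i) = h (n - 1 - i)" "p i < n" if "i < n" for i
    using hm[OF that] that f_inv_into_f[of "h (n - 1 - i)" k "{..<n}"] inv_into_into[of "h (n - 1 - i)" k "{..<n}"]
    by (auto simp: p_def M_def)
  have dec: "k (p j) < k (p i)" if "i < j" "j < n" for i j
    using strict_mono_onD[OF h(2), of "n - 1 - j" "n - 1 - i"] that kp by auto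
  have "inj_on p {..<n}"
  proof (rule inj_onI)
    fix i j assume "i \<in> {..<n}" "j \<in> {..<n}" "p i = p j"
    then show "i = j" using dec[of i j] dec[of j i] by (cases i j rule: linorder_cases) auto
  qed
  moreover have "p ` {..<n} \<subseteq> {..<n}" using kp by auto
  ultimately have "bij_betw p {..<n} {..<n}" by (simp add: bij_betw_def endo_inj_surj)
  then have "p permutes {..<n}" by (rule bij_imp_permutes) (simp add: p_def)
  then show ?thesis using dec by blast
qed

lemma partition_of_decreasing:
  assumes "\<And>i. Suc i < n \<Longrightarrow> lam (Suc i) \<le> lam i"
  shows "\<exists>\<nu>. is_partition \<nu> \<and> length \<nu> \<le> n \<and> (\<forall>i<n. pad \<nu> i = lam i)"
proof -
  define D where "D = {i. i < n \<and> lam i > 0}"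
  have D: "D = {..<card D}"
  proof (rule downward_closed_eq)
    fix j assume "Suc j \<in> D"
    then show "j \<in> D" using assms[of j] by (auto simp: D_def)
  qed (simp add: D_def)
  have Dm: "i \<in> D \<longleftrightarrow> i < card D" for i using arg_cong[OF D, of "\<lambda>S. i \<in> S"] by (simp only: lessThan_iff)
  have le: "card D \<le> n" using card_mono[of "{..<n}" D] by (auto simp: D_def)
  have dec: "lam j \<le> lam i" if "i \<le> j" "j < n" for i j using that
  proof (induction j)
    case (Suc j) then show ?case using assms[of j] by (cases "i = Suc j") auto
  qed simp
  define \<nu> where "\<nu> = map lam [0..<card D]"
  have "sorted (rev \<nu>)" unfolding sorted_rev_iff_nth_mono
    using dec le by (auto simp: \<nu>_def)
  moreover have "lam i > 0" if "i < card D" for i using Dm[of i] that unfolding D_def by blast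
  then have "\<forall>x\<in>set \<nu>. 0 < x" by (auto simp: \<nu>_def)
  moreover have "pad \<nu> i = lam i" if "i < n" for i
  proof (cases "i < card D")
    case False
    then have "i \<notin> D" using Dm by blast
    then have "lam i = 0" using that unfolding D_def by simp
    then show ?thesis using False by (simp add: pad_def \<nu>_def)
  qed (simp add: pad_def \<nu>_def)
  ultimately show ?thesis using le by (intro exI[of _ \<nu>]) (auto simp: is_partition_def \<nu>_def)
qed

text \<open>Repeated exponents give two equal rows; distinct ones are sorted, at the cost of a sign,
  into \<open>\<nu> + delta\<close>.\<close>

lemma alternant_schur:
  "\<exists>z \<nu>. is_partition \<nu> \<and> length \<nu> \<le> n \<and> alternant n X k = of_int z * (vdm n X * schur n \<nu>)"
proof (cases "inj_on k {..<n}")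
  case False
  then obtain i j where ij: "i < n" "j < n" "i \<noteq> j" "k i = k j" by (auto simp: inj_on_def)
  have "alternant n X k = 0"
    unfolding alternant_def adet_eq_det
    by (rule det_identical_rows[OF mat_carrier ij(3,1,2)]) (use ij in \<open>auto intro!: eq_vecI\<close>)
  moreover have "is_partition []" by (simp add: is_partition_def)
  ultimately show ?thesis by (intro exI[of _ 0] exI[of _ "[]"]) simp
next
  case True
  obtain p where p: "p permutes {..<n}" and dec: "\<And>i j. i < j \<Longrightarrow> j < n \<Longrightarrow> k (p j) < k (p i)"
    using decreasing_rearrangement[OF True] by blast
  define lam where "lam = (\<lambda>i. k (p i) - (n - 1 - i))"
  have step: "k (p (n - 1 - d)) \<ge> d" if "d < n" for d using that
  proof (induction d)
    case (Suc d)
    have "k (p (n - 1 - d)) < k (p (n - 1 - Suc d))" using Suc.prems by (intro dec) auto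
    then show ?case using Suc by simp
  qed simp
  have ge: "n - 1 - i \<le> k (p i)" if "i < n" for i using step[of "n - 1 - i"] that by simp
  have "lam (Suc i) \<le> lam i" if "Suc i < n" for i
    using dec[of i "Suc i"] that by (simp add: lam_def)
  then obtain \<nu> where \<nu>: "is_partition \<nu>" "length \<nu> \<le> n" "\<And>i. i < n \<Longrightarrow> pad \<nu> i = lam i"
    using partition_of_decreasing[of n lam] by blast
  have w: "wexp n \<nu> i = k (p i)" if "i < n" for i
    using ge[OF that] \<nu>(3)[OF that] that by (simp add: wexp_def lam_def)
  have "of_int (sign p) * alternant n X k = alternant n X (\<lambda>i. k (p i))"
    unfolding alternant_def using adet_permute_rows[OF p, of "\<lambda>i j. X j ^ k i"] by simp
  also have "\<dots> = alternant n X (wexp n \<nu>)" using w by (intro alternant_cong) simp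
  also have "\<dots> = vdm n X * schur n \<nu>" by (simp add: vdm_schur[OF \<nu>(1,2)])
  finally have "of_int (sign p) * (of_int (sign p) * alternant n X k) = of_int (sign p) * (vdm n X * schur n \<nu>)" by simp
  moreover have "of_int (sign p) * (of_int (sign p) * alternant n X k) = alternant n X k"
    by (simp add: sign_def)
  ultimately show ?thesis using \<nu> by metis
qed

definition schur_coeffs :: "nat \<Rightarrow> (nat list \<Rightarrow> int) \<Rightarrow> bool" where
  "schur_coeffs n c \<longleftrightarrow> finite {\<nu>. c \<nu> \<noteq> 0} \<and> (\<forall>\<nu>. c \<nu> \<noteq> 0 \<longrightarrow> is_partition \<nu> \<and> length \<nu> \<le> n)"

lemma AS_schur_expansion:
  "g \<in> AS n \<Longrightarrow> \<exists>c. schur_coeffs n c \<and> g = vdm n X * (\<Sum>\<nu> | c \<nu> \<noteq> 0. of_int (c \<nu>) * schur n \<nu>)"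
proof (induction rule: AS.induct)
  case (AS_base z k)
  obtain z' \<nu> where \<nu>: "is_partition \<nu>" "length \<nu> \<le> n" "alternant n X k = of_int z' * (vdm n X * schur n \<nu>)"
    using alternant_schur by blast
  define c where "c = (\<lambda>\<rho>. if \<rho> = \<nu> then z * z' else 0)"
  have "(\<Sum>\<rho> | c \<rho> \<noteq> 0. of_int (c \<rho>) * schur n \<rho>) = (\<Sum>\<rho>\<in>{\<nu>}. of_int (c \<rho>) * schur n \<rho>)"
    by (rule sum.mono_neutral_left) (auto simp: c_def)
  then have "of_int z * alternant n X k = vdm n X * (\<Sum>\<rho> | c \<rho> \<noteq> 0. of_int (c \<rho>) * schur n \<rho>)"
    using \<nu>(3) by (simp add: c_def mult_ac)
  moreover have "schur_coeffs n c" using \<nu> by (auto simp: schur_coeffs_def c_def)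
  ultimately show ?case by blast
next
  case (AS_add f g)
  then obtain c d where c: "schur_coeffs n c" "f = vdm n X * (\<Sum>\<nu> | c \<nu> \<noteq> 0. of_int (c \<nu>) * schur n \<nu>)"
    and d: "schur_coeffs n d" "g = vdm n X * (\<Sum>\<nu> | d \<nu> \<noteq> 0. of_int (d \<nu>) * schur n \<nu>)" by blast
  define U where "U = {\<nu>. c \<nu> \<noteq> 0} \<union> {\<nu>. d \<nu> \<noteq> 0}"
  have fU: "finite U" using c d by (simp add: U_def schur_coeffs_def)
  have ext: "(\<Sum>\<nu> | b \<nu> \<noteq> 0. of_int (b \<nu>) * schur n \<nu>) = (\<Sum>\<nu>\<in>U. of_int (b \<nu>) * schur n \<nu>)" if "{\<nu>. b \<nu> \<noteq> 0} \<subseteq> U" for b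
    using that fU by (intro sum.mono_neutral_left) auto
  have "f + g = vdm n X * (\<Sum>\<nu>\<in>U. of_int (c \<nu> + d \<nu>) * schur n \<nu>)"
    unfolding c(2) d(2) by (subst (1 2) ext) (auto simp: U_def distrib_left distrib_right sum.distrib)
  also have "(\<Sum>\<nu>\<in>U. of_int (c \<nu> + d \<nu>) * schur n \<nu>) = (\<Sum>\<nu> | c \<nu> + d \<nu> \<noteq> 0. of_int (c \<nu> + d \<nu>) * schur n \<nu>)"
    by (rule ext[of "\<lambda>\<nu>. c \<nu> + d \<nu>", symmetric]) (auto simp: U_def)
  finally have "f + g = vdm n X * (\<Sum>\<nu> | c \<nu> + d \<nu> \<noteq> 0. of_int (c \<nu> + d \<nu>) * schur n \<nu>)" .
  moreover have "schur_coeffs n (\<lambda>\<nu>. c \<nu> + d \<nu>)"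
    unfolding schur_coeffs_def
  proof
    show "finite {\<nu>. c \<nu> + d \<nu> \<noteq> 0}" by (rule finite_subset[OF _ fU]) (auto simp: U_def)
    show "\<forall>\<nu>. c \<nu> + d \<nu> \<noteq> 0 \<longrightarrow> is_partition \<nu> \<and> length \<nu> \<le> n" using c d unfolding schur_coeffs_def by force
  qed
  ultimately show ?case by (intro exI[of _ "\<lambda>\<nu>. c \<nu> + d \<nu>"]) simp
qed

lemma vdm_in_AS: "vdm n X \<in> AS n" unfolding vdm_def using AS_base[of 1 n] by simp

lemma vdm_nonzero: "vdm n X \<noteq> 0"
proof
  assume "vdm n X = 0"
  moreover have "Poly_Mapping.lookup (vdm n X * schur n []) (expo n (wexp n [])) = 1"
    by (subst lookup_vdm_schur) (auto simp: is_partition_def)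
  ultimately show False by simp
qed

lemma schur_coeff_extract:
  assumes c: "schur_coeffs n c" and f: "f = (\<Sum>\<nu> | c \<nu> \<noteq> 0. of_int (c \<nu>) * schur n \<nu>)"
    and \<mu>: "is_partition \<mu>" "length \<mu> \<le> n"
  shows "Poly_Mapping.lookup (vdm n X * f) (expo n (wexp n \<mu>)) = c \<mu>"
proof -
  have fin: "finite {\<nu>. c \<nu> \<noteq> 0}" using c by (simp add: schur_coeffs_def)
  have "Poly_Mapping.lookup (vdm n X * f) (expo n (wexp n \<mu>)) = (\<Sum>\<nu> | c \<nu> \<noteq> 0. c \<nu> * Poly_Mapping.lookup (vdm n X * schur n \<nu>) (expo n (wexp n \<mu>)))"
    unfolding f sum_distrib_left Poly_Mapping.lookup_sum
    by (intro sum.cong refl) (simp only: mult.left_commute[of "vdm n X"] lookup_of_int_times)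
  also have "\<dots> = (\<Sum>\<nu> | c \<nu> \<noteq> 0. if \<nu> = \<mu> then c \<mu> else 0)"
  proof (rule sum.cong[OF refl])
    fix \<nu> assume "\<nu> \<in> {\<nu>. c \<nu> \<noteq> 0}"
    then have "is_partition \<nu>" "length \<nu> \<le> n" using c by (auto simp: schur_coeffs_def)
    then show "c \<nu> * Poly_Mapping.lookup (vdm n X * schur n \<nu>) (expo n (wexp n \<mu>)) = (if \<nu> = \<mu> then c \<mu> else 0)"
      using lookup_vdm_schur \<mu> by simp
  qed
  also have "\<dots> = c \<mu>" using fin by auto
  finally show ?thesis .
qed

text \<open>The definite description in \<open>lr_coeff\<close> denotes: an expansion exists by
  membership in \<open>AS\<close> after cancelling \<open>vdm\<close>, and its coefficients are
  unique because the dual functionals recover them.\<close>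

theorem lr_coeff_eq_lookup:
  assumes n: "n = (\<Sum>la\<leftarrow>las. sum_list la)" and AS: "vdm n X * (\<Prod>la\<leftarrow>las. schur n la) \<in> AS n"
    and \<mu>: "is_partition (filter (\<lambda>x. 0 < x) mu)" "length (filter (\<lambda>x. 0 < x) mu) \<le> n"
  shows "lr_coeff las mu = Poly_Mapping.lookup (vdm n X * (\<Prod>la\<leftarrow>las. schur n la)) (expo n (wexp n (filter (\<lambda>x. 0 < x) mu)))"
proof -
  let ?f = "\<Prod>la\<leftarrow>las. schur n la"
  let ?P = "\<lambda>c. finite {nu. c nu \<noteq> 0} \<and> (\<forall>nu. c nu \<noteq> 0 \<longrightarrow> is_partition nu \<and> length nu \<le> n)
        \<and> ?f = (\<Sum>nu\<in>{nu. c nu \<noteq> 0}. of_int (c nu) * schur n nu)"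
  obtain c where c: "schur_coeffs n c" "vdm n X * ?f = vdm n X * (\<Sum>\<nu> | c \<nu> \<noteq> 0. of_int (c \<nu>) * schur n \<nu>)"
    using AS_schur_expansion[OF AS] by blast
  then have fc: "?f = (\<Sum>\<nu> | c \<nu> \<noteq> 0. of_int (c \<nu>) * schur n \<nu>)" using vdm_nonzero by simp
  then have Pc: "?P c" using c(1) by (simp add: schur_coeffs_def)
  have "d = c" if d: "?P d" for d
  proof
    fix \<nu>
    have sd: "schur_coeffs n d" using d by (simp add: schur_coeffs_def)
    show "d \<nu> = c \<nu>"
    proof (cases "is_partition \<nu> \<and> length \<nu> \<le> n")
      case True
      then show ?thesis using schur_coeff_extract[OF sd, of ?f \<nu>] schur_coeff_extract[OF c(1) fc, of \<nu>] d by simp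
    next
      case False
      then show ?thesis using sd c(1) unfolding schur_coeffs_def by metis
    qed
  qed
  then have "(THE c. ?P c) = c" using Pc by (rule the_equality[of ?P, rotated])
  then have "lr_coeff las mu = c (filter (\<lambda>x. 0 < x) mu)"
    unfolding lr_coeff_def Let_def n[symmetric] by simp
  also have "\<dots> = Poly_Mapping.lookup (vdm n X * ?f) (expo n (wexp n (filter (\<lambda>x. 0 < x) mu)))"
    by (rule schur_coeff_extract[OF c(1) fc \<mu>, symmetric])
  finally show ?thesis .
qed

section \<open>The coefficient as an alternating sum of weight multiplicities\<close>

lemma prod_one_minus_expand:
  fixes f :: "'b \<Rightarrow> 'a :: comm_ring_1"
  assumes "finite R"
  shows "(\<Prod>j\<in>R. 1 - f j) = (\<Sum>S\<in>Pow R. (-1) ^ card S * (\<Prod>j\<in>S. f j))"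
  using assms
proof (induction R rule: finite_induct)
  case (insert a R)
  have inj: "inj_on (insert a) (Pow R)" using insert.hyps by (auto simp: inj_on_def)
  have "(\<Sum>S\<in>Pow (insert a R). (-1) ^ card S * (\<Prod>j\<in>S. f j)) = (\<Sum>S\<in>Pow R. (-1) ^ card S * (\<Prod>j\<in>S. f j)) + (\<Sum>S\<in>insert a ` Pow R. (-1) ^ card S * (\<Prod>j\<in>S. f j))"
    unfolding Pow_insert using insert.hyps by (intro sum.union_disjoint) auto
  also have "(\<Sum>S\<in>insert a ` Pow R. (-1) ^ card S * (\<Prod>j\<in>S. f j)) = (\<Sum>S\<in>Pow R. (-1) ^ card (insert a S) * (\<Prod>j\<in>insert a S. f j))"
    using inj by (simp add: sum.reindex)
  also have "\<dots> = (\<Sum>S\<in>Pow R. - f a * ((-1) ^ card S * (\<Prod>j\<in>S. f j)))"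
  proof (rule sum.cong[OF refl])
    fix S assume "S \<in> Pow R"
    then have "finite S" "a \<notin> S" using insert.hyps finite_subset by auto
    then show "(-1) ^ card (insert a S) * (\<Prod>j\<in>insert a S. f j) = - f a * ((-1) ^ card S * (\<Prod>j\<in>S. f j))" by simp
  qed
  also have "\<dots> = - f a * (\<Sum>S\<in>Pow R. (-1) ^ card S * (\<Prod>j\<in>S. f j))" by (rule sum_distrib_left[symmetric])
  finally show ?case using insert by (simp add: left_diff_distrib)
qed simp

text \<open>Any function \<open>F\<close> on exponents extends linearly to the group ring, so an
  identity there can be evaluated by \<open>F\<close>.\<close>

lemma sum_single_functional:
  fixes c :: "'a \<Rightarrow> real" and d :: "'b \<Rightarrow> real" and F :: "'m \<Rightarrow> real"
  assumes "finite A" "finite B"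
    and eq: "(\<Sum>a\<in>A. Poly_Mapping.single (g a) (c a)) = (\<Sum>b\<in>B. Poly_Mapping.single (h b) (d b))"
  shows "(\<Sum>a\<in>A. c a * F (g a)) = (\<Sum>b\<in>B. d b * F (h b))"
proof -
  define K where "K = g ` A \<union> h ` B"
  have fK: "finite K" using assms by (simp add: K_def)
  have "(\<Sum>a\<in>S. e a * F (r a)) = (\<Sum>\<kappa>\<in>K. Poly_Mapping.lookup (\<Sum>a\<in>S. Poly_Mapping.single (r a) (e a)) \<kappa> * F \<kappa>)"
    if "r ` S \<subseteq> K" for S :: "'s set" and e :: "'s \<Rightarrow> real" and r
  proof -
    have "(\<Sum>\<kappa>\<in>K. Poly_Mapping.lookup (\<Sum>a\<in>S. Poly_Mapping.single (r a) (e a)) \<kappa> * F \<kappa>) = (\<Sum>\<kappa>\<in>K. \<Sum>a\<in>S. if \<kappa> = r a then e a * F (r a) else 0)"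
      unfolding Poly_Mapping.lookup_sum sum_distrib_right
      by (intro sum.cong refl) (auto simp: Poly_Mapping.lookup_single when_def)
    also have "\<dots> = (\<Sum>a\<in>S. \<Sum>\<kappa>\<in>K. if \<kappa> = r a then e a * F (r a) else 0)" by (rule sum.swap)
    also have "\<dots> = (\<Sum>a\<in>S. e a * F (r a))"
      using that fK by (intro sum.cong refl) auto
    finally show ?thesis by simp
  qed
  from this[of g A c] this[of h B d] show ?thesis using eq by (simp add: K_def)
qed

section \<open>The Weyl denominator formula\<close>

lemma unit_powers:
  fixes u v :: "'a :: comm_ring_1"
  assumes "u * v = 1" "x + y' = x' + y"
  shows "u ^ x * v ^ y = u ^ x' * v ^ y'"
proof -
  have uv: "u ^ d * v ^ d = 1" for d using assms(1) by (simp flip: power_mult_distrib)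
  have "u ^ x * v ^ y = u ^ x * v ^ y * (u ^ y' * v ^ y')" using uv by simp
  also have "\<dots> = u ^ (x + y') * v ^ y * v ^ y'" by (simp add: power_add mult_ac)
  also have "\<dots> = u ^ x' * (u ^ y * v ^ y) * v ^ y'" unfolding assms(2) by (simp add: power_add mult_ac)
  finally show ?thesis using uv by simp
qed

text \<open>Taking \<open>u a\<close> out of each factor leaves the Vandermonde product in the
  \<open>v a\<close>; as \<open>u a\<close> and \<open>v a\<close> are inverse to each other, only
  differences of exponents matter and the extra powers cancel.\<close>

lemma weyl_denominator_block:
  fixes u v :: "nat \<Rightarrow> 'a :: comm_ring_1"
  assumes uv: "\<And>a. a < L \<Longrightarrow> u a * v a = 1"
  shows "(\<Prod>a'<L. \<Prod>a<a'. 1 - u a * v a') = (\<Sum>p | p permutes {..<L}. of_int (sign p) * (\<Prod>a<L. u a ^ p a * v a ^ a))"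
proof -
  have "(\<Prod>a'<L. \<Prod>a<a'. 1 - u a * v a') = (\<Prod>a'<L. \<Prod>a<a'. u a * (v a - v a'))"
    using uv by (intro prod.cong refl) (auto simp: right_diff_distrib)
  also have "\<dots> = (\<Prod>a'<L. \<Prod>a<a'. u a) * vdm L v" by (simp add: prod.distrib vdm_prod)
  also have "(\<Prod>a'<L. \<Prod>a<a'. u a) = (\<Prod>a<L. u a ^ (L - 1 - a))"
  proof (induction L)
    case (Suc L)
    have "(\<Prod>a<L. u a ^ (L - 1 - a)) * (\<Prod>a<L. u a) = (\<Prod>a<L. u a ^ (L - a))"
      unfolding prod.distrib[symmetric]
    proof (rule prod.cong[OF refl])
      fix a assume "a \<in> {..<L}"
      then have "L - a = Suc (L - 1 - a)" by auto
      then show "u a ^ (L - 1 - a) * u a = u a ^ (L - a)" by (simp add: mult.commute)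
    qed
    then show ?case using Suc by simp
  qed simp
  also have "(\<Prod>a<L. u a ^ (L - 1 - a)) * vdm L v = (\<Sum>p | p permutes {..<L}. of_int (sign p) * (\<Prod>a<L. u a ^ (L - 1 - a) * v a ^ (L - 1 - p a)))"
    unfolding vdm_expand by (simp add: sum_distrib_left prod.distrib mult_ac)
  also have "\<dots> = (\<Sum>p | p permutes {..<L}. of_int (sign p) * (\<Prod>a<L. u a ^ p a * v a ^ a))"
  proof (rule sum.cong[OF refl])
    fix p assume p: "p \<in> {p. p permutes {..<L}}"
    have "u a ^ (L - 1 - a) * v a ^ (L - 1 - p a) = u a ^ p a * v a ^ a" if "a \<in> {..<L}" for a
    proof -
      have "a < L" "p a < L" using that p permutes_in_image[of p "{..<L}" a] by auto
      then show ?thesis by (intro unit_powers uv) auto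
    qed
    then have "(\<Prod>a<L. u a ^ (L - 1 - a) * v a ^ (L - 1 - p a)) = (\<Prod>a<L. u a ^ p a * v a ^ a)" by (rule prod.cong[OF refl])
    then show "of_int (sign p) * (\<Prod>a<L. u a ^ (L - 1 - a) * v a ^ (L - 1 - p a)) = of_int (sign p) * (\<Prod>a<L. u a ^ p a * v a ^ a)"
      by (simp only:)
  qed
  finally show ?thesis .
qed

context tables begin

definition Perms :: "(nat \<Rightarrow> nat \<Rightarrow> nat) set" where
  "Perms = PiE {..k} (\<lambda>b. {p. p permutes {..<sz b}})"

definition psgn :: "(nat \<Rightarrow> nat \<Rightarrow> nat) \<Rightarrow> int" where "psgn P = (\<Prod>b\<le>k. sign (P b))"

text \<open>This is \<open>rho\<close> minus the permuted \<open>rho\<close>, since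
  \<open>rho\<close> decreases by 1 from entry to entry within a block.\<close>

definition pshift :: "(nat \<Rightarrow> nat \<Rightarrow> nat) \<Rightarrow> idx \<Rightarrow> int" where
  "pshift P x = (if x \<in> I then int (P (fst x) (snd x)) - int (snd x) else 0)"

lemma finite_Perms [simp]: "finite Perms" unfolding Perms_def by (intro finite_PiE) (auto simp: finite_permutations)

lemma weyl_denominator:
  fixes u v :: "idx \<Rightarrow> 'a :: comm_ring_1"
  assumes uv: "\<And>x. u x * v x = 1"
  shows "(\<Sum>S\<in>Pow Rp. (-1) ^ card S * (\<Prod>(p, q)\<in>S. u p * v q)) = (\<Sum>P\<in>Perms. of_int (psgn P) * (\<Prod>x\<in>I. u x ^ P (fst x) (snd x) * v x ^ snd x))"
proof -
  have "(\<Sum>S\<in>Pow Rp. (-1) ^ card S * (\<Prod>(p, q)\<in>S. u p * v q)) = (\<Prod>(p, q)\<in>Rp. 1 - u p * v q)"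
    using prod_one_minus_expand[OF finite_Rp, of "\<lambda>(p, q). u p * v q"] by (simp add: case_prod_beta)
  also have "\<dots> = (\<Prod>t\<in>(SIGMA b:{..k}. SIGMA a':{..<sz b}. {..<a'}). 1 - u (fst t, snd (snd t)) * v (fst t, fst (snd t)))"
    by (rule prod.reindex_bij_witness[of _ "\<lambda>t. ((fst t, snd (snd t)), (fst t, fst (snd t)))" "\<lambda>(p, q). (fst p, snd q, snd p)"])
       (auto simp: Rp_def I_def)
  also have "\<dots> = (\<Prod>b\<le>k. \<Prod>a'<sz b. \<Prod>a<a'. 1 - u (b, a) * v (b, a'))"
    by (simp add: prod.Sigma case_prod_beta)
  also have "\<dots> = (\<Prod>b\<le>k. \<Sum>p | p permutes {..<sz b}. of_int (sign p) * (\<Prod>a<sz b. u (b, a) ^ p a * v (b, a) ^ a))"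
    by (intro prod.cong refl weyl_denominator_block uv)
  also have "\<dots> = (\<Sum>P\<in>Perms. \<Prod>b\<le>k. of_int (sign (P b)) * (\<Prod>a<sz b. u (b, a) ^ P b a * v (b, a) ^ a))"
    unfolding Perms_def by (rule prod_sum_PiE) (auto simp: finite_permutations)
  also have "\<dots> = (\<Sum>P\<in>Perms. of_int (psgn P) * (\<Prod>x\<in>I. u x ^ P (fst x) (snd x) * v x ^ snd x))"
    unfolding psgn_def I_def by (simp add: prod.distrib prod.Sigma[symmetric] case_prod_beta prod.Sigma)
  finally show ?thesis .
qed

text \<open>The denominator formula in the group ring of integral weights, evaluated by
  \<open>F\<close>. It trades the many subsets of roots for the shifts
  \<open>rho - w rho\<close>.\<close>

lemma weyl_functional:
  fixes F :: "(idx \<Rightarrow> int) \<Rightarrow> real"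
  shows "(\<Sum>S\<in>Pow Rp. (-1) ^ card S * F (\<gamma> S)) = (\<Sum>P\<in>Perms. of_int (psgn P) * F (pshift P))"
proof -
  define u where "u = (\<lambda>x :: idx. Poly_Mapping.single (Poly_Mapping.single x (1::int)) (1::real))"
  define v where "v = (\<lambda>x :: idx. Poly_Mapping.single (Poly_Mapping.single x (-1::int)) (1::real))"
  have uv: "u x * v x = 1" for x
    by (simp add: u_def v_def mult_single single_add[symmetric])
  have upow: "u x ^ d = Poly_Mapping.single (Poly_Mapping.single x (int d)) 1" for x d
    by (induction d) (simp_all add: u_def mult_single single_add[symmetric])
  have vpow: "v x ^ d = Poly_Mapping.single (Poly_Mapping.single x (- int d)) 1" for x d
    by (induction d) (simp_all add: v_def mult_single single_add[symmetric])
  have ps: "(\<Prod>j\<in>S. Poly_Mapping.single (e j) (1::real)) = Poly_Mapping.single (\<Sum>j\<in>S. e j) 1" if "finite S"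
    for S :: "'s set" and e :: "'s \<Rightarrow> idx \<Rightarrow>\<^sub>0 int"
    using that by (induction S rule: finite_induct) (simp_all add: mult_single)
  have sc: "of_int z * Poly_Mapping.single \<kappa> (1::real) = Poly_Mapping.single \<kappa> (of_int z)" for z and \<kappa> :: "idx \<Rightarrow>\<^sub>0 int"
  proof -
    have "of_int z * Poly_Mapping.single \<kappa> (1::real) = Poly_Mapping.single 0 (of_int z) * Poly_Mapping.single \<kappa> (1::real)" by simp
    also have "\<dots> = Poly_Mapping.single \<kappa> (of_int z)" unfolding mult_single by simp
    finally show ?thesis .
  qed
  define g where "g = (\<lambda>S :: (idx \<times> idx) set. \<Sum>(p, q)\<in>S. Poly_Mapping.single p (1::int) + Poly_Mapping.single q (-1))"
  define h where "h = (\<lambda>P. \<Sum>x\<in>I. Poly_Mapping.single x (int (P (fst x) (snd x))) + Poly_Mapping.single x (- int (snd x)))"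
  have "(\<Sum>S\<in>Pow Rp. Poly_Mapping.single (g S) ((-1 :: real) ^ card S)) = (\<Sum>P\<in>Perms. Poly_Mapping.single (h P) (of_int (psgn P)))"
  proof -
    have "(-1) ^ card S * (\<Prod>(p, q)\<in>S. u p * v q) = Poly_Mapping.single (g S) ((-1) ^ card S)" if "S \<in> Pow Rp" for S
    proof -
      have "finite S" using that finite_subset[OF _ finite_Rp] by auto
      then have "(\<Prod>(p, q)\<in>S. u p * v q) = Poly_Mapping.single (g S) 1"
        unfolding g_def by (simp add: u_def v_def mult_single case_prod_beta ps)
      then show ?thesis using sc[of "(-1) ^ card S" "g S"] by simp
    qed
    moreover have "of_int (psgn P) * (\<Prod>x\<in>I. u x ^ P (fst x) (snd x) * v x ^ snd x) = Poly_Mapping.single (h P) (of_int (psgn P))" for P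
      unfolding h_def by (simp add: upow vpow mult_single ps sc)
    ultimately show ?thesis using weyl_denominator[of u v, OF uv] by simp
  qed
  then have "(\<Sum>S\<in>Pow Rp. (-1) ^ card S * F (Poly_Mapping.lookup (g S))) = (\<Sum>P\<in>Perms. of_int (psgn P) * F (Poly_Mapping.lookup (h P)))"
    by (intro sum_single_functional[where F="\<lambda>\<kappa>. F (Poly_Mapping.lookup \<kappa>)"]) auto
  moreover have "Poly_Mapping.lookup (g S) = \<gamma> S" for S
    unfolding g_def \<gamma>_def
    by (auto simp: fun_eq_iff Poly_Mapping.lookup_sum Poly_Mapping.lookup_add Poly_Mapping.lookup_single when_def rt_def case_prod_beta intro!: sum.cong)
  moreover have "Poly_Mapping.lookup (h P) = pshift P" for P
  proof
    fix y
    have "Poly_Mapping.lookup (h P) y = (\<Sum>x\<in>I. if x = y then int (P (fst x) (snd x)) - int (snd x) else 0)"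
      unfolding h_def Poly_Mapping.lookup_sum by (intro sum.cong refl) (simp add: Poly_Mapping.lookup_add Poly_Mapping.lookup_single when_def)
    then show "Poly_Mapping.lookup (h P) y = pshift P y" by (simp add: pshift_def)
  qed
  ultimately show ?thesis by simp
qed

lemma sum_I: "(\<Sum>x\<in>I. f x) = (\<Sum>b\<le>k. \<Sum>a<sz b. f (b, a))"
  unfolding I_def by (simp add: sum.Sigma case_prod_beta)

text \<open>\<open>nrm S\<close> depends on \<open>\<gamma> S\<close> alone, so the denominator
  formula applies; at \<open>rho - w rho\<close> it equals
  \<open>|rho|^2 - |w rho|^2 = 0\<close>.\<close>

lemma weyl_norm: "(\<Sum>S\<in>Pow Rp. (-1) ^ card S * (of_int (nrm S) * F (\<gamma> S))) = (0 :: real)"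
proof -
  define n where "n = (\<lambda>\<eta> :: idx \<Rightarrow> int. (\<Sum>(p, q)\<in>Rp. \<eta> p - \<eta> q) - (\<Sum>x\<in>I. \<eta> x * \<eta> x))"
  have "n (pshift P) = 0" if P: "P \<in> Perms" for P
  proof -
    have "n (pshift P) = (\<Sum>x\<in>I. pshift P x * (int (sz (fst x)) - 1 - 2 * int (snd x) - pshift P x))"
      unfolding n_def Rp_sum by (simp add: right_diff_distrib sum_subtractf)
    also have "\<dots> = (\<Sum>b\<le>k. \<Sum>a<sz b. (int (P b a) - int a) * (int (sz b) - 1 - int a - int (P b a)))"
      unfolding sum_I by (intro sum.cong refl) (simp add: pshift_def I_def)
    also have "\<dots> = 0"
    proof (rule sum.neutral, rule ballI)
      fix b assume "b \<in> {..k}"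
      then have p: "P b permutes {..<sz b}" using P by (auto simp: Perms_def)
      have e: "(\<Sum>a<sz b. g (P b a)) = (\<Sum>a<sz b. g a)" for g :: "nat \<Rightarrow> int"
        using sum.permute[OF p, of g] by (simp add: o_def)
      have "(\<Sum>a<sz b. (int (P b a) - int a) * (int (sz b) - 1 - int a - int (P b a)))
         = (\<Sum>a<sz b. ((int (sz b) - 1) * int (P b a) - int (P b a) * int (P b a)) - ((int (sz b) - 1) * int a - int a * int a))"
        by (intro sum.cong refl) (simp add: algebra_simps)
      also have "\<dots> = 0" unfolding sum_subtractf[of "\<lambda>a. (int (sz b) - 1) * int (P b a) - int (P b a) * int (P b a)"]
        using e[of "\<lambda>a. (int (sz b) - 1) * int a - int a * int a"] by simp
      finally show "(\<Sum>a<sz b. (int (P b a) - int a) * (int (sz b) - 1 - int a - int (P b a))) = 0" .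
    qed
    finally show ?thesis .
  qed
  then have "(\<Sum>P\<in>Perms. of_int (psgn P) * (of_int (n (pshift P)) * F (pshift P))) = 0" by simp
  then show ?thesis using weyl_functional[of "\<lambda>\<eta>. of_int (n \<eta>) * F \<eta>"] by (simp add: nrm_def n_def)
qed

end

section \<open>Coefficients as counts of monomials of given weight\<close>

lemma lookup_prod_hsym:
  assumes C: "finite C"
  shows "Poly_Mapping.lookup ((\<Prod>j<n. X j ^ e j) * (\<Prod>c\<in>C. hsym n X (d c))) (expo n w)
    = int (card {A \<in> PiE C (\<lambda>c. if d c < 0 then {} else compos n (nat (d c))). \<forall>j<n. e j + (\<Sum>c\<in>C. A c j) = w j})"
proof -
  define D where "D = (\<lambda>c. if d c < 0 then {} else compos n (nat (d c)))"
  have fD: "finite (D c)" for c by (simp add: D_def)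
  have h: "hsym n X (d c) = (\<Sum>a\<in>D c. \<Prod>i<n. X i ^ a i)" for c by (simp add: hsym_def D_def)
  have "(\<Prod>c\<in>C. hsym n X (d c)) = (\<Sum>A\<in>PiE C D. \<Prod>c\<in>C. \<Prod>i<n. X i ^ A c i)"
    unfolding h using C fD by (rule prod_sum_PiE)
  also have "(\<Prod>j<n. X j ^ e j) * \<dots> = (\<Sum>A\<in>PiE C D. Poly_Mapping.single (expo n (\<lambda>j. e j + (\<Sum>c\<in>C. A c j))) 1)"
    unfolding sum_distrib_left
  proof (rule sum.cong[OF refl])
    fix A
    have "(\<Prod>c\<in>C. \<Prod>i<n. X i ^ A c i) = (\<Prod>i<n. X i ^ (\<Sum>c\<in>C. A c i))"
      by (subst prod.swap) (simp add: power_sum)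
    then have "(\<Prod>j<n. X j ^ e j) * (\<Prod>c\<in>C. \<Prod>i<n. X i ^ A c i) = (\<Prod>j<n. X j ^ (e j + (\<Sum>c\<in>C. A c j)))"
      by (simp add: prod.distrib power_add)
    then show "(\<Prod>j<n. X j ^ e j) * (\<Prod>c\<in>C. \<Prod>i<n. X i ^ A c i) = Poly_Mapping.single (expo n (\<lambda>j. e j + (\<Sum>c\<in>C. A c j))) 1"
      by (simp add: prod_X_power expo_def)
  qed
  moreover have "(\<forall>j<n. w j = e j + (\<Sum>c\<in>C. A c j)) = (\<forall>j<n. e j + (\<Sum>c\<in>C. A c j) = w j)" for A by metis
  ultimately have "Poly_Mapping.lookup ((\<Prod>j<n. X j ^ e j) * (\<Prod>c\<in>C. hsym n X (d c))) (expo n w)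
     = (\<Sum>A\<in>PiE C D. of_bool (\<forall>j<n. e j + (\<Sum>c\<in>C. A c j) = w j))"
    by (simp add: Poly_Mapping.lookup_sum Poly_Mapping.lookup_single when_def expo_eq_iff of_bool_def)
  also have "\<dots> = int (card {A \<in> PiE C D. \<forall>j<n. e j + (\<Sum>c\<in>C. A c j) = w j})"
    using finite_PiE[OF C fD] by (simp add: sum.If_cases of_bool_def Int_def)
  finally show ?thesis by (simp add: D_def)
qed

context tables begin

definition cols :: "idx set" where "cols = {c \<in> I. fst c \<noteq> 0}"

lemma finite_cols [simp]: "finite cols" by (simp add: cols_def)

lemma vars_eq: "vars = (\<lambda>(j, c). ((0, j), c)) ` ({..<sz 0} \<times> cols)"
  by (force simp: vars_def I_def cols_def image_iff)

lemma in_vars: "((b, j), c) \<in> vars \<longleftrightarrow> b = 0 \<and> j < sz 0 \<and> c \<in> cols"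
  by (auto simp: vars_def I_def cols_def)

lemma sum_vars: "(\<Sum>e\<in>vars. h e) = (\<Sum>j<sz 0. \<Sum>c\<in>cols. h ((0, j), c))"
proof -
  have "inj_on (\<lambda>(j, c). ((0::nat, j), c)) ({..<sz 0} \<times> cols)" by (auto simp: inj_on_def)
  then show ?thesis unfolding vars_eq by (subst sum.reindex) (simp_all add: sum.cartesian_product case_prod_beta)
qed

lemma wt_row: "j < sz 0 \<Longrightarrow> wt m (0, j) = (\<Sum>c\<in>cols. int (m ((0, j), c)))"
proof -
  assume j: "j < sz 0"
  have "wt m (0, j) = (\<Sum>i<sz 0. if i = j then (\<Sum>c\<in>cols. int (m ((0, j), c))) else 0)"
    unfolding wt_def sum_vars
  proof (rule sum.cong[OF refl])
    fix i
    have "inc ((0, i), c) (0, j) = of_bool (i = j)" if "c \<in> cols" for c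
      using that by (auto simp: inc_def cols_def)
    then have "(\<Sum>c\<in>cols. inc ((0, i), c) (0, j) * int (m ((0, i), c))) = (\<Sum>c\<in>cols. of_bool (i = j) * int (m ((0, i), c)))"
      by (intro sum.cong) auto
    then show "(\<Sum>c\<in>cols. inc ((0, i), c) (0, j) * int (m ((0, i), c))) = (if i = j then (\<Sum>c\<in>cols. int (m ((0, j), c))) else 0)"
      by simp
  qed
  then show ?thesis using j by simp
qed

lemma wt_col: "c \<in> cols \<Longrightarrow> wt m c = (\<Sum>j<sz 0. int (m ((0, j), c)))"
proof -
  assume c: "c \<in> cols"
  have "(\<Sum>c'\<in>cols. inc ((0, i), c') c * int (m ((0, i), c'))) = int (m ((0, i), c))" for i
  proof -
    have "(\<Sum>c'\<in>cols. inc ((0, i), c') c * int (m ((0, i), c'))) = (\<Sum>c'\<in>cols. if c' = c then int (m ((0, i), c)) else 0)"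
      using c by (intro sum.cong refl) (auto simp: inc_def cols_def)
    then show ?thesis using c by simp
  qed
  then show ?thesis unfolding wt_def sum_vars by simp
qed

lemma I_cases: "x \<in> I \<longleftrightarrow> x \<in> cols \<or> (\<exists>j<sz 0. x = (0, j))"
  by (cases x; cases "fst x = 0") (auto simp: I_def cols_def)

text \<open>A monomial of weight \<open>\<mu>\<close> is a family of compositions, one for each
  column, subject to the row sums. The offset \<open>e\<close> makes room for the exponents
  contributed by the Vandermonde determinant.\<close>

lemma card_Mon:
  assumes w: "\<And>j. j < sz 0 \<Longrightarrow> int (w j) = \<mu> (0, j) + int (e j)"
  shows "card {A \<in> PiE cols (\<lambda>c. if \<mu> c < 0 then {} else compos (sz 0) (nat (\<mu> c))). \<forall>j<sz 0. e j + (\<Sum>c\<in>cols. A c j) = w j} = card (Mon \<mu>)"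
    (is "card ?S = _")
proof (rule bij_betw_same_card[OF bij_betw_byWitness[where f' = "\<lambda>m. \<lambda>c\<in>cols. \<lambda>j. m ((0, j), c)" and f = "\<lambda>A e. if e \<in> vars then A (snd e) (snd (fst e)) else 0"]])
  show "\<forall>A\<in>?S. (\<lambda>c\<in>cols. \<lambda>j. (\<lambda>e. if e \<in> vars then A (snd e) (snd (fst e)) else 0) ((0, j), c)) = A"
  proof
    fix A assume A: "A \<in> ?S"
    show "(\<lambda>c\<in>cols. \<lambda>j. (\<lambda>e. if e \<in> vars then A (snd e) (snd (fst e)) else 0) ((0, j), c)) = A"
    proof
      fix c
      show "(\<lambda>c\<in>cols. \<lambda>j. (\<lambda>e. if e \<in> vars then A (snd e) (snd (fst e)) else 0) ((0, j), c)) c = A c"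
      proof (cases "c \<in> cols")
        case True
        then have "A c \<in> compos (sz 0) (nat (\<mu> c))" using A by (auto split: if_splits)
        then have "A c j = 0" if "\<not> j < sz 0" for j using that by (auto simp: compos_def)
        then show ?thesis using True by (auto simp: in_vars fun_eq_iff)
      qed (use A in auto)
    qed
  qed
  show "\<forall>m\<in>Mon \<mu>. (\<lambda>e. if e \<in> vars then (\<lambda>c\<in>cols. \<lambda>j. m ((0, j), c)) (snd e) (snd (fst e)) else 0) = m"
    by (auto simp: Mon_def fun_eq_iff in_vars)
  have wS: "(\<forall>j<sz 0. e j + (\<Sum>c\<in>cols. m ((0, j), c)) = w j) \<longleftrightarrow> (\<forall>j<sz 0. wt m (0, j) = \<mu> (0, j))" for m
  proof -
    have "e j + (\<Sum>c\<in>cols. m ((0, j), c)) = w j \<longleftrightarrow> wt m (0, j) = \<mu> (0, j)" if "j < sz 0" for j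
      using w[OF that] wt_row[OF that, of m] by (simp flip: of_nat_sum) linarith
    then show ?thesis by blast
  qed
  show "(\<lambda>A e. if e \<in> vars then A (snd e) (snd (fst e)) else 0) ` ?S \<subseteq> Mon \<mu>"
  proof (rule image_subsetI)
    fix A assume A: "A \<in> ?S"
    define m where "m = (\<lambda>e :: idx \<times> idx. if e \<in> vars then A (snd e) (snd (fst e)) else 0)"
    have mj: "m ((0, j), c) = A c j" if "c \<in> cols" "j < sz 0" for j c using that by (simp add: m_def in_vars)
    have Ac: "A c \<in> compos (sz 0) (nat (\<mu> c))" "\<mu> c \<ge> 0" if "c \<in> cols" for c
    proof -
      have "A c \<in> (if \<mu> c < 0 then {} else compos (sz 0) (nat (\<mu> c)))" using A that by (intro PiE_mem[of A cols]) auto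
      then show "A c \<in> compos (sz 0) (nat (\<mu> c))" "\<mu> c \<ge> 0" by (auto split: if_splits)
    qed
    have "wt m c = \<mu> c" if c: "c \<in> cols" for c
    proof -
      have "wt m c = int (\<Sum>j<sz 0. A c j)" using wt_col[OF c, of m] mj[OF c] by simp
      then show ?thesis using Ac[OF c] by (simp add: compos_def del: of_nat_sum)
    qed
    moreover have "\<forall>j<sz 0. e j + (\<Sum>c\<in>cols. m ((0, j), c)) = w j" using A mj by simp
    then have "\<forall>j<sz 0. wt m (0, j) = \<mu> (0, j)" unfolding wS .
    ultimately have "\<forall>p\<in>I. wt m p = \<mu> p" by (auto simp: I_cases)
    then show "(\<lambda>e. if e \<in> vars then A (snd e) (snd (fst e)) else 0) \<in> Mon \<mu>"
      unfolding m_def[symmetric] Mon_def by (simp add: m_def)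
  qed
  show "(\<lambda>m. \<lambda>c\<in>cols. \<lambda>j. m ((0, j), c)) ` Mon \<mu> \<subseteq> ?S"
  proof (rule image_subsetI)
    fix m assume m: "m \<in> Mon \<mu>"
    have "\<forall>j<sz 0. wt m (0, j) = \<mu> (0, j)" using m by (auto simp: Mon_def I_cases)
    then have "\<forall>j<sz 0. e j + (\<Sum>c\<in>cols. m ((0, j), c)) = w j" unfolding wS .
    moreover have "\<not> \<mu> c < 0 \<and> (\<lambda>j. m ((0, j), c)) \<in> compos (sz 0) (nat (\<mu> c))" if c: "c \<in> cols" for c
    proof -
      have "int (\<Sum>j<sz 0. m ((0, j), c)) = \<mu> c" using m c wt_col[OF c, of m] by (auto simp: Mon_def I_cases)
      moreover have "m ((0, j), c) = 0" if "sz 0 \<le> j" for j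
      proof -
        have "((0, j), c) \<notin> vars" using that by (simp add: in_vars)
        then show ?thesis using m unfolding Mon_def by blast
      qed
      ultimately show ?thesis by (auto simp: compos_def simp del: of_nat_sum)
    qed
    ultimately show "(\<lambda>c\<in>cols. \<lambda>j. m ((0, j), c)) \<in> ?S" by auto
  qed
qed

text \<open>Expanding the Vandermonde and the Jacobi-Trudi determinants chooses one permutation per
  block. That of block 0 shifts the row weights, the others shift the column weights, all by
  \<open>pshift\<close>.\<close>

lemma lookup_vdm_adets:
  assumes w: "\<And>j. j < sz 0 \<Longrightarrow> int (w j) = \<nu> (0, j) + int (sz 0) - 1 - int j"
    and \<nu>: "\<And>c. c \<in> cols \<Longrightarrow> \<nu> c = N"
  shows "Poly_Mapping.lookup (vdm (sz 0) X * (\<Prod>b\<in>{1..k}. adet (sz b) (\<lambda>i j. hsym (sz 0) X (N - int i + int j)))) (expo (sz 0) w)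
     = (\<Sum>P\<in>Perms. psgn P * int (card (Mon (\<lambda>x. \<nu> x + pshift P x))))"
proof -
  define T where "T = (\<lambda>b p. if b = 0 then (\<Prod>j<sz 0. X j ^ (sz 0 - 1 - p j)) else (\<Prod>i<sz b. hsym (sz 0) X (N - int i + int (p i))))"
  have k0: "{..k} = insert 0 {1..k}" by auto
  have "vdm (sz 0) X * (\<Prod>b\<in>{1..k}. adet (sz b) (\<lambda>i j. hsym (sz 0) X (N - int i + int j)))
     = (\<Prod>b\<le>k. \<Sum>p | p permutes {..<sz b}. of_int (sign p) * T b p)"
  proof -
    have "(\<Prod>b\<in>{1..k}. adet (sz b) (\<lambda>i j. hsym (sz 0) X (N - int i + int j))) = (\<Prod>b\<in>{1..k}. \<Sum>p | p permutes {..<sz b}. of_int (sign p) * T b p)"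
      by (intro prod.cong refl) (simp add: T_def adet_def)
    moreover have "vdm (sz 0) X = (\<Sum>p | p permutes {..<sz 0}. of_int (sign p) * T 0 p)" by (simp add: T_def vdm_expand)
    ultimately show ?thesis unfolding k0 by simp
  qed
  also have "\<dots> = (\<Sum>P\<in>Perms. \<Prod>b\<le>k. of_int (sign (P b)) * T b (P b))"
    unfolding Perms_def by (rule prod_sum_PiE) (auto simp: finite_permutations)
  also have "\<dots> = (\<Sum>P\<in>Perms. of_int (psgn P) * (\<Prod>b\<le>k. T b (P b)))"
    by (simp add: prod.distrib psgn_def)
  finally have "Poly_Mapping.lookup (vdm (sz 0) X * (\<Prod>b\<in>{1..k}. adet (sz b) (\<lambda>i j. hsym (sz 0) X (N - int i + int j)))) (expo (sz 0) w)
     = (\<Sum>P\<in>Perms. psgn P * Poly_Mapping.lookup (\<Prod>b\<le>k. T b (P b)) (expo (sz 0) w))"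
    by (simp only: Poly_Mapping.lookup_sum lookup_of_int_times)
  also have "\<dots> = (\<Sum>P\<in>Perms. psgn P * int (card (Mon (\<lambda>x. \<nu> x + pshift P x))))"
  proof (rule sum.cong[OF refl])
    fix P assume P: "P \<in> Perms"
    define \<mu> where "\<mu> = (\<lambda>x. \<nu> x + pshift P x)"
    have P0: "P 0 j < sz 0" if "j < sz 0" for j
    proof -
      have "P 0 permutes {..<sz 0}" using P by (auto simp: Perms_def)
      then show ?thesis using that permutes_in_image[of "P 0" "{..<sz 0}" j] by simp
    qed
    have "cols = (SIGMA b:{1..k}. {..<sz b})" by (auto simp: cols_def I_def)
    then have "(\<Prod>c\<in>cols. hsym (sz 0) X (\<mu> c)) = (\<Prod>b\<in>{1..k}. \<Prod>i<sz b. hsym (sz 0) X (\<mu> (b, i)))"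
      by (simp add: prod.Sigma case_prod_beta)
    also have "\<dots> = (\<Prod>b\<in>{1..k}. T b (P b))"
    proof (rule prod.cong[OF refl])
      fix b assume b: "b \<in> {1..k}"
      have "\<mu> (b, i) = N - int i + int (P b i)" if "i < sz b" for i
      proof -
        have "(b, i) \<in> cols" "(b, i) \<in> I" using b that by (auto simp: cols_def I_def)
        then show ?thesis using \<nu>[of "(b, i)"] by (simp add: \<mu>_def pshift_def)
      qed
      then show "(\<Prod>i<sz b. hsym (sz 0) X (\<mu> (b, i))) = T b (P b)" using b by (simp add: T_def)
    qed
    finally have "(\<Prod>b\<le>k. T b (P b)) = (\<Prod>j<sz 0. X j ^ (sz 0 - 1 - P 0 j)) * (\<Prod>c\<in>cols. hsym (sz 0) X (\<mu> c))"
      unfolding k0 by (simp add: T_def)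
    then have "Poly_Mapping.lookup (\<Prod>b\<le>k. T b (P b)) (expo (sz 0) w)
       = int (card {A \<in> PiE cols (\<lambda>c. if \<mu> c < 0 then {} else compos (sz 0) (nat (\<mu> c))). \<forall>j<sz 0. (sz 0 - 1 - P 0 j) + (\<Sum>c\<in>cols. A c j) = w j})"
      by (simp only: lookup_prod_hsym[OF finite_cols])
    also have "\<dots> = int (card (Mon \<mu>))"
    proof (subst card_Mon)
      fix j assume j: "j < sz 0"
      have "(0, j) \<in> I" using j by (simp add: I_def)
      then show "int (w j) = \<mu> (0, j) + int (sz 0 - 1 - P 0 j)"
        using w[OF j] P0[OF j] by (simp add: \<mu>_def pshift_def of_nat_diff)
    qed simp
    finally show "psgn P * Poly_Mapping.lookup (\<Prod>b\<le>k. T b (P b)) (expo (sz 0) w) = psgn P * int (card (Mon (\<lambda>x. \<nu> x + pshift P x)))"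
      by (simp add: \<mu>_def)
  qed
  finally show ?thesis .
qed

end

definition frame_wt :: "nat \<Rightarrow> nat \<Rightarrow> idx \<Rightarrow> int" where
  "frame_wt N M = (\<lambda>(b, a). if b = 0 then (if a < N then int M else 0) else int N)"

text \<open>Block 0 has one row for each variable used by \<open>lr_coeff\<close>; block
  \<open>i + 1\<close> has one column for each vector of leg \<open>i\<close>.\<close>

definition frame_sz :: "nat \<Rightarrow> nat list \<Rightarrow> nat \<Rightarrow> nat" where
  "frame_sz N L b = (if b = 0 then N * sum_list L else L ! (b - 1))"

lemma sum_list_rect: "sum_list (rect a b) = a * b"
  by (cases "a = 0") (auto simp: rect_def filter_replicate sum_list_replicate)

text \<open>Jacobi-Trudi turns the coefficient into a sum over block permutations of weight
  multiplicities. The denominator formula, read backwards, makes this the sum over sets of roots to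
  which the Casimir argument applies.\<close>

theorem lr_coeff_highest_weight:
  fixes L :: "nat list" and N :: nat
  assumes N: "N > 0"
  defines "sz \<equiv> frame_sz N L" and "\<nu> \<equiv> frame_wt N (sum_list L)"
  shows "lr_coeff (map (\<lambda>l. rect N l) L) (rect (sum_list L) N) \<noteq> 0 \<longleftrightarrow>
    (\<exists>f\<in>tables.V sz (length L) \<nu>. f \<noteq> (\<lambda>_. 0) \<and> (\<forall>(p, q)\<in>tables.Rp sz (length L). tables.E sz (length L) p q f = (\<lambda>_. 0)))"
proof -
  interpret tables sz "length L" .
  define M where "M = sum_list L"
  define n where "n = N * M"
  have sz0: "sz 0 = n" by (simp add: sz_def frame_sz_def n_def M_def)
  have n_sum: "n = (\<Sum>la\<leftarrow>map (\<lambda>l. rect N l) L. sum_list la)"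
    by (simp add: n_def M_def sum_list_rect o_def sum_list_const_mult)
  have rN: "rect N l = map (\<lambda>_. N) [0..<l]" for l
    using N by (simp add: rect_def filter_replicate map_replicate_const)
  have schur: "schur n (rect N l) = adet l (\<lambda>i j. hsym n X (int N - int i + int j))" for l
    unfolding rN schur_map by (rule jacobi_trudi) simp
  have inAS: "f * (\<Prod>la\<leftarrow>map (\<lambda>l. rect N l) L'. schur n la) \<in> AS n" if "f \<in> AS n" for f L'
    using that
  proof (induction L' arbitrary: f)
    case (Cons l L')
    have "f * schur n (rect N l) \<in> AS n" unfolding schur by (rule AS_adet[OF Cons.prems])
    from Cons.IH[OF this] show ?case by (simp add: mult.assoc)
  qed simp
  have prodL: "(\<Prod>la\<leftarrow>map (\<lambda>l. rect N l) L. schur n la) = (\<Prod>b\<in>{1..length L}. adet (sz b) (\<lambda>i j. hsym n X (int N - int i + int j)))"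
  proof -
    have "(\<Prod>la\<leftarrow>map (\<lambda>l. rect N l) L. schur n la) = (\<Prod>i<length L. schur n (rect N (L ! i)))"
      by (simp add: o_def prod.list_conv_set_nth atLeast0LessThan)
    also have "\<dots> = (\<Prod>i<length L. adet (sz (Suc i)) (\<lambda>i j. hsym n X (int N - int i + int j)))"
      by (simp add: schur sz_def frame_sz_def)
    also have "\<dots> = (\<Prod>b\<in>{1..length L}. adet (sz b) (\<lambda>i j. hsym n X (int N - int i + int j)))"
      by (rule prod.reindex_bij_witness[of _ "\<lambda>b. b - 1" Suc]) auto
    finally show ?thesis .
  qed
  define mu where "mu = filter (\<lambda>x. 0 < x) (rect M N)"
  have mu: "mu = (if M = 0 then [] else replicate N M)" by (simp add: mu_def rect_def filter_replicate)
  have mu_part: "is_partition mu" by (auto simp: mu is_partition_def)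
  have mu_len: "length mu \<le> n" by (simp add: mu n_def)
  have "lr_coeff (map (\<lambda>l. rect N l) L) (rect M N) = Poly_Mapping.lookup (vdm n X * (\<Prod>la\<leftarrow>map (\<lambda>l. rect N l) L. schur n la)) (expo n (wexp n mu))"
    unfolding mu_def by (rule lr_coeff_eq_lookup[OF n_sum inAS[OF vdm_in_AS]]) (use mu_part mu_len in \<open>simp_all add: mu_def\<close>)
  also have "\<dots> = (\<Sum>P\<in>Perms. psgn P * int (card (Mon (\<lambda>x. \<nu> x + pshift P x))))"
    unfolding prodL unfolding sz0[symmetric]
  proof (rule lookup_vdm_adets)
    fix j assume j: "j < sz 0"
    then have "M > 0" "j < n" by (auto simp: sz0 n_def intro: gr0I)
    then have "pad mu j = (if j < N then M else 0)" by (simp add: mu pad_def)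
    then show "int (wexp (sz 0) mu j) = \<nu> (0, j) + int (sz 0) - 1 - int j"
      using \<open>j < n\<close> by (simp add: wexp_def sz0 \<nu>_def frame_wt_def of_nat_diff M_def)
  next
    fix c assume "c \<in> cols"
    then show "\<nu> c = int N" by (auto simp: cols_def \<nu>_def frame_wt_def case_prod_beta)
  qed
  finally have lr: "lr_coeff (map (\<lambda>l. rect N l) L) (rect M N) = (\<Sum>P\<in>Perms. psgn P * int (card (Mon (\<lambda>x. \<nu> x + pshift P x))))" .
  have "real_of_int (lr_coeff (map (\<lambda>l. rect N l) L) (rect M N)) = (\<Sum>S\<in>Pow Rp. (-1) ^ card S * real (card (Mon (\<lambda>x. \<nu> x + \<gamma> S x))))"
    unfolding lr weyl_functional[of "\<lambda>\<eta>. real (card (Mon (\<lambda>x. \<nu> x + \<eta> x)))"] by simp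
  moreover have dom: "\<nu> q \<le> \<nu> p" if "(p, q) \<in> Rp" for p q
    using that by (cases p; cases q) (auto simp: Rp_def \<nu>_def frame_wt_def)
  ultimately show ?thesis
    using highest_weight_vector_iff[OF weyl_norm dom] unfolding M_def[symmetric] by (simp only: of_int_0_eq_iff[symmetric, where 'a=real]) simp
qed

section \<open>Determinantal highest weight vectors\<close>

lemma adet_add_row:
  fixes A :: "nat \<Rightarrow> nat \<Rightarrow> real"
  assumes "b < n" "a \<noteq> b"
  shows "adet n (\<lambda>u v. A u v + (if u = a then t * A b v else 0)) = adet n A"
proof -
  have "Matrix.mat n n (\<lambda>(u, v). A u v + (if u = a then t * A b v else 0)) = addrow t a b (Matrix.mat n n (\<lambda>(u, v). A u v))"
    using assms by (intro eq_matI) auto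
  then show ?thesis unfolding adet_eq_det using assms by (simp add: det_addrow[of b n])
qed

text \<open>Rows in \<open>T\<close> only receive rows outside \<open>T\<close>, so the additions
  can be carried out one after the other.\<close>

lemma adet_add_rows:
  fixes A :: "nat \<Rightarrow> nat \<Rightarrow> real"
  assumes "finite T" "\<And>u. u \<in> T \<Longrightarrow> g u < n \<and> g u \<notin> T"
  shows "adet n (\<lambda>u v. A u v + (if u \<in> T then t * A (g u) v else 0)) = adet n A"
proof -
  have "adet n (\<lambda>u v. A u v + (if u \<in> S then t * A (g u) v else 0)) = adet n A" if "finite S" "S \<subseteq> T" for S
    using that
  proof (induction S rule: finite_induct)
    case (insert a S)
    define A' where "A' = (\<lambda>u v. A u v + (if u \<in> S then t * A (g u) v else 0))"
    have g: "g a < n" "a \<noteq> g a" "g a \<notin> S" using assms(2)[of a] insert.prems by auto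
    have "(\<lambda>u v. A u v + (if u \<in> insert a S then t * A (g u) v else 0)) = (\<lambda>u v. A' u v + (if u = a then t * A' (g a) v else 0))"
      using insert.hyps g by (auto simp: A'_def fun_eq_iff)
    then show ?case using adet_add_row[OF g(1,2), of A' t] insert by (simp add: A'_def)
  qed simp
  then show ?thesis using assms(1) by blast
qed

lemma adet_transpose: "adet n (\<lambda>i j. A j i) = adet n A"
  unfolding adet_eq_det
  by (subst Determinant.det_transpose[symmetric, of _ n]) (auto intro!: arg_cong[of _ _ Determinant.det] eq_matI)

lemma adet_add_cols:
  fixes A :: "nat \<Rightarrow> nat \<Rightarrow> real"
  assumes "finite T" "\<And>v. v \<in> T \<Longrightarrow> g v < n \<and> g v \<notin> T"
  shows "adet n (\<lambda>u v. A u v + (if v \<in> T then t * A u (g v) else 0)) = adet n A"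
  using adet_add_rows[OF assms, where A = "\<lambda>u v. A v u" and t = t]
    adet_transpose[of n "\<lambda>u v. A u v + (if v \<in> T then t * A u (g v) else 0)"] adet_transpose[of n A] by simp

lemma adet_zero_left_kernel:
  fixes A :: "nat \<Rightarrow> nat \<Rightarrow> real"
  assumes "adet n A = 0"
  shows "\<exists>v. (\<exists>u<n. v u \<noteq> 0) \<and> (\<forall>j<n. (\<Sum>u<n. v u * A u j) = 0)"
proof -
  let ?M = "Matrix.mat n n (\<lambda>(i, j). A j i)"
  have "Determinant.det ?M = 0" using assms adet_transpose[of n A] by (simp add: adet_eq_det)
  then obtain v where v: "v \<in> carrier_vec n" "v \<noteq> 0\<^sub>v n" "?M *\<^sub>v v = 0\<^sub>v n"
    using det_0_iff_vec_prod_zero_field[of ?M n] by auto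
  have "\<exists>u<n. vec_index v u \<noteq> 0"
  proof (rule ccontr)
    assume "\<not> ?thesis"
    then have "v = 0\<^sub>v n" using v(1) by (intro eq_vecI) auto
    then show False using v(2) by simp
  qed
  moreover have "(\<Sum>u<n. vec_index v u * A u j) = 0" if j: "j < n" for j
  proof -
    have "vec_index (?M *\<^sub>v v) j = 0" unfolding v(3) using j by simp
    then show ?thesis using j v(1) by (auto simp: scalar_prod_def atLeast0LessThan mult.commute)
  qed
  ultimately show ?thesis by blast
qed

context tables begin

lemma wt_count:
  assumes U: "finite U" "\<And>u. u \<in> U \<Longrightarrow> ex u \<in> vars"
  shows "wt (\<lambda>e. card {u \<in> U. ex u = e}) x = (\<Sum>u\<in>U. inc (ex u) x)"
proof -
  have "wt (\<lambda>e. card {u \<in> U. ex u = e}) x = (\<Sum>e\<in>vars. \<Sum>u\<in>{u \<in> U. ex u = e}. inc (ex u) x)"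
    unfolding wt_def by (rule sum.cong[OF refl]) simp
  also have "\<dots> = (\<Sum>u\<in>U. inc (ex u) x)" by (rule sum.group) (use U in auto)
  finally show ?thesis .
qed

lemma mono_at_count:
  assumes U: "finite U" "\<And>u. u \<in> U \<Longrightarrow> ex u \<in> vars"
  shows "mono_at x (\<lambda>e. card {u \<in> U. ex u = e}) = (\<Prod>u\<in>U. x (ex u))"
proof -
  have "mono_at x (\<lambda>e. card {u \<in> U. ex u = e}) = (\<Prod>e\<in>vars. \<Prod>u\<in>{u \<in> U. ex u = e}. x (ex u))"
    unfolding mono_at_def by (rule prod.cong[OF refl]) simp
  also have "\<dots> = (\<Prod>u\<in>U. x (ex u))" by (rule prod.group) (use U in auto)
  finally show ?thesis .
qed

lemma supp_\<delta>m [simp]: "supp (\<delta>m m) = {m}" by (auto simp: supp_def \<delta>m_def)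

lemma pev_\<delta>m: "pev (\<delta>m m) x = mono_at x m" by (simp add: pev_def) (simp add: \<delta>m_def)

text \<open>The value of \<open>E p q f\<close> is the derivative of \<open>f\<close> along the
  motion in \<open>inv\<close>, and a polynomial that vanishes at all points is zero.\<close>

lemma E_zero_if_invariant:
  assumes pq: "(p, q) \<in> same" and f: "f \<in> V \<mu>"
    and inv: "\<And>x t. pev f (\<lambda>e. x e + t * (of_bool (fst e = q) * x (p, snd e) + of_bool (snd e = q) * x (fst e, p))) = pev f x"
  shows "E p q f = (\<lambda>_. 0)"
proof (rule pev_zero_imp)
  have E: "E p q f \<in> V (\<lambda>x. \<mu> x + rt p q x)" by (rule E_in_V[OF pq f])
  show "finite (supp (E p q f))" by (rule V_finite_supp[OF E])
  show "m e = 0" if "E p q f m \<noteq> 0" "e \<notin> vars" for m e by (rule V_vars[OF E that])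
  fix x
  have "((\<lambda>t. pev f x) has_real_derivative pev (E p q f) x) (at 0)"
    using pev_line_derivative[OF V_finite_supp[OF f], of x "\<lambda>e. of_bool (fst e = q) * x (p, snd e) + of_bool (snd e = q) * x (fst e, p)"]
    unfolding inv pev_E_direction[OF pq V_finite_supp[OF f]] .
  then show "pev (E p q f) x = 0" using DERIV_unique[OF _ DERIV_const] by blast
qed

end

text \<open>Adding a multiple of a line of x to another line of its block is a set of column
  operations (block 0) or row operations (other blocks) on the determinant, hence leaves it
  unchanged. Every Leibniz term uses each of the first \<open>N\<close> row lines \<open>M\<close>
  times and each column line \<open>N\<close> times, which is the weight. At \<open>B\<close> the
  determinant is nonzero, for a left kernel vector would be a cokernel element.\<close>

theorem nonsingular_highest_weight:
  fixes L :: "nat list" and N :: nat and B C :: legs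
  assumes N: "N > 0"
    and nonsing: "\<not> ext_nonzero (length L) {..<N} (\<lambda>i. {..<L ! i}) {..<sum_list L} {..<N} B C"
  defines "sz \<equiv> frame_sz N L" and "\<nu> \<equiv> frame_wt N (sum_list L)"
  shows "\<exists>f\<in>tables.V sz (length L) \<nu>. f \<noteq> (\<lambda>_. 0) \<and> (\<forall>(p, q)\<in>tables.Rp sz (length L). tables.E sz (length L) p q f = (\<lambda>_. 0))"
proof -
  interpret tables sz "length L" .
  define M where "M = sum_list L"
  define n where "n = N * M"
  have sz0: "sz 0 = n" by (simp add: sz_def frame_sz_def n_def M_def)
  have szS: "sz (Suc i) = L ! i" for i by (simp add: sz_def frame_sz_def)
  define R where "R = leg_rows (length L) (\<lambda>i. {..<L ! i}) {..<N}"
  define W where "W = {..<M} \<times> {..<N}"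
  have R_iff: "(i, s, c) \<in> R \<longleftrightarrow> i < length L \<and> s < N \<and> c < L ! i" for i s c
    by (auto simp: R_def leg_rows_def)
  have W_iff: "(w, a) \<in> W \<longleftrightarrow> w < M \<and> a < N" for w a by (auto simp: W_def)
  have fin: "finite R" "finite W" by (auto simp: R_def W_def leg_rows_def)
  have "card R = (\<Sum>i<length L. N * L ! i)"
    unfolding R_def leg_rows_def by (simp add: card_cartesian_product)
  also have "\<dots> = n" by (simp add: n_def M_def sum_list_sum_nth atLeast0LessThan sum_distrib_left)
  finally have cR: "card R = n" .
  have cW: "card W = n" by (simp add: W_def n_def mult.commute)
  obtain \<rho> where \<rho>: "bij_betw \<rho> {..<n} R" using ex_bij_betw_nat_finite[OF fin(1)] unfolding cR atLeast0LessThan by blast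
  obtain \<sigma> where \<sigma>: "bij_betw \<sigma> {..<n} W" using ex_bij_betw_nat_finite[OF fin(2)] unfolding cW atLeast0LessThan by blast
  \<comment> \<open>The variable at an entry of the matrix; legs are numbered from 0 but column
    blocks from 1, hence the \<open>Suc\<close>.\<close>
  define vr :: "nat \<times> nat \<times> nat \<Rightarrow> nat \<times> nat \<Rightarrow> idx \<times> idx" where
    "vr = (\<lambda>r w. ((0, snd w), (Suc (fst r), snd (snd r))))"
  define cf where "cf = (\<lambda>(r :: nat \<times> nat \<times> nat) (w :: nat \<times> nat). C (fst r) (fst (snd r)) (fst w))"
  define Mx where "Mx = (\<lambda>x u v. cf (\<rho> u) (\<sigma> v) * x (vr (\<rho> u) (\<sigma> v)) :: real)"
  define ex where "ex = (\<lambda>p u. vr (\<rho> u) (\<sigma> (p u)))"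
  \<comment> \<open>The exponent vector of the Leibniz term of \<open>p\<close>.\<close>
  define mp :: "(nat \<Rightarrow> nat) \<Rightarrow> mon" where "mp = (\<lambda>p e. card {u \<in> {..<n}. ex p u = e})"
  define cp where "cp = (\<lambda>p. real_of_int (sign p) * (\<Prod>u<n. cf (\<rho> u) (\<sigma> (p u))))"
  define f where "f = (\<lambda>m. \<Sum>p | p permutes {..<n}. cp p * \<delta>m (mp p) m)"
  have fP: "finite {p. p permutes {..<n}}" by (simp add: finite_permutations)
  have \<rho>R: "\<rho> u \<in> R" if "u < n" for u using bij_betwE[OF \<rho>] that by auto
  have \<sigma>W: "\<sigma> v \<in> W" if "v < n" for v using bij_betwE[OF \<sigma>] that by auto
  have vr_vars: "vr r w \<in> vars" if "r \<in> R" "w \<in> W" for r w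
  proof -
    obtain i s c where r: "r = (i, s, c)" by (cases r) auto
    obtain w' a where w: "w = (w', a)" by (cases w) auto
    have *: "i < length L" "c < L ! i" "w' < M" "a < N" using that by (auto simp: r w R_iff W_iff)
    then have "a < n" using N unfolding n_def by (cases M) auto
    then show ?thesis using * by (simp add: r w vr_def in_vars sz0 cols_def I_def szS)
  qed
  have exv: "ex p u \<in> vars" if "p permutes {..<n}" "u \<in> {..<n}" for p u
    unfolding ex_def using that permutes_in_image[OF that(1), of u] by (intro vr_vars \<rho>R \<sigma>W) auto
  have mp_Mon: "mp p \<in> Mon \<nu>" if p: "p permutes {..<n}" for p
  proof -
    have w: "wt (mp p) x = (\<Sum>u<n. inc (ex p u) x)" for x
      unfolding mp_def using exv[OF p] by (intro wt_count) auto
    have row: "wt (mp p) (0, a) = \<nu> (0, a)" for a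
    proof -
      have "wt (mp p) (0, a) = (\<Sum>u<n. of_bool (snd (\<sigma> (p u)) = a))"
        unfolding w by (intro sum.cong refl) (simp add: inc_def ex_def vr_def)
      also have "\<dots> = (\<Sum>v<n. of_bool (snd (\<sigma> v) = a))"
        using sum.permute[OF p, of "\<lambda>v. of_bool (snd (\<sigma> v) = a) :: int"] by (simp only: o_def)
      also have "\<dots> = (\<Sum>w\<in>W. of_bool (snd w = a))" by (rule sum.reindex_bij_betw[OF \<sigma>])
      also have "\<dots> = (\<Sum>w<M. \<Sum>a'<N. if a' = a then 1 else 0)"
        unfolding W_def sum.cartesian_product by (rule sum.cong) (auto simp: of_bool_def)
      finally show ?thesis by (simp add: \<nu>_def frame_wt_def M_def)
    qed
    have col: "wt (mp p) (Suc i, c) = \<nu> (Suc i, c)" if ic: "i < length L" "c < L ! i" for i c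
    proof -
      have "wt (mp p) (Suc i, c) = (\<Sum>u<n. of_bool (fst (\<rho> u) = i \<and> snd (snd (\<rho> u)) = c))"
        unfolding w by (intro sum.cong refl) (simp add: inc_def ex_def vr_def)
      also have "\<dots> = (\<Sum>r\<in>R. of_bool (fst r = i \<and> snd (snd r) = c))" by (rule sum.reindex_bij_betw[OF \<rho>])
      also have "\<dots> = int (card {r \<in> R. fst r = i \<and> snd (snd r) = c})"
        using fin(1) by (simp add: of_bool_def sum.If_cases Int_def)
      also have "{r \<in> R. fst r = i \<and> snd (snd r) = c} = (\<lambda>s. (i, s, c)) ` {..<N}"
        using ic by (force simp: R_iff image_iff)
      also have "card \<dots> = N" by (subst card_image) (auto simp: inj_on_def)
      finally show ?thesis by (simp add: \<nu>_def frame_wt_def)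
    qed
    have "wt (mp p) x = \<nu> x" if "x \<in> I" for x
    proof (cases x)
      case (Pair b a)
      then show ?thesis using row col that by (cases b) (auto simp: I_def szS)
    qed
    moreover have "mp p e = 0" if "e \<notin> vars" for e
      using exv[OF p] that by (auto simp: mp_def)
    ultimately show ?thesis unfolding Mon_def by blast
  qed
  have fV: "f \<in> V \<nu>"
    unfolding V_def
  proof (intro CollectI allI impI)
    fix m assume "f m \<noteq> 0"
    then obtain p where "p permutes {..<n}" "cp p * \<delta>m (mp p) m \<noteq> 0"
      unfolding f_def using sum.not_neutral_contains_not_neutral by blast
    then show "m \<in> Mon \<nu>" using mp_Mon by (auto simp: \<delta>m_def)
  qed
  have pev_f: "pev f x = adet n (Mx x)" for x
  proof -
    have "pev f x = (\<Sum>p | p permutes {..<n}. cp p * pev (\<delta>m (mp p)) x)"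
      unfolding f_def by (rule pev_sum[OF fP]) simp
    also have "\<dots> = (\<Sum>p | p permutes {..<n}. real_of_int (sign p) * (\<Prod>u<n. Mx x u (p u)))"
    proof (rule sum.cong[OF refl])
      fix p assume "p \<in> {p. p permutes {..<n}}"
      then have "mono_at x (mp p) = (\<Prod>u<n. x (ex p u))"
        unfolding mp_def using exv by (intro mono_at_count) auto
      then show "cp p * pev (\<delta>m (mp p)) x = real_of_int (sign p) * (\<Prod>u<n. Mx x u (p u))"
        by (simp add: pev_\<delta>m cp_def Mx_def prod.distrib ex_def mult.assoc)
    qed
    finally show ?thesis by (simp add: adet_def)
  qed
  define \<rho>' where "\<rho>' = the_inv_into {..<n} \<rho>"
  define \<sigma>' where "\<sigma>' = the_inv_into {..<n} \<sigma>"
  have \<rho>': "\<rho> (\<rho>' r) = r" "\<rho>' r < n" if "r \<in> R" for r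
    using f_the_inv_into_f_bij_betw[OF \<rho>] the_inv_into_into[OF bij_betw_imp_inj_on[OF \<rho>], of r "{..<n}"] bij_betw_imp_surj_on[OF \<rho>] that
    by (auto simp: \<rho>'_def)
  have \<sigma>': "\<sigma> (\<sigma>' r) = r" "\<sigma>' r < n" if "r \<in> W" for r
    using f_the_inv_into_f_bij_betw[OF \<sigma>] the_inv_into_into[OF bij_betw_imp_inj_on[OF \<sigma>], of r "{..<n}"] bij_betw_imp_surj_on[OF \<sigma>] that
    by (auto simp: \<sigma>'_def)
  have "E p q f = (\<lambda>_. 0)" if pq: "(p, q) \<in> Rp" for p q
  proof (rule E_zero_if_invariant[OF Rp_same[OF pq] fV])
    fix x :: "idx \<times> idx \<Rightarrow> real" and t
    define y where "y = (\<lambda>e. of_bool (fst e = q) * x (p, snd e) + of_bool (snd e = q) * x (fst e, p))"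
    obtain b a0 b0 where p: "p = (b, a0)" and q: "q = (b, b0)" and ab: "a0 < b0" and I: "(b, b0) \<in> I"
      using pq by (cases p, cases q) (auto simp: Rp_def)
    have "adet n (Mx (\<lambda>e. x e + t * y e)) = adet n (Mx x)"
    proof (cases b)
      case 0
      define T where "T = {v \<in> {..<n}. snd (\<sigma> v) = b0}"
      define g where "g = (\<lambda>v. \<sigma>' (fst (\<sigma> v), a0))"
      have T: "(fst (\<sigma> v), a0) \<in> W" if "v \<in> T" for v
        using that \<sigma>W[of v] ab by (cases "\<sigma> v") (auto simp: T_def W_iff)
      have "Mx (\<lambda>e. x e + t * y e) u v = Mx x u v + (if v \<in> T then t * Mx x u (g v) else 0)" if "v < n" for u v
      proof (cases "v \<in> T")
        case True
        have "\<sigma> (g v) = (fst (\<sigma> v), a0)" using \<sigma>'(1)[OF T[OF True]] by (simp add: g_def)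
        moreover have "y (vr (\<rho> u) (\<sigma> v)) = x (vr (\<rho> u) (fst (\<sigma> v), a0))"
          using True by (simp add: y_def vr_def p q 0 T_def)
        ultimately show ?thesis using True by (simp add: Mx_def cf_def algebra_simps)
      next
        case False
        then have "y (vr (\<rho> u) (\<sigma> v)) = 0" using that by (simp add: y_def vr_def p q 0 T_def)
        then show ?thesis using False by (simp add: Mx_def)
      qed
      then have "adet n (Mx (\<lambda>e. x e + t * y e)) = adet n (\<lambda>u v. Mx x u v + (if v \<in> T then t * Mx x u (g v) else 0))"
        by (intro adet_cong) auto
      also have "\<dots> = adet n (Mx x)"
      proof (rule adet_add_cols)
        show "g v < n \<and> g v \<notin> T" if "v \<in> T" for v
          using \<sigma>'[OF T[OF that]] ab by (auto simp: g_def T_def)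
      qed (simp add: T_def)
      finally show ?thesis .
    next
      case (Suc i)
      define T where "T = {u \<in> {..<n}. fst (\<rho> u) = i \<and> snd (snd (\<rho> u)) = b0}"
      define g where "g = (\<lambda>u. \<rho>' (i, fst (snd (\<rho> u)), a0))"
      have T: "(i, fst (snd (\<rho> u)), a0) \<in> R" if "u \<in> T" for u
        using that \<rho>R[of u] ab by (cases "\<rho> u") (auto simp: T_def R_iff)
      have "Mx (\<lambda>e. x e + t * y e) u v = Mx x u v + (if u \<in> T then t * Mx x (g u) v else 0)" if "u < n" for u v
      proof (cases "u \<in> T")
        case True
        have "\<rho> (g u) = (i, fst (snd (\<rho> u)), a0)" using \<rho>'(1)[OF T[OF True]] by (simp add: g_def)
        moreover have "y (vr (\<rho> u) (\<sigma> v)) = x (vr (i, fst (snd (\<rho> u)), a0) (\<sigma> v))"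
          using True by (simp add: y_def vr_def p q Suc T_def)
        ultimately show ?thesis using True by (simp add: Mx_def cf_def T_def algebra_simps)
      next
        case False
        then have "y (vr (\<rho> u) (\<sigma> v)) = 0" using that by (auto simp add: y_def vr_def p q Suc T_def)
        then show ?thesis using False by (simp add: Mx_def)
      qed
      then have "adet n (Mx (\<lambda>e. x e + t * y e)) = adet n (\<lambda>u v. Mx x u v + (if u \<in> T then t * Mx x (g u) v else 0))"
        by (intro adet_cong) auto
      also have "\<dots> = adet n (Mx x)"
      proof (rule adet_add_rows)
        show "g u < n \<and> g u \<notin> T" if "u \<in> T" for u
          using \<rho>'[OF T[OF that]] ab by (auto simp: g_def T_def)
      qed (simp add: T_def)
      finally show ?thesis .
    qed
    then show "pev f (\<lambda>e. x e + t * (of_bool (fst e = q) * x (p, snd e) + of_bool (snd e = q) * x (fst e, p))) = pev f x"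
      unfolding pev_f y_def .
  qed
  moreover have "f \<noteq> (\<lambda>_. 0)"
  proof
    assume f0: "f = (\<lambda>_. 0)"
    define xB where "xB = (\<lambda>e :: idx \<times> idx. B (fst (snd e) - 1) (snd (fst e)) (snd (snd e)))"
    have "adet n (Mx xB) = 0" using pev_f[of xB] unfolding f0 by (simp add: pev_def supp_def)
    then obtain v where v: "\<exists>u<n. v u \<noteq> 0" "\<And>j. j < n \<Longrightarrow> (\<Sum>u<n. v u * Mx xB u j) = 0"
      using adet_zero_left_kernel by blast
    have hm: "hom_matrix B C r w = cf r w * xB (vr r w)" for r w
      by (simp add: hom_matrix_def cf_def xB_def vr_def case_prod_beta)
    have \<rho>'\<rho>: "\<rho>' (\<rho> u) = u" if "u < n" for u
      using the_inv_into_f_f[OF bij_betw_imp_inj_on[OF \<rho>], of u] that by (simp add: \<rho>'_def)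
    have z: "(\<Sum>r\<in>R. v (\<rho>' r) * hom_matrix B C r j) = 0" if j: "j \<in> W" for j
    proof -
      have "(\<Sum>r\<in>R. v (\<rho>' r) * hom_matrix B C r j) = (\<Sum>u<n. v (\<rho>' (\<rho> u)) * hom_matrix B C (\<rho> u) j)"
        by (rule sum.reindex_bij_betw[OF \<rho>, symmetric])
      also have "\<dots> = (\<Sum>u<n. v u * Mx xB u (\<sigma>' j))"
        using \<sigma>'(1)[OF j] by (intro sum.cong refl) (simp add: \<rho>'\<rho> hm Mx_def)
      finally show ?thesis using v(2) \<sigma>'(2)[OF j] by simp
    qed
    obtain u where "u < n" "v u \<noteq> 0" using v(1) by blast
    then have u: "\<rho> u \<in> R" "v (\<rho>' (\<rho> u)) \<noteq> 0" using \<rho>R \<rho>'\<rho> by auto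
    have "ext_nonzero (length L) {..<N} (\<lambda>i. {..<L ! i}) {..<sum_list L} {..<N} B C"
      unfolding ext_nonzero_def R_def[symmetric] M_def[symmetric] W_def[symmetric]
      by (intro exI[of _ "\<lambda>r. v (\<rho>' r)"] conjI ballI bexI[of _ "\<rho> u"] u z)
    then show False using nonsing by blast
  qed
  ultimately show ?thesis using fV by blast
qed

section \<open>Tight frames from critical points\<close>

context tables begin

lemma gram_row:
  assumes "a < sz 0"
  shows "gram x (0, a) (0, a') = (\<Sum>c\<in>cols. x ((0, a), c) * x ((0, a'), c))"
proof -
  have "gram x (0, a) (0, a') = (\<Sum>j<sz 0. if j = a then (\<Sum>c\<in>cols. x ((0, a), c) * x ((0, a'), c)) else 0)"
    unfolding gram_def sum_vars
  proof (rule sum.cong[OF refl])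
    fix j
    have "(\<Sum>c\<in>cols. of_bool (fst ((0, j), c) = (0, a)) * (x ((0, j), c) * x ((0, a'), snd ((0::nat, j), c))) + of_bool (snd ((0::nat, j), c) = (0, a)) * (x ((0, j), c) * x (fst ((0, j), c), 0, a')))
       = (\<Sum>c\<in>cols. of_bool (j = a) * (x ((0, j), c) * x ((0, a'), c)))"
      by (intro sum.cong refl) (auto simp: cols_def)
    then show "(\<Sum>c\<in>cols. of_bool (fst ((0, j), c) = (0, a)) * (x ((0, j), c) * x ((0, a'), snd ((0::nat, j), c))) + of_bool (snd ((0::nat, j), c) = (0, a)) * (x ((0, j), c) * x (fst ((0, j), c), 0, a')))
       = (if j = a then (\<Sum>c\<in>cols. x ((0, a), c) * x ((0, a'), c)) else 0)" by simp
  qed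
  then show ?thesis using assms by simp
qed

lemma gram_col:
  assumes c: "c \<in> cols"
  shows "gram x c c' = (\<Sum>j<sz 0. x ((0, j), c) * x ((0, j), c'))"
  unfolding gram_def sum_vars
proof (rule sum.cong[OF refl])
  fix j
  have "(\<Sum>d\<in>cols. of_bool (fst ((0, j), d) = c) * (x ((0, j), d) * x (c', snd ((0::nat, j), d))) + of_bool (snd ((0::nat, j), d) = c) * (x ((0, j), d) * x (fst ((0, j), d), c')))
     = (\<Sum>d\<in>cols. if d = c then x ((0, j), c) * x ((0, j), c') else 0)"
    using c by (intro sum.cong refl) (auto simp: cols_def)
  then show "(\<Sum>d\<in>cols. of_bool (fst ((0, j), d) = c) * (x ((0, j), d) * x (c', snd ((0::nat, j), d))) + of_bool (snd ((0::nat, j), d) = c) * (x ((0, j), d) * x (fst ((0, j), d), c')))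
     = x ((0, j), c) * x ((0, j), c')" using c by simp
qed

end

text \<open>The columns of leg \<open>i\<close> are meant as an orthonormal basis of the range of
  the \<open>i\<close>-th projection.\<close>

definition tight_frame :: "nat \<Rightarrow> nat list \<Rightarrow> legs \<Rightarrow> bool" where
  "tight_frame N L B \<longleftrightarrow>
     (\<forall>i<length L. \<forall>c<L ! i. \<forall>c'<L ! i. (\<Sum>a<N. B i a c * B i a c') = of_bool (c = c')) \<and>
     (\<forall>a<N. \<forall>a'<N. (\<Sum>i<length L. \<Sum>c<L ! i. B i a c * B i a' c) = real (sum_list L) / real N * of_bool (a = a'))"

text \<open>At the critical point the columns of a leg are orthogonal with squared length
  \<open>N / n = 1 / M\<close>, and the rows are orthogonal with squared length
  \<open>M / n = 1 / N\<close>, or 0 for the surplus rows from \<open>N\<close> on. Scaling by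
  \<open>sqrt M\<close> makes the columns orthonormal and the squared row lengths
  \<open>M / N\<close>.\<close>

theorem highest_weight_tight_frame:
  fixes L :: "nat list" and N :: nat
  assumes N: "N > 0" and M0: "sum_list L > 0"
  defines "sz \<equiv> frame_sz N L" and "\<nu> \<equiv> frame_wt N (sum_list L)"
  assumes f: "f \<in> tables.V sz (length L) \<nu>" "f \<noteq> (\<lambda>_. 0)"
    and hw: "\<And>p q. (p, q) \<in> tables.Rp sz (length L) \<Longrightarrow> tables.E sz (length L) p q f = (\<lambda>_. 0)"
  shows "\<exists>B. tight_frame N L B"
proof -
  interpret tables sz "length L" .
  define M where "M = sum_list L"
  define n where "n = N * M"
  have sz0: "sz 0 = n" by (simp add: sz_def frame_sz_def n_def M_def)
  have szS: "sz (Suc i) = L ! i" for i by (simp add: sz_def frame_sz_def)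
  have Mp: "M > 0" using M0 by (simp add: M_def)
  then have Nn: "N \<le> n" and np: "n > 0" using N by (simp_all add: n_def)
  have \<nu>0: "\<nu> (0, a) = (if a < N then int M else 0)" and \<nu>S: "\<nu> (Suc i, c) = int N" for a i c
    by (simp_all add: \<nu>_def frame_wt_def M_def)
  \<comment> \<open>The degree is the sum of the row weights, \<open>M\<close> for each of the first
    \<open>N\<close> rows.\<close>
  have D: "(\<Sum>e\<in>vars. m e) = n" if m: "m \<in> Mon \<nu>" for m
  proof -
    have "int (\<Sum>e\<in>vars. m e) = (\<Sum>j<n. wt m (0, j))"
      unfolding sum_vars sz0 by (simp add: wt_row sz0)
    also have "\<dots> = (\<Sum>j<n. if j \<in> {..<N} then int M else 0)"
    proof (rule sum.cong[OF refl])
      fix j assume "j \<in> {..<n}"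
      then have "(0, j) \<in> I" by (simp add: I_def sz0)
      then show "wt m (0, j) = (if j \<in> {..<N} then int M else 0)" using m \<nu>0 by (simp add: Mon_def)
    qed
    also have "\<dots> = (\<Sum>j\<in>{..<n} \<inter> {..<N}. int M)" by (rule sum.inter_restrict[symmetric]) simp
    also have "{..<n} \<inter> {..<N} = {..<N}" using Nn by auto
    finally have "int (\<Sum>e\<in>vars. m e) = int n" by (simp add: n_def)
    then show ?thesis by linarith
  qed
  obtain x where x: "\<And>p q. (p, q) \<in> same \<Longrightarrow> gram x p q = of_bool (p = q) * of_int (\<nu> p) / real n"
    using highest_weight_critical_point[OF f hw D np] by blast
  have row: "(\<Sum>c\<in>cols. x ((0, a), c) * x ((0, a'), c)) = of_bool (a = a') * of_int (\<nu> (0, a)) / real n" if "a < n" "a' < n" for a a'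
    using x[of "(0, a)" "(0, a')"] gram_row[of a x a'] that by (simp add: same_def I_def sz0)
  have col: "(\<Sum>j<n. x ((0, j), c) * x ((0, j), c')) = of_bool (c = c') * of_int (\<nu> c) / real n" if "c \<in> cols" "c' \<in> cols" "fst c = fst c'" for c c'
    using x[of c c'] gram_col[of c x c'] that by (simp add: same_def cols_def sz0)
  have vanish: "x ((0, a), c) = 0" if "N \<le> a" "a < n" "c \<in> cols" for a c
  proof -
    have "(\<Sum>c\<in>cols. x ((0, a), c) * x ((0, a), c)) = 0" using row[of a a] that by (simp add: \<nu>0)
    then have "\<forall>c\<in>cols. x ((0, a), c) * x ((0, a), c) = 0" by (subst (asm) sum_nonneg_eq_0_iff) auto
    then show ?thesis using that by simp
  qed
  have in_cols: "(Suc i, c) \<in> cols" if "i < length L" "c < L ! i" for i c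
    using that by (simp add: cols_def I_def szS)
  define B where "B = (\<lambda>i a c. sqrt (real M) * x ((0, a), (Suc i, c)))"
  have BB: "B i a c * B i' a' c' = real M * (x ((0, a), (Suc i, c)) * x ((0, a'), (Suc i', c')))" for i a c i' a' c'
  proof -
    have "B i a c * B i' a' c' = (sqrt (real M) * sqrt (real M)) * (x ((0, a), (Suc i, c)) * x ((0, a'), (Suc i', c')))"
      unfolding B_def by (simp only: mult_ac)
    then show ?thesis by simp
  qed
  have "(\<Sum>a<N. B i a c * B i a c') = of_bool (c = c')" if i: "i < length L" "c < L ! i" "c' < L ! i" for i c c'
  proof -
    have "(\<Sum>j<N. x ((0, j), (Suc i, c)) * x ((0, j), (Suc i, c'))) = (\<Sum>j<n. x ((0, j), (Suc i, c)) * x ((0, j), (Suc i, c')))"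
      using Nn vanish in_cols[OF i(1,2)] by (intro sum.mono_neutral_left) auto
    also have "\<dots> = of_bool (c = c') * real N / real n"
      using col[OF in_cols[OF i(1,2)] in_cols[OF i(1,3)]] by (simp add: \<nu>S)
    finally show ?thesis using N Mp unfolding BB sum_distrib_left[symmetric] by (simp add: n_def)
  qed
  moreover have "(\<Sum>i<length L. \<Sum>c<L ! i. B i a c * B i a' c) = real M / real N * of_bool (a = a')" if a: "a < N" "a' < N" for a a'
  proof -
    have "(\<Sum>c\<in>cols. x ((0, a), c) * x ((0, a'), c)) = (\<Sum>i<length L. \<Sum>c<L ! i. x ((0, a), (Suc i, c)) * x ((0, a'), (Suc i, c)))"
    proof -
      have "(\<Sum>c\<in>cols. x ((0, a), c) * x ((0, a'), c)) = (\<Sum>t\<in>(SIGMA i:{..<length L}. {..<L ! i}). x ((0, a), (Suc (fst t), snd t)) * x ((0, a'), (Suc (fst t), snd t)))"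
      proof (rule sum.reindex_bij_witness[of _ "\<lambda>t. (Suc (fst t), snd t)" "\<lambda>c. (fst c - 1, snd c)"])
        fix c assume c: "c \<in> cols"
        then show "(Suc (fst (fst c - 1, snd c)), snd (fst c - 1, snd c)) = c" by (cases c) (simp add: cols_def)
        show "(fst c - 1, snd c) \<in> (SIGMA i:{..<length L}. {..<L ! i})"
          using c szS[of "fst c - 1"] by (cases c) (auto simp: cols_def I_def)
      qed (use in_cols in \<open>auto simp: cols_def\<close>)
      then show ?thesis by (simp add: sum.Sigma case_prod_beta)
    qed
    then have "(\<Sum>i<length L. \<Sum>c<L ! i. x ((0, a), (Suc i, c)) * x ((0, a'), (Suc i, c))) = of_bool (a = a') * real M / real n"
      using row[of a a'] a Nn by (simp add: \<nu>0)
    then show ?thesis using N Mp unfolding BB sum_distrib_left[symmetric] by (simp add: n_def)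
  qed
  ultimately show ?thesis unfolding tight_frame_def M_def by blast
qed

theorem lr_coeff_iff_tight_frame:
  assumes N: "N > 0"
  shows "lr_coeff (map (\<lambda>l. rect N l) L) (rect (sum_list L) N) \<noteq> 0 \<longleftrightarrow> (\<exists>B. tight_frame N L B)"
proof
  assume lr: "lr_coeff (map (\<lambda>l. rect N l) L) (rect (sum_list L) N) \<noteq> 0"
  show "\<exists>B. tight_frame N L B"
  proof (cases "sum_list L = 0")
    \<comment> \<open>If all ranks are zero, every \<open>B\<close> is a tight frame; this case is
      separate because the critical point requires positive degree.\<close>
    case True
    then have "L ! i = 0" if "i < length L" for i using that by simp
    then have "tight_frame N L B" for B unfolding tight_frame_def True by simp
    then show ?thesis by blast
  next
    case False
    obtain f where f: "f \<in> tables.V (frame_sz N L) (length L) (frame_wt N (sum_list L))" "f \<noteq> (\<lambda>_. 0)"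
      and hw: "\<forall>(p, q)\<in>tables.Rp (frame_sz N L) (length L). tables.E (frame_sz N L) (length L) p q f = (\<lambda>_. 0)"
      using lr unfolding lr_coeff_highest_weight[OF N] by blast
    show ?thesis by (rule highest_weight_tight_frame[OF N _ f]) (use False hw in blast)+
  qed
next
  assume "\<exists>B. tight_frame N L B"
  then obtain B0 where B0: "tight_frame N L B0" ..
  have "\<exists>B C. \<not> ext_nonzero (length L) {..<N} (\<lambda>i. {..<L ! i}) {..<sum_list L} {..<N} B C"
    by (rule tight_frame_generic_nonsingular[where ?B0.0 = B0 and l = "\<lambda>i. L ! i" and k = "length L", OF N])
       (use B0 in \<open>auto simp: tight_frame_def sum_list_sum_nth atLeast0LessThan\<close>)
  then show "lr_coeff (map (\<lambda>l. rect N l) L) (rect (sum_list L) N) \<noteq> 0"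
    unfolding lr_coeff_highest_weight[OF N] using nonsingular_highest_weight[OF N] by blast
qed

hide_const (open) Matrix.mat Matrix.vec Matrix.orthogonal

section \<open>Tight frames and projections\<close>

lemma orthonormal_projection:
  fixes u :: "nat \<Rightarrow> real^'n" and P :: "real^'n^'n"
  assumes orth: "\<And>c c'. c < l \<Longrightarrow> c' < l \<Longrightarrow> u c \<bullet> u c' = of_bool (c = c')"
    and P: "\<And>x. P *v x = (\<Sum>c<l. (u c \<bullet> x) *\<^sub>R u c)"
  shows "P ** P = P" "transpose P = P" "rank P = l"
proof -
  have Pu: "P *v u c = u c" if "c < l" for c
  proof -
    have "P *v u c = (\<Sum>c'<l. if c' = c then u c else 0)"
      unfolding P using that by (intro sum.cong refl) (auto simp: orth)
    then show ?thesis using that by simp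
  qed
  have "(P ** P) *v x = P *v x" for x
  proof -
    have "P *v (P *v x) = (\<Sum>c<l. (u c \<bullet> x) *\<^sub>R (P *v u c))"
      unfolding P[of x] by (simp add: linear_sum[OF matrix_vector_mul_linear] linear_cmul[OF matrix_vector_mul_linear])
    also have "\<dots> = P *v x" unfolding P[of x] by (intro sum.cong refl) (simp add: Pu)
    finally show ?thesis by (simp add: matrix_vector_mul_assoc)
  qed
  then show "P ** P = P" by (simp add: matrix_eq)
  have "(P *v x) \<bullet> y = x \<bullet> (P *v y)" for x y
    unfolding P by (simp add: inner_sum_left inner_sum_right inner_commute mult_ac)
  then have "(transpose P *v y) \<bullet> x = (P *v y) \<bullet> x" for x y
    by (metis dot_lmul_matrix inner_commute transpose_matrix_vector)
  then have "transpose P *v y = P *v y" for y by (metis vector_eq_rdot)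
  then show "transpose P = P" by (simp add: matrix_eq)
  have inj: "inj_on u {..<l}"
  proof (rule inj_onI)
    fix c c' assume "c \<in> {..<l}" "c' \<in> {..<l}" "u c = u c'"
    then show "c = c'" using orth[of c c'] orth[of c c] by (auto split: if_splits)
  qed
  have ind: "independent (u ` {..<l})"
  proof (rule pairwise_orthogonal_independent)
    show "pairwise orthogonal (u ` {..<l})"
      unfolding pairwise_def Linear_Algebra.orthogonal_def using orth by auto
    show "0 \<notin> u ` {..<l}"
    proof
      assume "0 \<in> u ` {..<l}"
      then obtain c where "c < l" "u c = 0" by auto
      then show False using orth[of c c] by simp
    qed
  qed
  have "span (range ((*v) P)) = span (u ` {..<l})"
  proof (rule subset_antisym)
    show "span (range ((*v) P)) \<subseteq> span (u ` {..<l})"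
    proof (rule span_minimal, rule image_subsetI)
      fix x show "P *v x \<in> span (u ` {..<l})"
        unfolding P by (intro span_sum span_scale span_base) simp
    qed simp
    show "span (u ` {..<l}) \<subseteq> span (range ((*v) P))"
    proof (rule span_mono, rule image_subsetI)
      fix c assume "c \<in> {..<l}"
      then have "u c = P *v u c" using Pu by simp
      then show "u c \<in> range ((*v) P)" by blast
    qed
  qed
  then have "dim (range ((*v) P)) = card (u ` {..<l})"
    using ind by (metis dim_span dim_eq_card_independent)
  then show "rank P = l" by (simp add: rank_dim_range card_image[OF inj])
qed

text \<open>Any orthonormal basis of the range serves: \<open>P x\<close> minus its expansion lies
  in the range and, by symmetry of \<open>P\<close>, is orthogonal to it.\<close>

lemma projection_orthonormal_columns:
  fixes P :: "real^'n^'n"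
  assumes PP: "P ** P = P" and tP: "transpose P = P"
  shows "\<exists>u :: nat \<Rightarrow> real^'n. (\<forall>c<rank P. \<forall>c'<rank P. u c \<bullet> u c' = of_bool (c = c')) \<and> (\<forall>x. P *v x = (\<Sum>c<rank P. (u c \<bullet> x) *\<^sub>R u c))"
proof -
  define S where "S = range ((*v) P)"
  have "subspace S" unfolding S_def by (intro linear_subspace_image) auto
  then obtain Bs where Bs: "Bs \<subseteq> S" "pairwise orthogonal Bs" "\<And>b. b \<in> Bs \<Longrightarrow> norm b = 1" "independent Bs" "card Bs = dim S" "span Bs = S"
    using orthonormal_basis_subspace by blast
  have fB: "finite Bs" using Bs(4) by (rule independent_imp_finite)
  have cB: "card Bs = rank P" using Bs(5) by (simp add: S_def rank_dim_range)
  obtain u where u: "bij_betw u {..<rank P} Bs"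
    using ex_bij_betw_nat_finite[OF fB] unfolding cB atLeast0LessThan by blast
  have orth: "u c \<bullet> u c' = of_bool (c = c')" if "c < rank P" "c' < rank P" for c c'
  proof (cases "c = c'")
    case True
    then show ?thesis using Bs(3)[of "u c"] bij_betwE[OF u] that by (simp add: dot_square_norm)
  next
    case False
    then have "u c \<noteq> u c'" using bij_betw_imp_inj_on[OF u] that by (auto simp: inj_on_def)
    then show ?thesis using Bs(2) bij_betwE[OF u] that False by (auto simp: pairwise_def Linear_Algebra.orthogonal_def)
  qed
  have Pu: "P *v u c = u c" if "c < rank P" for c
  proof -
    have "u c \<in> S" using Bs(1) bij_betwE[OF u] that by auto
    then obtain x where "u c = P *v x" by (auto simp: S_def)
    then show ?thesis by (simp add: matrix_vector_mul_assoc PP)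
  qed
  have adj: "(P *v x) \<bullet> y = x \<bullet> (P *v y)" for x y
    using dot_lmul_matrix[of x P y] tP by (metis transpose_matrix_vector)
  have "P *v x = (\<Sum>c<rank P. (u c \<bullet> x) *\<^sub>R u c)" for x
  proof -
    define w where "w = P *v x - (\<Sum>c<rank P. (u c \<bullet> x) *\<^sub>R u c)"
    have uB: "u c \<in> Bs" if "c < rank P" for c using bij_betwE[OF u] that by auto
    have "w \<in> span Bs"
      unfolding w_def using Bs(6) uB by (intro span_diff span_sum span_scale) (auto simp: S_def span_base)
    moreover have "orthogonal w b" if b: "b \<in> Bs" for b
    proof -
      obtain c where c: "c < rank P" "b = u c" using bij_betw_imp_surj_on[OF u] b by auto
      have "(\<Sum>c'<rank P. (u c' \<bullet> x) *\<^sub>R u c') \<bullet> u c = (\<Sum>c'<rank P. if c' = c then u c \<bullet> x else 0)"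
        unfolding inner_sum_left using c by (intro sum.cong refl) (auto simp: orth)
      then show ?thesis using c adj[of x "u c"] Pu[of c] by (simp add: Linear_Algebra.orthogonal_def w_def inner_diff_left inner_diff_right inner_commute)
    qed
    ultimately have "orthogonal w w" using orthogonal_to_span by blast
    then show ?thesis by (simp add: orthogonal_self w_def)
  qed
  then show ?thesis using orth by blast
qed

text \<open>The entries of the sum of the projections are the inner products of the rows of the
  frame. \<open>h\<close> enumerates the coordinates, since frames are indexed by numbers and
  matrices by the type \<open>'n\<close>.\<close>

lemma projections_iff_tight_frame:
  fixes L :: "nat list"
  shows "(\<exists>P :: nat \<Rightarrow> real^'n^'n. (\<forall>i<length L. orth_proj (P i) \<and> rank (P i) = L ! i)
          \<and> (\<Sum>i<length L. P i) = (real (sum_list L) / real CARD('n)) *\<^sub>R mat 1)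
     \<longleftrightarrow> (\<exists>B. tight_frame CARD('n) L B)"
proof -
  define N where "N = CARD('n)"
  obtain h :: "nat \<Rightarrow> 'n" where h: "bij_betw h {..<N} UNIV"
    using ex_bij_betw_nat_finite[of "UNIV :: 'n set"] unfolding N_def atLeast0LessThan by auto
  define h' where "h' = the_inv_into {..<N} h"
  have hh': "h (h' a) = a" "h' a < N" for a
    using f_the_inv_into_f_bij_betw[OF h, of a] the_inv_into_into[OF bij_betw_imp_inj_on[OF h], of a "{..<N}"] bij_betw_imp_surj_on[OF h]
    by (auto simp: h'_def)
  have h'h: "h' (h a) = a" if "a < N" for a
    using the_inv_into_f_f[OF bij_betw_imp_inj_on[OF h], of a] that by (simp add: h'_def)
  have sum_h: "(\<Sum>a<N. g (h a)) = (\<Sum>a\<in>UNIV. g a)" for g :: "'n \<Rightarrow> real"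
    by (rule sum.reindex_bij_betw[OF h])
  have entries: "(\<Sum>i<length L. P i) = (real (sum_list L) / real N) *\<^sub>R mat 1
      \<longleftrightarrow> (\<forall>a<N. \<forall>a'<N. (\<Sum>i<length L. \<Sum>c<L ! i. (u i c $ h a) * (u i c $ h a')) = real (sum_list L) / real N * of_bool (a = a'))"
    if P: "\<And>i x. i < length L \<Longrightarrow> P i *v x = (\<Sum>c<L ! i. (u i c \<bullet> x) *\<^sub>R u i c)" for P :: "nat \<Rightarrow> real^'n^'n" and u
  proof -
    have Pe: "P i $ a $ b = (\<Sum>c<L ! i. (u i c $ a) * (u i c $ b))" if "i < length L" for i a b
    proof -
      have "P i $ a $ b = (P i *v axis b 1) $ a" by (simp add: matrix_vector_mul_component inner_axis)
      also have "\<dots> = (\<Sum>c<L ! i. (u i c $ a) * (u i c $ b))"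
        unfolding P[OF that] by (simp add: sum_component inner_axis mult.commute)
      finally show ?thesis .
    qed
    have "(\<Sum>i<length L. P i) = (real (sum_list L) / real N) *\<^sub>R mat 1 \<longleftrightarrow> (\<forall>a b. (\<Sum>i<length L. P i $ a $ b) = real (sum_list L) / real N * of_bool (a = b))"
      by (simp add: Finite_Cartesian_Product.vec_eq_iff sum_component Finite_Cartesian_Product.mat_def of_bool_def)
    also have "\<dots> \<longleftrightarrow> (\<forall>a b. (\<Sum>i<length L. \<Sum>c<L ! i. (u i c $ a) * (u i c $ b)) = real (sum_list L) / real N * of_bool (a = b))"
      by (simp add: Pe)
    also have "\<dots> \<longleftrightarrow> (\<forall>a<N. \<forall>a'<N. (\<Sum>i<length L. \<Sum>c<L ! i. (u i c $ h a) * (u i c $ h a')) = real (sum_list L) / real N * of_bool (a = a'))"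
      (is "?l \<longleftrightarrow> ?r")
    proof
      assume l: ?l
      show ?r
      proof (intro allI impI)
        fix a a' assume "a < N" "a' < N"
        then have "h a = h a' \<longleftrightarrow> a = a'" using bij_betw_imp_inj_on[OF h] by (auto simp: inj_on_def)
        then show "(\<Sum>i<length L. \<Sum>c<L ! i. (u i c $ h a) * (u i c $ h a')) = real (sum_list L) / real N * of_bool (a = a')"
          using l by simp
      qed
    next
      assume r: ?r
      show ?l
      proof (intro allI)
        fix a b
        have "h' a = h' b \<longleftrightarrow> a = b" by (metis hh'(1))
        then show "(\<Sum>i<length L. \<Sum>c<L ! i. (u i c $ a) * (u i c $ b)) = real (sum_list L) / real N * of_bool (a = b)"
          using r hh'(2)[of a] hh'(2)[of b] hh'(1) by fastforce
      qed
    qed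
    finally show ?thesis .
  qed
  show ?thesis unfolding N_def[symmetric]
  proof
    assume "\<exists>P :: nat \<Rightarrow> real^'n^'n. (\<forall>i<length L. orth_proj (P i) \<and> rank (P i) = L ! i) \<and> (\<Sum>i<length L. P i) = (real (sum_list L) / real N) *\<^sub>R mat 1"
    then obtain P :: "nat \<Rightarrow> real^'n^'n" where P: "\<And>i. i < length L \<Longrightarrow> orth_proj (P i) \<and> rank (P i) = L ! i"
      and PS: "(\<Sum>i<length L. P i) = (real (sum_list L) / real N) *\<^sub>R mat 1" by blast
    define Q where "Q = (\<lambda>i (u :: nat \<Rightarrow> real^'n). (\<forall>c<L ! i. \<forall>c'<L ! i. u c \<bullet> u c' = of_bool (c = c')) \<and> (\<forall>x. P i *v x = (\<Sum>c<L ! i. (u c \<bullet> x) *\<^sub>R u c)))"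
    have "\<exists>u. i < length L \<longrightarrow> Q i u" for i
    proof (cases "i < length L")
      case True
      have "P i ** P i = P i" "transpose (P i) = P i" and r: "rank (P i) = L ! i"
        using P[OF True] by (auto simp: orth_proj_def)
      then show ?thesis using projection_orthonormal_columns[of "P i"] unfolding r Q_def by blast
    qed simp
    then obtain u where Q: "\<And>i. i < length L \<Longrightarrow> Q i (u i)" using choice[of "\<lambda>i u. i < length L \<longrightarrow> Q i u"] by blast
    have u: "u i c \<bullet> u i c' = of_bool (c = c')" if "i < length L" "c < L ! i" "c' < L ! i" for i c c'
      using Q[OF that(1)] that(2,3) unfolding Q_def by blast
    have Pu: "P i *v x = (\<Sum>c<L ! i. (u i c \<bullet> x) *\<^sub>R u i c)" if "i < length L" for i x
      using Q[OF that] unfolding Q_def by blast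
    have "tight_frame N L (\<lambda>i a c. u i c $ h a)"
      unfolding tight_frame_def
    proof (intro conjI)
      show "\<forall>a<N. \<forall>a'<N. (\<Sum>i<length L. \<Sum>c<L ! i. u i c $ h a * u i c $ h a') = real (sum_list L) / real N * of_bool (a = a')"
        by (rule iffD1[OF entries[of P u, OF Pu] PS])
      show "\<forall>i<length L. \<forall>c<L ! i. \<forall>c'<L ! i. (\<Sum>a<N. u i c $ h a * u i c' $ h a) = of_bool (c = c')"
      proof (intro allI impI)
        fix i c c' assume *: "i < length L" "c < L ! i" "c' < L ! i"
        show "(\<Sum>a<N. u i c $ h a * u i c' $ h a) = of_bool (c = c')"
          using u[OF *] sum_h[of "\<lambda>a. u i c $ a * u i c' $ a"] by (simp add: inner_vec_def)
      qed
    qed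
    then show "\<exists>B. tight_frame N L B" by blast
  next
    assume "\<exists>B. tight_frame N L B"
    then obtain B where B: "tight_frame N L B" ..
    define u :: "nat \<Rightarrow> nat \<Rightarrow> real^'n" where "u = (\<lambda>i c. \<chi> a. B i (h' a) c)"
    define P :: "nat \<Rightarrow> real^'n^'n" where "P = (\<lambda>i. \<chi> a b. \<Sum>c<L ! i. u i c $ a * u i c $ b)"
    have uh: "u i c $ h a = B i a c" if "a < N" for i c a using that by (simp add: u_def h'h)
    have orth: "u i c \<bullet> u i c' = of_bool (c = c')" if "i < length L" "c < L ! i" "c' < L ! i" for i c c'
    proof -
      have "u i c \<bullet> u i c' = (\<Sum>a<N. u i c $ h a * u i c' $ h a)"
        using sum_h[of "\<lambda>a. u i c $ a * u i c' $ a"] by (simp add: inner_vec_def)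
      also have "\<dots> = (\<Sum>a<N. B i a c * B i a c')" by (intro sum.cong refl) (simp add: uh)
      finally show ?thesis using B that by (simp add: tight_frame_def)
    qed
    have Pv: "P i *v x = (\<Sum>c<L ! i. (u i c \<bullet> x) *\<^sub>R u i c)" for i x
    proof -
      have "(P i *v x) $ a = (\<Sum>c<L ! i. (u i c \<bullet> x) *\<^sub>R u i c) $ a" for a
        unfolding matrix_vector_mult_def P_def inner_vec_def
        by (simp add: sum_component sum_distrib_left sum_distrib_right mult_ac) (rule sum.swap)
      then show ?thesis by (simp add: Finite_Cartesian_Product.vec_eq_iff)
    qed
    have "orth_proj (P i) \<and> rank (P i) = L ! i" if "i < length L" for i
      unfolding orth_proj_def using orthonormal_projection[of "L ! i" "u i" "P i", OF orth[OF that] Pv] by blast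
    moreover have "(\<Sum>i<length L. P i) = (real (sum_list L) / real N) *\<^sub>R mat 1"
      unfolding entries[of P u, OF Pv]
    proof (intro allI impI)
      fix a a' assume a: "a < N" "a' < N"
      have "(\<Sum>i<length L. \<Sum>c<L ! i. u i c $ h a * u i c $ h a') = (\<Sum>i<length L. \<Sum>c<L ! i. B i a c * B i a' c)"
        by (intro sum.cong refl) (simp add: uh a)
      then show "(\<Sum>i<length L. \<Sum>c<L ! i. u i c $ h a * u i c $ h a') = real (sum_list L) / real N * of_bool (a = a')"
        using B a by (simp add: tight_frame_def)
    qed
    ultimately show "\<exists>P :: nat \<Rightarrow> real^'n^'n. (\<forall>i<length L. orth_proj (P i) \<and> rank (P i) = L ! i) \<and> (\<Sum>i<length L. P i) = (real (sum_list L) / real N) *\<^sub>R mat 1"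
      by blast
  qed
qed

theorem theorem4p3:
  fixes L :: "nat list"
  assumes "0 < length L"
    and "sorted (rev L)"
    and "L ! 0 \<le> CARD('n)"
  shows "(\<exists>P :: nat \<Rightarrow> real^'n^'n.
            (\<forall>i < length L. orth_proj (P i) \<and> rank (P i) = L ! i)
          \<and> (\<Sum>i < length L. P i) = (real (sum_list L) / real CARD('n)) *\<^sub>R mat 1)
     \<longleftrightarrow> lr_coeff (map (\<lambda>l. rect CARD('n) l) L) (rect (sum_list L) CARD('n)) \<noteq> 0"
  unfolding projections_iff_tight_frame by (rule lr_coeff_iff_tight_frame[symmetric]) simp

end
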